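(* For every positive integer $n$, let $F_n=\{[z_0,z_1,z_2,z_3]\in\mathbb{C}\mathbf{P}^3 : z_0^{\,n}+z_1^{\,n}+z_2^{\,n}+z_3^{\,n}=0\}$, and let $\Gamma_n$ be the group of isomorphisms of $F_n$ induced by permutations and phase multiplications of the homogeneous coordinates of $\mathbb{C}\mathbf{P}^3$. Then there is a tessellation of $F_n$ (viewed as a real 4-manifold) such that: (i) it has exactly $6n^3$ 4-cells; (ii) each 4-cell is bounded by four pentahedrons (3-cells of the tessellation); (iii) each of these pentahedrons is a pyramid with one quadrilateral face and four triangular faces; (iv) the tessellation is invariant under the action of $\Gamma_n$; and (v) $\Gamma_n$ acts transitively on the set of 4-cells of the tessellation.
   Context: $\mathbb{C}\mathbf{P}^3$ is complex projective 3-space with the standard homogeneous coordinates $[z_0,z_1,z_2,z_3]$. $F_n$ is a smooth complex algebraic surface, hence a closed real 4-manifold. A phase multiplication means multiplying any of the homogeneous coordinates by a number of the form $e^{i2k\pi/n}$ with $k$ an integer. Permutations of the four coordinates and phase multiplications preserve the equation of $F_n$ and so induce isomorphisms of $F_n$; $\Gamma_n$ is the group consisting of all isomorphisms of $F_n$ induced from such permutations and/or phase multiplications. A tessellation of a closed 4-manifold $M$ is a decomposition of $M$ into finitely many embedded closed cells of dimensions $0,1,2,3,4$ (vertices, edges, 2-cells, 3-cells, 4-cells) with pairwise disjoint interiors, whose union is $M$, such that the boundary sphere of each cell is a union of cells of lower dimension (i.e. a finite regular CW structure on $M$). A 4-cell is bounded by four 3-cells if its boundary 3-sphere is the union of exactly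 four distinct 3-cells of the tessellation. A 3-cell is a pyramid with one quadrilateral face and four triangular faces if the induced cell structure on its boundary 2-sphere is combinatorially that of a square pyramid (five faces: one 2-cell with four boundary edges, the base, and four 2-cells with three boundary edges each, all sharing the apex vertex). The tessellation is invariant under $\Gamma_n$ if every element of $\Gamma_n$, as a self-map of $F_n$, carries each cell of the tessellation onto a cell of the tessellation. *)

theory Defs
  imports
    "HOL-Analysis.Analysis"
    "HOL-Homology.Homology"
    "HOL-Algebra.Bij"
    "HOL-Algebra.Generated_Groups"
begin

section \<open>Complex projective 3-space\<close>

text \<open>The index type \<^typ>\<open>4\<close> has the four elements 0, 1, 2, 3, so a vector of type
  \<^typ>\<open>complex ^ 4\<close> has coordinates \<open>z $ 0, z $ 1, z $ 2, z $ 3\<close>.\<close>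

definition proportional :: "complex ^ 4 \<Rightarrow> complex ^ 4 \<Rightarrow> bool"
  where "proportional u v \<longleftrightarrow> u \<noteq> 0 \<and> v \<noteq> 0 \<and> (\<exists>c. c \<noteq> 0 \<and> u = c *s v)"

lemma part_equivp_proportional: "part_equivp proportional"
proof (rule part_equivpI)
  show "\<exists>x. proportional x x"
    unfolding proportional_def by (intro exI[of _ "axis 0 1"] conjI exI[of _ 1]) (auto simp: axis_eq_0_iff)
  show "symp proportional"
  proof (rule sympI)
    fix u v assume "proportional u v"
    then obtain c where c: "u \<noteq> 0" "v \<noteq> 0" "c \<noteq> 0" "u = c *s v"
      by (auto simp: proportional_def)
    then have "v = inverse c *s u"
      by (simp add: vector_smult_assoc)
    with c show "proportional v u"
      unfolding proportional_def by (metis nonzero_imp_inverse_nonzero)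
  qed
  show "transp proportional"
  proof (rule transpI)
    fix u v w assume "proportional u v" "proportional v w"
    then obtain c d where "u \<noteq> 0" "w \<noteq> 0" "c \<noteq> 0" "u = c *s v" "d \<noteq> 0" "v = d *s w"
      by (auto simp: proportional_def)
    then show "proportional u w"
      unfolding proportional_def by (metis mult_eq_0_iff vector_smult_assoc)
  qed
qed

quotient_type cp3 = "complex ^ 4" / partial: proportional
  by (rule part_equivp_proportional)

text \<open>\<open>cp3_of z\<close> is the point with homogeneous coordinates \<open>z\<close>; it is only meaningful
  for \<open>z \<noteq> 0\<close>.\<close>

definition cp3_of :: "complex ^ 4 \<Rightarrow> cp3"
  where "cp3_of = abs_cp3"

lemma cp3_of_eq_iff:
  assumes "u \<noteq> 0" "v \<noteq> 0"
  shows "cp3_of u = cp3_of v \<longleftrightarrow> (\<exists>c. c \<noteq> 0 \<and> u = c *s v)"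
proof -
  have refl: "proportional w w" if "w \<noteq> 0" for w
    using that unfolding proportional_def by (intro conjI exI[of _ 1]) auto
  have "cp3_of u = cp3_of v \<longleftrightarrow> proportional u v"
    using Quotient_rel[OF Quotient_cp3, of u v] refl assms by (simp add: cp3_of_def)
  then show ?thesis
    using assms by (simp add: proportional_def)
qed

lemma cp3_of_surj: "\<exists>z. z \<noteq> 0 \<and> cp3_of z = p"
  by (metis Quotient_cp3 Quotient_rep_reflp Quotient_abs_rep cp3_of_def proportional_def)

text \<open>The topology is the quotient topology from the nonzero vectors.\<close>

instantiation cp3 :: topological_space
begin

definition open_cp3 :: "cp3 set \<Rightarrow> bool"
  where "open_cp3 U \<longleftrightarrow> open {z. z \<noteq> 0 \<and> cp3_of z \<in> U}"

instance
proof
  have "{z. z \<noteq> 0 \<and> cp3_of z \<in> UNIV} = - {0}"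
    by auto
  then show "open (UNIV :: cp3 set)"
    unfolding open_cp3_def by (simp add: open_Compl)
next
  fix S T :: "cp3 set" assume "open S" "open T"
  moreover have "{z. z \<noteq> 0 \<and> cp3_of z \<in> S \<inter> T}
      = {z. z \<noteq> 0 \<and> cp3_of z \<in> S} \<inter> {z. z \<noteq> 0 \<and> cp3_of z \<in> T}"
    by auto
  ultimately show "open (S \<inter> T)"
    unfolding open_cp3_def by (simp add: open_Int)
next
  fix K :: "cp3 set set" assume "\<forall>S\<in>K. open S"
  moreover have "{z. z \<noteq> 0 \<and> cp3_of z \<in> \<Union>K} = (\<Union>S\<in>K. {z. z \<noteq> 0 \<and> cp3_of z \<in> S})"
    by auto
  ultimately show "open (\<Union>K)"
    unfolding open_cp3_def by (simp add: open_UN)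
qed

end

lemma quotient_map_cp3_of: "quotient_map (top_of_set (- {0})) euclidean cp3_of"
proof -
  have "openin (top_of_set (- {0})) {z \<in> topspace (top_of_set (- {0})). cp3_of z \<in> U} \<longleftrightarrow> open U"
    for U
  proof -
    have "{z \<in> topspace (top_of_set (- {0})). cp3_of z \<in> U} = {z. z \<noteq> 0 \<and> cp3_of z \<in> U}"
      by auto
    moreover have "{z. z \<noteq> 0 \<and> cp3_of z \<in> U} \<subseteq> - {0}"
      by auto
    ultimately show ?thesis
      by (simp add: openin_open_eq open_Compl open_cp3_def)
  qed
  moreover have "cp3_of ` (- {0}) = UNIV"
  proof (intro equalityI subsetI UNIV_I)
    fix p :: cp3
    obtain z where "z \<noteq> 0" "cp3_of z = p"
      using cp3_of_surj by blast
    then show "p \<in> cp3_of ` (- {0})"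
      by blast
  qed
  ultimately show ?thesis
    unfolding quotient_map_def by simp
qed

section \<open>The Fermat surface and its symmetry group\<close>

definition fermat_surface :: "nat \<Rightarrow> cp3 set"
  where "fermat_surface n = {cp3_of z | z. z \<noteq> 0 \<and> (\<Sum>i\<in>UNIV. (z $ i) ^ n) = 0}"

lemma cp3_of_in_fermat_surface:
  assumes "z \<noteq> 0"
  shows "cp3_of z \<in> fermat_surface n \<longleftrightarrow> (\<Sum>i\<in>UNIV. (z $ i) ^ n) = 0"
proof
  assume "cp3_of z \<in> fermat_surface n"
  then obtain w where w: "w \<noteq> 0" "cp3_of z = cp3_of w" "(\<Sum>i\<in>UNIV. (w $ i) ^ n) = 0"
    by (auto simp: fermat_surface_def)
  then obtain c where "z = c *s w"
    using assms by (auto simp: cp3_of_eq_iff)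
  then have "(\<Sum>i\<in>UNIV. (z $ i) ^ n) = c ^ n * (\<Sum>i\<in>UNIV. (w $ i) ^ n)"
    by (simp add: power_mult_distrib sum_distrib_left)
  with w show "(\<Sum>i\<in>UNIV. (z $ i) ^ n) = 0"
    by simp
qed (use assms in \<open>auto simp: fermat_surface_def\<close>)

text \<open>\<open>induced_on S A f\<close>: the self-map \<open>f\<close> of \<open>S\<close> is given in homogeneous coordinates by \<open>A\<close>.\<close>

definition induced_on :: "cp3 set \<Rightarrow> (complex ^ 4 \<Rightarrow> complex ^ 4) \<Rightarrow> (cp3 \<Rightarrow> cp3) \<Rightarrow> bool"
  where "induced_on S A f \<longleftrightarrow>
    f \<in> Bij S \<and> (\<forall>z. z \<noteq> 0 \<and> cp3_of z \<in> S \<longrightarrow> f (cp3_of z) = cp3_of (A z))"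

definition permute_coords :: "(4 \<Rightarrow> 4) \<Rightarrow> complex ^ 4 \<Rightarrow> complex ^ 4"
  where "permute_coords \<sigma> z = (\<chi> i. z $ \<sigma> i)"

definition phase_mult :: "nat \<Rightarrow> (4 \<Rightarrow> int) \<Rightarrow> complex ^ 4 \<Rightarrow> complex ^ 4"
  where "phase_mult n k z = (\<chi> i. exp (\<i> * of_real (2 * of_int (k i) * pi / of_nat n)) * z $ i)"

definition fermat_generators :: "nat \<Rightarrow> (cp3 \<Rightarrow> cp3) set"
  where "fermat_generators n =
    {f. \<exists>\<sigma>. bij \<sigma> \<and> induced_on (fermat_surface n) (permute_coords \<sigma>) f} \<union>
    {f. \<exists>k. induced_on (fermat_surface n) (phase_mult n k) f}"

definition fermat_group :: "nat \<Rightarrow> (cp3 \<Rightarrow> cp3) set"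
  where "fermat_group n = generate (BijGroup (fermat_surface n)) (fermat_generators n)"

lemma subgroup_fermat_group: "subgroup (fermat_group n) (BijGroup (fermat_surface n))"
  unfolding fermat_group_def
  by (rule group.generate_is_subgroup[OF group_BijGroup])
     (auto simp: fermat_generators_def induced_on_def BijGroup_def)

lemma induced_on_exists:
  assumes nz: "\<And>z. z \<noteq> 0 \<Longrightarrow> A z \<noteq> 0" "\<And>z. z \<noteq> 0 \<Longrightarrow> B z \<noteq> 0"
    and lin: "\<And>c z. A (c *s z) = c *s A z" "\<And>c z. B (c *s z) = c *s B z"
    and inv: "\<And>z. A (B z) = z" "\<And>z. B (A z) = z"
    and pres: "\<And>z. (\<Sum>i\<in>UNIV. (A z $ i) ^ n) = (\<Sum>i\<in>UNIV. (z $ i) ^ n)"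
  shows "\<exists>f. induced_on (fermat_surface n) A f"
proof -
  define S where "S = fermat_surface n"
  define r where "r p = (SOME z. z \<noteq> 0 \<and> cp3_of z = p)" for p
  have r: "r p \<noteq> 0" "cp3_of (r p) = p" for p
    using someI_ex[OF cp3_of_surj[of p]] by (auto simp: r_def)
  define f where "f = (\<lambda>p\<in>S. cp3_of (A (r p)))"
  define g where "g = (\<lambda>p\<in>S. cp3_of (B (r p)))"
  have presB: "(\<Sum>i\<in>UNIV. (B z $ i) ^ n) = (\<Sum>i\<in>UNIV. (z $ i) ^ n)" for z
    using pres[of "B z"] inv by simp
  have wd: "cp3_of (C (r (cp3_of z))) = cp3_of (C z)"
    if C: "z \<noteq> 0" "\<And>z. z \<noteq> 0 \<Longrightarrow> C z \<noteq> 0" "\<And>c z. C (c *s z) = c *s C z" for C z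
  proof -
    obtain c where "c \<noteq> 0" "r (cp3_of z) = c *s z"
      using cp3_of_eq_iff[OF r(1) C(1)] r(2) by blast
    then show ?thesis
      using cp3_of_eq_iff[of "C (r (cp3_of z))" "C z"] r(1) C by metis
  qed
  have f: "f (cp3_of z) = cp3_of (A z)" "cp3_of (A z) \<in> S" if "z \<noteq> 0" "cp3_of z \<in> S" for z
    using that wd[of z A] nz lin pres by (auto simp: f_def S_def cp3_of_in_fermat_surface)
  have g: "g (cp3_of z) = cp3_of (B z)" "cp3_of (B z) \<in> S" if "z \<noteq> 0" "cp3_of z \<in> S" for z
    using that wd[of z B] nz lin presB by (auto simp: g_def S_def cp3_of_in_fermat_surface)
  have "bij_betw f S S"
  proof (rule bij_betw_byWitness[where f' = g])
    show "\<forall>p\<in>S. g (f p) = p" "\<forall>p\<in>S. f (g p) = p"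
      using f g r nz inv by metis+
    show "f ` S \<subseteq> S" "g ` S \<subseteq> S"
      using f g r by (metis image_subsetI)+
  qed
  then have "f \<in> Bij S"
    by (simp add: Bij_def f_def)
  then show ?thesis
    using f by (auto simp: induced_on_def S_def)
qed

lemma permutation_induces:
  assumes "bij \<sigma>"
  shows "\<exists>f \<in> fermat_group n. induced_on (fermat_surface n) (permute_coords \<sigma>) f"
proof -
  have "(\<Sum>i\<in>UNIV. (permute_coords \<sigma> z $ i) ^ n) = (\<Sum>i\<in>UNIV. (z $ i) ^ n)" for z
    using sum.reindex_bij_betw[OF assms, of "\<lambda>i. (z $ i) ^ n"] by (simp add: permute_coords_def)
  moreover obtain \<tau> where \<tau>: "\<And>i. \<tau> (\<sigma> i) = i" "\<And>i. \<sigma> (\<tau> i) = i"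
    using assms by (metis bij_pointE)
  then have inv: "permute_coords \<sigma> (permute_coords \<tau> z) = z"
      "permute_coords \<tau> (permute_coords \<sigma> z) = z" for z
    by (simp_all add: permute_coords_def)
  moreover have "permute_coords \<rho> 0 = 0" for \<rho>
    by (simp add: permute_coords_def vec_eq_iff)
  then have "permute_coords \<sigma> z \<noteq> 0" "permute_coords \<tau> z \<noteq> 0" if "z \<noteq> 0" for z
    using that inv by metis+
  moreover have "permute_coords \<rho> (c *s z) = c *s permute_coords \<rho> z" for \<rho> c z
    by (simp add: permute_coords_def vec_eq_iff)
  ultimately have "\<exists>f. induced_on (fermat_surface n) (permute_coords \<sigma>) f"
    by (intro induced_on_exists[where B = "permute_coords \<tau>"]) auto
  then show ?thesis
    using assms by (auto simp: fermat_group_def fermat_generators_def intro!: generate.incl)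
qed

lemma phase_mult_induces:
  assumes "n > 0"
  shows "\<exists>f \<in> fermat_group n. induced_on (fermat_surface n) (phase_mult n k) f"
proof -
  have "exp (\<i> * of_real (2 * of_int a * pi / of_nat n)) ^ n = 1" for a
  proof -
    have "exp (\<i> * of_real (2 * of_int a * pi / of_nat n)) ^ n
        = exp (of_nat n * (\<i> * of_real (2 * of_int a * pi / of_nat n)))"
      by (simp only: exp_of_nat_mult)
    also have "of_nat n * (\<i> * of_real (2 * of_int a * pi / of_nat n)) = (2 * of_int a * pi) * \<i>"
      using assms by simp
    also have "exp \<dots> = 1"
      using exp_eq_1[of "of_real (2 * of_int a * pi) * \<i>"] by auto
    finally show ?thesis .
  qed
  then have "\<And>z. (\<Sum>i\<in>UNIV. (phase_mult n k z $ i) ^ n) = (\<Sum>i\<in>UNIV. (z $ i) ^ n)"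
    unfolding phase_mult_def by (simp add: power_mult_distrib)
  moreover have "exp (\<i> * of_real (2 * of_int (- a) * pi / of_nat n)) *
      exp (\<i> * of_real (2 * of_int a * pi / of_nat n)) = 1" for a
    by (simp flip: exp_add)
  then have inv: "phase_mult n (\<lambda>i. - k i) (phase_mult n k z) = z"
      "phase_mult n k (phase_mult n (\<lambda>i. - k i) z) = z" for k z
    unfolding phase_mult_def vec_eq_iff by (simp_all flip: exp_add mult.assoc)
  moreover have "\<And>k z. z \<noteq> 0 \<Longrightarrow> phase_mult n k z \<noteq> 0"
    by (auto simp: phase_mult_def vec_eq_iff)
  moreover have "\<And>k c z. phase_mult n k (c *s z) = c *s phase_mult n k z"
    by (auto simp: phase_mult_def vec_eq_iff)
  ultimately have "\<exists>f. induced_on (fermat_surface n) (phase_mult n k) f"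
    by (intro induced_on_exists[where B = "phase_mult n (\<lambda>i. - k i)"]) auto
  then show ?thesis
    by (auto simp: fermat_group_def fermat_generators_def intro!: generate.incl)
qed

section \<open>Tessellations\<close>

text \<open>The closed unit ball and unit sphere of \<open>k\<close>-space, for a variable dimension \<open>k\<close>
  including 0 (where the ball is a point and the sphere is empty).\<close>

definition unit_ball :: "nat \<Rightarrow> (nat \<Rightarrow> real) set"
  where "unit_ball k = {x \<in> topspace (Euclidean_space k). (\<Sum>i<k. (x i)\<^sup>2) \<le> 1}"

definition unit_sphere :: "nat \<Rightarrow> (nat \<Rightarrow> real) set"
  where "unit_sphere k = {x \<in> topspace (Euclidean_space k). (\<Sum>i<k. (x i)\<^sup>2) = 1}"

definition cell_param :: "'a topology \<Rightarrow> nat \<Rightarrow> 'a set \<Rightarrow> ((nat \<Rightarrow> real) \<Rightarrow> 'a) \<Rightarrow> bool"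
  where "cell_param X k c h \<longleftrightarrow>
    embedding_map (subtopology (Euclidean_space k) (unit_ball k)) X h \<and> h ` unit_ball k = c"

definition closed_cell :: "'a topology \<Rightarrow> nat \<Rightarrow> 'a set \<Rightarrow> bool"
  where "closed_cell X k c \<longleftrightarrow> (\<exists>h. cell_param X k c h)"

text \<open>By invariance of domain all parametrizations of a closed cell give the same boundary
  sphere, see \<open>cell_boundary_eq\<close> below.\<close>

definition cell_boundary :: "'a topology \<Rightarrow> nat \<Rightarrow> 'a set \<Rightarrow> 'a set"
  where "cell_boundary X k c = (\<Union>h \<in> {h. cell_param X k c h}. h ` unit_sphere k)"

definition cell_interior :: "'a topology \<Rightarrow> nat \<Rightarrow> 'a set \<Rightarrow> 'a set"
  where "cell_interior X k c = c - cell_boundary X k c"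

lemma open_not_in_ball:
  assumes "openin (Euclidean_space k) V" "x \<in> V" "x \<in> unit_sphere k"
  shows "\<not> V \<subseteq> unit_ball k"
proof
  assume V: "V \<subseteq> unit_ball k"
  define f where "f t = (\<lambda>i. t * x i)" for t :: real
  have x: "(\<Sum>i<k. (x i)\<^sup>2) = 1" "\<forall>i\<ge>k. x i = 0"
    using assms by (auto simp: unit_sphere_def topspace_Euclidean_space)
  have "continuous_map euclideanreal (Euclidean_space k) f"
    unfolding Euclidean_space_def f_def using x
    by (auto simp: continuous_map_in_subtopology continuous_map_componentwise_UNIV
        intro!: continuous_intros)
  then have "open {t. f t \<in> V}"
    using openin_continuous_map_preimage[OF _ assms(1)] by fastforce
  moreover have "1 \<in> {t. f t \<in> V}"
    using assms by (simp add: f_def)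
  ultimately obtain e where e: "e > 0" "\<And>t. dist t 1 < e \<Longrightarrow> f t \<in> V"
    by (metis mem_Collect_eq open_dist)
  have "f (1 + e / 2) \<in> V"
    using e by (simp add: dist_norm)
  then have "(\<Sum>i<k. ((1 + e / 2) * x i)\<^sup>2) \<le> 1"
    using V by (auto simp: unit_ball_def f_def)
  moreover have "(\<Sum>i<k. ((1 + e / 2) * x i)\<^sup>2) = (1 + e / 2)\<^sup>2"
    using x by (simp add: power_mult_distrib flip: sum_distrib_left)
  moreover have "(1 + e / 2)\<^sup>2 > 1"
    using e by (simp add: one_less_power)
  ultimately show False
    by simp
qed

lemma openin_interior_ball: "openin (Euclidean_space k) (unit_ball k - unit_sphere k)"
proof -
  have "continuous_map (Euclidean_space k) euclideanreal (\<lambda>x. \<Sum>i<k. (x i)\<^sup>2)"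
    unfolding Euclidean_space_def
    by (auto intro!: continuous_intros continuous_map_from_subtopology)
  then have "openin (Euclidean_space k)
      {x \<in> topspace (Euclidean_space k). (\<Sum>i<k. (x i)\<^sup>2) \<in> {..<1}}"
    by (rule openin_continuous_map_preimage) simp
  moreover have "{x \<in> topspace (Euclidean_space k). (\<Sum>i<k. (x i)\<^sup>2) \<in> {..<1}}
      = unit_ball k - unit_sphere k"
    by (auto simp: unit_ball_def unit_sphere_def)
  ultimately show ?thesis
    by simp
qed

lemma cell_boundary_subset:
  assumes h: "cell_param X k c h" and h': "cell_param X k c h'"
  shows "h' ` unit_sphere k \<subseteq> h ` unit_sphere k"
proof
  fix y assume "y \<in> h' ` unit_sphere k"
  then obtain x where x: "x \<in> unit_sphere k" "y = h' x"
    by blast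
  define B where "B = subtopology (Euclidean_space k) (unit_ball k)"
  define U where "U = unit_ball k - unit_sphere k"
  have tB: "topspace B = unit_ball k"
    by (auto simp: B_def unit_ball_def)
  have x_ball: "x \<in> unit_ball k"
    using x by (auto simp: unit_ball_def unit_sphere_def)
  have H: "homeomorphic_map B (subtopology X c) h" "homeomorphic_map B (subtopology X c) h'"
      "h ` unit_ball k = c" "h' ` unit_ball k = c"
    using h h' tB by (auto simp: cell_param_def embedding_map_def simp flip: B_def)
  then obtain g where g: "homeomorphic_maps B (subtopology X c) h' g"
    by (auto simp: homeomorphic_map_maps)
  have hom: "homeomorphic_map B B (g \<circ> h)"
    using homeomorphic_map_compose[OF H(1)] g homeomorphic_maps_map by blast
  then have img: "(g \<circ> h) ` unit_ball k = unit_ball k"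
    using homeomorphic_imp_surjective_map tB by metis
  obtain x' where x': "x' \<in> unit_ball k" "y = h x'"
    using H x x_ball by (metis imageE imageI)
  have gx: "g (h x') = x"
    using g x x_ball x'(2) tB by (auto simp: homeomorphic_maps_def)
  have UB: "U \<subseteq> unit_ball k"
    by (auto simp: U_def)
  have "x' \<notin> U"
  proof
    assume "x' \<in> U"
    have "continuous_map B (Euclidean_space k) (g \<circ> h)"
      using homeomorphic_imp_continuous_map[OF hom]
      by (simp add: B_def continuous_map_in_subtopology)
    then have "continuous_map (subtopology (Euclidean_space k) U) (Euclidean_space k) (g \<circ> h)"
      using UB by (auto simp: B_def intro: continuous_map_from_subtopology_mono)
    moreover have "inj_on (g \<circ> h) U"
      using homeomorphic_imp_injective_map[OF hom] UB tB inj_on_subset by metis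
    ultimately have "openin (Euclidean_space k) ((g \<circ> h) ` U)"
      using invariance_of_domain_Euclidean_space openin_interior_ball U_def by blast
    moreover have "x \<in> (g \<circ> h) ` U"
      using gx \<open>x' \<in> U\<close> by force
    ultimately show False
      using open_not_in_ball[of k _ x] x img UB by blast
  qed
  then show "y \<in> h ` unit_sphere k"
    using x' by (auto simp: U_def)
qed

lemma cell_boundary_eq:
  assumes "cell_param X k c h"
  shows "cell_boundary X k c = h ` unit_sphere k"
  using assms cell_boundary_subset unfolding cell_boundary_def by blast

text \<open>\<open>C k\<close> is the set of \<open>k\<close>-cells.\<close>

definition tessellation :: "nat \<Rightarrow> 'a topology \<Rightarrow> (nat \<Rightarrow> 'a set set) \<Rightarrow> bool"
  where "tessellation m X C \<longleftrightarrow>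
    (\<forall>k>m. C k = {}) \<and>
    (\<forall>k. finite (C k)) \<and>
    (\<forall>k. \<forall>c\<in>C k. closed_cell X k c) \<and>
    (\<forall>j k. \<forall>c\<in>C j. \<forall>d\<in>C k. (j, c) \<noteq> (k, d) \<longrightarrow>
        cell_interior X j c \<inter> cell_interior X k d = {}) \<and>
    (\<Union>k. \<Union>(C k)) = topspace X \<and>
    (\<forall>k. \<forall>c\<in>C k. \<exists>D \<subseteq> (\<Union>j<k. C j). cell_boundary X k c = \<Union>D)"

definition boundary_cells :: "'a topology \<Rightarrow> (nat \<Rightarrow> 'a set set) \<Rightarrow> nat \<Rightarrow> 'a set \<Rightarrow> nat \<Rightarrow> 'a set set"
  where "boundary_cells X C k c j = {d \<in> C j. d \<subseteq> cell_boundary X k c}"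

text \<open>The proper faces of a square pyramid with base vertices 0, 1, 2, 3 (in cyclic order) and
  apex 4, by dimension, each given by its set of vertices.\<close>

definition pyramid_faces :: "nat \<Rightarrow> nat set set"
  where "pyramid_faces j =
    (if j = 0 then {{0}, {1}, {2}, {3}, {4}}
     else if j = 1 then {{0,1}, {1,2}, {2,3}, {3,0}, {0,4}, {1,4}, {2,4}, {3,4}}
     else if j = 2 then {{0,1,2,3}, {0,1,4}, {1,2,4}, {2,3,4}, {3,0,4}}
     else {})"

definition square_pyramid :: "'a topology \<Rightarrow> (nat \<Rightarrow> 'a set set) \<Rightarrow> 'a set \<Rightarrow> bool"
  where "square_pyramid X C d \<longleftrightarrow>
    (\<exists>\<phi>. (\<forall>j\<le>2. bij_betw \<phi> (boundary_cells X C 3 d j) (pyramid_faces j)) \<and>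
         (\<forall>a \<in> (\<Union>j\<le>2. boundary_cells X C 3 d j). \<forall>b \<in> (\<Union>j\<le>2. boundary_cells X C 3 d j).
            a \<subseteq> b \<longleftrightarrow> \<phi> a \<subseteq> \<phi> b))"

definition invariant_under :: "('a \<Rightarrow> 'a) set \<Rightarrow> (nat \<Rightarrow> 'a set set) \<Rightarrow> bool"
  where "invariant_under G C \<longleftrightarrow> (\<forall>g\<in>G. \<forall>k. \<forall>c\<in>C k. g ` c \<in> C k)"

definition transitive_on :: "('a \<Rightarrow> 'a) set \<Rightarrow> 'a set set \<Rightarrow> bool"
  where "transitive_on G K \<longleftrightarrow> (\<forall>c\<in>K. \<forall>d\<in>K. \<exists>g\<in>G. g ` c = d)"

end

theory Submission
  imports Defs
begin

text \<open>A point of the surface has homogeneous coordinates \<open>z\<close> whose powers \<open>z $ i ^ n\<close> sum to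
  zero: they are the sides of a closed quadrilateral in the plane, up to similarity. After sorting the
  sides by direction the quadrilateral is convex. The 4-cells are the sets of points for which the sides
  occur in a given cyclic order, with given choices of the \<open>n\<close>-th roots. There are 6 cyclic
  orders, and the roots contribute \<open>n ^ 3\<close> choices up to a common factor, which gives the number
  of 4-cells (\<open>card_top_cells\<close>); sorting shows that they cover the surface (\<open>covering\<close>), and
  a quadrilateral with four distinct directions belongs to one of them only (\<open>generic_overlap\<close>).
  Permutations and phases permute the cyclic orders and the choices of roots, so the symmetry group
  acts transitively on the 4-cells by construction: all of them are translates of \<open>base_cell\<close>.

  The boundary of a 4-cell consists of the degenerate quadrilaterals, where two neighbouring sides
  have the same direction; there are four such pairs (\<open>base_cell_boundary_faces\<close>). Such a
  quadrilateral is a triangle with a point marked on one side, so it is determined by its side lengths,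
  and at perimeter 1 these form a polytope. Besides two side lengths being nonnegative it is cut out by
  the three triangle inequalities, and these five facets bound a pyramid with a quadrilateral base, the
  base being the case in which the two parallel sides make up half of the perimeter. Thus the side
  lengths are a chart of each pyramid and of its faces (\<open>pyramid_cone_exists\<close>,
  \<open>pyramid_cone_unique\<close>, \<open>closed_base_face\<close>).

  Different translates of faces have to be disjoint or equal in their interiors. For this the tight
  inequalities are rephrased by the position of the products \<open>z $ i * cnj (z $ j)\<close> relative to the
  rays at multiples of the angle \<open>pi / n\<close>, a description which every symmetry preserves
  (\<open>pyramid_cone_le_slk\<close>, \<open>pyramid_cone_leI\<close>, \<open>face_cells_disjoint\<close>).

  It remains to see that the space of convex quadrilaterals is a 4-ball whose boundary is the
  degenerate part (\<open>closed_base_cell\<close>). The side lengths at perimeter 1 range over an octahedron.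
  For fixed lengths in its interior the quadrilateral is determined by the length of one diagonal:
  when it grows the other diagonal shrinks (\<open>diagonals_antitone\<close>), and convexity persists until one
  of the triangles cut off becomes flat (\<open>fiber_exists\<close>). So the fibre is an interval, at whose
  ends one or the other diagonal is as long as possible, and over the boundary of the octahedron it is a
  point. Rescaling the intervals maps the cell onto the cone over the octahedron, and a compact set
  with a continuous injection onto a convex body is a closed cell (\<open>closed_cell_convex\<close>).\<close>

section \<open>Convex bodies as closed cells\<close>

text \<open>By invariance of domain the image of the relative interior is open in the affine hull of \<open>T\<close>.\<close>

lemma homeomorphism_rel_interior:
  fixes S :: "'a::euclidean_space set" and T :: "'b::euclidean_space set"
  assumes hom: "homeomorphism S T f g" and aff: "aff_dim S = aff_dim T"
  shows "f ` rel_interior S \<subseteq> rel_interior T"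
proof -
  have f: "continuous_on S f" "f ` S = T" "inj_on f S"
    using hom by (auto simp: homeomorphism_def intro: inj_on_inverseI)
  have sub: "rel_interior S \<subseteq> S"
    by (rule rel_interior_subset)
  have img: "f ` rel_interior S \<subseteq> T"
    using f(2) sub by blast
  have cont: "continuous_on (rel_interior S) f" and inj: "inj_on f (rel_interior S)"
    using f sub by (blast intro: continuous_on_subset inj_on_subset)+
  have img2: "f ` rel_interior S \<subseteq> affine hull T"
    using img hull_subset[of T affine] by blast
  have "openin (top_of_set (affine hull T)) (f ` rel_interior S)"
    using invariance_of_domain_affine_sets[OF openin_rel_interior affine_affine_hull
        affine_affine_hull _ cont img2 inj] aff by simp
  then show ?thesis
    using rel_interior_maximal[OF img] by simp
qed

lemma homeomorphism_rel_frontier: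
  fixes S :: "'a::euclidean_space set" and T :: "'b::euclidean_space set"
  assumes hom: "homeomorphism S T f g" and aff: "aff_dim S = aff_dim T"
    and "closed S" "closed T"
  shows "f ` rel_frontier S = rel_frontier T"
proof -
  have "f ` rel_interior S = rel_interior T"
  proof
    show "f ` rel_interior S \<subseteq> rel_interior T"
      using homeomorphism_rel_interior[OF hom aff] .
    have "g ` rel_interior T \<subseteq> rel_interior S"
      using homeomorphism_rel_interior[of T S g f] hom aff homeomorphism_sym by metis
    moreover have "rel_interior T = f ` (g ` rel_interior T)"
    proof -
      have "f (g y) = y" if "y \<in> rel_interior T" for y
        using hom that rel_interior_subset by (metis homeomorphism_apply2 subsetD)
      then show ?thesis
        by (simp add: image_image)
    qed
    ultimately show "rel_interior T \<subseteq> f ` rel_interior S"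
      by (metis image_mono)
  qed
  moreover have "inj_on f S" "f ` S = T"
    using hom by (auto simp: homeomorphism_def intro: inj_on_inverseI)
  ultimately show ?thesis
    using assms(3,4) inj_on_image_set_diff[of f S S "rel_interior S"] rel_interior_subset[of S]
    by (simp add: rel_frontier_def)
qed

text \<open>The standard ball of dimension \<open>k\<close> sits in any Euclidean space of dimension at
  least \<open>k\<close> as the unit ball of a coordinate subspace, where the theory of convex sets applies.\<close>

lemma unit_ball_convex_model:
  assumes "k \<le> DIM('b::euclidean_space)"
  obtains J :: "(nat \<Rightarrow> real) \<Rightarrow> 'b::euclidean_space" and K :: "'b set"
  where "homeomorphic_map (subtopology (Euclidean_space k) (unit_ball k)) (top_of_set K) J"
    "convex K" "compact K" "aff_dim K = int k" "J ` unit_sphere k = rel_frontier K"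
proof -
  obtain T :: "'b set" where T: "T \<subseteq> Basis" "card T = k"
    using assms by (meson obtain_subset_with_card_n)
  have finT: "finite T"
    using T finite_Basis finite_subset by blast
  obtain e where e: "bij_betw e {..<k} T"
    using ex_bij_betw_nat_finite[OF finT] T by (auto simp: atLeast0LessThan)
  have inner_e: "e i \<bullet> e j = (if i = j then 1 else 0)" if "i < k" "j < k" for i j
  proof -
    have "e i \<in> Basis" "e j \<in> Basis" "e i = e j \<longleftrightarrow> i = j"
      using that e T by (auto simp: bij_betw_def inj_on_def)
    then show ?thesis by (simp add: inner_Basis)
  qed
  define J :: "(nat \<Rightarrow> real) \<Rightarrow> 'b" where "J x = (\<Sum>i<k. x i *\<^sub>R e i)" for x
  define I where "I v = (\<lambda>i. if i < k then v \<bullet> e i else 0)" for v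
  have Je: "J x \<bullet> e i = x i" if "i < k" for x i
  proof -
    have "J x \<bullet> e i = (\<Sum>j<k. x j * (if j = i then 1 else 0))"
      unfolding J_def inner_sum_left using that by (intro sum.cong) (auto simp: inner_e)
    then show ?thesis using that by (simp add: if_distrib cong: if_cong)
  qed
  have IJ: "I (J x) = x" if "x \<in> topspace (Euclidean_space k)" for x
    using that by (auto simp: I_def Je topspace_Euclidean_space fun_eq_iff)
  have norm_J: "(norm (J x))\<^sup>2 = (\<Sum>i<k. (x i)\<^sup>2)" for x
    unfolding power2_norm_eq_inner
    by (subst (2) J_def) (simp add: inner_sum_right Je power2_eq_square)
  have sphere: "norm (J x) = 1 \<longleftrightarrow> (\<Sum>i<k. (x i)\<^sup>2) = 1" "norm (J x) \<le> 1 \<longleftrightarrow> (\<Sum>i<k. (x i)\<^sup>2) \<le> 1" for x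
    unfolding norm_J[symmetric] using norm_ge_zero[of "J x"]
    by (auto simp: power2_eq_1_iff abs_square_le_1 simp del: norm_ge_zero)
  have Jspan: "J x \<in> span T" for x
    unfolding J_def using e by (intro span_sum span_scale span_base) (auto simp: bij_betw_def)
  have JI: "J (I v) = v" if "v \<in> span T" for v
  proof -
    have "J (I v) = (\<Sum>i<k. (v \<bullet> e i) *\<^sub>R e i)"
      by (simp add: J_def I_def)
    also have "\<dots> = (\<Sum>b\<in>T. (v \<bullet> b) *\<^sub>R b)"
      using sum.reindex_bij_betw[OF e, of "\<lambda>b. (v \<bullet> b) *\<^sub>R b"] .
    also have "\<dots> = v"
    proof (rule euclidean_eqI)
      fix b :: 'b assume b: "b \<in> Basis"
      have "(\<Sum>c\<in>T. (v \<bullet> c) *\<^sub>R c) \<bullet> b = (\<Sum>c\<in>T. (v \<bullet> c) * (if c = b then 1 else 0))"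
        unfolding inner_sum_left using T b by (intro sum.cong) (auto simp: inner_Basis)
      also have "\<dots> = (if b \<in> T then v \<bullet> b else 0)"
        using finT by (simp add: if_distrib cong: if_cong)
      also have "\<dots> = v \<bullet> b"
        using span_substd_basis[OF T(1)] that b by auto
      finally show "(\<Sum>c\<in>T. (v \<bullet> c) *\<^sub>R c) \<bullet> b = v \<bullet> b" .
    qed
    finally show ?thesis .
  qed
  have Itop: "I v \<in> topspace (Euclidean_space k)" for v
    by (simp add: I_def topspace_Euclidean_space)
  define K where "K = cball 0 1 \<inter> span T"
  have contJ: "continuous_map (Euclidean_space k) euclidean J"
    unfolding J_def
  proof (intro continuous_map_sum)
    fix i assume "i \<in> {..<k}"
    have "continuous_map (Euclidean_space k) euclideanreal (\<lambda>x. x i)"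
      unfolding Euclidean_space_def
      by (intro continuous_map_from_subtopology continuous_map_product_projection) simp
    moreover have "continuous_map euclideanreal euclidean (\<lambda>a. a *\<^sub>R e i)"
      by (simp add: continuous_intros)
    ultimately show "continuous_map (Euclidean_space k) euclidean (\<lambda>x. x i *\<^sub>R e i)"
      using continuous_map_compose[of "Euclidean_space k" euclideanreal "\<lambda>x. x i" euclidean "\<lambda>a. a *\<^sub>R e i"]
      by (simp add: o_def)
  qed simp
  have contI: "continuous_map euclidean (Euclidean_space k) I"
    unfolding Euclidean_space_def I_def
    by (auto simp: continuous_map_in_subtopology continuous_map_componentwise_UNIV
        intro!: continuous_intros)
  have "homeomorphic_maps (subtopology (Euclidean_space k) (unit_ball k)) (top_of_set K) J I"
    unfolding homeomorphic_maps_def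
  proof (intro conjI ballI)
    show "continuous_map (subtopology (Euclidean_space k) (unit_ball k)) (top_of_set K) J"
      using contJ Jspan sphere
      by (auto simp: continuous_map_in_subtopology continuous_map_from_subtopology K_def unit_ball_def)
    have "I v \<in> unit_ball k" if "v \<in> K" for v
      using that Itop sphere(2)[of "I v"] JI[of v] by (auto simp: K_def unit_ball_def)
    then show "continuous_map (top_of_set K) (subtopology (Euclidean_space k) (unit_ball k)) I"
      using contI by (auto simp: continuous_map_in_subtopology continuous_map_from_subtopology)
  qed (use IJ JI in \<open>auto simp: K_def unit_ball_def\<close>)
  then have 1: "homeomorphic_map (subtopology (Euclidean_space k) (unit_ball k)) (top_of_set K) J"
    using homeomorphic_map_maps by blast
  have sub: "interior (cball 0 1) \<inter> span T \<noteq> {}"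
    using span_0[of T] by (metis IntI centre_in_ball empty_iff interior_cball zero_less_one)
  have "aff_dim K = aff_dim (span T)"
    unfolding K_def using sub
    by (metis Int_commute aff_dim_convex_Int_nonempty_interior subspace_span subspace_imp_convex)
  also have "\<dots> = int k"
    using T by (metis aff_dim_subspace dim_span dim_substandard independent_substdbasis dim_eq_card_independent subspace_span)
  finally have 4: "aff_dim K = int k" .
  have "rel_interior K = ball 0 1 \<inter> span T"
    unfolding K_def using sub
    by (subst rel_interior_convex_Int_affine) (auto simp: subspace_imp_affine)
  moreover have cl: "closed K"
    by (auto simp: K_def closed_Int closed_subspace)
  ultimately have rf: "rel_frontier K = sphere 0 1 \<inter> span T"
    unfolding rel_frontier_def K_def closure_closed[OF cl, unfolded K_def] cball_diff_sphere[symmetric]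
    using sphere_cball by blast
  have 5: "J ` unit_sphere k = rel_frontier K"
  proof
    show "J ` unit_sphere k \<subseteq> rel_frontier K"
      using sphere Jspan by (auto simp: rf unit_sphere_def)
    show "rel_frontier K \<subseteq> J ` unit_sphere k"
    proof
      fix v assume "v \<in> rel_frontier K"
      then have "v = J (I v)" "norm (J (I v)) = 1"
        using JI[of v] by (auto simp: rf)
      then show "v \<in> J ` unit_sphere k"
        using sphere(1)[of "I v"] Itop[of v] by (auto simp: unit_sphere_def intro!: image_eqI[of v J "I v"])
    qed
  qed
  show thesis
    by (rule that[OF 1 _ _ 4 5])
       (auto simp: K_def convex_Int subspace_imp_convex compact_Int_closed closed_subspace)
qed

text \<open>A chart onto a convex body suffices to recognise a closed cell: a continuous bijection
  from a compact set is a homeomorphism, all convex bodies of the same dimension are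
  homeomorphic, and invariance of domain makes any such homeomorphism respect the
  relative frontiers.\<close>

lemma closed_cell_convex:
  fixes c S :: "'a::topological_space set" and f :: "'a \<Rightarrow> 'b::euclidean_space"
  assumes c: "compact c" "c \<subseteq> S" and f: "continuous_on c f" "inj_on f c"
    and K: "convex (f ` c)" "aff_dim (f ` c) = int k"
  shows "closed_cell (top_of_set S) k c"
    and "cell_boundary (top_of_set S) k c = {x \<in> c. f x \<in> rel_frontier (f ` c)}"
proof -
  define Q where "Q = f ` c"
  have Q: "convex Q" "compact Q" "aff_dim Q = int k"
    using K c f by (auto simp: Q_def compact_continuous_image)
  have "k \<le> DIM('b)"
    using Q(3) aff_dim_le_DIM[of Q] by simp
  then obtain J :: "(nat \<Rightarrow> real) \<Rightarrow> 'b" and K0 where J: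
    "homeomorphic_map (subtopology (Euclidean_space k) (unit_ball k)) (top_of_set K0) J"
    "convex K0" "compact K0" "aff_dim K0 = int k" "J ` unit_sphere k = rel_frontier K0"
    using unit_ball_convex_model by metis
  have tB: "topspace (subtopology (Euclidean_space k) (unit_ball k)) = unit_ball k"
    by (auto simp: unit_ball_def)
  obtain p q where pq: "homeomorphism K0 Q p q"
    using homeomorphic_convex_compact_sets[OF J(2,3) Q(1,2)] J(4) Q(3)
    by (auto simp: homeomorphic_def)
  then have pq': "homeomorphic_map (top_of_set K0) (top_of_set Q) p"
    by (auto simp: homeomorphic_map_maps homeomorphic_maps_iff_homeomorphism)
  define g where "g = the_inv_into c f"
  have gf: "\<forall>x\<in>c. g (f x) = x"
    using f by (simp add: g_def the_inv_into_f_f)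
  have "homeomorphism Q c g f"
    using continuous_on_inv[OF f(1) c(1) gf] f gf by (simp add: homeomorphism_def Q_def image_image)
  then have g: "homeomorphic_map (top_of_set Q) (top_of_set c) g"
    by (auto simp: homeomorphic_map_maps homeomorphic_maps_iff_homeomorphism)
  define h where "h = g \<circ> p \<circ> J"
  have h: "homeomorphic_map (subtopology (Euclidean_space k) (unit_ball k)) (top_of_set c) h"
    unfolding h_def using J(1) pq' g homeomorphic_map_compose by (metis comp_assoc)
  then have img: "h ` unit_ball k = c"
    using homeomorphic_imp_surjective_map tB by fastforce
  have "subtopology (top_of_set S) c = top_of_set c"
    using c by (simp add: subtopology_subtopology Int_absorb1)
  then have cp: "cell_param (top_of_set S) k c h"
    unfolding cell_param_def embedding_map_def using h img tB by simp
  then show "closed_cell (top_of_set S) k c"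
    by (auto simp: closed_cell_def)
  have "cell_boundary (top_of_set S) k c = h ` unit_sphere k"
    using cell_boundary_eq[OF cp] .
  also have "\<dots> = g ` rel_frontier Q"
    unfolding h_def image_comp[symmetric] J(5)
    using homeomorphism_rel_frontier[OF pq] J Q by (simp add: compact_imp_closed)
  also have "\<dots> = {x \<in> c. f x \<in> rel_frontier Q}"
  proof -
    have "rel_frontier Q \<subseteq> Q"
      using Q by (simp add: rel_frontier_def compact_imp_closed)
    then show ?thesis
      using gf by (force simp: Q_def image_iff)
  qed
  finally show "cell_boundary (top_of_set S) k c = {x \<in> c. f x \<in> rel_frontier (f ` c)}"
    by (simp add: Q_def)
qed

lemma cell_homeomorphic_image:
  assumes g: "homeomorphic_map X X g" and c: "closed_cell X k c"
  shows "closed_cell X k (g ` c)"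
    and "cell_boundary X k (g ` c) = g ` cell_boundary X k c"
proof -
  obtain h where h: "cell_param X k c h"
    using c by (auto simp: closed_cell_def)
  have "embedding_map (subtopology (Euclidean_space k) (unit_ball k)) X (g \<circ> h)"
    using h g embedding_map_compose section_imp_embedding_map section_and_retraction_eq_homeomorphic_map
    unfolding cell_param_def by metis
  then have p: "cell_param X k (g ` c) (g \<circ> h)"
    using h by (auto simp: cell_param_def)
  then show "closed_cell X k (g ` c)"
    by (auto simp: closed_cell_def)
  show "cell_boundary X k (g ` c) = g ` cell_boundary X k c"
    using cell_boundary_eq[OF p] cell_boundary_eq[OF h] by (simp add: image_comp)
qed

text \<open>For a polyhedron with a strictly feasible point all the given constraints are
  inequalities, so the relative frontier is where one of them is an equality.\<close>

lemma polyhedron_frontier: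
  fixes A :: "'a::euclidean_space set" and g :: "'i \<Rightarrow> 'a \<Rightarrow> real"
  assumes A: "affine A" and fin: "finite T"
    and aff: "\<And>t u v x y. u + v = 1 \<Longrightarrow> g t (u *\<^sub>R x + v *\<^sub>R y) = u * g t x + v * g t y"
    and cont: "\<And>t. continuous_on UNIV (g t)"
    and m: "m \<in> A" "\<And>t. t \<in> T \<Longrightarrow> g t m > 0"
  defines "K \<equiv> {x \<in> A. \<forall>t\<in>T. g t x \<ge> 0}"
  shows "convex K" "closed K" "affine hull K = A"
    "rel_frontier K = {x \<in> K. \<exists>t\<in>T. g t x = 0}"
proof -
  show cv: "convex K"
    unfolding convex_def
  proof (intro ballI allI impI)
    fix x y u v :: real and a b
    assume "a \<in> K" "b \<in> K" "0 \<le> u" "0 \<le> v" "u + v = (1::real)"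
    then show "u *\<^sub>R a + v *\<^sub>R b \<in> K"
      using A by (auto simp: K_def aff affine_def)
  qed
  have "K = A \<inter> (\<Inter>t\<in>T. {x. g t x \<ge> 0})"
    by (auto simp: K_def)
  moreover have "closed {x. g t x \<ge> 0}" for t
    using closed_Collect_le[OF continuous_on_const cont] by simp
  ultimately show cl: "closed K"
    using A by (simp add: closed_Int closed_INT affine_closed)
  define U where "U = (\<Inter>t\<in>T. {x. g t x > 0})"
  have "open {x. g t x > 0}" for t
    using open_Collect_less[OF continuous_on_const cont] by simp
  then have U: "open U"
    unfolding U_def using fin by (intro open_INT) auto
  have mU: "m \<in> A \<inter> U" and UK: "A \<inter> U \<subseteq> K"
    using m by (auto simp: U_def K_def less_imp_le)
  have "affine hull (A \<inter> U) = A"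
    using affine_hull_affine_Int_open[OF A U] mU hull_same[of affine A, OF A] by (metis empty_iff)
  then have "A \<subseteq> affine hull K"
    using hull_mono[OF UK, of affine] by simp
  moreover have "affine hull K \<subseteq> A"
    by (rule hull_minimal) (use A in \<open>auto simp: K_def\<close>)
  ultimately show hull: "affine hull K = A"
    by blast
  have ri: "rel_interior K = A \<inter> U"
  proof
    show "A \<inter> U \<subseteq> rel_interior K"
      using UK U hull by (intro rel_interior_maximal) (auto simp: openin_open)
    show "rel_interior K \<subseteq> A \<inter> U"
    proof
      fix x assume x: "x \<in> rel_interior K"
      then have xK: "x \<in> K"
        using rel_interior_subset by blast
      obtain e where e: "e > 1" "(1 - e) *\<^sub>R m + e *\<^sub>R x \<in> K"
        using convex_rel_interior_if[OF cv x] mU UK hull_subset[of K affine] by force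
      have "g t x > 0" if "t \<in> T" for t
      proof (rule ccontr)
        assume "\<not> g t x > 0"
        then have "g t x = 0"
          using xK that by (fastforce simp: K_def)
        then have "g t ((1 - e) *\<^sub>R m + e *\<^sub>R x) = (1 - e) * g t m"
          by (simp add: aff)
        also have "\<dots> < 0"
          using m(2)[OF that] e by (simp add: mult_neg_pos)
        finally show False
          using e that by (auto simp: K_def)
      qed
      then show "x \<in> A \<inter> U"
        using xK by (auto simp: K_def U_def)
    qed
  qed
  show "rel_frontier K = {x \<in> K. \<exists>t\<in>T. g t x = 0}"
    unfolding rel_frontier_def ri using cl by (force simp: K_def U_def)
qed

section \<open>Homogeneous coordinates and the symmetry group\<close>

text \<open>Some vector of homogeneous coordinates. Only functions that are invariant under scaling are
  evaluated at it.\<close>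

definition homog :: "cp3 \<Rightarrow> complex ^ 4"
  where "homog p = (SOME z. z \<noteq> 0 \<and> cp3_of z = p)"

lemma homog: "homog p \<noteq> 0" "cp3_of (homog p) = p"
  using someI_ex[OF cp3_of_surj[of p]] by (auto simp: homog_def)

lemma cp3_of_scale: "z \<noteq> 0 \<Longrightarrow> c \<noteq> 0 \<Longrightarrow> cp3_of (c *s z) = cp3_of z"
  by (subst cp3_of_eq_iff) auto

lemma cp3_lift:
  assumes "z \<noteq> 0" "\<And>c z. c \<noteq> 0 \<Longrightarrow> z \<noteq> 0 \<Longrightarrow> f (c *s z) = f z"
  shows "f (homog (cp3_of z)) = f z"
  using cp3_of_eq_iff[OF homog(1) assms(1), of "cp3_of z"] homog(2) assms by metis

lemma open_cp3_iff: "open (U :: cp3 set) \<longleftrightarrow> open {z. z \<noteq> 0 \<and> cp3_of z \<in> U}"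
  by (simp add: open_cp3_def)

lemma continuous_on_cp3_of: "continuous_on (- {0}) cp3_of"
proof (subst continuous_on_open_vimage)
  show "\<forall>B. open B \<longrightarrow> open (cp3_of -` B \<inter> - {0})"
  proof (intro allI impI)
    fix B :: "cp3 set" assume "open B"
    moreover have "cp3_of -` B \<inter> - {0} = {z. z \<noteq> 0 \<and> cp3_of z \<in> B}" by auto
    ultimately show "open (cp3_of -` B \<inter> - {0})"
      by (simp add: open_cp3_iff)
  qed
qed (simp add: open_Compl)

text \<open>The topology of projective space is the quotient topology.\<close>

lemma continuous_cp3_lift:
  fixes f :: "complex ^ 4 \<Rightarrow> 'a::topological_space"
  assumes f: "continuous_on (- {0}) f" and inv: "\<And>c z. c \<noteq> 0 \<Longrightarrow> z \<noteq> 0 \<Longrightarrow> f (c *s z) = f z"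
  shows "continuous_on UNIV (\<lambda>p. f (homog p))"
proof (subst continuous_on_open_vimage)
  show "\<forall>B. open B \<longrightarrow> open ((\<lambda>p. f (homog p)) -` B \<inter> UNIV)"
  proof (intro allI impI)
    fix B :: "'a set" assume B: "open B"
    have "{z. z \<noteq> 0 \<and> cp3_of z \<in> (\<lambda>p. f (homog p)) -` B \<inter> UNIV} = f -` B \<inter> - {0}"
      using cp3_lift[of _ f] inv by auto
    moreover have "open (f -` B \<inter> - {0})"
      using continuous_open_preimage[OF f _ B] by (simp add: open_Compl Int_commute)
    ultimately show "open ((\<lambda>p. f (homog p)) -` B \<inter> UNIV)"
      by (simp only: open_cp3_iff)
  qed
qed simp

text \<open>A subset of projective space is handled through the scaling-invariant set of its
  homogeneous coordinates.\<close>

definition cone :: "(complex ^ 4) set \<Rightarrow> bool"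
  where "cone K \<longleftrightarrow> 0 \<notin> K \<and> (\<forall>z\<in>K. \<forall>c. c \<noteq> 0 \<longrightarrow> c *s z \<in> K)"

lemma cone_mem:
  assumes "cone K" "z \<noteq> 0"
  shows "cp3_of z \<in> cp3_of ` K \<longleftrightarrow> z \<in> K"
proof
  assume "cp3_of z \<in> cp3_of ` K"
  then obtain w where w: "w \<in> K" "cp3_of z = cp3_of w" by auto
  then have "w \<noteq> 0" using assms by (auto simp: cone_def)
  then obtain c where "c \<noteq> 0" "z = c *s w"
    using w assms by (auto simp: cp3_of_eq_iff)
  then show "z \<in> K" using assms w by (auto simp: cone_def)
qed auto

lemma cone_subset:
  assumes "cone K" "cone L"
  shows "cp3_of ` K \<subseteq> cp3_of ` L \<longleftrightarrow> K \<subseteq> L"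
proof
  assume "cp3_of ` K \<subseteq> cp3_of ` L"
  then show "K \<subseteq> L"
    using cone_mem[OF assms(2)] assms(1) by (metis cone_def image_subset_iff subsetI)
qed auto

lemma cone_eq:
  assumes "cone K" "cone L"
  shows "cp3_of ` K = cp3_of ` L \<longleftrightarrow> K = L"
  using cone_subset[OF assms] cone_subset[OF assms(2,1)] by auto

text \<open>Unlike the permutations and phase multiplications that generate the symmetry group, these maps,
  for roots of unity \<open>u\<close>, are closed under composition.\<close>

definition permscale :: "(4 \<Rightarrow> 4) \<Rightarrow> (4 \<Rightarrow> complex) \<Rightarrow> complex ^ 4 \<Rightarrow> complex ^ 4"
  where "permscale \<sigma> u z = (\<chi> i. u i * z $ \<sigma> i)"

lemma permscale_nth [simp]: "permscale \<sigma> u z $ i = u i * z $ \<sigma> i"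
  by (simp add: permscale_def)

lemma permscale_comp: "permscale \<sigma> u (permscale \<tau> v z) = permscale (\<tau> \<circ> \<sigma>) (\<lambda>i. u i * v (\<sigma> i)) z"
  by (simp add: vec_eq_iff)

lemma permscale_scale: "permscale \<sigma> u (c *s z) = c *s permscale \<sigma> u z"
  by (simp add: vec_eq_iff)

lemma bij_on_4:
  assumes "bij (\<sigma> :: 4 \<Rightarrow> 4)"
  shows "bij (inv_into UNIV \<sigma>)" "\<sigma> (inv_into UNIV \<sigma> i) = i" "inv_into UNIV \<sigma> (\<sigma> i) = i"
  using assms by (auto simp: bij_imp_bij_inv bij_is_surj surj_f_inv_f bij_is_inj)

locale fermat =
  fixes n :: nat
  assumes n_pos: "n > 0"
begin

definition monomial :: "(complex ^ 4 \<Rightarrow> complex ^ 4) \<Rightarrow> bool"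
  where "monomial A \<longleftrightarrow> (\<exists>\<sigma> u. bij \<sigma> \<and> (\<forall>i. u i ^ n = 1) \<and> A = permscale \<sigma> u)"

lemma monomial_permscale: "bij \<sigma> \<Longrightarrow> (\<And>i. u i ^ n = 1) \<Longrightarrow> monomial (permscale \<sigma> u)"
  by (auto simp: monomial_def)

lemma root_nonzero: "(u::complex) ^ n = 1 \<Longrightarrow> u \<noteq> 0"
  using n_pos by (auto simp: power_0_left)

lemma root_norm: "(u::complex) ^ n = 1 \<Longrightarrow> cmod u = 1"
  using n_pos by (metis norm_one norm_power power_eq_1_iff norm_ge_zero less_not_refl)

lemma monomial_id: "monomial (\<lambda>z. z)"
proof -
  have "(\<lambda>z. z) = permscale id (\<lambda>_. 1)" by (auto simp: vec_eq_iff)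
  then show ?thesis using monomial_permscale[of id "\<lambda>_. 1"] by simp
qed

lemma monomial_comp:
  assumes "monomial A" "monomial B"
  shows "monomial (\<lambda>z. A (B z))"
proof -
  obtain \<sigma> u where A: "bij \<sigma>" "\<And>i. u i ^ n = 1" "A = permscale \<sigma> u"
    using assms(1) by (auto simp: monomial_def)
  obtain \<tau> v where B: "bij \<tau>" "\<And>i. v i ^ n = 1" "B = permscale \<tau> v"
    using assms(2) by (auto simp: monomial_def)
  show ?thesis
    unfolding A(3) B(3) permscale_comp using A B
    by (intro monomial_permscale) (auto simp: bij_comp power_mult_distrib)
qed

lemma monomial_inverse:
  assumes "monomial A"
  obtains B where "monomial B" "\<And>z. B (A z) = z" "\<And>z. A (B z) = z"
proof -
  obtain \<sigma> u where A: "bij \<sigma>" "\<And>i. u i ^ n = 1" "A = permscale \<sigma> u"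
    using assms(1) by (auto simp: monomial_def)
  note \<sigma> = bij_on_4[OF A(1)]
  show thesis
  proof
    show "monomial (permscale (inv_into UNIV \<sigma>) (\<lambda>i. inverse (u (inv_into UNIV \<sigma> i))))"
      using \<sigma> A by (intro monomial_permscale) (auto simp: power_inverse)
  qed (use \<sigma> A root_nonzero in \<open>simp_all add: vec_eq_iff mult.assoc[symmetric]\<close>)
qed

lemma monomial_scale: "monomial A \<Longrightarrow> A (c *s z) = c *s A z"
  by (auto simp: monomial_def permscale_scale)

lemma monomial_zero [simp]:
  assumes "monomial A" shows "A z = 0 \<longleftrightarrow> z = 0"
proof -
  obtain B where "\<And>z. B (A z) = z" "monomial B"
    using monomial_inverse[OF assms] by metis
  moreover have "C 0 = 0" if "monomial C" for C
    using monomial_scale[OF that, of 0 0] by simp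
  ultimately show ?thesis using assms by metis
qed

lemma monomial_sum:
  assumes "monomial A"
  shows "(\<Sum>i\<in>UNIV. (A z $ i) ^ n) = (\<Sum>i\<in>UNIV. (z $ i) ^ n)"
proof -
  obtain \<sigma> u where A: "bij \<sigma>" "\<And>i. u i ^ n = 1" "A = permscale \<sigma> u"
    using assms(1) by (auto simp: monomial_def)
  then show ?thesis
    using sum.reindex_bij_betw[OF A(1), of "\<lambda>i. (z $ i) ^ n"] by (simp add: power_mult_distrib)
qed

lemma monomial_continuous:
  assumes "monomial A" shows "continuous_on X A"
proof -
  obtain \<sigma> u where "A = permscale \<sigma> u"
    using assms(1) by (auto simp: monomial_def)
  then have A: "A = (\<lambda>z. \<chi> i. u i * z $ \<sigma> i)"
    by (auto simp: vec_eq_iff)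
  show ?thesis
    unfolding A by (intro continuous_on_vec_lambda continuous_intros)
qed

lemma cone_monomial:
  assumes A: "monomial A" and K: "cone K" shows "cone (A ` K)"
proof -
  have "A z \<noteq> 0" if "z \<in> K" for z
    using that A K by (auto simp: cone_def)
  then show ?thesis
    using K monomial_scale[OF A, symmetric] by (auto simp: cone_def)
qed

text \<open>The self-map of projective space that a linear map induces.\<close>

definition act :: "(complex ^ 4 \<Rightarrow> complex ^ 4) \<Rightarrow> cp3 \<Rightarrow> cp3"
  where "act A p = cp3_of (A (homog p))"

lemma act_cp3_of:
  assumes "monomial A" "z \<noteq> 0"
  shows "act A (cp3_of z) = cp3_of (A z)"
  unfolding act_def
  by (rule cp3_lift[where f = "\<lambda>z. cp3_of (A z)"])
     (use assms in \<open>auto simp: monomial_scale intro!: cp3_of_scale\<close>)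

lemma act_image:
  assumes "monomial A" "0 \<notin> K"
  shows "act A ` (cp3_of ` K) = cp3_of ` (A ` K)"
  unfolding image_image using assms by (intro image_cong) (auto intro!: act_cp3_of)

lemma act_comp:
  assumes "monomial A" "monomial B"
  shows "act A (act B p) = act (\<lambda>z. A (B z)) p"
  using act_cp3_of[OF assms(1), of "B (homog p)"] assms(2) homog(1) by (simp add: act_def)

lemma continuous_act:
  assumes "monomial A" shows "continuous_on X (act A)"
proof -
  have "continuous_on UNIV (\<lambda>p. cp3_of (A (homog p)))"
  proof (rule continuous_cp3_lift)
    show "continuous_on (- {0}) (\<lambda>z. cp3_of (A z))"
      using assms by (intro continuous_on_compose2[OF continuous_on_cp3_of monomial_continuous]) auto
  qed (use assms in \<open>auto simp: monomial_scale intro!: cp3_of_scale\<close>)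
  then show ?thesis
    by (auto simp: act_def[abs_def] intro: continuous_on_subset)
qed

abbreviation surf :: "cp3 set"
  where "surf \<equiv> fermat_surface n"

lemma act_surface:
  assumes "monomial A" "p \<in> surf" shows "act A p \<in> surf"
proof -
  have "(\<Sum>i\<in>UNIV. (homog p $ i) ^ n) = 0"
    using assms(2) cp3_of_in_fermat_surface[OF homog(1)] by (simp add: homog)
  then have "cp3_of (A (homog p)) \<in> surf"
    using assms(1) by (simp add: cp3_of_in_fermat_surface homog monomial_sum)
  then show ?thesis by (simp add: act_def)
qed

lemma homeomorphic_act:
  assumes A: "monomial A"
  shows "homeomorphic_map (top_of_set surf) (top_of_set surf) (act A)"
proof -
  obtain B where B: "monomial B" "\<And>z. B (A z) = z" "\<And>z. A (B z) = z"
    using monomial_inverse[OF A] by metis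
  have id: "act (\<lambda>z. z) p = p" for p
    by (simp add: act_def homog)
  have "homeomorphic_maps (top_of_set surf) (top_of_set surf) (act A) (act B)"
    using A B id by (auto simp: homeomorphic_maps_def act_comp act_surface continuous_act image_subset_iff)
  then show ?thesis using homeomorphic_map_maps by blast
qed

text \<open>Induction over the generated group: both kinds of generators are monomial, and monomial maps
  are closed under composition and inverses.\<close>

lemma fermat_group_act:
  assumes "g \<in> fermat_group n"
  shows "\<exists>A. monomial A \<and> (\<forall>p\<in>surf. g p = act A p)"
proof -
  have surf: "p \<in> surf \<Longrightarrow> homog p \<noteq> 0 \<and> cp3_of (homog p) \<in> surf" for p
    by (simp add: homog)
  have gens: "\<exists>A. monomial A \<and> (\<forall>p\<in>surf. g p = act A p)" if "g \<in> fermat_generators n" for g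
  proof -
    obtain A where A: "monomial A" "induced_on surf A g"
    proof -
      have "monomial (permute_coords \<sigma>)" if "bij \<sigma>" for \<sigma>
      proof -
        have "permute_coords \<sigma> = permscale \<sigma> (\<lambda>_. 1)"
          by (auto simp: permute_coords_def vec_eq_iff)
        then show ?thesis using that by (auto intro!: monomial_permscale)
      qed
      moreover have "monomial (phase_mult n k)" for k
      proof -
        have "phase_mult n k = permscale id (\<lambda>i. exp (\<i> * of_real (2 * of_int (k i) * pi / of_nat n)))"
          by (auto simp: phase_mult_def vec_eq_iff)
        moreover have "exp (\<i> * of_real (2 * of_int a * pi / of_nat n)) ^ n = 1" for a
        proof -
          have "exp (\<i> * of_real (2 * of_int a * pi / of_nat n)) ^ n = cis (2 * pi * of_int a)"
            using n_pos by (simp add: cis_conv_exp exp_of_nat_mult[symmetric] mult_ac)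
          also have "\<dots> = 1" by (simp add: cis_multiple_2pi)
          finally show ?thesis .
        qed
        ultimately show ?thesis by (auto intro!: monomial_permscale)
      qed
      ultimately show thesis
        using that \<open>g \<in> fermat_generators n\<close> unfolding fermat_generators_def by blast
    qed
    then show ?thesis
      using surf by (intro exI[of _ A]) (auto simp: induced_on_def act_def homog dest!: spec[of _ "homog _"])
  qed
  have carr: "fermat_generators n \<subseteq> Bij surf"
    by (auto simp: fermat_generators_def induced_on_def)
  show ?thesis
    using assms unfolding fermat_group_def
  proof (induction rule: generate.induct)
    case one
    then show ?case
      using monomial_id by (intro exI[of _ "\<lambda>z. z"]) (auto simp: BijGroup_def act_def homog)
  next
    case (incl h)
    then show ?case by (rule gens)
  next
    case (inv h)
    then obtain A where A: "monomial A" "\<forall>p\<in>surf. h p = act A p"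
      using gens by blast
    obtain B where B: "monomial B" "\<And>z. B (A z) = z" "\<And>z. A (B z) = z"
      using monomial_inverse[OF A(1)] by metis
    have h: "h \<in> Bij surf" using inv carr by blast
    have "inv\<^bsub>BijGroup surf\<^esub> h = (\<lambda>x\<in>surf. inv_into surf h x)"
      using inv_BijGroup[OF h] .
    moreover have "inv_into surf h p = act B p" if p: "p \<in> surf" for p
    proof (rule inv_into_f_eq)
      show "inj_on h surf" using h by (auto simp: Bij_def bij_betw_def)
      show "act B p \<in> surf" using B p act_surface by blast
      then show "h (act B p) = p"
        using A B p by (simp add: act_comp) (simp add: act_def homog)
    qed
    ultimately show ?case using B by auto
  next
    case (eng h1 h2)
    then obtain A B where AB: "monomial A" "\<forall>p\<in>surf. h1 p = act A p"
      "monomial B" "\<forall>p\<in>surf. h2 p = act B p" by blast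
    have "h1 \<in> Bij surf" "h2 \<in> Bij surf"
      using eng(1,2) group.generate_incl[OF group_BijGroup, of "fermat_generators n" surf] carr
      by (auto simp: BijGroup_def)
    then have "(h1 \<otimes>\<^bsub>BijGroup surf\<^esub> h2) p = h1 (h2 p)" if "p \<in> surf" for p
      using that by (simp add: BijGroup_def compose_def)
    then show ?case
      using AB act_surface by (intro exI[of _ "\<lambda>z. A (B z)"]) (auto simp: act_comp monomial_comp)
  qed
qed

lemma act_fermat_group:
  assumes "monomial A"
  shows "\<exists>g\<in>fermat_group n. \<forall>p\<in>surf. g p = act A p"
proof -
  obtain \<sigma> u where A: "bij \<sigma>" "\<And>i. u i ^ n = 1" "A = permscale \<sigma> u"
    using assms(1) by (auto simp: monomial_def)
  have "\<exists>j. u i = exp (\<i> * of_real (2 * of_int j * pi / of_nat n))" for i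
  proof -
    obtain j :: nat where "u i = exp (2 * of_real pi * \<i> * of_nat j / of_nat n)"
      using A(2)[of i] n_pos complex_roots_unity[of n] by auto
    then show ?thesis by (intro exI[of _ "int j"]) (simp add: mult_ac)
  qed
  then obtain k where k: "\<And>i. u i = exp (\<i> * of_real (2 * of_int (k i) * pi / of_nat n))"
    by metis
  have mono: "A z = phase_mult n k (permute_coords \<sigma> z)" for z
    by (simp add: A(3) vec_eq_iff phase_mult_def permute_coords_def k)
  obtain f where f: "f \<in> fermat_group n" "induced_on surf (permute_coords \<sigma>) f"
    using permutation_induces[OF A(1)] by blast
  obtain g where g: "g \<in> fermat_group n" "induced_on surf (phase_mult n k) g"
    using phase_mult_induces[OF n_pos] by blast
  have Bij: "f \<in> Bij surf" "g \<in> Bij surf"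
    using f g by (auto simp: induced_on_def)
  have "g \<otimes>\<^bsub>BijGroup surf\<^esub> f \<in> fermat_group n"
    using subgroup_fermat_group f g by (metis subgroup.m_closed)
  moreover have "(g \<otimes>\<^bsub>BijGroup surf\<^esub> f) p = act A p" if p: "p \<in> surf" for p
  proof -
    have z: "homog p \<noteq> 0" "cp3_of (homog p) \<in> surf" using p by (auto simp: homog)
    have fp: "f p = cp3_of (permute_coords \<sigma> (homog p))"
      using f(2) z by (auto simp: induced_on_def homog dest!: spec[of _ "homog p"])
    have "f p \<in> surf" using Bij p by (auto simp: Bij_def bij_betw_def)
    moreover have "permute_coords \<sigma> (homog p) \<noteq> 0"
    proof
      assume "permute_coords \<sigma> (homog p) = 0"
      then have "A (homog p) = 0" by (simp add: mono phase_mult_def vec_eq_iff)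
      then show False using assms z by simp
    qed
    ultimately have "g (f p) = cp3_of (A (homog p))"
      using g(2) fp by (auto simp: induced_on_def mono)
    then show ?thesis
      using Bij p by (simp add: BijGroup_def compose_def act_def)
  qed
  ultimately show ?thesis by blast
qed

end

section \<open>Nonnegative reals, sectors and the fan of rays\<close>

lemma all4: "(\<forall>i::4. P i) \<longleftrightarrow> P 0 \<and> P 1 \<and> P 2 \<and> P 3"
proof -
  have "(4::4) = 0" by simp
  then show ?thesis using forall_4[of P] by metis
qed

lemma sum4: "sum f (UNIV::4 set) = f 0 + f 1 + f 2 + f 3"
proof -
  have "(4::4) = 0" by simp
  then have "f 4 = f 0" by (simp only:)
  then show ?thesis unfolding sum_4 by (simp add: add_ac)
qed

definition nn :: "complex \<Rightarrow> bool"
  where "nn c \<longleftrightarrow> Im c = 0 \<and> 0 \<le> Re c"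

lemma nn_cnj [simp]: "nn (cnj c) = nn c"
  by (simp add: nn_def)

lemma nn_0 [simp]: "nn 0"
  by (simp add: nn_def)

lemma nn_iff_cmod: "nn c \<longleftrightarrow> Re c = cmod c"
proof
  assume "nn c" then show "Re c = cmod c"
    by (simp add: nn_def cmod_eq_Re)
next
  assume a: "Re c = cmod c"
  then have "(Re c)\<^sup>2 = (Re c)\<^sup>2 + (Im c)\<^sup>2"
    using cmod_power2[of c] by simp
  then show "nn c" using a by (simp add: nn_def)
qed

lemma nn_both: "nn c \<Longrightarrow> nn (- c) \<Longrightarrow> c = 0"
  by (auto simp: nn_def complex_eq_iff)

lemma cmod_add_power2: "(cmod (a + b))\<^sup>2 = (cmod a)\<^sup>2 + (cmod b)\<^sup>2 + 2 * Re (a * cnj b)"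
  unfolding cmod_power2 by (simp add: power2_eq_square algebra_simps)

text \<open>Equality in the triangle inequality. With its counterpart for opposite directions it turns
  statements about directions of sides into equations between side lengths.\<close>

lemma nn_iff_add: "nn (a * cnj b) \<longleftrightarrow> cmod (a + b) = cmod a + cmod b"
proof -
  have "nn (a * cnj b) \<longleftrightarrow> (cmod (a + b))\<^sup>2 = (cmod a + cmod b)\<^sup>2"
    unfolding nn_iff_cmod cmod_add_power2 power2_sum norm_mult complex_mod_cnj by linarith
  then show ?thesis by (simp add: power2_eq_iff_nonneg)
qed

lemma nn_iff_diff:
  "nn (- (a * cnj b)) \<longleftrightarrow> cmod (a + b) = cmod a - cmod b \<or> cmod (a + b) = cmod b - cmod a"
proof -
  have "nn (- (a * cnj b)) \<longleftrightarrow> (cmod (a + b))\<^sup>2 = (cmod a - cmod b)\<^sup>2"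
    unfolding nn_iff_cmod cmod_add_power2 power2_diff norm_minus_cancel norm_mult complex_mod_cnj
      uminus_complex.sel by linarith
  then show ?thesis by (auto simp: power2_eq_iff)
qed

lemma nn_parallel:
  assumes "nn (a * cnj b)"
  shows "of_real (cmod a) * b = of_real (cmod b) * a"
proof -
  define x y where "x = of_real (cmod a) * b" and "y = - (of_real (cmod b) * a)"
  have "Re (a * cnj b) = cmod a * cmod b"
    using assms by (simp add: nn_iff_cmod norm_mult)
  then have "Re (b * cnj a) = cmod a * cmod b" by (simp add: algebra_simps)
  moreover have "x * cnj y = of_real (- (cmod a * cmod b)) * (b * cnj a)"
    by (simp add: x_def y_def)
  then have "Re (x * cnj y) = - (cmod a * cmod b) * Re (b * cnj a)"
    by (simp only: Re_complex_of_real Im_complex_of_real times_complex.sel)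
  ultimately have "Re (x * cnj y) = - (cmod a * cmod b) * (cmod a * cmod b)" by simp
  then have "(cmod (x + y))\<^sup>2 = 0"
    unfolding cmod_add_power2 by (simp add: x_def y_def norm_mult power2_eq_square)
  then show ?thesis by (simp add: x_def y_def)
qed

lemma complex_eq_upper:
  assumes "Re a = Re b" "cmod a = cmod b" "0 \<le> Im a" "0 \<le> Im b"
  shows "a = b"
proof -
  have "(Im a)\<^sup>2 = (Im b)\<^sup>2"
    using assms cmod_power2[of a] cmod_power2[of b] by simp
  then show ?thesis using assms by (simp add: complex_eq_iff power2_eq_iff_nonneg)
qed

text \<open>Homogeneous coordinates are compared through the Hermitian products of two of them,
  which determine the point.\<close>

definition hp :: "complex ^ 4 \<Rightarrow> 4 \<Rightarrow> 4 \<Rightarrow> complex"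
  where "hp z i j = z $ i * cnj (z $ j)"

lemma hp_cnj: "cnj (hp z i j) = hp z j i"
  by (simp add: hp_def)

lemma hp_self: "nn (hp z i i)" "hp z i i = 0 \<longleftrightarrow> z $ i = 0"
  by (auto simp: hp_def nn_def)

text \<open>Both vectors are multiples of the same column of the matrix of products.\<close>

lemma hp_determines:
  assumes z: "z \<noteq> 0" and y: "y \<noteq> 0" and hp: "\<And>i j. hp y i j = hp z i j"
  shows "cp3_of y = cp3_of z"
proof -
  obtain j where j: "z $ j \<noteq> 0" using z by (auto simp: vec_eq_iff)
  then have yj: "y $ j \<noteq> 0" using hp[of j j] hp_self(2) by metis
  define c where "c = cnj (z $ j) / cnj (y $ j)"
  have "y $ i = c * z $ i" for i
    using hp[of i j] yj by (simp add: hp_def c_def field_simps)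
  then have "y = c *s z" by (simp add: vec_eq_iff)
  moreover have "c \<noteq> 0" using j yj by (simp add: c_def)
  ultimately show ?thesis using z by (simp add: cp3_of_scale)
qed

definition vec4 :: "'a \<Rightarrow> 'a \<Rightarrow> 'a \<Rightarrow> 'a \<Rightarrow> 'a ^ 4"
  where "vec4 a b c d = (\<chi> i. if i = 0 then a else if i = 1 then b else if i = 2 then c else d)"

lemma vec4_nth [simp]:
  "vec4 a b c d $ 0 = a" "vec4 a b c d $ 1 = b" "vec4 a b c d $ 2 = c" "vec4 a b c d $ 3 = d"
  by (simp_all add: vec4_def)

context fermat begin

abbreviation \<eta> :: complex where "\<eta> \<equiv> cis (pi / n)"
abbreviation \<omega> :: complex where "\<omega> \<equiv> cis (2 * pi / n)"

lemma cis_pow: "cis (x / n) ^ n = cis x"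
  using n_pos unfolding Complex.DeMoivre by simp

lemma omega_pow: "\<omega> ^ n = 1" "\<omega> ^ (2 * n) = 1" and eta_pow: "cnj \<eta> ^ (2 * n) = 1" "cnj \<eta> ^ n = - 1"
proof -
  show 1: "\<omega> ^ n = 1" by (simp add: cis_pow)
  show "\<omega> ^ (2 * n) = 1" using 1 by (metis mult.commute power_mult power_one)
  show 2: "cnj \<eta> ^ n = - 1"
    using cis_pow[of pi] by (metis complex_cnj_power cis_pi complex_cnj_minus complex_cnj_one)
  then show "cnj \<eta> ^ (2 * n) = 1" by (metis mult.commute power_mult power2_minus power_one)
qed

text \<open>The closed sector of the angles between 0 and \<open>pi / n\<close>, on which the power map is injective.\<close>

definition sec :: "complex \<Rightarrow> bool"
  where "sec c \<longleftrightarrow> 0 \<le> Im c \<and> Im (cnj \<eta> * c) \<le> 0"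

lemma pi_n: "0 < pi / n" "pi / n \<le> pi"
  using n_pos by (auto simp: field_simps)

lemma sec_0 [simp]: "sec 0" by (simp add: sec_def)

lemma sec_polar:
  assumes "sec c"
  obtains \<phi> where "0 \<le> \<phi>" "\<phi> \<le> pi / n" "c = cmod c * cis \<phi>"
proof (cases "c = 0")
  case True
  then show thesis using that[of 0] pi_n by simp
next
  case False
  define \<phi> where "\<phi> = Arg c"
  have \<phi>: "- pi < \<phi>" "\<phi> \<le> pi" using Arg_bounded[of c] by (auto simp: \<phi>_def)
  have c: "c = cmod c * cis \<phi>"
    using rcis_cmod_Arg[of c] by (simp add: \<phi>_def rcis_def)
  have "Im c = cmod c * sin \<phi>" by (subst c) simp
  then have "sin \<phi> \<ge> 0"
    using assms False by (simp add: sec_def zero_le_mult_iff)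
  then have \<phi>0: "0 \<le> \<phi>"
    using \<phi> sin_gt_zero[of "- \<phi>"] by fastforce
  have "Im (cnj \<eta> * c) = cmod c * sin (\<phi> - pi / n)"
    by (subst c) (simp add: sin_diff algebra_simps)
  then have le: "sin (\<phi> - pi / n) \<le> 0"
    using assms False by (simp add: sec_def mult_le_0_iff)
  have "\<phi> \<le> pi / n"
  proof (rule ccontr)
    assume "\<not> \<phi> \<le> pi / n"
    then show False
      using sin_gt_zero[of "\<phi> - pi / n"] \<phi> pi_n le by linarith
  qed
  then show thesis using that \<phi>0 c by blast
qed

lemma sec_cis:
  assumes "0 \<le> t" "0 \<le> \<phi>" "\<phi> \<le> pi / n"
  shows "sec (of_real t * cis \<phi>)"
proof -
  have "Im (cnj \<eta> * (t * cis \<phi>)) = t * sin (\<phi> - pi / n)"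
    by (simp add: sin_diff algebra_simps)
  moreover have "sin (\<phi> - pi / n) \<le> 0"
    using sin_ge_zero[of "pi / n - \<phi>"] assms pi_n by (simp add: sin_diff mult.commute)
  moreover have "sin \<phi> \<ge> 0" using assms pi_n by (intro sin_ge_zero) linarith+
  ultimately show ?thesis using assms by (simp add: sec_def mult_nonneg_nonpos)
qed

lemma sec_pow_polar:
  assumes "sec c"
  obtains \<phi> where "0 \<le> \<phi>" "\<phi> \<le> pi" "c = cmod c * cis (\<phi> / n)" "c ^ n = cmod c ^ n * cis \<phi>"
proof -
  obtain \<phi> where \<phi>: "0 \<le> \<phi>" "\<phi> \<le> pi / n" "c = cmod c * cis \<phi>"
    using sec_polar[OF assms] .
  show thesis
  proof
    show "0 \<le> n * \<phi>" "n * \<phi> \<le> pi" using \<phi> n_pos by (auto simp: field_simps)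
    show c: "c = cmod c * cis (n * \<phi> / n)" using \<phi> n_pos by simp
    have "c ^ n = (cmod c * cis (n * \<phi> / n)) ^ n" using c by simp
    then show "c ^ n = cmod c ^ n * cis (n * \<phi>)"
      unfolding power_mult_distrib cis_pow by simp
  qed
qed

lemma cos_half_turn_eq:
  assumes "0 \<le> \<phi>" "\<phi> \<le> pi"
  shows "sin \<phi> = 0 \<and> cos \<phi> \<ge> 0 \<longleftrightarrow> \<phi> = 0" "sin \<phi> = 0 \<and> cos \<phi> \<le> 0 \<longleftrightarrow> \<phi> = pi"
proof -
  have "sin \<phi> = 0 \<Longrightarrow> \<phi> = 0 \<or> \<phi> = pi"
    using sin_gt_zero[of \<phi>] assms by fastforce
  then show "sin \<phi> = 0 \<and> cos \<phi> \<ge> 0 \<longleftrightarrow> \<phi> = 0" "sin \<phi> = 0 \<and> cos \<phi> \<le> 0 \<longleftrightarrow> \<phi> = pi"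
    by auto
qed

text \<open>The power map takes the sector onto the closed upper half plane, and its two bounding rays onto
  the two halves of the real axis.\<close>

lemma sec_pow:
  assumes "sec c"
  shows "0 \<le> Im (c ^ n)" "nn (c ^ n) \<longleftrightarrow> nn c" "nn (- (c ^ n)) \<longleftrightarrow> nn (cnj \<eta> * c)"
proof -
  obtain \<phi> where \<phi>: "0 \<le> \<phi>" "\<phi> \<le> pi" "c = cmod c * cis (\<phi> / n)" "c ^ n = cmod c ^ n * cis \<phi>"
    using sec_pow_polar[OF assms] .
  have pow: "Im (c ^ n) = cmod c ^ n * sin \<phi>" "Re (c ^ n) = cmod c ^ n * cos \<phi>"
    by (simp_all add: \<phi>(4) flip: of_real_power)
  then show "0 \<le> Im (c ^ n)"
    using \<phi> sin_ge_zero by simp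
  have c: "Im c = cmod c * sin (\<phi> / n)" "Re c = cmod c * cos (\<phi> / n)"
    by (subst \<phi>(3); simp)+
  have e: "Im (cnj \<eta> * c) = cmod c * sin (\<phi> / n - pi / n)" "Re (cnj \<eta> * c) = cmod c * cos (\<phi> / n - pi / n)"
    by (subst \<phi>(3); simp add: sin_diff cos_diff algebra_simps)+
  have n1: "0 \<le> \<phi> / n" "\<phi> / n \<le> pi" "0 \<le> pi / n - \<phi> / n" "pi / n - \<phi> / n \<le> pi"
    using \<phi> n_pos pi_n by (auto simp: field_simps)
      (smt (verit) mult_le_cancel_left1 mult_left_mono of_nat_0_le_iff of_nat_1 of_nat_mono Suc_leI One_nat_def)+
  show "nn (c ^ n) \<longleftrightarrow> nn c"
  proof (cases "c = 0")
    case False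
    then have "nn (c ^ n) \<longleftrightarrow> \<phi> = 0"
    proof -
      define p where "p = cmod c ^ n"
      have "p > 0" using False by (simp add: p_def)
      then show ?thesis
        using cos_half_turn_eq(1)[OF \<phi>(1,2)] by (simp add: nn_def pow[folded p_def] zero_le_mult_iff)
    qed
    moreover have "nn c \<longleftrightarrow> \<phi> / n = 0"
      using False cos_half_turn_eq[OF n1(1,2)] by (simp add: nn_def c zero_le_mult_iff)
    ultimately show ?thesis using n_pos by simp
  qed (use n_pos in \<open>simp add: power_0_left\<close>)
  show "nn (- (c ^ n)) \<longleftrightarrow> nn (cnj \<eta> * c)"
  proof (cases "c = 0")
    case False
    then have "nn (- (c ^ n)) \<longleftrightarrow> \<phi> = pi"
    proof -
      define p where "p = cmod c ^ n"
      have "p > 0" using False by (simp add: p_def)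
      then show ?thesis
        using cos_half_turn_eq(2)[OF \<phi>(1,2)] by (simp add: nn_def pow[folded p_def] mult_le_0_iff)
    qed
    moreover have "nn (cnj \<eta> * c) \<longleftrightarrow> pi / n - \<phi> / n = 0"
    proof -
      have "sin (\<phi> / n - pi / n) = - sin (pi / n - \<phi> / n)" "cos (\<phi> / n - pi / n) = cos (pi / n - \<phi> / n)"
        by (simp_all add: sin_diff cos_diff)
      then show ?thesis
        using False cos_half_turn_eq[OF n1(3,4)] unfolding nn_def e by (simp add: zero_le_mult_iff)
    qed
    ultimately show ?thesis using n_pos by (auto simp: field_simps)
  qed (use n_pos in \<open>simp add: power_0_left\<close>)
qed

lemma sec_pow_inj:
  assumes "sec a" "sec b" "a ^ n = b ^ n" shows "a = b"
proof -
  obtain \<phi> where \<phi>: "0 \<le> \<phi>" "\<phi> \<le> pi" "a = cmod a * cis (\<phi> / n)" "a ^ n = cmod a ^ n * cis \<phi>"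
    using sec_pow_polar[OF assms(1)] .
  obtain \<psi> where \<psi>: "0 \<le> \<psi>" "\<psi> \<le> pi" "b = cmod b * cis (\<psi> / n)" "b ^ n = cmod b ^ n * cis \<psi>"
    using sec_pow_polar[OF assms(2)] .
  have "cmod a ^ n = cmod b ^ n" using assms(3) by (metis norm_power)
  then have ab: "cmod a = cmod b"
    using n_pos by (simp add: power_eq_iff_eq_base)
  show ?thesis
  proof (cases "a = 0")
    case False
    then have "complex_of_real (cmod b) ^ n \<noteq> 0" using ab by auto
    then have "cis \<phi> = cis \<psi>" using assms(3) \<phi>(4) \<psi>(4) ab n_pos by auto
    then have "cos \<phi> = cos \<psi>" by (simp add: complex_eq_iff)
    then have "\<phi> = \<psi>" using cos_inj_pi \<phi> \<psi> by blast
    then show ?thesis using \<phi>(3) \<psi>(3) ab by simp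
  qed (use ab in simp)
qed

text \<open>The rays at angles that are multiples of \<open>\<pi> / n\<close> divide the plane into sectors.
  \<open>same_sector b a\<close> says that \<open>b\<close> lies in the smallest closed cell (origin, ray or
  sector) of this fan that contains \<open>a\<close>. Since the tests are indexed by the roots of unity
  of order \<open>2 * n\<close>, the relation is invariant under phase changes for free.\<close>

definition same_sector :: "complex \<Rightarrow> complex \<Rightarrow> bool"
  where "same_sector b a \<longleftrightarrow> (\<forall>\<xi>. \<xi> ^ (2 * n) = 1 \<longrightarrow>
    (0 \<le> Im (\<xi> * a) \<longrightarrow> 0 \<le> Im (\<xi> * b)) \<and> (nn (\<xi> * a) \<longrightarrow> nn (\<xi> * b)))"

lemma same_sector_nn: "same_sector b a \<Longrightarrow> nn a \<Longrightarrow> nn b"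
  unfolding same_sector_def by (drule spec[of _ 1]) simp

lemma same_sector_sec:
  assumes "same_sector b a" "sec a" shows "sec b"
proof -
  have "(- cnj \<eta>) ^ (2 * n) = 1" using eta_pow by (simp add: power_mult)
  then have "0 \<le> Im (- cnj \<eta> * a) \<longrightarrow> 0 \<le> Im (- cnj \<eta> * b)" "0 \<le> Im a \<longrightarrow> 0 \<le> Im b"
    using assms(1) unfolding same_sector_def by (blast, metis mult_1 power_one)
  then show ?thesis using assms(2) by (simp add: sec_def)
qed

lemma same_sector_mult_imp:
  assumes "\<zeta> ^ (2 * n) = 1" "same_sector b a"
  shows "same_sector (\<zeta> * b) (\<zeta> * a)"
  unfolding same_sector_def
proof (intro allI impI)
  fix \<xi> :: complex assume "\<xi> ^ (2 * n) = 1"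
  then have "(\<xi> * \<zeta>) ^ (2 * n) = 1" using assms by (simp add: power_mult_distrib)
  then show "(0 \<le> Im (\<xi> * (\<zeta> * a)) \<longrightarrow> 0 \<le> Im (\<xi> * (\<zeta> * b))) \<and> (nn (\<xi> * (\<zeta> * a)) \<longrightarrow> nn (\<xi> * (\<zeta> * b)))"
    using assms(2) unfolding same_sector_def by (metis mult.assoc)
qed

lemma same_sector_mult:
  assumes "\<zeta> ^ (2 * n) = 1"
  shows "same_sector (\<zeta> * b) (\<zeta> * a) \<longleftrightarrow> same_sector b a"
proof
  assume "same_sector (\<zeta> * b) (\<zeta> * a)"
  moreover have "\<zeta> \<noteq> 0" using assms n_pos by (auto simp: power_0_left)
  moreover have "inverse \<zeta> ^ (2 * n) = 1" using assms by (simp add: power_inverse)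
  ultimately show "same_sector b a"
    using same_sector_mult_imp[of "inverse \<zeta>" "\<zeta> * b" "\<zeta> * a"] by (simp flip: mult.assoc)
qed (use same_sector_mult_imp assms in blast)

lemma same_sector_cnj_imp: "same_sector b a \<Longrightarrow> same_sector (cnj b) (cnj a)"
  unfolding same_sector_def
proof (intro allI impI)
  fix \<xi> :: complex
  assume s: "\<forall>\<xi>. \<xi> ^ (2 * n) = 1 \<longrightarrow>
    (0 \<le> Im (\<xi> * a) \<longrightarrow> 0 \<le> Im (\<xi> * b)) \<and> (nn (\<xi> * a) \<longrightarrow> nn (\<xi> * b))" and "\<xi> ^ (2 * n) = 1"
  then have "cnj \<xi> ^ (2 * n) = 1" "(- cnj \<xi>) ^ (2 * n) = 1"
    by (metis complex_cnj_power complex_cnj_one, metis complex_cnj_power complex_cnj_one power_even_eq power2_minus power_mult)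
  moreover have "Im (\<xi> * cnj c) = Im (- cnj \<xi> * c)" "nn (\<xi> * cnj c) = nn (cnj \<xi> * c)" for c
    by (auto simp: nn_def)
  ultimately show "(0 \<le> Im (\<xi> * cnj a) \<longrightarrow> 0 \<le> Im (\<xi> * cnj b)) \<and> (nn (\<xi> * cnj a) \<longrightarrow> nn (\<xi> * cnj b))"
    using s by (metis (no_types, lifting))
qed

lemma same_sector_nnI:
  assumes "nn a" "nn b" "a = 0 \<Longrightarrow> b = 0"
  shows "same_sector b a"
proof -
  have "a = of_real (Re a)" "b = of_real (Re b)" "Re a \<ge> 0" "Re b \<ge> 0"
    using assms by (auto simp: nn_def complex_eq_iff)
  then obtain s t :: real where st: "a = of_real s" "b = of_real t" "s \<ge> 0" "t \<ge> 0" by metis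
  then have "s = 0 \<Longrightarrow> t = 0" using assms by simp
  then show ?thesis
    using st by (cases "s = 0")
      (auto simp: same_sector_def nn_def zero_le_mult_iff mult_nonneg_nonneg)
qed

text \<open>A point of the standard sector that lies on neither bounding ray sees the whole sector
  on the same side of every line of the fan.\<close>

lemma same_sector_secI:
  assumes a: "sec a" and b: "sec b"
    and nn1: "nn (a ^ n) \<Longrightarrow> nn (b ^ n)" and nn2: "nn (- (a ^ n)) \<Longrightarrow> nn (- (b ^ n))"
  shows "same_sector b a"
proof -
  have zero: "b = 0" if "a = 0"
    using that nn1 nn2 n_pos nn_both[of "b ^ n"] by (simp add: power_0_left)
  consider "nn a" | "nn (cnj \<eta> * a)" | "\<not> nn a" "\<not> nn (cnj \<eta> * a)" by blast
  then show ?thesis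
  proof cases
    case 1
    then have "nn b" using nn1 sec_pow a b by blast
    then show ?thesis using 1 zero by (intro same_sector_nnI)
  next
    case 2
    then have "nn (cnj \<eta> * b)" using nn2 sec_pow a b by blast
    then have "same_sector (cnj \<eta> * b) (cnj \<eta> * a)" using 2 zero by (intro same_sector_nnI) auto
    then show ?thesis using same_sector_mult eta_pow by blast
  next
    case 3
    obtain \<phi> where \<phi>: "0 \<le> \<phi>" "\<phi> \<le> pi / n" "a = cmod a * cis \<phi>" using sec_polar[OF a] .
    obtain \<psi> where \<psi>: "0 \<le> \<psi>" "\<psi> \<le> pi / n" "b = cmod b * cis \<psi>" using sec_polar[OF b] .
    have a0: "cmod a > 0" using 3 by auto
    have "\<phi> \<noteq> 0" using 3(1) \<phi>(3) by (metis cis_zero mult.right_neutral nn_def Im_complex_of_real Re_complex_of_real norm_ge_zero)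
    moreover have "\<phi> \<noteq> pi / n"
    proof
      assume p: "\<phi> = pi / n"
      have "cnj \<eta> * a = cmod a * (cnj \<eta> * \<eta>)" by (subst \<phi>(3)) (simp add: p)
      also have "\<dots> = cmod a" by (simp add: cis_cnj cis_mult)
      finally have "cnj \<eta> * a = of_real (cmod a)" .
      then have "nn (cnj \<eta> * a)" by (simp only: nn_def) simp
      then show False using 3 by simp
    qed
    ultimately have strict: "0 < \<phi>" "\<phi> < pi / n" using \<phi> by auto
    show ?thesis
      unfolding same_sector_def
    proof (intro allI impI)
      fix \<xi> :: complex assume "\<xi> ^ (2 * n) = 1"
      then obtain j where j: "j < 2 * n" "\<xi> = exp (2 * of_real pi * \<i> * of_nat j / of_nat (2 * n))"
        using complex_roots_unity[of "2 * n"] n_pos by auto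
      have \<xi>: "\<xi> = cis (j * (pi / n))"
        using n_pos by (simp add: j(2) cis_conv_exp field_simps)
      have Im: "Im (\<xi> * a) = cmod a * sin (\<phi> + j * (pi / n))" "Im (\<xi> * b) = cmod b * sin (\<psi> + j * (pi / n))"
        by (subst \<phi>(3) \<psi>(3), simp add: \<xi> sin_add algebra_simps)+
      show "(0 \<le> Im (\<xi> * a) \<longrightarrow> 0 \<le> Im (\<xi> * b)) \<and> (nn (\<xi> * a) \<longrightarrow> nn (\<xi> * b))"
      proof (cases "j < n")
        case True
        then have "real j + 1 \<le> real n" by simp
        then have "(real j + 1) * (pi / n) \<le> n * (pi / n)"
          using pi_n by (intro mult_right_mono) auto
        moreover have "(real j + 1) * (pi / n) = j * (pi / n) + pi / n" "n * (pi / n) = pi"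
          using n_pos by (auto simp only: distrib_right mult_1) simp
        ultimately have jn: "j * (pi / n) + pi / n \<le> pi" by linarith
        have j0: "0 \<le> j * (pi / n)" using pi_n by simp
        have "sin (\<psi> + j * (pi / n)) \<ge> 0" using \<psi> jn j0 by (intro sin_ge_zero) linarith+
        moreover have "sin (\<phi> + j * (pi / n)) > 0" using strict jn j0 by (intro sin_gt_zero) linarith+
        ultimately show ?thesis using a0 unfolding nn_def Im by auto
      next
        case False
        then have "real n \<le> real j" "real j + 1 \<le> 2 * real n" using j by auto
        then have "n * (pi / n) \<le> j * (pi / n)" "(real j + 1) * (pi / n) \<le> (2 * real n) * (pi / n)"
          using pi_n by (blast intro: mult_right_mono less_imp_le)+
        moreover have "(real j + 1) * (pi / n) = j * (pi / n) + pi / n"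
          by (simp only: distrib_right mult_1)
        moreover have "n * (pi / n) = pi" using n_pos by simp
        moreover have "(2 * real n) * (pi / n) = 2 * pi" using n_pos by simp
        ultimately have jn: "pi \<le> j * (pi / n)" "j * (pi / n) + pi / n \<le> 2 * pi" by linarith+
        have "sin (\<phi> + j * (pi / n)) < 0" using strict jn by (intro sin_lt_zero) linarith+
        then have "Im (\<xi> * a) < 0" unfolding Im using a0 by (simp add: mult_pos_neg)
        then show ?thesis unfolding nn_def by auto
      qed
    qed
  qed
qed

text \<open>On the cells of dimension at most 3 this says that \<open>y\<close> lies in the smallest cell containing
  \<open>z\<close>, and it does so by the relative position of the coordinates alone.\<close>

definition le :: "complex ^ 4 \<Rightarrow> complex ^ 4 \<Rightarrow> bool"
  where "le y z \<longleftrightarrow> (\<forall>i j. same_sector (hp y i j) (hp z i j))"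

lemma le_monomial:
  assumes "monomial A" "le y z" shows "le (A y) (A z)"
proof -
  obtain \<sigma> u where A: "bij \<sigma>" "\<And>i. u i ^ n = 1" "A = permscale \<sigma> u"
    using assms(1) by (auto simp: monomial_def)
  have hpA: "hp (A x) i j = (u i * cnj (u j)) * hp x (\<sigma> i) (\<sigma> j)" for x i j
    by (simp add: A(3) hp_def)
  have "cnj (u j) ^ n = 1" for j using A(2)[of j] by (metis complex_cnj_power complex_cnj_one)
  then have "(u i * cnj (u j)) ^ (2 * n) = 1" for i j
    using A(2) by (metis mult.commute mult.right_neutral power_mult power_mult_distrib power_one)
  then show ?thesis
    using assms(2) unfolding le_def hpA by (simp add: same_sector_mult)
qed

end

section \<open>The pyramid of degenerate quadrilaterals\<close>

text \<open>The vectors \<open>w $ i\<close> are the sides of a quadrilateral, in cyclic order, whose first two sides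
  have the same direction, so that it is a triangle with sides \<open>w $ 0 + w $ 1\<close>,
  \<open>w $ 2\<close> and \<open>w $ 3\<close>, traversed counterclockwise.\<close>

definition tri :: "complex ^ 4 \<Rightarrow> bool"
  where "tri w \<longleftrightarrow> (\<Sum>i\<in>UNIV. w $ i) = 0 \<and> nn (hp w 0 1) \<and> 0 \<le> Im (hp w 2 0) \<and> 0 \<le> Im (hp w 2 1)
    \<and> 0 \<le> Im (hp w 3 2) \<and> 0 \<le> Im (hp w 0 3) \<and> 0 \<le> Im (hp w 1 3)"

text \<open>The five inequalities between the side lengths of such a triangle, one for each facet of the
  pyramid. Number 4 defines the quadrilateral base.\<close>

definition slack :: "nat \<Rightarrow> real ^ 4 \<Rightarrow> real"
  where "slack t r =
    (if t = 0 then r $ 0 else if t = 1 then r $ 0 + r $ 1 + r $ 3 - r $ 2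
     else if t = 2 then r $ 1 else if t = 3 then r $ 0 + r $ 1 + r $ 2 - r $ 3
     else r $ 2 + r $ 3 - r $ 0 - r $ 1)"

lemma slack_simps [simp]:
  "slack 0 r = r $ 0" "slack (Suc 0) r = r $ 0 + r $ 1 + r $ 3 - r $ 2" "slack 2 r = r $ 1"
  "slack 3 r = r $ 0 + r $ 1 + r $ 2 - r $ 3" "slack 4 r = r $ 2 + r $ 3 - r $ 0 - r $ 1"
  by (simp_all add: slack_def)

definition cmods :: "complex ^ 4 \<Rightarrow> real ^ 4"
  where "cmods w = (\<chi> i. cmod (w $ i))"

lemma cmods_nth [simp]: "cmods w $ i = cmod (w $ i)"
  by (simp add: cmods_def)

lemma less5: "(\<forall>t<5::nat. P t) \<longleftrightarrow> P 0 \<and> P (Suc 0) \<and> P 2 \<and> P 3 \<and> P 4"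
  by (simp add: numeral_eq_Suc All_less_Suc) blast

context
  fixes w :: "complex ^ 4"
  assumes tri: "tri w"
begin

private lemma e: "cmod (w $ 0 + w $ 1) = cmod (w $ 0) + cmod (w $ 1)"
  and sums: "w $ 3 + w $ 2 = - (w $ 0 + w $ 1)" "w $ 2 + (w $ 0 + w $ 1) = - w $ 3"
    "w $ 3 + (w $ 0 + w $ 1) = - w $ 2"
proof -
  show "cmod (w $ 0 + w $ 1) = cmod (w $ 0) + cmod (w $ 1)"
    using tri by (simp add: tri_def hp_def nn_iff_add)
  have s: "w $ 0 + w $ 1 + w $ 2 + w $ 3 = 0" using tri by (simp add: tri_def sum4)
  show "w $ 3 + w $ 2 = - (w $ 0 + w $ 1)" "w $ 2 + (w $ 0 + w $ 1) = - w $ 3"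
    "w $ 3 + (w $ 0 + w $ 1) = - w $ 2"
    using s by (simp_all add: complex_eq_iff)
qed

private lemma scaled:
  "of_real (cmod (w $ 0) + cmod (w $ 1)) * w $ 0 = of_real (cmod (w $ 0)) * (w $ 0 + w $ 1)"
  "of_real (cmod (w $ 0) + cmod (w $ 1)) * w $ 1 = of_real (cmod (w $ 1)) * (w $ 0 + w $ 1)"
proof -
  have "of_real (cmod (w $ 0)) * w $ 1 = of_real (cmod (w $ 1)) * w $ 0"
    using tri nn_parallel by (auto simp: tri_def hp_def)
  then show "of_real (cmod (w $ 0) + cmod (w $ 1)) * w $ 0 = of_real (cmod (w $ 0)) * (w $ 0 + w $ 1)"
    "of_real (cmod (w $ 0) + cmod (w $ 1)) * w $ 1 = of_real (cmod (w $ 1)) * (w $ 0 + w $ 1)"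
    by (simp_all add: algebra_simps)
qed

text \<open>The first two sides and their sum have the same direction.\<close>

private lemma nn_e:
  assumes j: "j = 0 \<or> j = 1" and w: "w $ j \<noteq> 0"
  shows "nn (c * cnj (w $ j)) \<longleftrightarrow> nn (c * cnj (w $ 0 + w $ 1))"
    "nn (- (c * cnj (w $ j))) \<longleftrightarrow> nn (- (c * cnj (w $ 0 + w $ 1)))"
proof -
  define s t where "s = cmod (w $ 0) + cmod (w $ 1)" and "t = cmod (w $ j)"
  have "t > 0" using w by (simp add: t_def)
  moreover have "s \<ge> t" using j by (auto simp: s_def t_def)
  ultimately have pos: "s > 0" "t > 0" by auto
  have "of_real s * w $ j = of_real t * (w $ 0 + w $ 1)"
    using scaled j by (auto simp: s_def t_def)
  then have "cnj (of_real s * w $ j) = cnj (of_real t * (w $ 0 + w $ 1))" by (simp only:)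
  then have eq: "of_real s * (c * cnj (w $ j)) = of_real t * (c * cnj (w $ 0 + w $ 1))"
    by (simp add: mult.left_commute distrib_left)
  have nn_scale: "nn (of_real r * x) \<longleftrightarrow> nn x" if "r > 0" for r x
    using that by (auto simp: nn_def zero_le_mult_iff)
  show "nn (c * cnj (w $ j)) \<longleftrightarrow> nn (c * cnj (w $ 0 + w $ 1))"
    using eq nn_scale pos by metis
  show "nn (- (c * cnj (w $ j))) \<longleftrightarrow> nn (- (c * cnj (w $ 0 + w $ 1)))"
    using eq nn_scale pos by (metis mult_minus_right)
qed

text \<open>Two sides of a triangle are parallel only if the triangle is flat, and which of the triangle
  inequalities is then an equality tells the orientation. The next two lemmas treat the other
  pairs of sides in the same way.\<close>

lemma tri_32: "nn (hp w 3 2) \<longleftrightarrow> slack 4 (cmods w) = 0"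
  "nn (- hp w 3 2) \<longleftrightarrow> slack 1 (cmods w) = 0 \<or> slack 3 (cmods w) = 0"
  unfolding hp_def nn_iff_add nn_iff_diff sums norm_minus_cancel e by auto

lemma tri_2:
  assumes j: "j = 0 \<or> j = 1"
  shows "nn (hp w 2 j) \<longleftrightarrow> w $ j = 0 \<or> slack 3 (cmods w) = 0"
    "nn (- hp w 2 j) \<longleftrightarrow> w $ j = 0 \<or> slack 1 (cmods w) = 0 \<or> slack 4 (cmods w) = 0"
proof -
  have 1: "nn (w $ 2 * cnj (w $ 0 + w $ 1)) \<longleftrightarrow> slack 3 (cmods w) = 0"
    "nn (- (w $ 2 * cnj (w $ 0 + w $ 1))) \<longleftrightarrow> slack 1 (cmods w) = 0 \<or> slack 4 (cmods w) = 0"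
    unfolding nn_iff_add nn_iff_diff sums norm_minus_cancel e by auto
  show "nn (hp w 2 j) \<longleftrightarrow> w $ j = 0 \<or> slack 3 (cmods w) = 0"
    "nn (- hp w 2 j) \<longleftrightarrow> w $ j = 0 \<or> slack 1 (cmods w) = 0 \<or> slack 4 (cmods w) = 0"
    unfolding hp_def 1[symmetric] using nn_e[OF j, of "w $ 2"] by fastforce+
qed

lemma tri_3:
  assumes j: "j = 0 \<or> j = 1"
  shows "nn (hp w 3 j) \<longleftrightarrow> w $ j = 0 \<or> slack 1 (cmods w) = 0"
    "nn (- hp w 3 j) \<longleftrightarrow> w $ j = 0 \<or> slack 3 (cmods w) = 0 \<or> slack 4 (cmods w) = 0"
proof -
  have 1: "nn (w $ 3 * cnj (w $ 0 + w $ 1)) \<longleftrightarrow> slack 1 (cmods w) = 0"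
    "nn (- (w $ 3 * cnj (w $ 0 + w $ 1))) \<longleftrightarrow> slack 3 (cmods w) = 0 \<or> slack 4 (cmods w) = 0"
    unfolding nn_iff_add nn_iff_diff sums norm_minus_cancel e by auto
  show "nn (hp w 3 j) \<longleftrightarrow> w $ j = 0 \<or> slack 1 (cmods w) = 0"
    "nn (- hp w 3 j) \<longleftrightarrow> w $ j = 0 \<or> slack 3 (cmods w) = 0 \<or> slack 4 (cmods w) = 0"
    unfolding hp_def 1[symmetric] using nn_e[OF j, of "w $ 3"] by fastforce+
qed

lemma tri_slack: "t < 5 \<Longrightarrow> 0 \<le> slack t (cmods w)"
proof -
  have "cmod (w $ 2) \<le> cmod (w $ 3) + cmod (w $ 0 + w $ 1)"
    using norm_triangle_ineq[of "w $ 3" "w $ 0 + w $ 1"] by (simp add: sums)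
  moreover have "cmod (w $ 3) \<le> cmod (w $ 2) + cmod (w $ 0 + w $ 1)"
    using norm_triangle_ineq[of "w $ 2" "w $ 0 + w $ 1"] by (simp add: sums)
  moreover have "cmod (w $ 0 + w $ 1) \<le> cmod (w $ 3) + cmod (w $ 2)"
    using norm_triangle_ineq[of "w $ 3" "w $ 2"] unfolding sums norm_minus_cancel .
  ultimately have "\<forall>t<5. 0 \<le> slack t (cmods w)"
    unfolding less5 using e by simp
  then show "t < 5 \<Longrightarrow> 0 \<le> slack t (cmods w)" by simp
qed

text \<open>The law of cosines for the three angles of the triangle.\<close>

lemma tri_Re:
  defines "s \<equiv> cmod (w $ 0) + cmod (w $ 1)"
  shows "2 * Re (hp w 3 2) = s\<^sup>2 - (cmod (w $ 3))\<^sup>2 - (cmod (w $ 2))\<^sup>2"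
    "j = 0 \<or> j = 1 \<Longrightarrow> 2 * s * Re (hp w 2 j) = cmod (w $ j) * ((cmod (w $ 3))\<^sup>2 - s\<^sup>2 - (cmod (w $ 2))\<^sup>2)"
    "j = 0 \<or> j = 1 \<Longrightarrow> 2 * s * Re (hp w 3 j) = cmod (w $ j) * ((cmod (w $ 2))\<^sup>2 - s\<^sup>2 - (cmod (w $ 3))\<^sup>2)"
proof -
  show "2 * Re (hp w 3 2) = s\<^sup>2 - (cmod (w $ 3))\<^sup>2 - (cmod (w $ 2))\<^sup>2"
    using cmod_add_power2[of "w $ 3" "w $ 2"] unfolding sums norm_minus_cancel e hp_def s_def by linarith
  assume j: "j = 0 \<or> j = 1"
  have eq: "of_real s * w $ j = of_real (cmod (w $ j)) * (w $ 0 + w $ 1)"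
    using scaled j by (auto simp: s_def)
  have sc: "s * Re (c * cnj (w $ j)) = cmod (w $ j) * Re (c * cnj (w $ 0 + w $ 1))" for c
  proof -
    have "cnj (of_real s * w $ j) = cnj (of_real (cmod (w $ j)) * (w $ 0 + w $ 1))" using eq by (simp only:)
    then have "of_real s * (c * cnj (w $ j)) = of_real (cmod (w $ j)) * (c * cnj (w $ 0 + w $ 1))"
      by (simp add: mult.left_commute distrib_left)
    then have "Re (of_real s * (c * cnj (w $ j))) = Re (of_real (cmod (w $ j)) * (c * cnj (w $ 0 + w $ 1)))"
      by (simp only:)
    then show ?thesis by (simp only: times_complex.sel Re_complex_of_real Im_complex_of_real)
  qed
  have "2 * Re (w $ 2 * cnj (w $ 0 + w $ 1)) = (cmod (w $ 3))\<^sup>2 - s\<^sup>2 - (cmod (w $ 2))\<^sup>2"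
    using cmod_add_power2[of "w $ 2" "w $ 0 + w $ 1"] unfolding sums norm_minus_cancel e s_def by linarith
  then show "2 * s * Re (hp w 2 j) = cmod (w $ j) * ((cmod (w $ 3))\<^sup>2 - s\<^sup>2 - (cmod (w $ 2))\<^sup>2)"
    using sc[of "w $ 2"] by (simp only: hp_def mult.assoc mult.left_commute[of 2])
  have "2 * Re (w $ 3 * cnj (w $ 0 + w $ 1)) = (cmod (w $ 2))\<^sup>2 - s\<^sup>2 - (cmod (w $ 3))\<^sup>2"
    using cmod_add_power2[of "w $ 3" "w $ 0 + w $ 1"] unfolding sums norm_minus_cancel e s_def by linarith
  then show "2 * s * Re (hp w 3 j) = cmod (w $ j) * ((cmod (w $ 2))\<^sup>2 - s\<^sup>2 - (cmod (w $ 3))\<^sup>2)"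
    using sc[of "w $ 3"] by (simp only: hp_def mult.assoc mult.left_commute[of 2])
qed

end

lemma nn_eqI: "nn a \<Longrightarrow> nn b \<Longrightarrow> cmod a = cmod b \<Longrightarrow> a = b"
proof (rule complex_eq_upper)
  assume "nn a" "nn b" "cmod a = cmod b"
  then show "Re a = Re b" "0 \<le> Im a" "0 \<le> Im b" by (simp_all only: nn_iff_cmod, simp_all add: nn_def flip: nn_iff_cmod)
qed

text \<open>A triangle is determined up to rotation by its side lengths: the law of cosines gives the real
  parts of the products, and the orientation the signs of the imaginary parts.\<close>

lemma tri_unique:
  assumes v: "tri v" and w: "tri w" and eq: "cmods v = cmods w"
  shows "hp v 0 1 = hp w 0 1" "hp v 3 2 = hp w 3 2"
    "j = 0 \<or> j = 1 \<Longrightarrow> hp v 2 j = hp w 2 j" "j = 0 \<or> j = 1 \<Longrightarrow> hp v j 3 = hp w j 3"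
proof -
  have c: "cmod (v $ i) = cmod (w $ i)" for i
    using eq by (metis cmods_nth)
  then have ch: "cmod (hp v i j) = cmod (hp w i j)" for i j
    by (simp add: hp_def norm_mult)
  show "hp v 0 1 = hp w 0 1"
    using v w ch[of 0 1] by (intro nn_eqI) (auto simp: tri_def)
  show "hp v 3 2 = hp w 3 2"
    using tri_Re(1)[OF v] tri_Re(1)[OF w] c ch v w by (intro complex_eq_upper) (auto simp: tri_def)
  assume j: "j = 0 \<or> j = 1"
  show "hp v 2 j = hp w 2 j"
  proof (cases "v $ j = 0")
    case True
    then show ?thesis using c[of j] by (simp add: hp_def)
  next
    case False
    then have "cmod (v $ 0) + cmod (v $ 1) > 0" using j by (auto simp: add_pos_nonneg add_nonneg_pos)
    moreover have "2 * (cmod (v $ 0) + cmod (v $ 1)) * Re (hp v 2 j)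
        = 2 * (cmod (v $ 0) + cmod (v $ 1)) * Re (hp w 2 j)"
      using tri_Re(2)[OF v j] tri_Re(2)[OF w j] by (simp only: c)
    ultimately have "Re (hp v 2 j) = Re (hp w 2 j)"
      unfolding mult_cancel_left by auto
    then show ?thesis using ch v w j by (intro complex_eq_upper) (auto simp: tri_def)
  qed
  show "hp v j 3 = hp w j 3"
  proof (cases "v $ j = 0")
    case True
    then show ?thesis using c[of j] by (simp add: hp_def)
  next
    case False
    then have "cmod (v $ 0) + cmod (v $ 1) > 0" using j by (auto simp: add_pos_nonneg add_nonneg_pos)
    moreover have "2 * (cmod (v $ 0) + cmod (v $ 1)) * Re (hp v 3 j)
        = 2 * (cmod (v $ 0) + cmod (v $ 1)) * Re (hp w 3 j)"
      using tri_Re(3)[OF v j] tri_Re(3)[OF w j] by (simp only: c)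
    ultimately have "Re (hp v 3 j) = Re (hp w 3 j)"
      unfolding mult_cancel_left by auto
    then have "Re (hp v j 3) = Re (hp w j 3)" by (simp add: hp_def mult.commute)
    then show ?thesis using ch v w j by (intro complex_eq_upper) (auto simp: tri_def)
  qed
qed

text \<open>The angles are exterior angles at two vertices of a triangle, where the interior ones add up
  to at most a half turn.\<close>

lemma triangle_angles:
  fixes a b c :: real
  assumes abc: "0 \<le> a" "0 \<le> b" "0 \<le> c" "a + b + c > 0"
    and a: "0 \<le> \<theta>" "\<theta> \<le> pi" "0 \<le> \<phi>" "\<phi> \<le> pi"
      "a + b * cos \<theta> + c * cos \<phi> = 0" "b * sin \<theta> = c * sin \<phi>"
  shows "\<theta> + \<phi> \<ge> pi"
proof (rule ccontr)
  assume lt: "\<not> \<theta> + \<phi> \<ge> pi"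
  have "c * sin (\<theta> + \<phi>) = sin \<theta> * (c * cos \<phi>) + cos \<theta> * (c * sin \<phi>)"
    by (simp add: sin_add algebra_simps)
  also have "\<dots> = sin \<theta> * (- a - b * cos \<theta>) + cos \<theta> * (b * sin \<theta>)"
  proof -
    have "c * cos \<phi> = - a - b * cos \<theta>" using a(5) by linarith
    then show ?thesis using a(6) by simp
  qed
  finally have c: "c * sin (\<theta> + \<phi>) = - a * sin \<theta>" by (simp add: algebra_simps)
  have "b * sin (\<theta> + \<phi>) = (b * sin \<theta>) * cos \<phi> + (b * cos \<theta>) * sin \<phi>"
    by (simp add: sin_add algebra_simps)
  also have "b * cos \<theta> = - a - c * cos \<phi>" using a(5) by linarith
  finally have b: "b * sin (\<theta> + \<phi>) = - a * sin \<phi>" using a(6) by (simp add: algebra_simps)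
  have s: "sin \<theta> \<ge> 0" "sin \<phi> \<ge> 0" using a sin_ge_zero by auto
  then have "(b + c) * sin (\<theta> + \<phi>) \<le> 0"
    using b c mult_nonneg_nonneg[OF abc(1) s(1)] mult_nonneg_nonneg[OF abc(1) s(2)]
    by (simp add: distrib_right)
  moreover have "b + c > 0"
  proof (rule ccontr)
    assume "\<not> b + c > 0"
    then have "b = 0" "c = 0" using abc by linarith+
    then show False using a(5) abc by simp
  qed
  ultimately have "sin (\<theta> + \<phi>) \<le> 0" by (simp add: mult_le_0_iff)
  then have "\<theta> + \<phi> = 0" using sin_gt_zero[of "\<theta> + \<phi>"] lt a by linarith
  then have "\<theta> = 0" "\<phi> = 0" using a by linarith+
  then show False using a(5) abc by simp
qed

text \<open>The angles are the exterior angles given by the law of cosines; if a side is zero, they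
  are 0 and a half turn.\<close>

lemma triangle_exists:
  fixes a b c :: real
  assumes "0 \<le> a" "0 \<le> b" "0 \<le> c" "a \<le> b + c" "b \<le> a + c" "c \<le> a + b" "a + b + c > 0"
  obtains \<theta> \<phi> where "0 \<le> \<theta>" "\<theta> \<le> pi" "0 \<le> \<phi>" "\<phi> \<le> pi" "\<theta> + \<phi> \<ge> pi"
    "a + b * cos \<theta> + c * cos \<phi> = 0" "b * sin \<theta> = c * sin \<phi>"
proof -
  have "\<exists>\<theta> \<phi>. 0 \<le> \<theta> \<and> \<theta> \<le> pi \<and> 0 \<le> \<phi> \<and> \<phi> \<le> pi \<and>
    a + b * cos \<theta> + c * cos \<phi> = 0 \<and> b * sin \<theta> = c * sin \<phi>"
  proof -
    consider "a = 0" | "b = 0" | "c = 0" | "a > 0" "b > 0" "c > 0" using assms by linarith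
    then show ?thesis
    proof cases
      case 1 then show ?thesis using assms by (intro exI[of _ 0] exI[of _ pi]) auto
    next
      case 2 then show ?thesis using assms by (intro exI[of _ 0] exI[of _ pi]) auto
    next
      case 3 then show ?thesis using assms by (intro exI[of _ pi] exI[of _ 0]) auto
    next
      case 4
      define x y where "x = (c\<^sup>2 - a\<^sup>2 - b\<^sup>2) / (2 * a * b)" and "y = (b\<^sup>2 - a\<^sup>2 - c\<^sup>2) / (2 * a * c)"
      have x: "- 1 \<le> x" "x \<le> 1" and y: "- 1 \<le> y" "y \<le> 1"
      proof -
        have sq: "(a - b)\<^sup>2 \<le> c\<^sup>2" "(a - c)\<^sup>2 \<le> b\<^sup>2" "c\<^sup>2 \<le> (a + b)\<^sup>2" "b\<^sup>2 \<le> (a + c)\<^sup>2"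
          using assms by (auto intro!: power2_le_iff_abs_le[THEN iffD2])
        then show "- 1 \<le> x" "x \<le> 1" "- 1 \<le> y" "y \<le> 1"
          using 4 by (auto simp: x_def y_def divide_simps power2_eq_square algebra_simps)
      qed
      have sum: "b * x + c * y = - a"
        using 4 by (simp add: x_def y_def field_simps power2_eq_square)
      have "(b * x)\<^sup>2 - (c * y)\<^sup>2 = b\<^sup>2 - c\<^sup>2"
        using 4 by (simp add: x_def y_def field_simps power2_eq_square)
      then have "b\<^sup>2 * (1 - x\<^sup>2) = c\<^sup>2 * (1 - y\<^sup>2)"
        by (simp add: algebra_simps power2_eq_square)
      then have "sqrt (b\<^sup>2 * (1 - x\<^sup>2)) = sqrt (c\<^sup>2 * (1 - y\<^sup>2))" by simp
      then have "b * sqrt (1 - x\<^sup>2) = c * sqrt (1 - y\<^sup>2)"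
        using 4 by (simp add: real_sqrt_mult)
      then show ?thesis
        using x y sum by (intro exI[of _ "arccos x"] exI[of _ "arccos y"])
          (auto simp: arccos_lbound arccos_ubound sin_arccos)
    qed
  qed
  then obtain \<theta> \<phi> where a: "0 \<le> \<theta>" "\<theta> \<le> pi" "0 \<le> \<phi>" "\<phi> \<le> pi"
    "a + b * cos \<theta> + c * cos \<phi> = 0" "b * sin \<theta> = c * sin \<phi>" by blast
  have "\<theta> + \<phi> \<ge> pi"
    by (rule triangle_angles[OF assms(1-3,7) a])
  then show thesis using that a by blast
qed

context fermat begin

definition pw :: "complex ^ 4 \<Rightarrow> complex ^ 4"
  where "pw z = (\<chi> i. (z $ i) ^ n)"

lemma pw_nth: "pw z $ i = (z $ i) ^ n"
  by (simp add: pw_def)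

lemma hp_pw: "hp (pw z) i j = hp z i j ^ n"
  by (simp add: hp_def power_mult_distrib pw_nth)

lemma pw_zero: "pw z $ i = 0 \<longleftrightarrow> z $ i = 0"
  using n_pos by (simp add: pw_nth)

text \<open>Homogeneous coordinates of the points of one pyramid. The angles between the coordinates are
  those between the sides of the quadrilateral of the powers, divided by \<open>n\<close>; the factor
  \<open>\<omega>\<close> accounts for the full turn between the last side and the first.\<close>

definition pyramid_cone :: "(complex ^ 4) set"
  where "pyramid_cone = {z. z \<noteq> 0 \<and> (\<Sum>i\<in>UNIV. (z $ i) ^ n) = 0 \<and> nn (hp z 0 1) \<and> sec (hp z 2 0) \<and> sec (hp z 2 1)
    \<and> sec (hp z 3 2) \<and> sec (\<omega> * hp z 0 3) \<and> sec (\<omega> * hp z 1 3)}"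

lemma pyramid_coneD:
  assumes "z \<in> pyramid_cone"
  shows "z \<noteq> 0" "(\<Sum>i\<in>UNIV. (z $ i) ^ n) = 0" "nn (hp z 0 1)" "sec (hp z 3 2)"
    "j = 0 \<or> j = 1 \<Longrightarrow> sec (hp z 2 j)" "j = 0 \<or> j = 1 \<Longrightarrow> sec (\<omega> * hp z j 3)"
  using assms unfolding pyramid_cone_def by blast+

lemma omega_mult_pow: "(\<omega> * c) ^ n = c ^ n"
  by (simp add: power_mult_distrib omega_pow)

lemma nn_pow: "nn c \<Longrightarrow> nn (c ^ n)"
proof -
  assume "nn c"
  then have "c = of_real (Re c)" "Re c \<ge> 0" by (auto simp: nn_def complex_eq_iff)
  then show ?thesis by (metis Im_complex_of_real Re_complex_of_real nn_def of_real_power zero_le_power)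
qed

lemma pyramid_cone_tri: "z \<in> pyramid_cone \<Longrightarrow> tri (pw z)"
  using sec_pow(1)[of "hp z 2 0"] sec_pow(1)[of "hp z 2 1"] sec_pow(1)[of "hp z 3 2"]
    sec_pow(1)[of "\<omega> * hp z 0 3"] sec_pow(1)[of "\<omega> * hp z 1 3"]
  by (auto simp: pyramid_cone_def tri_def hp_pw nn_pow omega_mult_pow pw_nth)

text \<open>Every condition that defines the pyramid is one of the tests of \<open>same_sector\<close>, so it passes
  from \<open>x\<close> to \<open>y\<close>.\<close>

lemma pyramid_cone_le:
  assumes "x \<in> pyramid_cone" "le y x" "y \<noteq> 0" "(\<Sum>i\<in>UNIV. (y $ i) ^ n) = 0"
  shows "y \<in> pyramid_cone"
proof -
  have s: "same_sector (hp y i j) (hp x i j)" for i j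
    using assms(2) by (simp add: le_def)
  have so: "same_sector (\<omega> * hp y i j) (\<omega> * hp x i j)" for i j
    using s same_sector_mult omega_pow by blast
  show ?thesis
    using assms same_sector_nn[OF s] same_sector_sec[OF s] same_sector_sec[OF so] by (simp add: pyramid_cone_def)
qed

definition slk :: "nat \<Rightarrow> complex ^ 4 \<Rightarrow> real"
  where "slk t z = slack t (cmods (pw z))"

text \<open>A tight inequality says that certain sides are parallel or zero, and this is visible in the
  relative position of the coordinates. If the first two sides both vanish, the other two have
  equal length, which makes the inequality in question tight as well.\<close>

lemma pyramid_cone_le_slk:
  assumes x: "x \<in> pyramid_cone" and y: "y \<in> pyramid_cone" and le: "le y x" and t: "t < 5" "slk t x = 0"
  shows "slk t y = 0"
proof -
  note tx = pyramid_cone_tri[OF x] and ty = pyramid_cone_tri[OF y]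
  have s: "same_sector (hp y i j) (hp x i j)" for i j
    using le by (simp add: le_def)
  have so: "same_sector (\<omega> * hp y i j) (\<omega> * hp x i j)" for i j
    using s same_sector_mult omega_pow by blast
  have zero: "x $ i = 0 \<Longrightarrow> y $ i = 0" for i
  proof -
    assume "x $ i = 0"
    then have "same_sector (hp y i i) 0" using s[of i i] by (simp add: hp_def)
    then have "same_sector (- 1 * hp y i i) (- 1 * 0)" by (intro same_sector_mult_imp) (auto simp: power_mult)
    then have "nn (- hp y i i)" using same_sector_nn by fastforce
    then show "y $ i = 0" using hp_self nn_both by blast
  qed
  have p32: "nn (hp (pw x) 3 2) \<Longrightarrow> nn (hp (pw y) 3 2)"
    using x y same_sector_nn[OF s] sec_pow(2) unfolding hp_pw pyramid_cone_def by blast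
  have p2: "nn (hp (pw x) 2 j) \<Longrightarrow> nn (hp (pw y) 2 j)" if "j = 0 \<or> j = 1" for j
    using x y same_sector_nn[OF s] sec_pow(2) that unfolding hp_pw pyramid_cone_def by blast
  have p3: "nn (hp (pw x) 3 j) \<Longrightarrow> nn (hp (pw y) 3 j)" if j: "j = 0 \<or> j = 1" for j
  proof -
    have "nn (hp (pw x) j 3) \<Longrightarrow> nn (hp (pw y) j 3)"
      using x y same_sector_nn[OF so] sec_pow(2) j omega_mult_pow unfolding hp_pw pyramid_cone_def
      by (metis (no_types, lifting) mem_Collect_eq)
    then show "nn (hp (pw x) 3 j) \<Longrightarrow> nn (hp (pw y) 3 j)" by (metis hp_cnj nn_cnj)
  qed
  have y3: "cmod (pw y $ 3) = cmod (pw y $ 2)" if "pw y $ 0 = 0" "pw y $ 1 = 0"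
    using tri_Re(1)[OF ty] tri_slack[OF ty, of 1] tri_slack[OF ty, of 3] that by simp
  consider "t = 0" | "t = 1" | "t = 2" | "t = 3" | "t = 4" using t by linarith
  then show ?thesis
  proof cases
    case 1 then show ?thesis using t zero[of 0] by (simp add: slk_def pw_zero)
  next
    case 3 then show ?thesis using t zero[of 1] by (simp add: slk_def pw_zero)
  next
    case 5
    then show ?thesis using t(2) p32 tri_32(1)[OF tx] tri_32(1)[OF ty] by (simp only: slk_def)
  next
    case 4
    then have "nn (hp (pw y) 2 0)" "nn (hp (pw y) 2 1)"
      using t(2) p2 tri_2(1)[OF tx] by (auto simp: slk_def)
    then have "slk 3 y = 0 \<or> (pw y $ 0 = 0 \<and> pw y $ 1 = 0)"
      using tri_2(1)[OF ty, of 0] tri_2(1)[OF ty, of 1] unfolding slk_def by blast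
    then show ?thesis using y3 4 by (auto simp: slk_def)
  next
    case 2
    then have "nn (hp (pw y) 3 0)" "nn (hp (pw y) 3 1)"
      using t(2) p3 tri_3(1)[OF tx] by (auto simp: slk_def)
    then have "slk 1 y = 0 \<or> (pw y $ 0 = 0 \<and> pw y $ 1 = 0)"
      using tri_3(1)[OF ty, of 0] tri_3(1)[OF ty, of 1] unfolding slk_def by blast
    then show ?thesis using y3 2 by (auto simp: slk_def)
  qed
qed

text \<open>Converse of \<open>pyramid_cone_le_slk\<close>: inside the pyramid the tight inequalities determine the
  relative position of the coordinates. Hence the combinatorics of the pyramid, which refers to
  side lengths, can be transported by monomial maps.\<close>

lemma pyramid_cone_leI:
  assumes x: "x \<in> pyramid_cone" and y: "y \<in> pyramid_cone" and tight: "\<And>t. t < 5 \<Longrightarrow> slk t x = 0 \<Longrightarrow> slk t y = 0"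
  shows "le y x"
proof -
  note tx = pyramid_cone_tri[OF x] and ty = pyramid_cone_tri[OF y]
  have tg: "slack t (cmods (pw x)) = 0 \<Longrightarrow> slack t (cmods (pw y)) = 0" if "t < 5" for t
    using tight[OF that] by (simp add: slk_def)
  have z01: "pw x $ j = 0 \<Longrightarrow> pw y $ j = 0" if "j = 0 \<or> j = 1" for j
    using tg[of 0] tg[of 2] that by auto
  have tg1: "slack 1 (cmods (pw x)) = 0 \<Longrightarrow> slack 1 (cmods (pw y)) = 0"
    and tg3: "slack 3 (cmods (pw x)) = 0 \<Longrightarrow> slack 3 (cmods (pw y)) = 0"
    and tg4: "slack 4 (cmods (pw x)) = 0 \<Longrightarrow> slack 4 (cmods (pw y)) = 0"
    by (auto intro: tg simp del: slack_simps)
  have z2: "pw x $ 2 = 0 \<Longrightarrow> pw y $ 2 = 0"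
  proof -
    assume "pw x $ 2 = 0"
    then have "slack 3 (cmods (pw x)) = 0" "slack 4 (cmods (pw x)) = 0"
      using tri_slack[OF tx, of 3] tri_slack[OF tx, of 4] by auto
    then have "slack 3 (cmods (pw y)) = 0" "slack 4 (cmods (pw y)) = 0"
      using tg3 tg4 by blast+
    then have "cmod (pw y $ 2) = 0" unfolding slack_simps One_nat_def cmods_nth by linarith
    then show "pw y $ 2 = 0" by simp
  qed
  have z3: "pw x $ 3 = 0 \<Longrightarrow> pw y $ 3 = 0"
  proof -
    assume "pw x $ 3 = 0"
    then have "slack 1 (cmods (pw x)) = 0" "slack 4 (cmods (pw x)) = 0"
      using tri_slack[OF tx, of 1] tri_slack[OF tx, of 4] by auto
    then have "slack 1 (cmods (pw y)) = 0" "slack 4 (cmods (pw y)) = 0"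
      using tg1 tg4 by blast+
    then have "cmod (pw y $ 3) = 0" unfolding slack_simps One_nat_def cmods_nth by linarith
    then show "pw y $ 3 = 0" by simp
  qed
  have zero: "x $ i = 0 \<Longrightarrow> y $ i = 0" for i
  proof -
    have "\<forall>i. pw x $ i = 0 \<longrightarrow> pw y $ i = 0"
      unfolding all4 using z01 z2 z3 by blast
    then show "x $ i = 0 \<Longrightarrow> y $ i = 0" by (metis pw_zero)
  qed
  have diag: "same_sector (hp y i i) (hp x i i)" for i
    using zero[of i] hp_self by (intro same_sector_nnI) auto
  have s01: "same_sector (hp y 0 1) (hp x 0 1)"
    using x y zero by (intro same_sector_nnI) (auto simp: pyramid_cone_def hp_def)
  have s32: "same_sector (hp y 3 2) (hp x 3 2)"
  proof (rule same_sector_secI)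
    show "sec (hp x 3 2)" "sec (hp y 3 2)" using x y by (auto simp: pyramid_cone_def)
    show "nn (hp x 3 2 ^ n) \<Longrightarrow> nn (hp y 3 2 ^ n)" "nn (- (hp x 3 2 ^ n)) \<Longrightarrow> nn (- (hp y 3 2 ^ n))"
      unfolding hp_pw[symmetric] tri_32[OF tx] tri_32[OF ty] using tg1 tg3 tg4 by blast+
  qed
  have s2: "same_sector (hp y 2 j) (hp x 2 j)" if j: "j = 0 \<or> j = 1" for j
  proof (rule same_sector_secI)
    show "sec (hp x 2 j)" "sec (hp y 2 j)" using x y j by (auto simp: pyramid_cone_def)
    show "nn (hp x 2 j ^ n) \<Longrightarrow> nn (hp y 2 j ^ n)" "nn (- (hp x 2 j ^ n)) \<Longrightarrow> nn (- (hp y 2 j ^ n))"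
      unfolding hp_pw[symmetric] tri_2[OF tx j] tri_2[OF ty j] using tg1 tg3 tg4 z01[OF j] by blast+
  qed
  have s3: "same_sector (hp y j 3) (hp x j 3)" if j: "j = 0 \<or> j = 1" for j
  proof -
    have "same_sector (\<omega> * hp y j 3) (\<omega> * hp x j 3)"
    proof (rule same_sector_secI)
      show "sec (\<omega> * hp x j 3)" "sec (\<omega> * hp y j 3)" using x y j by (auto simp: pyramid_cone_def)
      have "nn (hp (pw z) j 3) = nn (hp (pw z) 3 j)" "nn (- hp (pw z) j 3) = nn (- hp (pw z) 3 j)" for z
        by (metis hp_cnj nn_cnj, metis hp_cnj nn_cnj complex_cnj_minus)
      note swap = this
      show "nn ((\<omega> * hp x j 3) ^ n) \<Longrightarrow> nn ((\<omega> * hp y j 3) ^ n)"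
        "nn (- ((\<omega> * hp x j 3) ^ n)) \<Longrightarrow> nn (- ((\<omega> * hp y j 3) ^ n))"
        unfolding omega_mult_pow hp_pw[symmetric] swap tri_3[OF tx j] tri_3[OF ty j]
        using tg1 tg3 tg4 z01[OF j] by blast+
    qed
    then show ?thesis using same_sector_mult omega_pow by blast
  qed
  have rev: "same_sector (hp y j i) (hp x j i)" if "same_sector (hp y i j) (hp x i j)" for i j
    using same_sector_cnj_imp[OF that] by (simp add: hp_cnj)
  have "\<forall>i j. same_sector (hp y i j) (hp x i j)"
    unfolding all4 using diag s01 s32 s2[of 0] s2[of 1] s3[of 0] s3[of 1] rev by simp
  then show ?thesis by (simp add: le_def)
qed

lemma pyramid_cone_unique:
  assumes x: "x \<in> pyramid_cone" and y: "y \<in> pyramid_cone" and eq: "cmods (pw x) = cmods (pw y)"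
  shows "cp3_of x = cp3_of y"
proof -
  note u = tri_unique[OF pyramid_cone_tri[OF x] pyramid_cone_tri[OF y] eq, unfolded hp_pw]
  have c: "cmod (x $ i) = cmod (y $ i)" for i
  proof -
    have "cmod (x $ i) ^ n = cmod (y $ i) ^ n" using eq by (metis cmods_nth norm_power pw_nth)
    then show ?thesis using n_pos by (simp add: power_eq_iff_eq_base)
  qed
  then have ch: "cmod (hp x i j) = cmod (hp y i j)" for i j by (simp add: hp_def norm_mult)
  have diag: "hp x i i = hp y i i" for i
    unfolding hp_def complex_norm_square[symmetric] c ..
  have s01: "hp x 0 1 = hp y 0 1"
    by (rule nn_eqI[OF pyramid_coneD(3)[OF x] pyramid_coneD(3)[OF y] ch])
  have s32: "hp x 3 2 = hp y 3 2"
    by (rule sec_pow_inj[OF pyramid_coneD(4)[OF x] pyramid_coneD(4)[OF y] u(2)])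
  have s2: "hp x 2 j = hp y 2 j" if "j = 0 \<or> j = 1" for j
    by (rule sec_pow_inj[OF pyramid_coneD(5)[OF x that] pyramid_coneD(5)[OF y that] u(3)[OF that]])
  have s3: "hp x j 3 = hp y j 3" if j: "j = 0 \<or> j = 1" for j
  proof -
    have "\<omega> * hp x j 3 = \<omega> * hp y j 3"
      by (rule sec_pow_inj[OF pyramid_coneD(6)[OF x j] pyramid_coneD(6)[OF y j]])
        (simp only: omega_mult_pow u(4)[OF j])
    then show ?thesis by simp
  qed
  have rev: "hp x j i = hp y j i" if "hp x i j = hp y i j" for i j
    using that hp_cnj by metis
  have "\<forall>i j. hp x i j = hp y i j"
    unfolding all4 using diag s01 s32 s2[of 0] s2[of 1] s3[of 0] s3[of 1] rev by simp
  then show ?thesis using x y by (intro hp_determines) (auto simp: pyramid_cone_def)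
qed

lemma pyramid_cone_exists:
  fixes r :: "real ^ 4"
  assumes r: "\<And>t. t < 5 \<Longrightarrow> 0 \<le> slack t r" and pos: "(\<Sum>i\<in>UNIV. r $ i) > 0"
  obtains z where "z \<in> pyramid_cone" "cmods (pw z) = r"
proof -
  have r5: "0 \<le> r $ 0" "0 \<le> r $ 0 + r $ 1 + r $ 3 - r $ 2" "0 \<le> r $ 1" "0 \<le> r $ 0 + r $ 1 + r $ 2 - r $ 3"
    "0 \<le> r $ 2 + r $ 3 - r $ 0 - r $ 1"
    using r[of 0] r[of 1] r[of 2] r[of 3] r[of 4] by auto
  have r23: "0 \<le> r $ 2" "0 \<le> r $ 3" using r5 by linarith+
  obtain \<theta> \<phi> where a: "0 \<le> \<theta>" "\<theta> \<le> pi" "0 \<le> \<phi>" "\<phi> \<le> pi" "\<theta> + \<phi> \<ge> pi"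
    "(r $ 0 + r $ 1) + r $ 2 * cos \<theta> + r $ 3 * cos \<phi> = 0" "r $ 2 * sin \<theta> = r $ 3 * sin \<phi>"
    using triangle_exists[of "r $ 0 + r $ 1" "r $ 2" "r $ 3"] r5 r23 pos by (auto simp: sum4)
  define \<rho> where "\<rho> i = root n (r $ i)" for i
  have \<rho>: "\<rho> i \<ge> 0" "\<rho> i ^ n = r $ i" for i
  proof -
    have "\<forall>i. 0 \<le> r $ i" unfolding all4 using r5 r23 by simp
    then show "\<rho> i \<ge> 0" "\<rho> i ^ n = r $ i" using n_pos by (auto simp: \<rho>_def)
  qed
  define z where "z = vec4 (of_real (\<rho> 0)) (of_real (\<rho> 1)) (of_real (\<rho> 2) * cis (\<theta> / n))
    (of_real (\<rho> 3) * cis ((2 * pi - \<phi>) / n))"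
  have pwz: "pw z $ 0 = of_real (r $ 0)" "pw z $ 1 = of_real (r $ 1)" "pw z $ 2 = of_real (r $ 2) * cis \<theta>"
    "pw z $ 3 = of_real (r $ 3) * cis (2 * pi - \<phi>)"
    by (simp_all only: pw_nth z_def vec4_nth power_mult_distrib cis_pow flip: of_real_power \<rho>(2))
  have cm: "cmods (pw z) = r"
  proof -
    have "\<forall>i. cmods (pw z) $ i = r $ i"
      unfolding all4 cmods_nth pwz using r5 r23 by (simp add: norm_mult)
    then show ?thesis by (simp add: vec_eq_iff)
  qed
  have c2: "cis (2 * pi - \<phi>) = cis (- \<phi>)"
    using cis_divide[of "2 * pi" \<phi>] cis_divide[of 0 \<phi>] by simp
  have sum: "(\<Sum>i\<in>UNIV. (z $ i) ^ n) = 0"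
  proof -
    have "(\<Sum>i\<in>UNIV. (z $ i) ^ n) = pw z $ 0 + pw z $ 1 + pw z $ 2 + pw z $ 3" by (simp add: sum4 pw_nth)
    also have "\<dots> = 0" unfolding pwz c2 using a(6,7) by (simp add: complex_eq_iff)
    finally show ?thesis .
  qed
  have z0: "z \<noteq> 0"
  proof
    assume "z = 0"
    then have "r = 0" using cm n_pos by (simp add: vec_eq_iff power_0_left cmods_def pw_nth)
    then show False using pos by simp
  qed
  have d: "\<theta> / n \<le> pi / n" "\<phi> / n \<le> pi / n" "0 \<le> \<theta> / n" "0 \<le> \<phi> / n"
    "0 \<le> (2 * pi - \<phi> - \<theta>) / n" "(2 * pi - \<phi> - \<theta>) / n \<le> pi / n"
    using a by (auto intro!: divide_right_mono)
  have h2: "hp z 2 j = of_real (\<rho> 2 * \<rho> j) * cis (\<theta> / n)" if "j = 0 \<or> j = 1" for j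
    using that by (auto simp: hp_def z_def)
  have h32: "hp z 3 2 = of_real (\<rho> 3 * \<rho> 2) * cis ((2 * pi - \<phi> - \<theta>) / n)"
  proof -
    have "hp z 3 2 = of_real (\<rho> 3 * \<rho> 2) * (cis ((2 * pi - \<phi>) / n) * cis (- (\<theta> / n)))"
      by (simp add: hp_def z_def cis_cnj)
    also have "cis ((2 * pi - \<phi>) / n) * cis (- (\<theta> / n)) = cis ((2 * pi - \<phi> - \<theta>) / n)"
      unfolding cis_mult by (simp add: diff_divide_distrib)
    finally show ?thesis .
  qed
  have h3: "\<omega> * hp z j 3 = of_real (\<rho> j * \<rho> 3) * cis (\<phi> / n)" if "j = 0 \<or> j = 1" for j
  proof -
    have "\<omega> * hp z j 3 = of_real (\<rho> j * \<rho> 3) * (\<omega> * cis (- ((2 * pi - \<phi>) / n)))"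
      using that by (auto simp: hp_def z_def cis_cnj)
    also have "\<omega> * cis (- ((2 * pi - \<phi>) / n)) = cis (\<phi> / n)"
      unfolding cis_mult by (simp add: diff_divide_distrib)
    finally show ?thesis .
  qed
  have "z \<in> pyramid_cone"
  proof -
    have "sec (of_real (\<rho> i * \<rho> j) * cis \<alpha>)" if "0 \<le> \<alpha>" "\<alpha> \<le> pi / n" for i j \<alpha>
      using that \<rho>(1) by (intro sec_cis) auto
    then have "sec (hp z 2 0)" "sec (hp z 2 1)" "sec (hp z 3 2)" "sec (\<omega> * hp z 0 3)" "sec (\<omega> * hp z 1 3)"
      using d h2[of 0] h2[of 1] h32 h3[of 0] h3[of 1] by auto
    moreover have "hp z 0 1 = of_real (\<rho> 0 * \<rho> 1)" by (simp add: hp_def z_def)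
    then have "nn (hp z 0 1)" using \<rho>(1) by (simp add: nn_def)
    ultimately show ?thesis unfolding pyramid_cone_def using z0 sum by simp
  qed
  then show thesis using that cm by blast
qed

end

section \<open>The face lattice of the pyramid\<close>

text \<open>The vertices that lie on a facet, with the facets numbered like \<open>slack\<close>.\<close>

definition side :: "nat \<Rightarrow> nat set"
  where "side t = (if t = 0 then {0,1,4} else if t = 1 then {1,2,4} else if t = 2 then {2,3,4}
    else if t = 3 then {3,0,4} else {0,1,2,3})"

lemma side_simps [simp]:
  "side 0 = {0,1,4}" "side (Suc 0) = {1,2,4}" "side 2 = {2,3,4}" "side 3 = {3,0,4}" "side 4 = {0,1,2,3}"
  by (simp_all add: side_def)

text \<open>The side lengths of the five flat triangles at which four facets (for the apex) or three facets
  (for the others) meet.\<close>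

definition vert :: "nat \<Rightarrow> real ^ 4"
  where "vert v = (if v = 0 then vec4 0 (1/2) 0 (1/2) else if v = 1 then vec4 0 (1/2) (1/2) 0
    else if v = 2 then vec4 (1/2) 0 (1/2) 0 else if v = 3 then vec4 (1/2) 0 0 (1/2)
    else vec4 0 0 (1/2) (1/2))"

definition faces :: "nat \<Rightarrow> nat set set"
  where "faces j = (if j = 3 then {{0,1,2,3,4}} else pyramid_faces j)"

lemma faces_simps:
  "faces 0 = {{0}, {1}, {2}, {3}, {4}}"
  "faces (Suc 0) = {{0,1}, {1,2}, {2,3}, {3,0}, {0,4}, {1,4}, {2,4}, {3,4}}"
  "faces 2 = {{0,1,2,3}, {0,1,4}, {1,2,4}, {2,3,4}, {3,0,4}}"
  "faces 3 = {{0,1,2,3,4}}"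
  by (simp_all add: faces_def pyramid_faces_def)

lemma faces_pyramid: "j \<le> 2 \<Longrightarrow> faces j = pyramid_faces j"
  by (simp add: faces_def)

lemma faces_cases:
  assumes "V \<in> faces j"
  shows "j = 0 \<or> j = 1 \<or> j = 2 \<or> j = 3"
  using assms by (auto simp: faces_def pyramid_faces_def split: if_splits)

lemma faces_subset:
  assumes "V \<in> faces j" shows "V \<noteq> {}" "V \<subseteq> {0,1,2,3,4}" "finite V"
proof -
  show "V \<subseteq> {0,1,2,3,4}" "V \<noteq> {}"
    using assms faces_cases[OF assms] by (auto simp: faces_simps)
  then show "finite V" using finite_subset by blast
qed

lemma faces_less5: "V \<in> faces j \<Longrightarrow> v \<in> V \<Longrightarrow> v < 5"
  using faces_subset(2)[of V j] by (auto dest!: subsetD)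

text \<open>A face is the intersection of the facets that contain it.\<close>

lemma faces_closed:
  assumes "V \<in> faces j" "v < 5" "\<And>t. t < 5 \<Longrightarrow> V \<subseteq> side t \<Longrightarrow> v \<in> side t"
  shows "v \<in> V"
proof -
  have "\<forall>t<5. V \<subseteq> side t \<longrightarrow> v \<in> side t" using assms(3) by blast
  moreover have "v \<in> {0,1,2,3,4}" using assms(2) by auto
  moreover have "V \<in> faces 0 \<union> faces (Suc 0) \<union> faces 2 \<union> faces 3"
    using assms(1) faces_cases[OF assms(1)] by auto
  moreover have "\<forall>V \<in> faces 0 \<union> faces (Suc 0) \<union> faces 2 \<union> faces 3. \<forall>v\<in>{0,1,2,3,4}.
      (\<forall>t<5. V \<subseteq> side t \<longrightarrow> v \<in> side t) \<longrightarrow> v \<in> V"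
    unfolding less5 faces_simps by simp
  ultimately show ?thesis by blast
qed

lemma slack_linear: "slack t (u *\<^sub>R x + v *\<^sub>R y) = u * slack t x + v * slack t y"
  by (simp add: slack_def algebra_simps)

lemma slack_zero [simp]: "slack t 0 = 0"
  by (simp add: slack_def)

lemma slack_scale: "slack t (u *\<^sub>R x) = u * slack t x"
  using slack_linear[of t u x 0 0] by simp

lemma slack_sum: "slack t (\<Sum>v\<in>V. f v) = (\<Sum>v\<in>V. slack t (f v))"
  by (induction V rule: infinite_finite_induct) (simp_all add: slack_linear[of t 1 _ 1, simplified])

lemma continuous_slack: "continuous_on X (slack t)"
  by (cases "t = 0"; cases "t = 1"; cases "t = 2"; cases "t = 3"; simp add: slack_def[abs_def] continuous_intros)

text \<open>The face with vertex set \<open>V\<close>, in the coordinates given by the side lengths at perimeter 1.\<close>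

definition face_poly :: "nat set \<Rightarrow> (real ^ 4) set"
  where "face_poly V = {r. (\<Sum>i\<in>UNIV. r $ i) = 1 \<and> (\<forall>t<5. 0 \<le> slack t r) \<and> (\<forall>t<5. V \<subseteq> side t \<longrightarrow> slack t r = 0)}"

text \<open>The barycentre of the vertices, where exactly those inequalities are tight that have to be.\<close>

definition center :: "nat set \<Rightarrow> real ^ 4"
  where "center V = (1 / card V) *\<^sub>R (\<Sum>v\<in>V. vert v)"

lemma vert:
  assumes "v < 5" shows "(\<Sum>i\<in>UNIV. vert v $ i) = 1" "t < 5 \<Longrightarrow> 0 \<le> slack t (vert v)"
    "t < 5 \<Longrightarrow> slack t (vert v) = 0 \<longleftrightarrow> v \<in> side t"
proof -
  have "v = 0 \<or> v = 1 \<or> v = 2 \<or> v = 3 \<or> v = 4" using assms by linarith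
  then show "(\<Sum>i\<in>UNIV. vert v $ i) = 1" by (auto simp: sum4 vert_def)
  have "v = 0 \<or> v = 1 \<or> v = 2 \<or> v = 3 \<or> v = 4" using assms by linarith
  then have "\<forall>t<5. 0 \<le> slack t (vert v) \<and> (slack t (vert v) = 0 \<longleftrightarrow> v \<in> side t)"
    unfolding less5 by (elim disjE) (simp_all add: vert_def)
  then show "t < 5 \<Longrightarrow> 0 \<le> slack t (vert v)" "t < 5 \<Longrightarrow> slack t (vert v) = 0 \<longleftrightarrow> v \<in> side t"
    by auto
qed

lemma center:
  assumes V: "V \<noteq> {}" "V \<subseteq> {0,1,2,3,4}"
  shows "(\<Sum>i\<in>UNIV. center V $ i) = 1" "t < 5 \<Longrightarrow> 0 \<le> slack t (center V)"
    "t < 5 \<Longrightarrow> slack t (center V) = 0 \<longleftrightarrow> V \<subseteq> side t"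
proof -
  have fin: "finite V" using V finite_subset by blast
  then have card: "card V > 0" using V by (simp add: card_gt_0_iff)
  have v5: "v \<in> V \<Longrightarrow> v < 5" for v using V by auto
  have "(\<Sum>i\<in>UNIV. center V $ i) = (1 / card V) * (\<Sum>v\<in>V. \<Sum>i\<in>UNIV. vert v $ i)"
    by (simp add: center_def sum_component sum.swap[of _ UNIV] flip: sum_divide_distrib)
  also have "(\<Sum>v\<in>V. \<Sum>i\<in>UNIV. vert v $ i) = (\<Sum>v\<in>V. 1)" by (intro sum.cong) (auto simp: vert v5)
  finally show "(\<Sum>i\<in>UNIV. center V $ i) = 1" using card by simp
  have sl: "slack t (center V) = (1 / card V) * (\<Sum>v\<in>V. slack t (vert v))" for t
    by (simp only: center_def slack_scale slack_sum)
  show "t < 5 \<Longrightarrow> 0 \<le> slack t (center V)"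
    unfolding sl by (auto intro!: sum_nonneg vert(2) v5 divide_nonneg_nonneg)
  assume t: "t < 5"
  have "slack t (center V) = 0 \<longleftrightarrow> (\<Sum>v\<in>V. slack t (vert v)) = 0"
    unfolding sl using card by simp
  also have "\<dots> \<longleftrightarrow> (\<forall>v\<in>V. slack t (vert v) = 0)"
    using fin t v5 vert(2) by (intro sum_nonneg_eq_0_iff) auto
  finally show "slack t (center V) = 0 \<longleftrightarrow> V \<subseteq> side t" using t v5 vert(3) by auto
qed

lemma center_mem:
  assumes "V \<noteq> {}" "V \<subseteq> {0,1,2,3,4}" shows "center V \<in> face_poly V"
  using center[OF assms] by (auto simp: face_poly_def)

lemma face_poly_frontier:
  assumes V: "V \<noteq> {}" "V \<subseteq> {0,1,2,3,4}"
  shows "convex (face_poly V)"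
    "affine hull face_poly V = {r. (\<Sum>i\<in>UNIV. r $ i) = 1 \<and> (\<forall>t<5. V \<subseteq> side t \<longrightarrow> slack t r = 0)}"
    "rel_frontier (face_poly V) = {r \<in> face_poly V. \<exists>t<5. \<not> V \<subseteq> side t \<and> slack t r = 0}"
proof -
  define A where "A = {r :: real ^ 4. (\<Sum>i\<in>UNIV. r $ i) = 1 \<and> (\<forall>t<5. V \<subseteq> side t \<longrightarrow> slack t r = 0)}"
  define T where "T = {t. t < 5 \<and> \<not> V \<subseteq> side t}"
  have "affine A"
    unfolding affine_def A_def
  proof (intro ballI allI impI, safe)
    fix x y :: "real ^ 4" and u v :: real
    assume "u + v = 1" "(\<Sum>i\<in>UNIV. x $ i) = 1" "(\<Sum>i\<in>UNIV. y $ i) = 1"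
    then show "(\<Sum>i\<in>UNIV. (u *\<^sub>R x + v *\<^sub>R y) $ i) = 1"
      by (simp add: sum.distrib flip: sum_distrib_left)
  qed (auto simp: slack_linear)
  moreover have "finite T" by (simp add: T_def)
  moreover have "center V \<in> A" using center_mem[OF V] by (auto simp: A_def face_poly_def)
  moreover have "slack t (center V) > 0" if "t \<in> T" for t
    using that center(2,3)[OF V, of t] by (auto simp: T_def less_le)
  moreover have eq: "face_poly V = {r \<in> A. \<forall>t\<in>T. 0 \<le> slack t r}"
  proof -
    have "0 \<le> slack t r" if "r \<in> A" "\<forall>t\<in>T. 0 \<le> slack t r" "t < 5" for t r
      using that by (cases "V \<subseteq> side t") (auto simp: A_def T_def)
    then show ?thesis by (auto simp: face_poly_def A_def T_def)
  qed
  ultimately have "convex (face_poly V) \<and> affine hull (face_poly V) = A \<and>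
      rel_frontier (face_poly V) = {r \<in> face_poly V. \<exists>t\<in>T. slack t r = 0}"
    unfolding eq using polyhedron_frontier[where A = A and T = T and g = slack and m = "center V"] slack_linear continuous_slack by simp
  then show "convex (face_poly V)"
    "affine hull face_poly V = {r. (\<Sum>i\<in>UNIV. r $ i) = 1 \<and> (\<forall>t<5. V \<subseteq> side t \<longrightarrow> slack t r = 0)}"
    "rel_frontier (face_poly V) = {r \<in> face_poly V. \<exists>t<5. \<not> V \<subseteq> side t \<and> slack t r = 0}"
    by (auto simp: A_def T_def)
qed

text \<open>The centre of the larger face does not satisfy an equation that holds on the smaller one.\<close>

lemma aff_dim_face_less:
  assumes V: "V \<in> faces j" and W: "W \<in> faces k" and sub: "V \<subset> W"
  shows "aff_dim (face_poly V) < aff_dim (face_poly W)"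
proof (rule aff_dim_psubset)
  note V' = faces_subset(1,2)[OF V] and W' = faces_subset(1,2)[OF W]
  obtain v where v: "v \<in> W" "v \<notin> V" using sub by blast
  then obtain t where t: "t < 5" "V \<subseteq> side t" "v \<notin> side t"
    using faces_closed[OF V, of v] W' by force
  have "affine hull face_poly V \<subseteq> affine hull face_poly W"
    unfolding face_poly_frontier(2)[OF V'] face_poly_frontier(2)[OF W'] using sub by blast
  moreover have "center W \<in> affine hull face_poly W"
    using center_mem[OF W'] hull_subset[of "face_poly W" affine] by blast
  moreover have "center W \<notin> affine hull face_poly V"
    unfolding face_poly_frontier(2)[OF V'] using t center(3)[OF W' t(1)] v by blast
  ultimately show "affine hull face_poly V \<subset> affine hull face_poly W" by blast
qed

lemma faces_extend:
  assumes "V \<in> faces j"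
  shows "j < 3 \<Longrightarrow> \<exists>W\<in>faces (Suc j). V \<subset> W" "j > 0 \<Longrightarrow> \<exists>W\<in>faces (j - 1). W \<subset> V"
proof -
  have c: "j = 0 \<or> j = 1 \<or> j = 2 \<or> j = 3" by (rule faces_cases[OF assms])
  have s: "Suc (Suc 0) = 2" "Suc 2 = 3" by simp_all
  have ps: "A \<subset> B \<longleftrightarrow> A \<subseteq> B \<and> \<not> B \<subseteq> A" for A B :: "nat set" by blast
  have up: "\<forall>V\<in>faces 0. \<exists>W\<in>faces (Suc 0). V \<subset> W" "\<forall>V\<in>faces (Suc 0). \<exists>W\<in>faces 2. V \<subset> W"
      "\<forall>V\<in>faces 2. \<exists>W\<in>faces 3. V \<subset> W"
    and down: "\<forall>V\<in>faces (Suc 0). \<exists>W\<in>faces 0. W \<subset> V" "\<forall>V\<in>faces 2. \<exists>W\<in>faces (Suc 0). W \<subset> V"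
      "\<forall>V\<in>faces 3. \<exists>W\<in>faces 2. W \<subset> V"
    unfolding faces_simps ps by simp_all
  show "j < 3 \<Longrightarrow> \<exists>W\<in>faces (Suc j). V \<subset> W"
    using c assms up by (elim disjE) (auto simp only: s One_nat_def)
  show "j > 0 \<Longrightarrow> \<exists>W\<in>faces (j - 1). W \<subset> V"
    using c assms down by (elim disjE) simp_all
qed

text \<open>A maximal chain of faces climbs from dimension at least 0 to at most 3 in three steps, and every
  step raises the dimension.\<close>

lemma aff_dim_face:
  assumes "V \<in> faces j" shows "aff_dim (face_poly V) = int j"
proof -
  have lower: "int j \<le> aff_dim (face_poly V)" if "V \<in> faces j" for V j
    using that
  proof (induction j arbitrary: V)
    case 0
    have "face_poly V \<noteq> {}" using center_mem faces_subset[OF 0] by blast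
    then show ?case using aff_dim_geq[of "face_poly V"] aff_dim_empty[of "face_poly V"] by linarith
  next
    case (Suc j)
    then obtain W where "W \<in> faces j" "W \<subset> V" using faces_extend(2)[OF Suc.prems] by auto
    then show ?case using Suc.IH[of W] aff_dim_face_less[of W j V "Suc j"] Suc.prems by simp
  qed
  have upper: "aff_dim (face_poly V) \<le> 3 - int i" if "V \<in> faces (3 - i)" "i \<le> 3" for V i
    using that
  proof (induction i arbitrary: V)
    case 0
    define a :: "real ^ 4" where "a = vec4 1 1 1 1"
    have "face_poly V \<subseteq> {x. a \<bullet> x = 1}"
      by (auto simp: face_poly_def a_def inner_vec_def sum4)
    moreover have "a \<noteq> 0" by (metis a_def vec4_nth(1) zero_index zero_neq_one)
    then have "aff_dim {x. a \<bullet> x = 1} = 3" by (simp add: aff_dim_hyperplane)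
    ultimately show ?case using aff_dim_subset[of "face_poly V" "{x. a \<bullet> x = 1}"] by simp
  next
    case (Suc i)
    then obtain W where "W \<in> faces (Suc (3 - Suc i))" "V \<subset> W"
    proof -
      have "3 - Suc i < 3" using Suc.prems by linarith
      then show thesis using faces_extend(1)[OF Suc.prems(1)] that by blast
    qed
    moreover have "Suc (3 - Suc i) = 3 - i" using Suc.prems by simp
    ultimately show ?case
      using Suc.IH[of W] aff_dim_face_less[of V "3 - Suc i" W "3 - i"] Suc.prems by simp
  qed
  have "j \<le> 3" using faces_cases[OF assms] by auto
  then have "aff_dim (face_poly V) \<le> int j" using upper[of V "3 - j"] assms by simp
  then show ?thesis using lower[OF assms] by linarith
qed

lemma faces_dim_less: "V \<in> faces j \<Longrightarrow> W \<in> faces k \<Longrightarrow> V \<subset> W \<Longrightarrow> j < k"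
  using aff_dim_face_less[of V j W k] by (simp add: aff_dim_face)

text \<open>If two opposite triangular facets meet at a point, so do the other two, and the base does
  not. This leaves as sets of tight facets only those of the faces.\<close>

lemma face_of_point:
  assumes r: "(\<Sum>i\<in>UNIV. r $ i) = 1" "\<forall>t<5. 0 \<le> slack t r"
  obtains V j where "V \<in> faces j" "\<And>t. t < 5 \<Longrightarrow> slack t r = 0 \<longleftrightarrow> V \<subseteq> side t"
proof -
  define P where "P t \<longleftrightarrow> slack t r = 0" for t
  have s: "r $ 0 + r $ 1 + r $ 2 + r $ 3 = 1" using r by (simp add: sum4)
  have "P 0 \<and> P 2 \<longrightarrow> P (Suc 0) \<and> P 3 \<and> \<not> P 4" "P (Suc 0) \<and> P 3 \<longrightarrow> P 0 \<and> P 2 \<and> \<not> P 4"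
    using r(2) s unfolding P_def less5 by auto
  moreover have pattern: thesis if "V \<in> faces j" "\<forall>t<5. P t \<longleftrightarrow> V \<subseteq> side t" for V j
    using that(1) that(2) \<open>\<And>V j. \<lbrakk>V \<in> faces j; \<And>t. t < 5 \<Longrightarrow> slack t r = 0 \<longleftrightarrow> V \<subseteq> side t\<rbrakk> \<Longrightarrow> thesis\<close>
    by (simp add: P_def)
  moreover have "P 0 \<and> \<not> P (Suc 0) \<and> \<not> P 2 \<and> P 3 \<and> P 4 \<longrightarrow> thesis"
      "P 0 \<and> P (Suc 0) \<and> \<not> P 2 \<and> \<not> P 3 \<and> P 4 \<longrightarrow> thesis"
      "\<not> P 0 \<and> P (Suc 0) \<and> P 2 \<and> \<not> P 3 \<and> P 4 \<longrightarrow> thesis"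
      "\<not> P 0 \<and> \<not> P (Suc 0) \<and> P 2 \<and> P 3 \<and> P 4 \<longrightarrow> thesis"
      "P 0 \<and> P (Suc 0) \<and> P 2 \<and> P 3 \<and> \<not> P 4 \<longrightarrow> thesis"
    using pattern[of "{0}" "0"]
      pattern[of "{1}" "0"]
      pattern[of "{2}" "0"]
      pattern[of "{3}" "0"]
      pattern[of "{4}" "0"]
    unfolding less5 by (simp_all add: faces_simps)
  moreover have "P 0 \<and> \<not> P (Suc 0) \<and> \<not> P 2 \<and> \<not> P 3 \<and> P 4 \<longrightarrow> thesis"
      "\<not> P 0 \<and> P (Suc 0) \<and> \<not> P 2 \<and> \<not> P 3 \<and> P 4 \<longrightarrow> thesis"
      "\<not> P 0 \<and> \<not> P (Suc 0) \<and> P 2 \<and> \<not> P 3 \<and> P 4 \<longrightarrow> thesis"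
      "\<not> P 0 \<and> \<not> P (Suc 0) \<and> \<not> P 2 \<and> P 3 \<and> P 4 \<longrightarrow> thesis"
      "P 0 \<and> \<not> P (Suc 0) \<and> \<not> P 2 \<and> P 3 \<and> \<not> P 4 \<longrightarrow> thesis"
      "P 0 \<and> P (Suc 0) \<and> \<not> P 2 \<and> \<not> P 3 \<and> \<not> P 4 \<longrightarrow> thesis"
      "\<not> P 0 \<and> P (Suc 0) \<and> P 2 \<and> \<not> P 3 \<and> \<not> P 4 \<longrightarrow> thesis"
      "\<not> P 0 \<and> \<not> P (Suc 0) \<and> P 2 \<and> P 3 \<and> \<not> P 4 \<longrightarrow> thesis"
    using pattern[of "{0,1}" "Suc 0"]
      pattern[of "{1,2}" "Suc 0"]
      pattern[of "{2,3}" "Suc 0"]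
      pattern[of "{3,0}" "Suc 0"]
      pattern[of "{0,4}" "Suc 0"]
      pattern[of "{1,4}" "Suc 0"]
      pattern[of "{2,4}" "Suc 0"]
      pattern[of "{3,4}" "Suc 0"]
    unfolding less5 by (simp_all add: faces_simps)
  moreover have "\<not> P 0 \<and> \<not> P (Suc 0) \<and> \<not> P 2 \<and> \<not> P 3 \<and> P 4 \<longrightarrow> thesis"
      "P 0 \<and> \<not> P (Suc 0) \<and> \<not> P 2 \<and> \<not> P 3 \<and> \<not> P 4 \<longrightarrow> thesis"
      "\<not> P 0 \<and> P (Suc 0) \<and> \<not> P 2 \<and> \<not> P 3 \<and> \<not> P 4 \<longrightarrow> thesis"
      "\<not> P 0 \<and> \<not> P (Suc 0) \<and> P 2 \<and> \<not> P 3 \<and> \<not> P 4 \<longrightarrow> thesis"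
      "\<not> P 0 \<and> \<not> P (Suc 0) \<and> \<not> P 2 \<and> P 3 \<and> \<not> P 4 \<longrightarrow> thesis"
    using pattern[of "{0,1,2,3}" "2"]
      pattern[of "{0,1,4}" "2"]
      pattern[of "{1,2,4}" "2"]
      pattern[of "{2,3,4}" "2"]
      pattern[of "{3,0,4}" "2"]
    unfolding less5 by (simp_all add: faces_simps)
  moreover have "\<not> P 0 \<and> \<not> P (Suc 0) \<and> \<not> P 2 \<and> \<not> P 3 \<and> \<not> P 4 \<longrightarrow> thesis"
    using pattern[of "{0,1,2,3,4}" "3"]
    unfolding less5 by (simp_all add: faces_simps)
  ultimately show thesis
    by sat
qed

lemma face_poly_subset_iff:
  assumes V: "V \<in> faces j" and W: "W \<in> faces k"
  shows "face_poly V \<subseteq> face_poly W \<longleftrightarrow> V \<subseteq> W"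
proof
  assume a: "face_poly V \<subseteq> face_poly W"
  show "V \<subseteq> W"
  proof
    fix v assume v: "v \<in> V"
    then have v5: "v < 5" by (rule faces_less5[OF V])
    then have "vert v \<in> face_poly V"
      using vert[OF v5] v by (auto simp: face_poly_def)
    then have "vert v \<in> face_poly W" using a by blast
    then show "v \<in> W"
      using vert[OF v5] by (intro faces_closed[OF W v5]) (auto simp: face_poly_def)
  qed
qed (auto simp: face_poly_def)

lemma face_poly_boundary:
  assumes V: "V \<in> faces j"
  shows "rel_frontier (face_poly V) = (\<Union>k<j. \<Union>W\<in>{W \<in> faces k. W \<subset> V}. face_poly W)"
proof (intro equalityI subsetI)
  note V' = faces_subset(1,2)[OF V]
  fix r assume "r \<in> rel_frontier (face_poly V)"
  then obtain t where r: "r \<in> face_poly V" and t: "t < 5" "\<not> V \<subseteq> side t" "slack t r = 0"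
    unfolding face_poly_frontier(3)[OF V'] by blast
  obtain W k where W: "W \<in> faces k" "\<And>t. t < 5 \<Longrightarrow> slack t r = 0 \<longleftrightarrow> W \<subseteq> side t"
    using face_of_point[of r] r by (auto simp: face_poly_def)
  have "W \<subseteq> V"
  proof
    fix v assume v: "v \<in> W"
    have "slack t r = 0" if "t < 5" "V \<subseteq> side t" for t
      using r that by (simp add: face_poly_def)
    then show "v \<in> V"
      using v W(2) by (intro faces_closed[OF V faces_less5[OF W(1) v]]) blast
  qed
  then have "W \<subset> V" using t W by blast
  moreover have "r \<in> face_poly W" using r W by (auto simp: face_poly_def)
  ultimately show "r \<in> (\<Union>k<j. \<Union>W\<in>{W \<in> faces k. W \<subset> V}. face_poly W)"
    using W(1) faces_dim_less[OF W(1) V] by blast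
next
  note V' = faces_subset(1,2)[OF V]
  fix r assume "r \<in> (\<Union>k<j. \<Union>W\<in>{W \<in> faces k. W \<subset> V}. face_poly W)"
  then obtain W k where W: "W \<in> faces k" "W \<subset> V" "r \<in> face_poly W" by blast
  obtain v where v: "v \<in> V" "v \<notin> W" using W by blast
  then obtain t where "t < 5" "W \<subseteq> side t" "v \<notin> side t"
    using faces_closed[OF W(1), of v] V' by force
  then show "r \<in> rel_frontier (face_poly V)"
    unfolding face_poly_frontier(3)[OF V'] using W v by (auto simp: face_poly_def)
qed

section \<open>The cells of dimension at most three\<close>

lemma hp_scale: "hp (c *s z) i j = of_real ((cmod c)\<^sup>2) * hp z i j"
proof -
  have "hp (c *s z) i j = (c * cnj c) * hp z i j" by (simp add: hp_def)
  then show ?thesis by (simp only: complex_norm_square)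
qed

lemma nn_scale: "r > 0 \<Longrightarrow> nn (of_real r * c) \<longleftrightarrow> nn c"
  by (auto simp: nn_def zero_le_mult_iff)

context fermat begin

lemma sec_scale: "r > 0 \<Longrightarrow> sec (of_real r * c) \<longleftrightarrow> sec c"
proof -
  assume r: "r > 0"
  have "Im (of_real r * c) = r * Im c" "Im (cnj \<eta> * (of_real r * c)) = r * Im (cnj \<eta> * c)"
    by (simp_all add: algebra_simps)
  then show ?thesis unfolding sec_def using r by (simp only: zero_le_mult_iff mult_le_0_iff) auto
qed

definition total :: "complex ^ 4 \<Rightarrow> real"
  where "total z = (\<Sum>i\<in>UNIV. cmod (pw z $ i))"

text \<open>The side lengths of the quadrilateral with sides \<open>z $ i ^ n\<close>, scaled to perimeter 1.\<close>

definition lens :: "complex ^ 4 \<Rightarrow> real ^ 4"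
  where "lens z = (1 / total z) *\<^sub>R cmods (pw z)"

definition len :: "cp3 \<Rightarrow> real ^ 4"
  where "len p = lens (homog p)"

lemma total_pos: "z \<noteq> 0 \<Longrightarrow> total z > 0"
proof -
  assume "z \<noteq> 0"
  then obtain i where "z $ i \<noteq> 0" by (auto simp: vec_eq_iff)
  then have "cmod (pw z $ i) > 0" using pw_zero by simp
  then show ?thesis unfolding total_def by (intro sum_pos2[of _ i]) auto
qed

lemma pw_scale: "pw (c *s z) = c ^ n *s pw z"
  by (simp add: vec_eq_iff pw_nth power_mult_distrib)

lemma total_scale: "total (c *s z) = cmod c ^ n * total z"
  by (simp add: total_def pw_scale norm_mult norm_power sum_distrib_left)

lemma cmods_scale: "cmods (pw (c *s z)) = (cmod c ^ n) *\<^sub>R cmods (pw z)"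
  by (simp add: vec_eq_iff pw_scale norm_mult norm_power)

lemma lens_nth: "lens z $ i = cmod (pw z $ i) / total z"
  by (simp add: lens_def)

lemma lens_scale: "c \<noteq> 0 \<Longrightarrow> lens (c *s z) = lens z"
  by (simp add: vec_eq_iff lens_nth total_scale pw_scale norm_mult norm_power)

lemma lens_sum: "z \<noteq> 0 \<Longrightarrow> (\<Sum>i\<in>UNIV. lens z $ i) = 1"
  using total_pos[of z] by (simp add: lens_nth flip: sum_divide_distrib total_def)

lemma slack_lens: "slack t (lens z) = slk t z / total z"
  by (simp add: lens_def slk_def slack_scale)

lemma slack_lens_zero: "z \<noteq> 0 \<Longrightarrow> slack t (lens z) = 0 \<longleftrightarrow> slk t z = 0"
  using total_pos[of z] by (simp add: slack_lens)

lemma slk_scale: "slk t (c *s z) = cmod c ^ n * slk t z"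
  by (simp add: slk_def cmods_scale slack_scale)

lemma len_cp3_of: "z \<noteq> 0 \<Longrightarrow> len (cp3_of z) = lens z"
  unfolding len_def by (rule cp3_lift) (auto simp: lens_scale)

lemma continuous_pw_nth: "continuous_on X (\<lambda>z. pw z $ i)"
  by (simp add: pw_nth) (intro continuous_intros)

lemma continuous_total: "continuous_on X total"
  unfolding total_def[abs_def] by (intro continuous_intros continuous_pw_nth)

lemma continuous_lens: "continuous_on (- {0}) lens"
proof -
  have "lens = (\<lambda>z. \<chi> i. cmod (pw z $ i) / total z)" by (simp add: fun_eq_iff vec_eq_iff lens_nth)
  moreover have "continuous_on (- {0}) (\<lambda>z. \<chi> i. cmod (pw z $ i) / total z)"
    by (intro continuous_on_vec_lambda continuous_on_divide continuous_on_norm continuous_pw_nth continuous_total)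
      (use total_pos in force)
  ultimately show ?thesis by simp
qed

lemma continuous_len: "continuous_on X len"
  using continuous_cp3_lift[OF continuous_lens lens_scale] continuous_on_subset[OF _ subset_UNIV]
  by (simp add: len_def[abs_def])

lemma continuous_slk: "continuous_on X (slk t)"
proof -
  have "continuous_on X (\<lambda>z. cmods (pw z))"
    unfolding cmods_def by (intro continuous_on_vec_lambda continuous_on_norm continuous_pw_nth)
  then show ?thesis
    unfolding slk_def[abs_def] using continuous_on_compose2[OF continuous_slack[of UNIV]] by blast
qed

definition face_cone :: "nat set \<Rightarrow> (complex ^ 4) set"
  where "face_cone V = {z \<in> pyramid_cone. \<forall>t<5. V \<subseteq> side t \<longrightarrow> slk t z = 0}"

definition base_face :: "nat set \<Rightarrow> cp3 set"
  where "base_face V = cp3_of ` face_cone V"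

lemma sum_scale: "(\<Sum>i\<in>UNIV. ((c *s z) $ i) ^ n) = c ^ n * (\<Sum>i\<in>UNIV. (z $ i) ^ n)"
  for z :: "complex ^ 4"
  by (simp add: sum_distrib_left power_mult_distrib)

lemma pyramid_cone_scale: "z \<in> pyramid_cone \<Longrightarrow> c \<noteq> 0 \<Longrightarrow> c *s z \<in> pyramid_cone"
proof -
  assume z: "z \<in> pyramid_cone" and c: "c \<noteq> 0"
  then have p: "(cmod c)\<^sup>2 > 0" by simp
  have "\<omega> * hp (c *s z) j 3 = of_real ((cmod c)\<^sup>2) * (\<omega> * hp z j 3)" for j
    by (simp only: hp_scale mult.left_commute)
  then show "c *s z \<in> pyramid_cone"
    using z c pyramid_coneD[OF z] unfolding pyramid_cone_def mem_Collect_eq sum_scale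
    by (simp only: hp_scale nn_scale[OF p] sec_scale[OF p]) simp
qed

lemma cone_face_cone: "cone (face_cone V)"
  by (auto simp: cone_def face_cone_def pyramid_cone_scale slk_scale) (simp add: pyramid_cone_def)

lemma base_face_surf: "base_face V \<subseteq> surf"
  by (auto simp: base_face_def face_cone_def pyramid_cone_def cp3_of_in_fermat_surface)

text \<open>The image of the closed set of its representatives of norm 1.\<close>

lemma compact_base_face: "compact (base_face V)"
proof -
  define K where "K = face_cone V \<inter> sphere 0 1"
  have nn: "closed {z. nn (f z)}" if "continuous_on UNIV f" for f :: "complex ^ 4 \<Rightarrow> complex"
    unfolding nn_def using that
    by (intro closed_Collect_conj closed_Collect_eq closed_Collect_le continuous_intros) auto
  have sec: "closed {z. sec (f z)}" if "continuous_on UNIV f" for f :: "complex ^ 4 \<Rightarrow> complex"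
    unfolding sec_def using that
    by (intro closed_Collect_conj closed_Collect_le continuous_intros) auto
  have hp: "continuous_on UNIV (\<lambda>z. hp z i j)" for i j
    unfolding hp_def by (intro continuous_intros)
  have "K = sphere 0 1 \<inter> ({z. (\<Sum>i\<in>UNIV. (z $ i) ^ n) = 0 \<and> nn (hp z 0 1) \<and> sec (hp z 2 0) \<and> sec (hp z 2 1)
    \<and> sec (hp z 3 2) \<and> sec (\<omega> * hp z 0 3) \<and> sec (\<omega> * hp z 1 3)} \<inter> (\<Inter>t\<in>{t. t < 5 \<and> V \<subseteq> side t}. {z. slk t z = 0}))"
    by (auto simp: K_def face_cone_def pyramid_cone_def)
  moreover have "closed {z. (\<Sum>i\<in>UNIV. (z $ i) ^ n) = 0 \<and> nn (hp z 0 1) \<and> sec (hp z 2 0) \<and> sec (hp z 2 1)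
    \<and> sec (hp z 3 2) \<and> sec (\<omega> * hp z 0 3) \<and> sec (\<omega> * hp z 1 3)}"
    by (intro closed_Collect_conj nn sec hp continuous_on_mult continuous_on_const closed_Collect_eq continuous_on_sum
        continuous_on_power continuous_on_component continuous_on_id)
  moreover have "closed {z. slk t z = 0}" for t
    by (intro closed_Collect_eq continuous_slk continuous_on_const)
  ultimately have "compact K"
    by (auto intro!: compact_Int_closed closed_Int closed_INT)
  moreover have "K \<subseteq> - {0}" by (auto simp: K_def)
  ultimately have "compact (cp3_of ` K)"
    using compact_continuous_image continuous_on_subset[OF continuous_on_cp3_of] by blast
  moreover have "cp3_of ` K = base_face V"
  proof
    show "base_face V \<subseteq> cp3_of ` K"
      unfolding base_face_def
    proof clarify
      fix z assume z: "z \<in> face_cone V"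
      then have z0: "z \<noteq> 0" using cone_face_cone by (auto simp: cone_def)
      define c :: complex where "c = of_real (1 / norm z)"
      have c: "c \<noteq> 0" using z0 by (simp add: c_def)
      have "c *s z = (1 / norm z) *\<^sub>R z"
        by (simp add: vec_eq_iff c_def del: of_real_divide) (simp add: scaleR_conv_of_real)
      then have "norm (c *s z) = 1" using z0 by simp
      moreover have "c *s z \<in> face_cone V" using z c cone_face_cone by (auto simp: cone_def)
      ultimately show "cp3_of z \<in> cp3_of ` K"
        using cp3_of_scale[OF z0 c] by (intro image_eqI[of _ _ "c *s z"]) (auto simp: K_def)
    qed
  qed (auto simp: K_def base_face_def)
  ultimately show ?thesis by simp
qed

lemma pyramid_cone_len_inj:
  assumes x: "x \<in> pyramid_cone" and y: "y \<in> pyramid_cone" and eq: "lens x = lens y"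
  shows "cp3_of x = cp3_of y"
proof -
  have x0: "x \<noteq> 0" "y \<noteq> 0" using pyramid_coneD(1) x y by auto
  define c where "c = root n (total x / total y)"
  have c: "c > 0" "c ^ n = total x / total y"
    using total_pos[OF x0(1)] total_pos[OF x0(2)] n_pos by (auto simp: c_def intro: real_root_pow_pos)
  define y' where "y' = of_real c *s y"
  have y': "y' \<in> pyramid_cone" "cp3_of y' = cp3_of y"
    using pyramid_cone_scale[OF y] cp3_of_scale[OF x0(2)] c by (auto simp: y'_def)
  have "cmods (pw x) $ i = cmods (pw y') $ i" for i
  proof -
    have "cmod (pw x $ i) = total x * (lens x $ i)" using total_pos[OF x0(1)] by (simp add: lens_nth)
    also have "\<dots> = (total x / total y) * cmod (pw y $ i)" by (simp add: eq lens_nth)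
    finally show ?thesis using c by (simp add: y'_def cmods_scale)
  qed
  then have "cmods (pw x) = cmods (pw y')" by (simp add: vec_eq_iff)
  then show ?thesis using pyramid_cone_unique[OF x y'(1)] y'(2) by simp
qed

lemma lens_face_poly:
  assumes "z \<in> pyramid_cone" shows "lens z \<in> face_poly V \<longleftrightarrow> z \<in> face_cone V"
proof -
  have z: "z \<noteq> 0" using pyramid_coneD(1)[OF assms] .
  have "0 \<le> slack t (lens z)" if "t < 5" for t
    using tri_slack[OF pyramid_cone_tri[OF assms] that] total_pos[OF z] by (simp add: slack_lens slk_def)
  then show ?thesis
    using assms lens_sum[OF z] slack_lens_zero[OF z] by (auto simp: face_poly_def face_cone_def)
qed

lemma len_base_face:
  shows "len ` base_face V = face_poly V"
proof
  show "len ` base_face V \<subseteq> face_poly V"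
    unfolding base_face_def using lens_face_poly len_cp3_of pyramid_coneD(1) by (auto simp: face_cone_def)
  show "face_poly V \<subseteq> len ` base_face V"
  proof
    fix r assume r: "r \<in> face_poly V"
    then obtain z where z: "z \<in> pyramid_cone" "cmods (pw z) = r"
      using pyramid_cone_exists[of r] by (auto simp: face_poly_def)
    have "total z = (\<Sum>i\<in>UNIV. r $ i)" by (simp add: total_def flip: z(2))
    then have "total z = 1" using r by (simp add: face_poly_def)
    then have "lens z = r" using z by (simp add: lens_def)
    then show "r \<in> len ` base_face V"
      using lens_face_poly[OF z(1), of V] len_cp3_of pyramid_coneD(1)[OF z(1)] r by (force simp: base_face_def)
  qed
qed

lemma inj_on_len_base_face: "inj_on len (base_face V)"
  using pyramid_cone_len_inj len_cp3_of pyramid_coneD(1) by (auto simp: inj_on_def base_face_def face_cone_def)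

text \<open>The side lengths are a chart onto a convex polytope: two points of the pyramid with the same
  side lengths agree, and all admissible lengths occur.\<close>

lemma closed_base_face:
  assumes V: "V \<in> faces j"
  shows "closed_cell (top_of_set surf) j (base_face V)"
    "cell_boundary (top_of_set surf) j (base_face V) = {p \<in> base_face V. len p \<in> rel_frontier (face_poly V)}"
proof -
  note * = closed_cell_convex[OF compact_base_face base_face_surf continuous_len inj_on_len_base_face, unfolded len_base_face,
      OF face_poly_frontier(1)[OF faces_subset(1,2)[OF V]] aff_dim_face[OF V]]
  show "closed_cell (top_of_set surf) j (base_face V)"
    "cell_boundary (top_of_set surf) j (base_face V) = {p \<in> base_face V. len p \<in> rel_frontier (face_poly V)}"
    by (fact *)+
qed

lemma base_face_mono: "W \<subseteq> V \<Longrightarrow> base_face W \<subseteq> base_face V"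
  unfolding base_face_def face_cone_def by (intro image_mono) blast

lemma base_face_boundary:
  assumes V: "V \<in> faces j"
  shows "cell_boundary (top_of_set surf) j (base_face V) = (\<Union>k<j. \<Union>W\<in>{W \<in> faces k. W \<subset> V}. base_face W)"
proof -
  have "p \<in> base_face W" if "p \<in> base_face V" "len p \<in> face_poly W" for p W
    using that lens_face_poly len_cp3_of pyramid_coneD(1) by (auto simp: base_face_def face_cone_def)
  moreover have "len p \<in> face_poly W" if "p \<in> base_face W" for p W
    using that len_base_face by blast
  ultimately show ?thesis
    unfolding closed_base_face(2)[OF V] face_poly_boundary[OF V] using base_face_mono[of _ V] by blast
qed

lemma base_face_interior:
  assumes V: "V \<in> faces j" and p: "p \<in> cell_interior (top_of_set surf) j (base_face V)"
  obtains z where "z \<in> pyramid_cone" "p = cp3_of z" "\<And>t. t < 5 \<Longrightarrow> slk t z = 0 \<longleftrightarrow> V \<subseteq> side t"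
proof -
  obtain z where z: "z \<in> face_cone V" "p = cp3_of z"
    using p by (auto simp: cell_interior_def base_face_def)
  then have zF: "z \<in> pyramid_cone" by (simp add: face_cone_def)
  note z0 = pyramid_coneD(1)[OF zF]
  have "lens z \<notin> rel_frontier (face_poly V)"
    using p z len_cp3_of[OF z0] unfolding cell_interior_def closed_base_face(2)[OF V] by auto
  then have "slack t (lens z) = 0 \<longleftrightarrow> V \<subseteq> side t" if "t < 5" for t
    unfolding face_poly_frontier(3)[OF faces_subset(1,2)[OF V]]
    using lens_face_poly[OF zF, of V] z that by (auto simp: face_poly_def)
  then show thesis using that zF z(2) slack_lens_zero[OF z0] by blast
qed

text \<open>If two translated faces share a point that is interior to both, then any point of the first
  lies below the common point, and so it belongs to the second. This is where the
  comparison \<open>le\<close> pays off, as it is preserved by both symmetries.\<close>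

lemma base_face_overlap:
  assumes A: "monomial A" and B: "monomial B" and a: "a \<in> pyramid_cone" and b: "b \<in> pyramid_cone" and eq: "A a = B b"
    and V: "\<And>t. t < 5 \<Longrightarrow> slk t a = 0 \<longleftrightarrow> V \<subseteq> side t" and W: "\<And>t. t < 5 \<Longrightarrow> slk t b = 0 \<longleftrightarrow> W \<subseteq> side t"
  shows "A ` face_cone V \<subseteq> B ` face_cone W"
proof clarify
  fix y assume y: "y \<in> face_cone V"
  then have yF: "y \<in> pyramid_cone" by (simp add: face_cone_def)
  have "le y a" using y V by (intro pyramid_cone_leI[OF a yF]) (auto simp: face_cone_def)
  obtain B' where B': "monomial B'" "\<And>z. B' (B z) = z" "\<And>z. B (B' z) = z"
    using monomial_inverse[OF B] by metis
  define x where "x = B' (A y)"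
  have "le (A y) (B b)" using le_monomial[OF A \<open>le y a\<close>] eq by simp
  then have le: "le x b" using le_monomial[OF B'(1)] B'(2) unfolding x_def by metis
  have "x \<noteq> 0" using pyramid_coneD(1)[OF yF] A B' by (simp add: x_def)
  moreover have "(\<Sum>i\<in>UNIV. (x $ i) ^ n) = 0"
    using pyramid_coneD(2)[OF yF] A B'(1) by (simp add: x_def monomial_sum)
  ultimately have xF: "x \<in> pyramid_cone" by (rule pyramid_cone_le[OF b le])
  then have "x \<in> face_cone W" using pyramid_cone_le_slk[OF b xF le] W by (auto simp: face_cone_def)
  then show "A y \<in> B ` face_cone W" using B'(3) x_def by (metis image_eqI)
qed

lemma lens_monomial:
  assumes "monomial A"
  obtains \<sigma> where "bij \<sigma>" "\<And>z i. lens (A z) $ i = lens z $ \<sigma> i"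
proof -
  obtain \<sigma> u where A: "bij \<sigma>" "\<And>i. u i ^ n = 1" "A = permscale \<sigma> u"
    using assms(1) by (auto simp: monomial_def)
  have pw: "pw (A z) $ i = pw z $ \<sigma> i" for z i
    by (simp add: A pw_nth power_mult_distrib)
  then have "total (A z) = total z" for z
    unfolding total_def pw using sum.reindex_bij_betw[OF A(1), of "\<lambda>i. cmod (pw z $ i)"] by simp
  then show thesis using that[of \<sigma>] A(1) by (simp add: lens_nth pw)
qed

text \<open>The set of normalised side lengths has the dimension of the face, and a symmetry only permutes
  its coordinates.\<close>

lemma base_face_dim_unique:
  assumes A: "monomial A" and B: "monomial B" and V: "V \<in> faces j" and W: "W \<in> faces k"
    and eq: "A ` face_cone V = B ` face_cone W"
  shows "j = k"
proof -
  have lensC: "lens ` face_cone U = face_poly U" for U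
  proof -
    have "lens ` face_cone U = (\<lambda>z. len (cp3_of z)) ` face_cone U"
      using cone_face_cone[of U] len_cp3_of by (intro image_cong refl) (metis cone_def)
    then show ?thesis using len_base_face[of U] by (simp add: base_face_def image_image)
  qed
  have dim: "aff_dim (lens ` (A ` face_cone U)) = aff_dim (face_poly U)" if A: "monomial A" for A U
  proof -
    obtain \<sigma> where \<sigma>: "bij \<sigma>" "\<And>z i. lens (A z) $ i = lens z $ \<sigma> i"
      using lens_monomial[OF A] by metis
    define P where "P r = (\<chi> i. r $ \<sigma> i)" for r :: "real ^ 4"
    have "linear P" by (rule linearI) (simp_all add: P_def vec_eq_iff)
    moreover have "inj P"
    proof (rule injI)
      fix x y assume "P x = P y"
      then have "x $ \<sigma> i = y $ \<sigma> i" for i by (simp add: P_def vec_eq_iff)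
      then show "x = y" using bij_on_4[OF \<sigma>(1)] by (metis vec_eq_iff)
    qed
    moreover have "lens ` (A ` face_cone U) = P ` face_poly U"
      unfolding lensC[symmetric] image_image using \<sigma>(2) by (intro image_cong) (simp_all add: P_def vec_eq_iff)
    ultimately show ?thesis by (simp add: aff_dim_injective_linear_image)
  qed
  have "aff_dim (face_poly V) = aff_dim (face_poly W)"
    using dim[OF A, of V] dim[OF B, of W] eq by simp
  then show ?thesis using aff_dim_face V W by simp
qed

lemma inj_act: "monomial A \<Longrightarrow> inj_on (act A) surf"
  using homeomorphic_imp_injective_map[OF homeomorphic_act] by simp

lemma cell_interior_act:
  assumes A: "monomial A" and c: "closed_cell (top_of_set surf) k c" "c \<subseteq> surf"
  shows "cell_interior (top_of_set surf) k (act A ` c) = act A ` cell_interior (top_of_set surf) k c"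
proof -
  obtain h where h: "cell_param (top_of_set surf) k c h" using c by (auto simp: closed_cell_def)
  have "unit_sphere k \<subseteq> unit_ball k" by (auto simp: unit_sphere_def unit_ball_def)
  then have "cell_boundary (top_of_set surf) k c \<subseteq> c"
    using cell_boundary_eq[OF h] h by (auto simp: cell_param_def)
  then show ?thesis
    unfolding cell_interior_def cell_homeomorphic_image(2)[OF homeomorphic_act[OF A] c(1)]
    using inj_on_image_set_diff[OF inj_act[OF A], of c] c(2) by blast
qed

lemma act_base_face: "monomial A \<Longrightarrow> act A ` base_face V = cp3_of ` (A ` face_cone V)"
  unfolding base_face_def using cone_face_cone by (intro act_image) (auto simp: cone_def)

lemma face_cells_disjoint:
  assumes A: "monomial A" and B: "monomial B" and V: "V \<in> faces j" and W: "W \<in> faces k"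
    and p: "p \<in> cell_interior (top_of_set surf) j (act A ` base_face V)"
      "p \<in> cell_interior (top_of_set surf) k (act B ` base_face W)"
  shows "j = k" "act A ` base_face V = act B ` base_face W"
proof -
  obtain q where q: "q \<in> cell_interior (top_of_set surf) j (base_face V)" "p = act A q"
    using p(1) cell_interior_act[OF A closed_base_face(1)[OF V] base_face_surf] by blast
  obtain q' where q': "q' \<in> cell_interior (top_of_set surf) k (base_face W)" "p = act B q'"
    using p(2) cell_interior_act[OF B closed_base_face(1)[OF W] base_face_surf] by blast
  obtain a where a: "a \<in> pyramid_cone" "q = cp3_of a" "\<And>t. t < 5 \<Longrightarrow> slk t a = 0 \<longleftrightarrow> V \<subseteq> side t"
    using base_face_interior[OF V q(1)] by metis
  obtain b where b: "b \<in> pyramid_cone" "q' = cp3_of b" "\<And>t. t < 5 \<Longrightarrow> slk t b = 0 \<longleftrightarrow> W \<subseteq> side t"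
    using base_face_interior[OF W q'(1)] by metis
  have nz: "a \<noteq> 0" "b \<noteq> 0" "A a \<noteq> 0" "B b \<noteq> 0" using pyramid_coneD(1) a b A B by auto
  have "cp3_of (A a) = cp3_of (B b)"
    using q(2) q'(2) a(2) b(2) act_cp3_of A B nz by metis
  then obtain c where c: "c \<noteq> 0" "A a = c *s B b" using nz cp3_of_eq_iff by blast
  define b' where "b' = c *s b"
  have b': "b' \<in> pyramid_cone" "A a = B b'" "\<And>t. t < 5 \<Longrightarrow> slk t b' = 0 \<longleftrightarrow> W \<subseteq> side t"
    using pyramid_cone_scale[OF b(1)] c b(3) monomial_scale[OF B] by (auto simp: b'_def slk_scale)
  have eq: "A ` face_cone V = B ` face_cone W"
    using base_face_overlap[OF A B a(1) b'(1,2) a(3) b'(3)]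
      base_face_overlap[OF B A b'(1) a(1) b'(2)[symmetric] b'(3) a(3)] by blast
  show "j = k" by (rule base_face_dim_unique[OF A B V W eq])
  show "act A ` base_face V = act B ` base_face W" unfolding act_base_face[OF A] act_base_face[OF B] eq ..
qed

definition face_cells :: "nat \<Rightarrow> cp3 set set"
  where "face_cells j = {act A ` base_face V | A V. monomial A \<and> V \<in> faces j}"

lemma finite_monomial: "finite {A. monomial A}"
proof -
  have "finite (PiE (UNIV :: 4 set) (\<lambda>_. {u :: complex. u ^ n = 1}))"
    using n_pos by (intro finite_PiE) (auto simp: finite_roots_unity Suc_leI)
  then have "finite {u :: 4 \<Rightarrow> complex. \<forall>i. u i ^ n = 1}"
    by (auto simp: PiE_def Pi_def)
  then have "finite ((\<lambda>(\<sigma>, u). permscale \<sigma> u) ` (UNIV \<times> {u :: 4 \<Rightarrow> complex. \<forall>i. u i ^ n = 1}))"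
    by (intro finite_imageI finite_cartesian_product) auto
  moreover have "{A. monomial A} \<subseteq> (\<lambda>(\<sigma>, u). permscale \<sigma> u) ` (UNIV \<times> {u :: 4 \<Rightarrow> complex. \<forall>i. u i ^ n = 1})"
    by (auto simp: monomial_def)
  ultimately show ?thesis using finite_subset by blast
qed

lemma finite_face_cells: "finite (face_cells j)"
proof -
  have "finite (faces j)" by (simp add: faces_def pyramid_faces_def)
  then have "finite ((\<lambda>(A, V). act A ` base_face V) ` ({A. monomial A} \<times> faces j))"
    using finite_monomial by blast
  moreover have "face_cells j \<subseteq> (\<lambda>(A, V). act A ` base_face V) ` ({A. monomial A} \<times> faces j)"
    by (auto simp: face_cells_def)
  ultimately show ?thesis using finite_subset by blast
qed

lemma face_cell_closed:
  assumes A: "monomial A" and V: "V \<in> faces j"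
  shows "closed_cell (top_of_set surf) j (act A ` base_face V)"
    "cell_boundary (top_of_set surf) j (act A ` base_face V) =
      (\<Union>k<j. \<Union>W\<in>{W \<in> faces k. W \<subset> V}. act A ` base_face W)"
  using cell_homeomorphic_image[OF homeomorphic_act[OF A] closed_base_face(1)[OF V]] base_face_boundary[OF V]
  by (simp_all add: image_UN)

lemma act_base_face_subset_iff:
  assumes A: "monomial A" and V: "V \<in> faces j" and W: "W \<in> faces k"
  shows "act A ` base_face V \<subseteq> act A ` base_face W \<longleftrightarrow> V \<subseteq> W"
proof -
  have "act A ` base_face V \<subseteq> act A ` base_face W \<longleftrightarrow> base_face V \<subseteq> base_face W"
    using inj_on_image_subset_iff[OF inj_act[OF A]] base_face_surf by blast
  also have "\<dots> \<longleftrightarrow> V \<subseteq> W"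
  proof
    assume "base_face V \<subseteq> base_face W"
    then have "face_poly V \<subseteq> face_poly W" using len_base_face by (metis image_mono)
    then show "V \<subseteq> W" using face_poly_subset_iff V W by blast
  qed (rule base_face_mono)
  finally show ?thesis .
qed

lemma face_interior_nonempty:
  assumes A: "monomial A" and V: "V \<in> faces j"
  obtains p where "p \<in> cell_interior (top_of_set surf) j (act A ` base_face V)" "p \<in> act A ` base_face V"
proof -
  note V' = faces_subset(1,2)[OF V]
  obtain p where p: "p \<in> base_face V" "len p = center V"
    using center_mem[OF V'] len_base_face[of V] by (metis imageE)
  have "center V \<notin> rel_frontier (face_poly V)"
    unfolding face_poly_frontier(3)[OF V'] using center(3)[OF V'] by blast
  then have "p \<in> cell_interior (top_of_set surf) j (base_face V)"
    unfolding cell_interior_def closed_base_face(2)[OF V] using p by auto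
  then show thesis
    using that cell_interior_act[OF A closed_base_face(1)[OF V] base_face_surf] p(1) by blast
qed

lemma base_face_point:
  assumes "p \<in> base_face V" "V \<in> faces j"
  obtains W k where "W \<in> faces k" "W \<subseteq> V" "p \<in> cell_interior (top_of_set surf) k (base_face W)"
proof -
  obtain z where z: "z \<in> face_cone V" "p = cp3_of z" using assms by (auto simp: base_face_def)
  then have zF: "z \<in> pyramid_cone" by (simp add: face_cone_def)
  note z0 = pyramid_coneD(1)[OF zF]
  have lp: "lens z \<in> face_poly V" using lens_face_poly[OF zF] z by blast
  obtain W k where W: "W \<in> faces k" "\<And>t. t < 5 \<Longrightarrow> slack t (lens z) = 0 \<longleftrightarrow> W \<subseteq> side t"
    using face_of_point[of "lens z"] lp by (auto simp: face_poly_def)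
  have "W \<subseteq> V"
  proof
    fix v assume v: "v \<in> W"
    have "slack t (lens z) = 0" if "t < 5" "V \<subseteq> side t" for t
      using lp that by (simp add: face_poly_def)
    then show "v \<in> V"
      using v W(2) by (intro faces_closed[OF assms(2) faces_less5[OF W(1) v]]) blast
  qed
  moreover have "p \<in> base_face W"
    using lens_face_poly[OF zF, of W] W lp z by (auto simp: base_face_def face_poly_def)
  moreover have "len p \<notin> rel_frontier (face_poly W)"
    unfolding face_poly_frontier(3)[OF faces_subset(1,2)[OF W(1)]] z(2) len_cp3_of[OF z0] using W by auto
  ultimately have "p \<in> cell_interior (top_of_set surf) k (base_face W)"
    unfolding cell_interior_def closed_base_face(2)[OF W(1)] by blast
  then show thesis using that[OF W(1) \<open>W \<subseteq> V\<close>] by blast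
qed

text \<open>A cell inside the boundary of the pyramid has an interior point in common with the interior of a
  face of it, so it is that face by disjointness.\<close>

lemma pyramid_boundary_cells:
  assumes A: "monomial A" and C: "\<And>i. i \<le> 2 \<Longrightarrow> C i = face_cells i" and j: "j \<le> 2"
    and d: "d = act A ` base_face {0,1,2,3,4}"
  shows "boundary_cells (top_of_set surf) C 3 d j = (\<lambda>V. act A ` base_face V) ` faces j"
proof (intro equalityI subsetI)
  have P: "{0,1,2,3,4} \<in> faces 3" by (simp add: faces_simps)
  note bd = face_cell_closed(2)[OF A P, folded d]
  fix e assume "e \<in> boundary_cells (top_of_set surf) C 3 d j"
  then have e: "e \<in> face_cells j" "e \<subseteq> cell_boundary (top_of_set surf) 3 d"
    using C[OF j] by (auto simp: boundary_cells_def)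
  then obtain B V where B: "monomial B" "V \<in> faces j" "e = act B ` base_face V" by (auto simp: face_cells_def)
  obtain p where p: "p \<in> cell_interior (top_of_set surf) j e" "p \<in> e"
    using face_interior_nonempty[OF B(1,2)] B(3) by metis
  then have "p \<in> cell_boundary (top_of_set surf) 3 d" using e(2) by blast
  then obtain W' where "W' \<subset> {0,1,2,3,4}" "p \<in> act A ` base_face W'"
    unfolding bd by blast
  then have "p \<in> act A ` base_face {0,1,2,3,4}"
    using base_face_mono[of W' "{0,1,2,3,4}"] by blast
  then obtain q where q: "q \<in> base_face {0,1,2,3,4}" "p = act A q" by blast
  obtain W k where W: "W \<in> faces k" "q \<in> cell_interior (top_of_set surf) k (base_face W)"
    using base_face_point[OF q(1) P] by metis
  then have "p \<in> cell_interior (top_of_set surf) k (act A ` base_face W)"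
    using q(2) cell_interior_act[OF A closed_base_face(1)[OF W(1)] base_face_surf] by blast
  then have "j = k" "e = act A ` base_face W"
    using face_cells_disjoint[OF B(1) A B(2) W(1)] p(1) B(3) by blast+
  then show "e \<in> (\<lambda>V. act A ` base_face V) ` faces j" using W by blast
next
  have P: "{0,1,2,3,4} \<in> faces 3" by (simp add: faces_simps)
  note bd = face_cell_closed(2)[OF A P, folded d]
  fix e assume "e \<in> (\<lambda>V. act A ` base_face V) ` faces j"
  then obtain V where V: "V \<in> faces j" "e = act A ` base_face V" by blast
  have "V \<noteq> {0,1,2,3,4}"
    using aff_dim_face[OF V(1)] aff_dim_face[OF P] j by auto
  then have "V \<subset> {0,1,2,3,4}" using faces_subset(2)[OF V(1)] by blast
  then have "V \<in> {W \<in> faces j. W \<subset> {0,1,2,3,4}}" "j < 3" using V j by auto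
  then have "e \<subseteq> cell_boundary (top_of_set surf) 3 d"
    unfolding bd V(2) by blast
  then show "e \<in> boundary_cells (top_of_set surf) C 3 d j"
    using V A C[OF j] by (auto simp: boundary_cells_def face_cells_def)
qed

lemma face_cells_square_pyramid:
  assumes C: "\<And>i. i \<le> 2 \<Longrightarrow> C i = face_cells i" and d: "d \<in> face_cells 3"
  shows "square_pyramid (top_of_set surf) C d"
proof -
  obtain A where A: "monomial A" and d: "d = act A ` base_face {0,1,2,3,4}"
    using d by (auto simp: face_cells_def faces_simps)
  define F where "F V = act A ` base_face V" for V
  define U where "U = (\<Union>j\<le>2. faces j)"
  have U: "V \<in> U \<longleftrightarrow> (\<exists>j\<le>2. V \<in> faces j)" for V by (auto simp: U_def)
  have sub: "F V \<subseteq> F W \<longleftrightarrow> V \<subseteq> W" if "V \<in> U" "W \<in> U" for V W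
    using that act_base_face_subset_iff[OF A] unfolding U F_def by blast
  have inj: "inj_on F U"
    using sub by (auto intro!: inj_onI)
  define \<phi> where "\<phi> = the_inv_into U F"
  have \<phi>: "\<phi> (F V) = V" if "V \<in> U" for V
    unfolding \<phi>_def using the_inv_into_f_f[OF inj that] .
  have bc: "boundary_cells (top_of_set surf) C 3 d j = F ` faces j" if "j \<le> 2" for j
    using pyramid_boundary_cells[OF A C that d] by (simp add: F_def[abs_def])
  show ?thesis
    unfolding square_pyramid_def
  proof (intro exI[of _ \<phi>] conjI allI impI ballI)
    fix j :: nat assume j: "j \<le> 2"
    then have fU: "faces j \<subseteq> U" by (auto simp: U_def)
    have "bij_betw \<phi> (F ` faces j) (faces j)"
      using \<phi> fU sub by (intro bij_betw_byWitness[where f' = F]) auto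
    then show "bij_betw \<phi> (boundary_cells (top_of_set surf) C 3 d j) (pyramid_faces j)"
      using bc[OF j] faces_pyramid[OF j] by simp
  next
    fix a b
    assume "a \<in> (\<Union>j\<le>2. boundary_cells (top_of_set surf) C 3 d j)" "b \<in> (\<Union>j\<le>2. boundary_cells (top_of_set surf) C 3 d j)"
    then obtain i k where ik: "i \<le> 2" "a \<in> F ` faces i" "k \<le> 2" "b \<in> F ` faces k"
      using bc by auto
    then obtain V W where "V \<in> U" "W \<in> U" "a = F V" "b = F W"
      unfolding U by blast
    then show "a \<subseteq> b \<longleftrightarrow> \<phi> a \<subseteq> \<phi> b" using sub \<phi> by simp
  qed
qed

end

section \<open>Convex quadrilaterals with directed sides\<close>

lemma mult_cnj_self: "z * cnj z = of_real ((cmod z)\<^sup>2)"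
  by (simp only: complex_norm_square)

lemma cis_eq_iff: "cis a = cis b \<longleftrightarrow> (\<exists>k::int. a = b + 2 * pi * k)"
  using sin_cos_eq_iff[of a b] by (auto simp: complex_eq_iff)

lemma cis_inj_2pi:
  assumes "cis a = cis b" "0 \<le> a" "a < 2 * pi" "0 \<le> b" "b < 2 * pi"
  shows "a = b"
proof -
  obtain k :: int where k: "a = b + 2 * pi * k" using assms(1) cis_eq_iff by blast
  have "2 * pi * k < 2 * pi * 1" "2 * pi * (- 1) < 2 * pi * k" using k assms by linarith+
  then have "real_of_int k < 1" "- 1 < real_of_int k"
    using mult_less_cancel_left_pos[of "2 * pi"] pi_gt_zero by (metis zero_less_mult_iff zero_less_numeral)+
  then have "k = 0" by linarith
  then show ?thesis using k by simp
qed

lemma nn_of_real_cis: "0 < r \<Longrightarrow> nn (of_real r * cis \<phi>) \<longleftrightarrow> sin \<phi> = 0 \<and> 0 \<le> cos \<phi>"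
  by (auto simp: nn_def zero_le_mult_iff)

lemma full_turn_cases:
  assumes "0 \<le> \<phi>" "\<phi> \<le> 2 * pi"
  shows "sin \<phi> \<ge> 0 \<Longrightarrow> \<phi> \<le> pi \<or> \<phi> = 2 * pi"
    "sin \<phi> = 0 \<Longrightarrow> 0 \<le> cos \<phi> \<Longrightarrow> \<phi> = 0 \<or> \<phi> = 2 * pi"
proof -
  show 1: "sin \<phi> \<ge> 0 \<Longrightarrow> \<phi> \<le> pi \<or> \<phi> = 2 * pi"
    using sin_lt_zero[of \<phi>] assms by fastforce
  show "sin \<phi> = 0 \<Longrightarrow> 0 \<le> cos \<phi> \<Longrightarrow> \<phi> = 0 \<or> \<phi> = 2 * pi"
    using 1 sin_gt_zero[of \<phi>] assms by fastforce
qed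

text \<open>All summands project positively onto the bisector of the sector.\<close>

lemma half_plane_sum:
  fixes r \<phi> :: "4 \<Rightarrow> real"
  assumes r: "\<And>i. 0 \<le> r i" and \<phi>: "\<And>i. a \<le> \<phi> i" "\<And>i. \<phi> i \<le> b" and ab: "b - a < pi"
    and sum: "(\<Sum>i\<in>UNIV. of_real (r i) * cis (\<phi> i)) = 0"
  shows "r i = 0"
proof -
  define m where "m = (a + b) / 2"
  have m: "cos (\<phi> i - m) > 0" for i
  proof (rule cos_gt_zero_pi)
    show "- (pi / 2) < \<phi> i - m" "\<phi> i - m < pi / 2"
      using \<phi>[of i] ab by (auto simp: m_def field_simps)
  qed
  have "(\<Sum>i\<in>UNIV. r i * cos (\<phi> i - m)) = Re (cis (- m) * (\<Sum>i\<in>UNIV. of_real (r i) * cis (\<phi> i)))"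
    by (simp add: sum_distrib_left cos_diff algebra_simps sum.distrib)
  then have "(\<Sum>i\<in>UNIV. r i * cos (\<phi> i - m)) = 0" using sum by simp
  then have "\<forall>i\<in>UNIV. r i * cos (\<phi> i - m) = 0"
    using r m less_imp_le by (subst (asm) sum_nonneg_eq_0_iff) (auto intro!: mult_nonneg_nonneg)
  then show ?thesis using m[of i] by (metis UNIV_I less_irrefl mult_eq_0_iff)
qed

text \<open>A triangle that turns left at one corner turns left at the others.\<close>

lemma three_directions:
  fixes p q r :: real
  assumes pos: "p > 0" "r > 0" "q \<ge> 0"
    and sum: "of_real p * cis \<alpha> + of_real q * cis \<beta> + of_real r * cis \<gamma> = 0"
    and ang: "\<alpha> \<le> \<beta>" "\<beta> \<le> \<gamma>" "\<gamma> \<le> \<alpha> + 2 * pi" "\<beta> - \<alpha> \<le> pi"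
  shows "\<alpha> + 2 * pi - \<gamma> \<le> pi"
proof -
  have re: "p * cos \<alpha> + q * cos \<beta> + r * cos \<gamma> = 0" and im: "p * sin \<alpha> + q * sin \<beta> + r * sin \<gamma> = 0"
    using sum by (simp_all add: complex_eq_iff)
  have "r * sin (\<alpha> - \<gamma>) = (r * cos \<gamma>) * sin \<alpha> - (r * sin \<gamma>) * cos \<alpha>"
    by (simp add: sin_diff algebra_simps)
  also have "r * cos \<gamma> = - p * cos \<alpha> - q * cos \<beta>" using re by linarith
  also have "r * sin \<gamma> = - p * sin \<alpha> - q * sin \<beta>" using im by linarith
  finally have "r * sin (\<alpha> - \<gamma>) = q * sin (\<beta> - \<alpha>)"
    by (simp add: sin_diff algebra_simps)
  moreover have "sin (\<beta> - \<alpha>) \<ge> 0" using ang by (intro sin_ge_zero) auto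
  ultimately have "r * sin (\<alpha> - \<gamma>) \<ge> 0" using pos by simp
  then have "sin (\<alpha> - \<gamma>) \<ge> 0" using pos by (simp add: zero_le_mult_iff)
  then have s: "sin (\<alpha> + 2 * pi - \<gamma>) \<ge> 0"
    using sin_periodic[of "\<alpha> - \<gamma>"] by (simp add: algebra_simps)
  have "\<alpha> + 2 * pi - \<gamma> \<noteq> 2 * pi"
  proof
    assume "\<alpha> + 2 * pi - \<gamma> = 2 * pi"
    then have "\<gamma> = \<alpha>" "\<beta> = \<alpha>" using ang by linarith+
    then have "(p + q + r) * cos \<alpha> = 0" "(p + q + r) * sin \<alpha> = 0"
      using re im by (simp_all add: algebra_simps)
    moreover have "p + q + r > 0" using pos by linarith
    ultimately have "cos \<alpha> = 0" "sin \<alpha> = 0" by auto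
    then show False using sin_cos_squared_add[of \<alpha>] by simp
  qed
  then show ?thesis using full_turn_cases(1)[of "\<alpha> + 2 * pi - \<gamma>"] s ang by linarith
qed

text \<open>Two sides are parallel with the same orientation, or one of them is zero.\<close>

definition degen :: "complex ^ 4 \<Rightarrow> bool"
  where "degen w \<longleftrightarrow> (\<exists>i j. i \<noteq> j \<and> nn (hp w i j))"

lemma degen_perm:
  assumes "bij \<sigma>" shows "degen (\<chi> i. w $ \<sigma> i) \<longleftrightarrow> degen w"
proof -
  have "degen (\<chi> i. w $ \<sigma> i) \<Longrightarrow> degen w" if "bij \<sigma>" for \<sigma> w
    using that unfolding degen_def hp_def by (auto simp: bij_def inj_def)
  from this[OF assms, of w] this[OF bij_on_4(1)[OF assms], of "\<chi> i. w $ \<sigma> i"] show ?thesis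
    using bij_on_4[OF assms] by (auto simp: vec_lambda_eta)
qed

context fermat begin

text \<open>Angles of the sides that increase by at most a half turn from each side to the next and by one
  full turn altogether: the quadrilateral is convex and traversed counterclockwise. A zero side may
  have any angle, so that degenerate quadrilaterals are included.\<close>

definition lifted :: "complex ^ 4 \<Rightarrow> real ^ 4 \<Rightarrow> bool"
  where "lifted z \<theta> \<longleftrightarrow> (\<forall>i. z $ i = of_real (cmod (z $ i)) * cis (\<theta> $ i / n)) \<and>
    \<theta> $ 0 \<le> \<theta> $ 1 \<and> \<theta> $ 1 \<le> \<theta> $ 2 \<and> \<theta> $ 2 \<le> \<theta> $ 3 \<and> \<theta> $ 3 \<le> \<theta> $ 0 + 2 * pi \<and>
    \<theta> $ 1 - \<theta> $ 0 \<le> pi \<and> \<theta> $ 2 - \<theta> $ 1 \<le> pi \<and> \<theta> $ 3 - \<theta> $ 2 \<le> pi \<and> \<theta> $ 0 + 2 * pi - \<theta> $ 3 \<le> pi"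

text \<open>Homogeneous coordinates of the points of one 4-cell.\<close>

definition quad_cone :: "(complex ^ 4) set"
  where "quad_cone = {z. z \<noteq> 0 \<and> (\<Sum>i\<in>UNIV. (z $ i) ^ n) = 0 \<and> (\<exists>\<theta>. lifted z \<theta>)}"

lemma lifted_pw:
  assumes "lifted z \<theta>" shows "pw z $ i = of_real (cmod (pw z $ i)) * cis (\<theta> $ i)"
proof -
  have "z $ i = of_real (cmod (z $ i)) * cis (\<theta> $ i / n)" using assms by (simp add: lifted_def)
  then have "(z $ i) ^ n = of_real (cmod (z $ i) ^ n) * cis (\<theta> $ i)"
    by (metis cis_pow of_real_power power_mult_distrib)
  then show ?thesis unfolding pw_nth norm_power .
qed

lemma lifted_hp:
  assumes "lifted z \<theta>"
  shows "hp z i j = of_real (cmod (z $ i) * cmod (z $ j)) * cis ((\<theta> $ i - \<theta> $ j) / n)"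
proof -
  have i: "z $ k = of_real (cmod (z $ k)) * cis (\<theta> $ k / n)" for k using assms by (simp add: lifted_def)
  have "hp z i j = (of_real (cmod (z $ i)) * cis (\<theta> $ i / n)) * cnj (of_real (cmod (z $ j)) * cis (\<theta> $ j / n))"
    using i by (simp only: hp_def)
  also have "\<dots> = of_real (cmod (z $ i) * cmod (z $ j)) * (cis (\<theta> $ i / n) * cis (- (\<theta> $ j / n)))"
    by (simp add: cis_cnj)
  finally show ?thesis unfolding cis_mult by (simp add: diff_divide_distrib)
qed

lemma quad_coneE:
  assumes "z \<in> quad_cone"
  obtains \<theta> where "lifted z \<theta>" using assms by (auto simp: quad_cone_def)

lemma quad_coneD: "z \<in> quad_cone \<Longrightarrow> z \<noteq> 0" "z \<in> quad_cone \<Longrightarrow> (\<Sum>i\<in>UNIV. (z $ i) ^ n) = 0"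
  by (auto simp: quad_cone_def)

lemma pw_sum: "(\<Sum>i\<in>UNIV. pw z $ i) = (\<Sum>i\<in>UNIV. (z $ i) ^ n)"
  by (simp add: pw_nth)

lemma quad_cone_scale:
  assumes z: "z \<in> quad_cone" and c: "c \<noteq> 0" shows "c *s z \<in> quad_cone"
proof -
  obtain \<theta> where \<theta>: "lifted z \<theta>" using z by (rule quad_coneE)
  define a where "a = Arg c"
  have c': "c = of_real (cmod c) * cis a" using rcis_cmod_Arg[of c] by (simp add: a_def rcis_def)
  have "(c *s z) $ i = of_real (cmod ((c *s z) $ i)) * cis ((\<theta> $ i + n * a) / n)" for i
  proof -
    have "(\<theta> $ i + n * a) / n = \<theta> $ i / n + a" using n_pos by (simp add: field_simps)
    then have "cis ((\<theta> $ i + n * a) / n) = cis (\<theta> $ i / n) * cis a" by (simp add: cis_mult)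
    moreover have "z $ i = of_real (cmod (z $ i)) * cis (\<theta> $ i / n)" using \<theta> by (simp add: lifted_def)
    moreover have "of_real (cmod (c * z $ i)) * (cis (\<theta> $ i / n) * cis a)
        = (of_real (cmod c) * cis a) * (of_real (cmod (z $ i)) * cis (\<theta> $ i / n))"
      by (simp add: norm_mult)
    ultimately have "of_real (cmod (c * z $ i)) * cis ((\<theta> $ i + n * a) / n) = c * z $ i"
      using c' by simp
    then show ?thesis by simp
  qed
  then have "lifted (c *s z) (\<chi> i. \<theta> $ i + n * a)"
    using \<theta> unfolding lifted_def by simp
  then show ?thesis using z c unfolding quad_cone_def by (auto simp: sum_scale simp del: vector_smult_component)
qed

lemma cone_quad_cone: "cone quad_cone"
  by (auto simp: cone_def quad_cone_scale dest: quad_coneD)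

text \<open>Cyclic renumbering of the sides; the factor is the effect of one full turn on the angle of the
  side that moves from the front to the end.\<close>

definition rot :: "complex ^ 4 \<Rightarrow> complex ^ 4"
  where "rot = permscale (\<lambda>i. i + 1) (\<lambda>i. if i = 3 then \<omega> else 1)"

lemma rot_nth [simp]: "rot z $ 0 = z $ 1" "rot z $ 1 = z $ 2" "rot z $ 2 = z $ 3" "rot z $ 3 = \<omega> * z $ 0"
proof -
  have "(4::4) = 0" by simp
  then have "z $ 4 = z $ 0" by (simp only:)
  then show "rot z $ 0 = z $ 1" "rot z $ 1 = z $ 2" "rot z $ 2 = z $ 3" "rot z $ 3 = \<omega> * z $ 0"
    by (simp_all add: rot_def)
qed

lemma bij_succ4: "bij (\<lambda>i::4. i + 1)"
  by (rule o_bij[of "\<lambda>i. i - 1"]) (auto simp: fun_eq_iff)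

lemma monomial_rot: "monomial rot"
  unfolding rot_def using bij_succ4 by (intro monomial_permscale) (auto simp: omega_pow)

lemma monomial_rot_pow: "monomial (rot ^^ m)"
proof (induction m)
  case 0
  then show ?case using monomial_id by (simp add: id_def)
next
  case (Suc m)
  then show ?case using monomial_comp[OF monomial_rot Suc] by (simp add: comp_def)
qed

lemma rot4: "rot (rot (rot (rot z))) = \<omega> *s z"
proof -
  have "\<forall>i. rot (rot (rot (rot z))) $ i = (\<omega> *s z) $ i" unfolding all4 by simp
  then show ?thesis by (simp add: vec_eq_iff)
qed

lemma cis_divide_add: "cis ((x + 2 * pi) / n) = \<omega> * cis (x / n)"
  unfolding cis_mult by (simp add: add_divide_distrib add.commute)

lemma lifted_rot:
  assumes "lifted z \<theta>"
  shows "lifted (rot z) (vec4 (\<theta> $ 1) (\<theta> $ 2) (\<theta> $ 3) (\<theta> $ 0 + 2 * pi))"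
proof -
  have z: "z $ k = of_real (cmod (z $ k)) * cis (\<theta> $ k / n)" for k using assms by (simp add: lifted_def)
  have "\<omega> * z $ 0 = of_real (cmod (\<omega> * z $ 0)) * cis ((\<theta> $ 0 + 2 * pi) / n)"
  proof -
    have "\<omega> * (of_real (cmod (z $ 0)) * cis (\<theta> $ 0 / n)) = of_real (cmod (\<omega> * z $ 0)) * (\<omega> * cis (\<theta> $ 0 / n))"
      by (simp add: norm_mult)
    then show ?thesis unfolding cis_divide_add using z[of 0] by simp
  qed
  then show ?thesis using assms z[symmetric] unfolding lifted_def all4 by simp
qed

lemma rot_quad_cone_imp: "z \<in> quad_cone \<Longrightarrow> rot z \<in> quad_cone"
proof -
  assume z: "z \<in> quad_cone"
  then obtain \<theta> where "lifted z \<theta>" by (rule quad_coneE)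
  then have "\<exists>\<theta>. lifted (rot z) \<theta>" using lifted_rot by blast
  then show "rot z \<in> quad_cone"
    using quad_coneD[OF z] monomial_rot by (simp add: quad_cone_def monomial_sum)
qed

lemma rot_quad_cone: "rot z \<in> quad_cone \<longleftrightarrow> z \<in> quad_cone"
proof
  assume "rot z \<in> quad_cone"
  then have "\<omega> *s z \<in> quad_cone" using rot_quad_cone_imp rot4 by metis
  then have "cis (- (2 * pi / n)) *s (\<omega> *s z) \<in> quad_cone" by (rule quad_cone_scale) simp
  moreover have "cis (- (2 * pi / n)) *s (\<omega> *s z) = z"
    by (simp add: vector_smult_assoc cis_mult)
  ultimately show "z \<in> quad_cone" by simp
qed (rule rot_quad_cone_imp)

lemma rot_pow_quad_cone: "(rot ^^ m) z \<in> quad_cone \<longleftrightarrow> z \<in> quad_cone"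
  by (induction m) (auto simp: rot_quad_cone)

text \<open>The pyramid is the facet of the 4-cell where the first two sides have the same
  direction. If one of these sides is zero, its angle is arbitrary, and the angle conditions for
  it hold because its product with every coordinate vanishes; those for the other side come
  from the remaining triangle.\<close>

lemma quad_cone_pyramid_cone:
  assumes z: "z \<in> quad_cone" and nn10: "nn (hp z 1 0)" shows "z \<in> pyramid_cone"
proof -
  obtain \<theta> where \<theta>: "lifted z \<theta>" using z by (rule quad_coneE)
  note h = lifted_hp[OF \<theta>] and w = lifted_pw[OF \<theta>]
  have g: "\<theta> $ 0 \<le> \<theta> $ 1" "\<theta> $ 1 \<le> \<theta> $ 2" "\<theta> $ 2 \<le> \<theta> $ 3" "\<theta> $ 3 \<le> \<theta> $ 0 + 2 * pi"
    "\<theta> $ 1 - \<theta> $ 0 \<le> pi" "\<theta> $ 2 - \<theta> $ 1 \<le> pi" "\<theta> $ 3 - \<theta> $ 2 \<le> pi" "\<theta> $ 0 + 2 * pi - \<theta> $ 3 \<le> pi"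
    using \<theta> unfolding lifted_def by blast+
  have sec: "sec (of_real (x * y) * cis (d / n))" if "x \<ge> 0" "y \<ge> 0" "0 \<le> d" "d \<le> pi" for x y d
    using that n_pos by (intro sec_cis) (auto intro: divide_right_mono)
  have om: "\<omega> * hp z j 3 = of_real (cmod (z $ j) * cmod (z $ 3)) * cis ((\<theta> $ j + 2 * pi - \<theta> $ 3) / n)" for j
  proof -
    have "\<theta> $ j + 2 * pi - \<theta> $ 3 = (\<theta> $ j - \<theta> $ 3) + 2 * pi" by simp
    then show ?thesis unfolding h by (simp only: cis_divide_add mult.left_commute)
  qed
  have sum: "pw z $ 0 + pw z $ 1 + pw z $ 2 + pw z $ 3 = 0"
    using quad_coneD(2)[OF z] pw_sum[of z] by (simp add: sum4)
  have s21: "sec (hp z 2 1)" and s32: "sec (hp z 3 2)" and s03: "sec (\<omega> * hp z 0 3)"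
    unfolding om unfolding h by (intro sec; use g in simp)+
  have "sec (hp z 2 0) \<and> sec (\<omega> * hp z 1 3)"
  proof (cases "z $ 0 = 0")
    case z0: True
    have "\<theta> $ 1 + 2 * pi - \<theta> $ 3 \<le> pi" if "z $ 1 \<noteq> 0" "z $ 3 \<noteq> 0"
    proof (rule three_directions[where q = "cmod (pw z $ 2)" and \<beta> = "\<theta> $ 2"])
      show "of_real (cmod (pw z $ 1)) * cis (\<theta> $ 1) + of_real (cmod (pw z $ 2)) * cis (\<theta> $ 2)
        + of_real (cmod (pw z $ 3)) * cis (\<theta> $ 3) = 0"
        using sum z0 pw_zero[of z 0] unfolding w[symmetric] by simp
    qed (use g that pw_zero in auto)
    then have "sec (\<omega> * hp z 1 3)"
    proof (cases "z $ 1 = 0 \<or> z $ 3 = 0")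
      case True then show ?thesis by (auto simp: hp_def)
    next
      case False
      then show ?thesis unfolding om using g \<open>z $ 1 \<noteq> 0 \<Longrightarrow> z $ 3 \<noteq> 0 \<Longrightarrow> \<theta> $ 1 + 2 * pi - \<theta> $ 3 \<le> pi\<close>
        by (intro sec) auto
    qed
    then show ?thesis using z0 by (simp add: hp_def)
  next
    case z0: False
    show ?thesis
    proof (cases "z $ 1 = 0")
      case z1: True
      have "\<theta> $ 2 + 2 * pi - (\<theta> $ 0 + 2 * pi) \<le> pi" if "z $ 2 \<noteq> 0"
      proof (rule three_directions[where q = "cmod (pw z $ 3)" and \<beta> = "\<theta> $ 3"])
        have "cis (\<theta> $ 0 + 2 * pi) = cis (\<theta> $ 0)" by (simp add: complex_eq_iff)
        then show "of_real (cmod (pw z $ 2)) * cis (\<theta> $ 2) + of_real (cmod (pw z $ 3)) * cis (\<theta> $ 3)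
          + of_real (cmod (pw z $ 0)) * cis (\<theta> $ 0 + 2 * pi) = 0"
          using sum z1 pw_zero[of z 1] w[symmetric] by (simp add: add_ac)
      qed (use g that z0 pw_zero in auto)
      then have "sec (hp z 2 0)"
      proof (cases "z $ 2 = 0")
        case True then show ?thesis by (auto simp: hp_def)
      next
        case False
        then show ?thesis unfolding h using g \<open>z $ 2 \<noteq> 0 \<Longrightarrow> \<theta> $ 2 + 2 * pi - (\<theta> $ 0 + 2 * pi) \<le> pi\<close>
          by (intro sec) auto
      qed
      then show ?thesis using z1 by (simp add: hp_def)
    next
      case False
      define d where "d = (\<theta> $ 1 - \<theta> $ 0) / n"
      have d: "0 \<le> d" "d \<le> pi"
      proof -
        show "0 \<le> d" using g by (simp add: d_def)
        have "d \<le> pi / n" unfolding d_def using g by (intro divide_right_mono) auto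
        then show "d \<le> pi" using pi_n by linarith
      qed
      have "cmod (z $ 1) * cmod (z $ 0) > 0" using z0 False by simp
      then have "sin d = 0 \<and> 0 \<le> cos d"
        using nn10 unfolding h d_def by (simp only: nn_of_real_cis)
      then have "d = 0" using cos_half_turn_eq[OF d] by blast
      then have "\<theta> $ 1 = \<theta> $ 0" using n_pos by (simp add: d_def)
      then show ?thesis unfolding om unfolding h using g by (intro conjI sec) simp_all
    qed
  qed
  moreover have "nn (hp z 0 1)" using nn10 hp_cnj nn_cnj by metis
  ultimately show ?thesis
    unfolding pyramid_cone_def using s21 s32 s03 quad_coneD[OF z] by simp
qed

lemma direction_of_hp:
  assumes j: "z $ j = of_real (cmod (z $ j)) * cis a" "z $ j \<noteq> 0"
    and hp: "hp z i j = of_real (cmod (hp z i j)) * cis \<phi>"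
  shows "z $ i = of_real (cmod (z $ i)) * cis (a + \<phi>)"
proof -
  have "hp z i j * z $ j = z $ i * of_real ((cmod (z $ j))\<^sup>2)"
    unfolding mult_cnj_self[symmetric] by (simp add: hp_def mult_ac)
  moreover have "hp z i j * z $ j = of_real (cmod (z $ i)) * cis (a + \<phi>) * of_real ((cmod (z $ j))\<^sup>2)"
    by (subst hp, subst j(1)) (simp add: hp_def norm_mult cis_mult[symmetric] power2_eq_square mult_ac)
  ultimately show ?thesis using j(2) by simp
qed

text \<open>The angles are taken relative to a nonzero one among the first two coordinates, from which the
  sector conditions give those of the others. The remaining gap, between the last two sides, is at
  most a half turn because the exterior angles at two corners of a triangle add up to at least a half
  turn. If the first two coordinates vanish, the last two sides are opposite.\<close>

lemma pyramid_cone_quad_cone: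
  assumes z: "z \<in> pyramid_cone" shows "z \<in> quad_cone"
proof -
  have sum: "pw z $ 0 + pw z $ 1 + pw z $ 2 + pw z $ 3 = 0"
    using pyramid_coneD(2)[OF z] pw_sum[of z] by (simp add: sum4)
  have polar: "x = of_real (cmod x) * cis (Arg x)" for x
    using rcis_cmod_Arg[of x] by (simp add: rcis_def)
  have na: "n * x / n = x" for x :: real using n_pos by simp
  have "\<exists>\<theta>. lifted z \<theta>"
  proof (cases "z $ 0 = 0 \<and> z $ 1 = 0")
    case True
    then have "pw z $ 0 = 0" "pw z $ 1 = 0" using pw_zero by auto
    then have w: "pw z $ 3 = - (pw z $ 2)" using sum by (simp add: add_eq_0_iff)
    have z2: "z $ 2 \<noteq> 0"
    proof
      assume "z $ 2 = 0"
      then have "pw z $ 3 = 0" using w pw_zero[of z 2] by simp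
      then have "z $ 3 = 0" using pw_zero by blast
      then have "\<forall>i. z $ i = 0" unfolding all4 using True \<open>z $ 2 = 0\<close> by blast
      then show False using pyramid_coneD(1)[OF z] by (simp add: vec_eq_iff)
    qed
    obtain \<phi> where \<phi>: "0 \<le> \<phi>" "\<phi> \<le> pi" "hp z 3 2 = of_real (cmod (hp z 3 2)) * cis (\<phi> / n)"
      "hp z 3 2 ^ n = cmod (hp z 3 2) ^ n * cis \<phi>"
      using sec_pow_polar[OF pyramid_coneD(4)[OF z]] .
    have "hp z 3 2 ^ n = - of_real ((cmod (pw z $ 2))\<^sup>2)"
      unfolding hp_pw[symmetric] mult_cnj_self[symmetric] by (simp add: hp_def w)
    then have e: "of_real (cmod (hp z 3 2) ^ n) * cis \<phi> = - of_real ((cmod (pw z $ 2))\<^sup>2)"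
      using \<phi>(4) by simp
    define s t where "s = cmod (hp z 3 2) ^ n" and "t = (cmod (pw z $ 2))\<^sup>2"
    have "of_real s * cis \<phi> = - of_real t" using e by (simp only: s_def t_def)
    then have "s * cos \<phi> = - t" "s * sin \<phi> = 0" by (simp_all add: complex_eq_iff)
    moreover have "t > 0" using z2 pw_zero by (simp add: t_def)
    moreover have "s \<ge> 0" by (simp add: s_def)
    ultimately have "cos \<phi> < 0" "sin \<phi> = 0"
      by (smt (verit) mult_nonneg_nonneg, smt (verit) mult_eq_0_iff)
    then have p: "\<phi> = pi" using cos_half_turn_eq(2)[OF \<phi>(1,2)] by simp
    define a where "a = n * Arg (z $ 2)"
    have 2: "z $ 2 = of_real (cmod (z $ 2)) * cis (a / n)" using polar by (simp only: a_def na)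
    have "z $ 3 = of_real (cmod (z $ 3)) * cis (a / n + pi / n)"
      using direction_of_hp[OF 2 z2 \<phi>(3)] p by simp
    then have "lifted z (vec4 a a a (a + pi))"
      unfolding lifted_def all4 using True 2 by (simp add: add_divide_distrib)
    then show ?thesis by blast
  next
    case False
    then obtain j where j: "j = 0 \<or> j = 1" "z $ j \<noteq> 0" by blast
    define a where "a = n * Arg (z $ j)"
    have za: "z $ j = of_real (cmod (z $ j)) * cis (a / n)" using polar by (simp only: a_def na)
    have z01: "z $ k = of_real (cmod (z $ k)) * cis (a / n)" if k: "k = 0 \<or> k = 1" for k
    proof -
      have "nn (hp z k j)"
        using k j pyramid_coneD(3)[OF z] hp_self(1) by (metis hp_cnj nn_cnj)
      then have "hp z k j = of_real (cmod (hp z k j)) * cis 0"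
        by (simp add: nn_iff_cmod complex_eq_iff) (simp add: nn_def flip: nn_iff_cmod)
      from direction_of_hp[OF za j(2) this] show ?thesis by simp
    qed
    obtain \<phi> where \<phi>: "0 \<le> \<phi>" "\<phi> \<le> pi" "hp z 2 j = of_real (cmod (hp z 2 j)) * cis (\<phi> / n)"
      using sec_pow_polar[OF pyramid_coneD(5)[OF z j(1)]] by metis
    obtain \<psi> where \<psi>: "0 \<le> \<psi>" "\<psi> \<le> pi" "\<omega> * hp z j 3 = of_real (cmod (\<omega> * hp z j 3)) * cis (\<psi> / n)"
      using sec_pow_polar[OF pyramid_coneD(6)[OF z j(1)]] by metis
    have z2: "z $ 2 = of_real (cmod (z $ 2)) * cis (a / n + \<phi> / n)"
      by (rule direction_of_hp[OF za j(2) \<phi>(3)])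
    have "hp z j 3 = of_real (cmod (hp z j 3)) * (cis (\<psi> / n) * cnj \<omega>)"
    proof -
      have "cnj \<omega> * (\<omega> * hp z j 3) = hp z j 3" by (simp add: cis_cnj cis_mult flip: mult.assoc)
      then show ?thesis using \<psi>(3) by (metis (no_types, lifting) mult.assoc mult.commute mult_1 norm_cis norm_mult)
    qed
    also have "cis (\<psi> / n) * cnj \<omega> = cis (- (2 * pi / n - \<psi> / n))"
      by (simp add: cis_cnj cis_mult)
    finally have "cnj (hp z j 3) = cnj (of_real (cmod (hp z j 3)) * cis (- (2 * pi / n - \<psi> / n)))" by (rule arg_cong)
    then have "hp z 3 j = of_real (cmod (hp z 3 j)) * cis (2 * pi / n - \<psi> / n)"
      by (simp add: hp_cnj cis_cnj) (simp add: hp_def norm_mult mult_ac)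
    from direction_of_hp[OF za j(2) this]
    have z3: "z $ 3 = of_real (cmod (z $ 3)) * cis (a / n + (2 * pi / n - \<psi> / n))" .
    have pows: "pw z $ k = of_real (cmod (pw z $ k)) * (cis a * cis \<alpha>)"
      if "z $ k = of_real (cmod (z $ k)) * cis (a / n + \<alpha> / n)" for k \<alpha>
    proof -
      have "cis (a / n + \<alpha> / n) ^ n = cis a * cis \<alpha>"
        using cis_pow[of "a + \<alpha>"] by (simp add: add_divide_distrib cis_mult)
      then show ?thesis using that by (metis norm_power of_real_power power_mult_distrib pw_nth)
    qed
    have w: "pw z $ 0 = of_real (cmod (pw z $ 0)) * (cis a * cis 0)" "pw z $ 1 = of_real (cmod (pw z $ 1)) * (cis a * cis 0)"
      "pw z $ 2 = of_real (cmod (pw z $ 2)) * (cis a * cis \<phi>)" "pw z $ 3 = of_real (cmod (pw z $ 3)) * (cis a * cis (2 * pi - \<psi>))"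
      using pows[of 0 0] pows[of 1 0] z01 pows[OF z2] pows[of 3 "2 * pi - \<psi>"] z3 by (simp_all add: diff_divide_distrib)
    define r where "r k = cmod (pw z $ k)" for k
    have "cis a * (of_real (r 0 + r 1) + of_real (r 2) * cis \<phi> + of_real (r 3) * cis (2 * pi - \<psi>)) = 0"
      using sum w unfolding r_def[symmetric] by (simp add: algebra_simps)
    then have e: "of_real (r 0 + r 1) + of_real (r 2) * cis \<phi> + of_real (r 3) * cis (2 * pi - \<psi>) = 0" by simp
    have "(r 0 + r 1) + r 2 * cos \<phi> + r 3 * cos \<psi> = 0" "r 2 * sin \<phi> = r 3 * sin \<psi>"
      using e by (simp_all add: complex_eq_iff)
    moreover have "r 0 + r 1 + r 2 + r 3 > 0"
      using total_pos[OF pyramid_coneD(1)[OF z]] by (simp add: total_def sum4 r_def)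
    ultimately have ge: "\<phi> + \<psi> \<ge> pi"
      using \<phi> \<psi> by (intro triangle_angles[where a = "r 0 + r 1" and b = "r 2" and c = "r 3"]) (auto simp: r_def)
    have "lifted z (vec4 a a (a + \<phi>) (a + 2 * pi - \<psi>))"
      unfolding lifted_def all4 using z01[of 0] z01[of 1] z2 z3 \<phi> \<psi> ge
      by (simp add: add_divide_distrib diff_divide_distrib add_diff_eq)
    then show ?thesis by blast
  qed
  then show ?thesis using pyramid_coneD[OF z] unfolding quad_cone_def by blast
qed

lemma degen_monomial:
  assumes "monomial A" shows "degen (pw (A z)) \<longleftrightarrow> degen (pw z)"
proof -
  obtain \<sigma> u where A: "bij \<sigma>" "\<And>i. u i ^ n = 1" "A = permscale \<sigma> u"
    using assms(1) by (auto simp: monomial_def)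
  have "pw (A z) = (\<chi> i. pw z $ \<sigma> i)"
    by (simp add: A vec_eq_iff pw_nth power_mult_distrib)
  then show ?thesis using degen_perm[OF A(1)] by simp
qed

lemma degen_scale:
  assumes "c \<noteq> 0" shows "degen (pw (c *s z)) \<longleftrightarrow> degen (pw z)"
proof -
  have "hp (pw (c *s z)) i j = of_real ((cmod (c ^ n))\<^sup>2) * hp (pw z) i j" for i j
    by (simp only: pw_scale hp_scale)
  moreover have "(cmod (c ^ n))\<^sup>2 > 0" using assms by simp
  ultimately show ?thesis unfolding degen_def by (metis nn_scale)
qed

lemma pyramid_cone_degen: "z \<in> pyramid_cone \<Longrightarrow> degen (pw z)"
  using pyramid_cone_tri[of z] unfolding degen_def tri_def by (intro exI[of _ 0] exI[of _ 1]) auto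

lemma rot_gap:
  assumes \<theta>: "lifted z \<theta>" and z: "z \<in> quad_cone"
  shows "z $ 0 = 0 \<or> z $ 1 = 0 \<or> \<theta> $ 1 = \<theta> $ 0 \<Longrightarrow> z \<in> pyramid_cone"
proof -
  assume "z $ 0 = 0 \<or> z $ 1 = 0 \<or> \<theta> $ 1 = \<theta> $ 0"
  then have "nn (hp z 1 0)"
    using lifted_hp[OF \<theta>, of 1 0] by (auto simp: hp_def nn_def)
  then show ?thesis using quad_cone_pyramid_cone z by blast
qed

text \<open>Two parallel sides of a convex quadrilateral are neighbours in the cyclic order, or have the same
  direction as all sides between them.\<close>

lemma degen_pyramid_cone:
  assumes z: "z \<in> quad_cone" and d: "degen (pw z)"
  obtains m where "m < 4" "(rot ^^ m) z \<in> pyramid_cone"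
proof -
  obtain \<theta> where \<theta>: "lifted z \<theta>" using z by (rule quad_coneE)
  have g: "\<theta> $ 0 \<le> \<theta> $ 1" "\<theta> $ 1 \<le> \<theta> $ 2" "\<theta> $ 2 \<le> \<theta> $ 3" "\<theta> $ 3 \<le> \<theta> $ 0 + 2 * pi"
    using \<theta> unfolding lifted_def by blast+
  note \<theta>1 = lifted_rot[OF \<theta>]
  note \<theta>2 = lifted_rot[OF \<theta>1]
  note \<theta>3 = lifted_rot[OF \<theta>2]
  have B: "rot z \<in> quad_cone" "rot (rot z) \<in> quad_cone" "rot (rot (rot z)) \<in> quad_cone"
    using z by (simp_all add: rot_quad_cone)
  have done0: thesis if "z \<in> pyramid_cone" using that \<open>\<And>m. m < 4 \<Longrightarrow> (rot ^^ m) z \<in> pyramid_cone \<Longrightarrow> thesis\<close>[of 0] by simp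
  have done1: thesis if "rot z \<in> pyramid_cone" using that \<open>\<And>m. m < 4 \<Longrightarrow> (rot ^^ m) z \<in> pyramid_cone \<Longrightarrow> thesis\<close>[of 1] by simp
  have done2: thesis if "rot (rot z) \<in> pyramid_cone"
    using that \<open>\<And>m. m < 4 \<Longrightarrow> (rot ^^ m) z \<in> pyramid_cone \<Longrightarrow> thesis\<close>[of 2] by (simp add: numeral_2_eq_2)
  have done3: thesis if "rot (rot (rot z)) \<in> pyramid_cone"
    using that \<open>\<And>m. m < 4 \<Longrightarrow> (rot ^^ m) z \<in> pyramid_cone \<Longrightarrow> thesis\<close>[of 3] by (simp add: numeral_3_eq_3)
  show thesis
  proof (cases "(\<exists>i. z $ i = 0) \<or> \<theta> $ 1 = \<theta> $ 0 \<or> \<theta> $ 2 = \<theta> $ 1 \<or> \<theta> $ 3 = \<theta> $ 2 \<or> \<theta> $ 0 + 2 * pi = \<theta> $ 3")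
    case True
    moreover have "(\<exists>i. z $ i = 0) \<longleftrightarrow> z $ 0 = 0 \<or> z $ 1 = 0 \<or> z $ 2 = 0 \<or> z $ 3 = 0"
      using all4[of "\<lambda>i. z $ i \<noteq> 0"] by blast
    ultimately consider "z $ 0 = 0 \<or> z $ 1 = 0 \<or> \<theta> $ 1 = \<theta> $ 0" | "z $ 1 = 0 \<or> z $ 2 = 0 \<or> \<theta> $ 2 = \<theta> $ 1"
      | "z $ 3 = 0 \<or> \<theta> $ 3 = \<theta> $ 2" | "\<theta> $ 0 + 2 * pi = \<theta> $ 3" by blast
    then show thesis
    proof cases
      case 1 then show thesis using rot_gap[OF \<theta> z] done0 by blast
    next
      case 2 then show thesis using rot_gap[OF \<theta>1 B(1)] done1 by simp
    next
      case 3 then show thesis using rot_gap[OF \<theta>2 B(2)] done2 by auto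
    next
      case 4 then show thesis using rot_gap[OF \<theta>3 B(3)] done3 by simp
    qed
  next
    case False
    then have s: "\<theta> $ 0 < \<theta> $ 1" "\<theta> $ 1 < \<theta> $ 2" "\<theta> $ 2 < \<theta> $ 3" "\<theta> $ 3 < \<theta> $ 0 + 2 * pi"
      using g by auto
    obtain i j where ij: "i \<noteq> j" "nn (hp (pw z) i j)" using d by (auto simp: degen_def)
    have hpp: "hp (pw z) i j = of_real (cmod (pw z $ i) * cmod (pw z $ j)) * cis (\<theta> $ i - \<theta> $ j)" for i j
    proof -
      have "hp (pw z) i j = (of_real (cmod (pw z $ i)) * cis (\<theta> $ i)) * cnj (of_real (cmod (pw z $ j)) * cis (\<theta> $ j))"
        using lifted_pw[OF \<theta>] by (simp only: hp_def)
      also have "\<dots> = of_real (cmod (pw z $ i) * cmod (pw z $ j)) * (cis (\<theta> $ i) * cis (- (\<theta> $ j)))"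
        by (simp add: cis_cnj)
      finally show ?thesis by (simp add: cis_mult)
    qed
    have not: "\<not> nn (hp (pw z) i j)" if "\<theta> $ j < \<theta> $ i" "\<theta> $ i < \<theta> $ j + 2 * pi" for i j
    proof
      assume "nn (hp (pw z) i j)"
      moreover have "cmod (pw z $ i) * cmod (pw z $ j) > 0" using False pw_zero by auto
      ultimately have "sin (\<theta> $ i - \<theta> $ j) = 0 \<and> 0 \<le> cos (\<theta> $ i - \<theta> $ j)"
        unfolding hpp by (simp only: nn_of_real_cis)
      then show False using full_turn_cases(2)[of "\<theta> $ i - \<theta> $ j"] that by auto
    qed
    have "\<forall>i j. i \<noteq> j \<longrightarrow> \<not> nn (hp (pw z) i j)"
    proof -
      have "\<forall>i j. \<theta> $ j < \<theta> $ i \<longrightarrow> \<theta> $ i < \<theta> $ j + 2 * pi" "\<forall>i j. i \<noteq> j \<longrightarrow> \<theta> $ j < \<theta> $ i \<or> \<theta> $ i < \<theta> $ j"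
        unfolding all4 using s by auto
      then show ?thesis using not by (metis hp_cnj nn_cnj)
    qed
    then show thesis using ij by blast
  qed
qed

end

section \<open>Quadrilaterals with four directions, and the covering of the surface\<close>

lemma increasing_perm_id:
  fixes \<theta> :: "real ^ 4"
  assumes \<sigma>: "bij \<sigma>" "\<sigma> 0 = 0"
    and inc: "\<theta> $ 0 < \<theta> $ 1" "\<theta> $ 1 < \<theta> $ 2" "\<theta> $ 2 < \<theta> $ 3"
    and incs: "\<theta> $ \<sigma> 1 < \<theta> $ \<sigma> 2" "\<theta> $ \<sigma> 2 < \<theta> $ \<sigma> 3"
  shows "\<sigma> = id"
proof -
  have inj: "\<sigma> i = \<sigma> j \<longleftrightarrow> i = j" for i j using \<sigma>(1) by (metis bij_pointE)
  have cases: "i = 0 \<or> i = 1 \<or> i = 2 \<or> i = 3" for i :: 4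
    using all4[of "\<lambda>i. i = 0 \<or> i = 1 \<or> i = 2 \<or> i = 3"] by blast
  have "\<sigma> i \<noteq> 0" if "i \<noteq> 0" for i using inj[of i 0] \<sigma>(2) that by simp
  then have "\<sigma> 1 = 1 \<or> \<sigma> 1 = 2 \<or> \<sigma> 1 = 3" "\<sigma> 2 = 1 \<or> \<sigma> 2 = 2 \<or> \<sigma> 2 = 3" "\<sigma> 3 = 1 \<or> \<sigma> 3 = 2 \<or> \<sigma> 3 = 3"
    using cases[of "\<sigma> 1"] cases[of "\<sigma> 2"] cases[of "\<sigma> 3"] by simp_all
  then have "\<sigma> 1 = 1 \<and> \<sigma> 2 = 2 \<and> \<sigma> 3 = 3"
    using incs inc by (elim disjE) simp_all
  then have "\<forall>i. \<sigma> i = id i" unfolding all4 using \<sigma>(2) by simp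
  then show ?thesis by (simp add: fun_eq_iff)
qed

lemma sort4:
  fixes \<alpha> :: "4 \<Rightarrow> real"
  obtains \<tau> :: "4 \<Rightarrow> 4" where "bij \<tau>" "\<alpha> (\<tau> 0) \<le> \<alpha> (\<tau> 1)" "\<alpha> (\<tau> 1) \<le> \<alpha> (\<tau> 2)" "\<alpha> (\<tau> 2) \<le> \<alpha> (\<tau> 3)"
proof -
  define xs where "xs = sort_key \<alpha> [0, 1, 2, 3 :: 4]"
  have set: "set xs = UNIV"
    using all4[of "\<lambda>i. i \<in> {0,1,2,3}"] by (auto simp: xs_def)
  have xs: "length xs = 4" "sorted (map \<alpha> xs)" by (simp_all add: xs_def)
  then obtain a b c d where abcd: "xs = [a, b, c, d]"
    by (auto simp: length_Suc_conv numeral_eq_Suc)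
  define \<tau> where "\<tau> i = vec4 a b c d $ i" for i
  have \<tau>: "\<tau> 0 = a" "\<tau> 1 = b" "\<tau> 2 = c" "\<tau> 3 = d" by (simp_all add: \<tau>_def)
  have "surj \<tau>"
  proof -
    have "UNIV = {a, b, c, d}" using set abcd by auto
    also have "\<dots> \<subseteq> range \<tau>" using \<tau> by (metis insert_subset empty_subsetI rangeI)
    finally show ?thesis by blast
  qed
  then have "bij \<tau>" by (simp add: bij_def finite_UNIV_surj_inj)
  then show thesis using that xs(2) by (simp add: abcd \<tau>)
qed

context fermat begin

lemma generic_angles:
  assumes \<theta>: "lifted z \<theta>" and nd: "\<not> degen (pw z)"
  shows "\<theta> $ 0 < \<theta> $ 1" "\<theta> $ 1 < \<theta> $ 2" "\<theta> $ 2 < \<theta> $ 3" "\<theta> $ 3 < \<theta> $ 0 + 2 * pi" "pw z $ i \<noteq> 0"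
proof -
  have g: "\<theta> $ 0 \<le> \<theta> $ 1" "\<theta> $ 1 \<le> \<theta> $ 2" "\<theta> $ 2 \<le> \<theta> $ 3" "\<theta> $ 3 \<le> \<theta> $ 0 + 2 * pi"
    using \<theta> unfolding lifted_def by blast+
  have ne: "cis (\<theta> $ i) \<noteq> cis (\<theta> $ j)" if "i \<noteq> j" for i j
  proof
    assume c: "cis (\<theta> $ i) = cis (\<theta> $ j)"
    have "hp (pw z) i j = (of_real (cmod (pw z $ i)) * cis (\<theta> $ i)) * cnj (of_real (cmod (pw z $ j)) * cis (\<theta> $ j))"
      using lifted_pw[OF \<theta>] by (simp only: hp_def)
    also have "\<dots> = of_real (cmod (pw z $ i) * cmod (pw z $ j)) * (cis (\<theta> $ j) * cnj (cis (\<theta> $ j)))"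
      by (simp add: c)
    also have "cis (\<theta> $ j) * cnj (cis (\<theta> $ j)) = 1" by (simp add: cis_cnj cis_mult)
    finally have "nn (hp (pw z) i j)" by (simp add: nn_def)
    then show False using nd that by (auto simp: degen_def)
  qed
  have "cis (\<theta> $ 0 + 2 * pi) = cis (\<theta> $ 0)" by (simp add: complex_eq_iff)
  then have "\<theta> $ 3 \<noteq> \<theta> $ 0 + 2 * pi" using ne[of 3 0] by force
  moreover have "\<theta> $ 0 \<noteq> \<theta> $ 1" "\<theta> $ 1 \<noteq> \<theta> $ 2" "\<theta> $ 2 \<noteq> \<theta> $ 3"
    using ne[of 0 1] ne[of 1 2] ne[of 2 3] by force+
  ultimately show "\<theta> $ 0 < \<theta> $ 1" "\<theta> $ 1 < \<theta> $ 2" "\<theta> $ 2 < \<theta> $ 3" "\<theta> $ 3 < \<theta> $ 0 + 2 * pi"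
    using g by linarith+
  show "pw z $ i \<noteq> 0"
  proof
    assume "pw z $ i = 0"
    then have "nn (hp (pw z) i (i + 1))" by (simp add: hp_def)
    moreover have "i \<noteq> i + 1" by simp
    ultimately show False using nd unfolding degen_def by blast
  qed
qed

text \<open>Four distinct directions determine their cyclic order and the differences of their
  angles, so a symmetry that fixes the first coordinate and keeps a generic point in the cell
  cannot permute the sides, and it turns all coordinates by the same phase.\<close>

lemma generic_rigid:
  assumes z: "z \<in> quad_cone" and nd: "\<not> degen (pw z)" and \<sigma>: "bij \<sigma>" "\<sigma> 0 = 0" and u: "\<And>i. u i ^ n = 1"
    and Az: "permscale \<sigma> u z \<in> quad_cone"
  shows "\<sigma> = id" "u i = u 0"
proof -
  define A where "A = permscale \<sigma> u"
  have A: "monomial A" using \<sigma> u by (auto simp: A_def intro: monomial_permscale)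
  obtain \<theta> where \<theta>: "lifted z \<theta>" using z by (rule quad_coneE)
  obtain \<theta>' where \<theta>': "lifted (A z) \<theta>'" using Az unfolding A_def by (rule quad_coneE)
  have nd': "\<not> degen (pw (A z))" using nd degen_monomial[OF A] by simp
  note g = generic_angles[OF \<theta> nd] and g' = generic_angles[OF \<theta>' nd']
  have pwA: "pw (A z) $ i = pw z $ \<sigma> i" for i
    by (simp add: A_def pw_nth power_mult_distrib u)
  have c: "cis (\<theta>' $ i) = cis (\<theta> $ \<sigma> i)" for i
  proof -
    have "of_real (cmod (pw z $ \<sigma> i)) * cis (\<theta>' $ i) = of_real (cmod (pw z $ \<sigma> i)) * cis (\<theta> $ \<sigma> i)"
      using lifted_pw[OF \<theta>', of i] lifted_pw[OF \<theta>, of "\<sigma> i"] unfolding pwA by simp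
    then show ?thesis using g(5)[of "\<sigma> i"] by simp
  qed
  have bd: "0 \<le> \<theta> $ i - \<theta> $ 0 \<and> \<theta> $ i - \<theta> $ 0 < 2 * pi" for i
  proof -
    have "\<forall>i. 0 \<le> \<theta> $ i - \<theta> $ 0 \<and> \<theta> $ i - \<theta> $ 0 < 2 * pi" unfolding all4 using g by auto
    then show ?thesis by blast
  qed
  have bd': "0 \<le> \<theta>' $ i - \<theta>' $ 0 \<and> \<theta>' $ i - \<theta>' $ 0 < 2 * pi" for i
  proof -
    have "\<forall>i. 0 \<le> \<theta>' $ i - \<theta>' $ 0 \<and> \<theta>' $ i - \<theta>' $ 0 < 2 * pi" unfolding all4 using g' by auto
    then show ?thesis by blast
  qed
  have eq: "\<theta>' $ i - \<theta>' $ 0 = \<theta> $ \<sigma> i - \<theta> $ 0" for i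
  proof (rule cis_inj_2pi)
    show "cis (\<theta>' $ i - \<theta>' $ 0) = cis (\<theta> $ \<sigma> i - \<theta> $ 0)"
      using c[of i] c[of 0] \<sigma>(2) by (simp flip: cis_divide)
  qed (use bd bd' in auto)
  show id: "\<sigma> = id"
    by (rule increasing_perm_id[OF \<sigma> g(1-3)]) (use eq[of 1] eq[of 2] eq[of 3] g' in linarith)+
  have u1: "u i = cis ((\<theta>' $ 0 - \<theta> $ 0) / n)" for i
  proof -
    have z0: "z $ i \<noteq> 0" using g(5) pw_zero by blast
    have cm: "cmod (u i * z $ i) = cmod (z $ i)" using root_norm[OF u] by (simp add: norm_mult)
    have "u i * z $ i = of_real (cmod (u i * z $ i)) * cis (\<theta>' $ i / n)"
      using \<theta>' id by (simp add: lifted_def A_def)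
    also have "\<dots> = of_real (cmod (z $ i)) * (cis (\<theta> $ i / n) * cis ((\<theta>' $ 0 - \<theta> $ 0) / n))"
    proof -
      have "\<theta>' $ i / n = \<theta> $ i / n + (\<theta>' $ 0 - \<theta> $ 0) / n"
        using eq[of i] id unfolding add_divide_distrib[symmetric] by simp
      then show ?thesis unfolding cm by (simp add: cis_mult)
    qed
    also have "\<dots> = z $ i * cis ((\<theta>' $ 0 - \<theta> $ 0) / n)"
      using \<theta> unfolding lifted_def by (metis mult.assoc)
    finally show ?thesis using z0 by simp
  qed
  then show "u i = u 0" by metis
qed

text \<open>A power of the rotation reduces an arbitrary symmetry to one that fixes the first coordinate, and
  this one is a scalar by rigidity.\<close>

lemma generic_overlap:
  assumes z: "z \<in> quad_cone" and nd: "\<not> degen (pw z)" and A: "monomial A" and Az: "A z \<in> quad_cone"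
  shows "A x \<in> quad_cone \<longleftrightarrow> x \<in> quad_cone"
proof -
  obtain \<sigma> u where A': "bij \<sigma>" "\<And>i. u i ^ n = 1" "A = permscale \<sigma> u"
    using A by (auto simp: monomial_def)
  define k where "k = inv_into UNIV \<sigma> 0"
  have k: "\<sigma> k = 0" unfolding k_def by (rule bij_on_4(2)[OF A'(1)])
  have "\<exists>m. \<forall>z. \<exists>c. (rot ^^ m) z $ 0 = c * z $ k"
  proof -
    have "k = 0 \<or> k = 1 \<or> k = 2 \<or> k = 3" using all4[of "\<lambda>i. i = 0 \<or> i = 1 \<or> i = 2 \<or> i = 3"] by blast
    then show ?thesis
    proof (elim disjE)
      assume "k = 0" then show ?thesis by (intro exI[of _ 0] allI exI[of _ 1]) simp
    next
      assume "k = 1" then show ?thesis by (intro exI[of _ 1] allI exI[of _ 1]) simp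
    next
      assume "k = 2" then show ?thesis by (intro exI[of _ 2] allI exI[of _ 1]) (simp add: numeral_2_eq_2)
    next
      assume "k = 3" then show ?thesis by (intro exI[of _ 3] allI exI[of _ 1]) (simp add: numeral_3_eq_3)
    qed
  qed
  then obtain m where m: "\<And>z. \<exists>c. (rot ^^ m) z $ 0 = c * z $ k" by blast
  define B where "B x = (rot ^^ m) (A x)" for x
  have B: "monomial B" unfolding B_def[abs_def] by (rule monomial_comp[OF monomial_rot_pow A])
  then obtain \<tau> v where \<tau>: "bij \<tau>" "\<And>i. v i ^ n = 1" "B = permscale \<tau> v" by (auto simp: monomial_def)
  have "\<tau> 0 = 0"
  proof (rule ccontr)
    assume "\<tau> 0 \<noteq> 0"
    \<comment> \<open>A vector whose only zero is the first coordinate detects where the permutation sends it.\<close>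
    define x :: "complex ^ 4" where "x = (\<chi> i. if i = 0 then 0 else 1)"
    have "B x $ 0 \<noteq> 0" using \<open>\<tau> 0 \<noteq> 0\<close> root_nonzero[OF \<tau>(2)] by (simp add: \<tau>(3) x_def)
    moreover have "B x $ 0 = 0"
      using m[of "A x"] by (auto simp: B_def A'(3) k x_def)
    ultimately show False by simp
  qed
  have Bz: "permscale \<tau> v z \<in> quad_cone" using Az \<tau>(3) by (simp add: B_def rot_pow_quad_cone flip: \<tau>(3))
  note rigid = generic_rigid[OF z nd \<tau>(1) \<open>\<tau> 0 = 0\<close> \<tau>(2) Bz]
  have "\<tau> = id" "v i = v 0" for i by (fact rigid)+
  then have Bx: "B x = v 0 *s x"
    unfolding \<tau>(3) vec_eq_iff permscale_nth vector_smult_component id_apply by metis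
  have v0: "v 0 \<noteq> 0" using root_nonzero[OF \<tau>(2)] .
  have "A x \<in> quad_cone \<longleftrightarrow> B x \<in> quad_cone" by (simp add: B_def rot_pow_quad_cone)
  also have "\<dots> \<longleftrightarrow> x \<in> quad_cone"
  proof
    assume "B x \<in> quad_cone"
    then have "inverse (v 0) *s B x \<in> quad_cone"
      using v0 by (intro quad_cone_scale) simp_all
    then show "x \<in> quad_cone" using v0 by (simp add: Bx vector_smult_assoc)
  next
    assume "x \<in> quad_cone"
    then show "B x \<in> quad_cone" unfolding Bx using v0 by (rule quad_cone_scale)
  qed
  finally show ?thesis .
qed

text \<open>Any closed quadrilateral becomes convex after its sides are sorted by direction: a
  gap of more than a half turn would leave all sides in an open half plane.\<close>

lemma covering:
  assumes z: "z \<noteq> 0" "(\<Sum>i\<in>UNIV. (z $ i) ^ n) = 0"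
  obtains A y where "monomial A" "y \<in> quad_cone" "z = A y"
proof -
  define \<alpha> where "\<alpha> i = Arg2pi (pw z $ i)" for i
  have \<alpha>: "0 \<le> \<alpha> i" "\<alpha> i < 2 * pi" "pw z $ i = of_real (cmod (pw z $ i)) * cis (\<alpha> i)" for i
    using Arg2pi[of "pw z $ i"] by (auto simp: \<alpha>_def is_Arg_def cis_conv_exp)
  obtain \<tau> :: "4 \<Rightarrow> 4" where \<tau>: "bij \<tau>" "\<alpha> (\<tau> 0) \<le> \<alpha> (\<tau> 1)" "\<alpha> (\<tau> 1) \<le> \<alpha> (\<tau> 2)" "\<alpha> (\<tau> 2) \<le> \<alpha> (\<tau> 3)"
    using sort4[of \<alpha>] .
  define \<theta> :: "real ^ 4" where "\<theta> = (\<chi> i. \<alpha> (\<tau> i))"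
  define y :: "complex ^ 4" where "y = (\<chi> i. of_real (cmod (z $ \<tau> i)) * cis (\<theta> $ i / n))"
  have pwy: "pw y $ i = pw z $ \<tau> i" for i
  proof -
    have "pw y $ i = of_real (cmod (z $ \<tau> i) ^ n) * cis (\<theta> $ i)"
      by (simp add: pw_nth y_def power_mult_distrib cis_pow)
    also have "\<dots> = pw z $ \<tau> i" using \<alpha>(3)[of "\<tau> i"] by (simp add: \<theta>_def pw_nth norm_power)
    finally show ?thesis .
  qed
  have cmy: "cmod (y $ i) = cmod (z $ \<tau> i)" for i by (simp add: y_def norm_mult)
  have y0: "y \<noteq> 0"
  proof
    assume "y = 0"
    then have "z $ \<tau> i = 0" for i using cmy[of i] by simp
    then have "z $ i = 0" for i using bij_on_4(2)[OF \<tau>(1)] by metis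
    then show False using z by (simp add: vec_eq_iff)
  qed
  have sumy: "(\<Sum>i\<in>UNIV. pw y $ i) = 0"
    unfolding pwy using sum.reindex_bij_betw[OF \<tau>(1), of "\<lambda>i. pw z $ i"] z(2) by (simp add: pw_sum)
  have gap: False
    if \<phi>: "\<forall>i. cis (\<phi> i) = cis (\<theta> $ i)" and ab: "\<forall>i. a \<le> \<phi> i \<and> \<phi> i \<le> b" "b - a < pi" for \<phi> a b
  proof -
    have e: "pw y $ i = of_real (cmod (pw y $ i)) * cis (\<phi> i)" for i
      using \<alpha>(3)[of "\<tau> i"] \<phi> unfolding pwy by (simp add: \<theta>_def)
    have "(\<Sum>i\<in>UNIV. of_real (cmod (pw y $ i)) * cis (\<phi> i)) = (\<Sum>i\<in>UNIV. pw y $ i)"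
      by (rule sum.cong[OF refl e[symmetric]])
    then have "(\<Sum>i\<in>UNIV. of_real (cmod (pw y $ i)) * cis (\<phi> i)) = 0" using sumy by simp
    then have "cmod (pw y $ i) = 0" for i
      using ab by (intro half_plane_sum[where r = "\<lambda>i. cmod (pw y $ i)" and \<phi> = \<phi> and a = a and b = b]) auto
    then have "y $ i = 0" for i using pw_zero[of y i] by simp
    then show False using y0 by (simp add: vec_eq_iff)
  qed
  have per: "cis (x + 2 * pi) = cis x" for x by (simp add: complex_eq_iff)
  have mono: "\<theta> $ 0 \<le> \<theta> $ 1" "\<theta> $ 1 \<le> \<theta> $ 2" "\<theta> $ 2 \<le> \<theta> $ 3" "\<theta> $ 3 \<le> \<theta> $ 0 + 2 * pi"
    using \<tau> \<alpha>(1)[of "\<tau> 0"] \<alpha>(2)[of "\<tau> 3"] by (simp_all add: \<theta>_def)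
  have "\<theta> $ 1 - \<theta> $ 0 \<le> pi"
  proof (rule ccontr)
    assume "\<not> \<theta> $ 1 - \<theta> $ 0 \<le> pi"
    then show False
      using gap[of "\<lambda>i. vec4 (\<theta> $ 0 + 2 * pi) (\<theta> $ 1) (\<theta> $ 2) (\<theta> $ 3) $ i" "\<theta> $ 1" "\<theta> $ 0 + 2 * pi"] mono
      by (simp add: all4 per)
  qed
  moreover have "\<theta> $ 2 - \<theta> $ 1 \<le> pi"
  proof (rule ccontr)
    assume "\<not> \<theta> $ 2 - \<theta> $ 1 \<le> pi"
    then show False
      using gap[of "\<lambda>i. vec4 (\<theta> $ 0 + 2 * pi) (\<theta> $ 1 + 2 * pi) (\<theta> $ 2) (\<theta> $ 3) $ i" "\<theta> $ 2" "\<theta> $ 1 + 2 * pi"] mono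
      by (simp add: all4 per)
  qed
  moreover have "\<theta> $ 3 - \<theta> $ 2 \<le> pi"
  proof (rule ccontr)
    assume "\<not> \<theta> $ 3 - \<theta> $ 2 \<le> pi"
    then show False
      using gap[of "\<lambda>i. vec4 (\<theta> $ 0 + 2 * pi) (\<theta> $ 1 + 2 * pi) (\<theta> $ 2 + 2 * pi) (\<theta> $ 3) $ i" "\<theta> $ 3" "\<theta> $ 2 + 2 * pi"] mono
      by (simp add: all4 per)
  qed
  moreover have "\<theta> $ 0 + 2 * pi - \<theta> $ 3 \<le> pi"
  proof (rule ccontr)
    assume "\<not> \<theta> $ 0 + 2 * pi - \<theta> $ 3 \<le> pi"
    then show False
      using gap[of "\<lambda>i. \<theta> $ i" "\<theta> $ 0" "\<theta> $ 3"] mono by (simp add: all4)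
  qed
  moreover have "\<forall>i. y $ i = of_real (cmod (y $ i)) * cis (\<theta> $ i / n)"
    unfolding cmy by (simp add: y_def)
  ultimately have "lifted y \<theta>" unfolding lifted_def using mono by blast
  then have yB: "y \<in> quad_cone" using y0 sumy unfolding quad_cone_def pw_sum[symmetric] by blast
  define u where "u i = (if z $ \<tau> i = 0 then 1 else z $ \<tau> i / y $ i)" for i
  have u: "u i ^ n = 1" "z $ \<tau> i = u i * y $ i" for i
  proof -
    have "z $ \<tau> i = 0 \<longleftrightarrow> y $ i = 0" using cmy[of i] by (metis norm_eq_zero)
    then show "u i ^ n = 1" "z $ \<tau> i = u i * y $ i"
      using pwy[of i] by (auto simp: u_def power_divide pw_nth)
  qed
  define A where "A = permscale (inv_into UNIV \<tau>) (\<lambda>i. u (inv_into UNIV \<tau> i))"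
  have "z $ i = A y $ i" for i
    using u(2)[of "inv_into UNIV \<tau> i"] bij_on_4(2)[OF \<tau>(1)] by (simp add: A_def)
  then have "z = A y" by (simp add: vec_eq_iff)
  moreover have "monomial A" unfolding A_def by (intro monomial_permscale bij_on_4(1) \<tau>(1) u(1))
  ultimately show thesis using that yB by blast
qed

definition base_cell :: "cp3 set"
  where "base_cell = cp3_of ` quad_cone"

lemma compact_base_cell: "compact base_cell"
proof -
  \<comment> \<open>Polar coordinates of the representatives whose absolute values sum to 1 and whose first
    angle is 0.\<close>
  define Q :: "((real ^ 4) \<times> (real ^ 4)) set" where "Q = {q. (\<forall>i. 0 \<le> fst q $ i) \<and> (\<Sum>i\<in>UNIV. fst q $ i) = 1 \<and> snd q $ 0 = 0 \<and>
    (\<Sum>i\<in>UNIV. of_real (fst q $ i ^ n) * cis (snd q $ i)) = 0 \<and>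
    snd q $ 0 \<le> snd q $ 1 \<and> snd q $ 1 \<le> snd q $ 2 \<and> snd q $ 2 \<le> snd q $ 3 \<and> snd q $ 3 \<le> snd q $ 0 + 2 * pi \<and>
    snd q $ 1 - snd q $ 0 \<le> pi \<and> snd q $ 2 - snd q $ 1 \<le> pi \<and> snd q $ 3 - snd q $ 2 \<le> pi \<and> snd q $ 0 + 2 * pi - snd q $ 3 \<le> pi}"
  define f where "f q = (\<chi> i. of_real (fst q $ i) * cis (snd q $ i / n))" for q :: "(real ^ 4) \<times> (real ^ 4)"
  have fst_cont: "continuous_on UNIV (\<lambda>q :: (real ^ 4) \<times> (real ^ 4). fst q $ i)"
    and snd_cont: "continuous_on UNIV (\<lambda>q :: (real ^ 4) \<times> (real ^ 4). snd q $ i)"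
    for i :: 4
    by (intro continuous_intros)+
  have cis_cont: "continuous_on UNIV (\<lambda>q :: (real ^ 4) \<times> (real ^ 4). cis (snd q $ i / c))" for i c
    unfolding cis_conv_exp using n_pos by (cases "c = 0") (auto intro!: continuous_intros)
  have "closed Q"
    unfolding Q_def
    by (intro closed_Collect_conj closed_Collect_all closed_Collect_le closed_Collect_eq continuous_intros
        continuous_on_mult continuous_on_of_real continuous_on_power fst_cont cis_cont[of _ 1, simplified])
  moreover have "bounded Q"
  proof -
    have "Q \<subseteq> cbox (vec 0) (vec 1) \<times> cbox (vec 0) (vec (2 * pi))"
    proof clarify
      fix \<rho> \<theta> assume q: "(\<rho>, \<theta>) \<in> Q"
      have "\<rho> $ i \<le> 1" for i
        using q member_le_sum[of i UNIV "\<lambda>i. \<rho> $ i"] by (auto simp: Q_def)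
      moreover have "\<forall>i. 0 \<le> \<theta> $ i \<and> \<theta> $ i \<le> 2 * pi"
        unfolding all4 using q by (auto simp: Q_def)
      ultimately show "\<rho> \<in> cbox (vec 0) (vec 1) \<and> \<theta> \<in> cbox (vec 0) (vec (2 * pi))"
        using q by (auto simp: mem_box_cart Q_def)
    qed
    then show ?thesis using bounded_subset bounded_Times bounded_cbox by metis
  qed
  ultimately have "compact Q" by (simp add: compact_eq_bounded_closed)
  moreover have "continuous_on Q f"
    unfolding f_def using cis_cont fst_cont
    by (intro continuous_on_vec_lambda continuous_on_mult continuous_on_of_real) (auto intro: continuous_on_subset)
  ultimately have "compact (f ` Q)" by (rule compact_continuous_image[rotated])
  have fB: "f q \<in> quad_cone" if q: "q \<in> Q" for q
  proof -
    obtain \<rho> \<theta> where q': "q = (\<rho>, \<theta>)" by (cases q)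
    have cm: "cmod (f q $ i) = \<rho> $ i" for i using q by (simp add: f_def q' norm_mult Q_def)
    have "f q \<noteq> 0"
    proof
      assume "f q = 0"
      then have "\<rho> $ i = 0" for i using cm[of i] by simp
      then show False using q by (simp add: Q_def q')
    qed
    moreover have "(\<Sum>i\<in>UNIV. (f q $ i) ^ n) = 0"
      using q by (simp add: f_def q' Q_def power_mult_distrib cis_pow)
    moreover have "\<forall>i. f q $ i = of_real (cmod (f q $ i)) * cis (\<theta> $ i / n)"
      unfolding cm by (simp add: f_def q')
    then have "lifted (f q) \<theta>"
      using q unfolding lifted_def Q_def q' mem_Collect_eq fst_conv snd_conv by blast
    ultimately show ?thesis unfolding quad_cone_def mem_Collect_eq by (intro conjI exI)
  qed
  have "0 \<notin> quad_cone" by (simp add: quad_cone_def)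
  then have "f ` Q \<subseteq> - {0}" using fB by force
  then have "compact (cp3_of ` f ` Q)"
    using \<open>compact (f ` Q)\<close> compact_continuous_image continuous_on_subset[OF continuous_on_cp3_of] by blast
  moreover have "cp3_of ` f ` Q = base_cell"
  proof
    show "cp3_of ` f ` Q \<subseteq> base_cell" using fB by (auto simp: base_cell_def)
    show "base_cell \<subseteq> cp3_of ` f ` Q"
      unfolding base_cell_def
    proof clarify
      fix z assume z: "z \<in> quad_cone"
      obtain \<theta> where \<theta>: "lifted z \<theta>" using z by (rule quad_coneE)
      note z0 = quad_coneD(1)[OF z]
      define s where "s = (\<Sum>i\<in>UNIV. cmod (z $ i))"
      have s: "s > 0"
      proof -
        obtain i where "z $ i \<noteq> 0" using z0 by (auto simp: vec_eq_iff)
        then show ?thesis unfolding s_def by (intro sum_pos2[of _ i]) auto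
      qed
      define c where "c = of_real (1 / s) * cis (- (\<theta> $ 0 / n))"
      have c: "c \<noteq> 0" using s by (simp add: c_def)
      define q where "q = ((\<chi> i. cmod (z $ i) / s), (\<chi> i. \<theta> $ i - \<theta> $ 0))"
      have zi: "z $ i = of_real (cmod (z $ i)) * cis (\<theta> $ i / n)" for i using \<theta> by (simp add: lifted_def)
      have fq: "f q = c *s z"
      proof -
        have "f q $ i = c * z $ i" for i
        proof -
          have "c * z $ i = (of_real (1 / s) * of_real (cmod (z $ i))) * (cis (- (\<theta> $ 0 / n)) * cis (\<theta> $ i / n))"
            by (subst zi) (simp only: c_def mult_ac)
          also have "cis (- (\<theta> $ 0 / n)) * cis (\<theta> $ i / n) = cis ((\<theta> $ i - \<theta> $ 0) / n)"
            by (simp add: cis_mult diff_divide_distrib)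
          finally show ?thesis by (simp add: f_def q_def)
        qed
        then show ?thesis by (simp add: vec_eq_iff)
      qed
      have "(\<Sum>i\<in>UNIV. of_real (fst q $ i ^ n) * cis (snd q $ i)) = 0"
      proof -
        have "(\<Sum>i\<in>UNIV. of_real (fst q $ i ^ n) * cis (snd q $ i)) = (\<Sum>i\<in>UNIV. (f q $ i) ^ n)"
          by (simp add: f_def power_mult_distrib cis_pow)
        also have "\<dots> = 0" unfolding fq sum_scale using quad_coneD(2)[OF z] by simp
        finally show ?thesis .
      qed
      moreover have "(\<Sum>i\<in>UNIV. fst q $ i) = 1"
        using s by (simp add: q_def flip: sum_divide_distrib s_def)
      ultimately have "q \<in> Q"
        using \<theta> s unfolding Q_def lifted_def by (simp add: q_def)
      then show "cp3_of z \<in> cp3_of ` f ` Q"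
        using fq cp3_of_scale[OF z0 c] by (metis imageI)
    qed
  qed
  ultimately show ?thesis by simp
qed

end

section \<open>Quadrilaterals with given side lengths\<close>

lemma cmod_add_cis:
  "(cmod (of_real p * cis a + of_real q * cis b))\<^sup>2 = p\<^sup>2 + q\<^sup>2 + 2 * p * q * cos (b - a)" for p q a b :: real
proof -
  have "(of_real p * cis a) * cnj (of_real q * cis b) = of_real (p * q) * (cis a * cis (- b))"
    by (simp add: cis_cnj)
  also have "\<dots> = of_real (p * q) * cis (a - b)" by (simp add: cis_mult)
  finally have "Re ((of_real p * cis a) * cnj (of_real q * cis b)) = Re (of_real (p * q) * cis (a - b))"
    by (rule arg_cong)
  also have "\<dots> = p * q * cos (a - b)" by simp
  finally have "Re ((of_real p * cis a) * cnj (of_real q * cis b)) = p * q * cos (a - b)" .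
  moreover have "cos (a - b) = cos (b - a)" by (simp add: cos_diff mult.commute)
  ultimately show ?thesis unfolding cmod_add_power2 by (simp add: norm_mult)
qed

text \<open>Fix the four side lengths of a convex quadrilateral. If one diagonal grows, the
  exterior angles at the two vertices opposite to it shrink, so by the angle sum the other
  two cannot both shrink, and the other diagonal gets shorter.\<close>

lemma diagonals_antitone:
  fixes a b c d :: real and x y :: "nat \<Rightarrow> real"
  assumes pos: "a > 0" "b > 0" "c > 0" "d > 0"
    and x: "\<And>i. i < 4 \<Longrightarrow> 0 \<le> x i \<and> x i \<le> pi" "x 0 + x 1 + x 2 + x 3 = 2 * pi"
    and y: "\<And>i. i < 4 \<Longrightarrow> 0 \<le> y i \<and> y i \<le> pi" "y 0 + y 1 + y 2 + y 3 = 2 * pi"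
    and ex: "e = a\<^sup>2 + b\<^sup>2 + 2 * a * b * cos (x 0)" "e = c\<^sup>2 + d\<^sup>2 + 2 * c * d * cos (x 2)"
    and ey: "e' = a\<^sup>2 + b\<^sup>2 + 2 * a * b * cos (y 0)" "e' = c\<^sup>2 + d\<^sup>2 + 2 * c * d * cos (y 2)"
    and fx: "f = b\<^sup>2 + c\<^sup>2 + 2 * b * c * cos (x 1)" "f = d\<^sup>2 + a\<^sup>2 + 2 * d * a * cos (x 3)"
    and fy: "f' = b\<^sup>2 + c\<^sup>2 + 2 * b * c * cos (y 1)" "f' = d\<^sup>2 + a\<^sup>2 + 2 * d * a * cos (y 3)"
  shows "e < e' \<Longrightarrow> f' < f" "e = e' \<Longrightarrow> x 0 = y 0 \<and> x 1 = y 1 \<and> x 2 = y 2 \<and> x 3 = y 3"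
proof -
  have le: "x i \<le> y i" if "i < 4" "p > 0" "q > 0" "u = v + 2 * p * q * cos (x i)" "u' = v + 2 * p * q * cos (y i)" "u' \<le> u"
    for i :: nat and p q u u' v :: real
  proof -
    have "2 * p * q > 0" using that by simp
    then have "cos (y i) \<le> cos (x i)" using that by simp
    then show ?thesis using x(1)[OF that(1)] y(1)[OF that(1)] cos_mono_le_eq by blast
  qed
  have le': "y i \<le> x i" if "i < 4" "p > 0" "q > 0" "u = v + 2 * p * q * cos (x i)" "u' = v + 2 * p * q * cos (y i)" "u \<le> u'"
    for i :: nat and p q u u' v :: real
  proof -
    have "2 * p * q > 0" using that by simp
    then have "cos (x i) \<le> cos (y i)" using that by simp
    then show ?thesis using x(1)[OF that(1)] y(1)[OF that(1)] cos_mono_le_eq by blast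
  qed
  have 02: "e \<le> e' \<Longrightarrow> y 0 \<le> x 0 \<and> y 2 \<le> x 2" "e' \<le> e \<Longrightarrow> x 0 \<le> y 0 \<and> x 2 \<le> y 2"
    using le[OF _ pos(1,2) ex(1) ey(1)] le[OF _ pos(3,4) ex(2) ey(2)]
      le'[OF _ pos(1,2) ex(1) ey(1)] le'[OF _ pos(3,4) ex(2) ey(2)] by auto
  have 13: "f \<le> f' \<Longrightarrow> y 1 \<le> x 1 \<and> y 3 \<le> x 3" "f' \<le> f \<Longrightarrow> x 1 \<le> y 1 \<and> x 3 \<le> y 3"
    using le[OF _ pos(2,3) fx(1) fy(1)] le[OF _ pos(4,1) fx(2) fy(2)]
      le'[OF _ pos(2,3) fx(1) fy(1)] le'[OF _ pos(4,1) fx(2) fy(2)] by auto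
  show "e < e' \<Longrightarrow> f' < f"
  proof (rule ccontr)
    assume lt: "e < e'" "\<not> f' < f"
    have "y 0 = x 0 \<and> y 2 = x 2" using 02 13 lt x(2) y(2) by linarith
    then show False using ex(1) ey(1) lt by simp
  qed
  show "e = e' \<Longrightarrow> x 0 = y 0 \<and> x 1 = y 1 \<and> x 2 = y 2 \<and> x 3 = y 3"
    using 02 13 x(2) y(2) by (cases "f \<le> f'") auto
qed

lemma cos_diff_nonneg:
  assumes "0 \<le> a" "0 \<le> b" "b \<le> pi" "a + b / 2 \<le> pi"
  shows "cos (a + b) \<le> cos a"
proof -
  have "cos a - cos (a + b) = 2 * sin ((a + (a + b)) / 2) * sin (((a + b) - a) / 2)"
    by (rule cos_diff_cos)
  also have "\<dots> = 2 * sin (a + b / 2) * sin (b / 2)" by (simp add: field_simps)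
  also have "\<dots> \<ge> 0" using assms by (intro mult_nonneg_nonneg sin_ge_zero) auto
  finally show ?thesis by simp
qed

lemma three_parallel:
  assumes "b \<noteq> 0" "nn (a * cnj b)" "nn (c * cnj b)"
  shows "cmod (a + b + c) = cmod a + cmod b + cmod c"
proof -
  have "of_real (cmod b) * a = of_real (cmod a) * b" "of_real (cmod b) * c = of_real (cmod c) * b"
    using nn_parallel[OF assms(2)] nn_parallel[OF assms(3)] by simp_all
  then have "of_real (cmod b) * (a + b + c) = of_real (cmod a + cmod b + cmod c) * b"
    by (simp add: algebra_simps)
  then have "cmod (of_real (cmod b) * (a + b + c)) = cmod (of_real (cmod a + cmod b + cmod c) * b)" by simp
  then have "cmod b * cmod (a + b + c) = (cmod a + cmod b + cmod c) * cmod b"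
    by (simp add: norm_mult del: of_real_add)
  then show ?thesis using assms(1) by simp
qed

lemma sum4_zero:
  fixes a b c d :: complex
  assumes "a + b + c + d = 0"
  shows "a + b = - (c + d)" "d = - (a + b + c)"
  using assms by (simp_all add: complex_eq_iff)

context fermat begin

text \<open>The length of the diagonal that separates the first two sides from the last two.\<close>

definition diagonal :: "complex ^ 4 \<Rightarrow> real"
  where "diagonal z = cmod (pw z $ 0 + pw z $ 1)"

lemma pw_rot [simp]: "pw (rot z) $ 0 = pw z $ 1" "pw (rot z) $ 1 = pw z $ 2" "pw (rot z) $ 2 = pw z $ 3"
  "pw (rot z) $ 3 = pw z $ 0"
  by (simp_all add: pw_nth power_mult_distrib omega_pow)

lemma pw_sum0: "z \<in> quad_cone \<Longrightarrow> pw z $ 0 + pw z $ 1 + pw z $ 2 + pw z $ 3 = 0"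
  using quad_coneD(2)[of z] pw_sum[of z] by (simp add: sum4)

lemma diagonal_alt: "z \<in> quad_cone \<Longrightarrow> diagonal z = cmod (pw z $ 2 + pw z $ 3)"
proof -
  assume "z \<in> quad_cone"
  then have "pw z $ 0 + pw z $ 1 = - (pw z $ 2 + pw z $ 3)"
    by (intro sum4_zero(1) pw_sum0)
  then show ?thesis unfolding diagonal_def by (simp only: norm_minus_cancel)
qed

lemma diagonal_cos:
  assumes z: "z \<in> quad_cone" and \<theta>: "lifted z \<theta>"
  defines "r \<equiv> \<lambda>i. cmod (pw z $ i)"
  shows "(diagonal z)\<^sup>2 = (r 0)\<^sup>2 + (r 1)\<^sup>2 + 2 * r 0 * r 1 * cos (\<theta> $ 1 - \<theta> $ 0)"
    "(diagonal z)\<^sup>2 = (r 2)\<^sup>2 + (r 3)\<^sup>2 + 2 * r 2 * r 3 * cos (\<theta> $ 3 - \<theta> $ 2)"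
proof -
  have w: "pw z $ i = of_real (r i) * cis (\<theta> $ i)" for i unfolding r_def by (rule lifted_pw[OF \<theta>])
  show "(diagonal z)\<^sup>2 = (r 0)\<^sup>2 + (r 1)\<^sup>2 + 2 * r 0 * r 1 * cos (\<theta> $ 1 - \<theta> $ 0)"
    unfolding diagonal_def w[of 0] w[of 1] by (rule cmod_add_cis)
  show "(diagonal z)\<^sup>2 = (r 2)\<^sup>2 + (r 3)\<^sup>2 + 2 * r 2 * r 3 * cos (\<theta> $ 3 - \<theta> $ 2)"
    unfolding diagonal_alt[OF z] w[of 2] w[of 3] by (rule cmod_add_cis)
qed

lemma lifted_gaps:
  assumes "lifted z \<theta>"
  shows "0 \<le> \<theta> $ 1 - \<theta> $ 0" "0 \<le> \<theta> $ 2 - \<theta> $ 1" "0 \<le> \<theta> $ 3 - \<theta> $ 2" "0 \<le> \<theta> $ 0 + 2 * pi - \<theta> $ 3"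
    "\<theta> $ 1 - \<theta> $ 0 \<le> pi" "\<theta> $ 2 - \<theta> $ 1 \<le> pi" "\<theta> $ 3 - \<theta> $ 2 \<le> pi" "\<theta> $ 0 + 2 * pi - \<theta> $ 3 \<le> pi"
  using assms unfolding lifted_def by auto

text \<open>The diagonals of \<open>rot x\<close> and \<open>x\<close> are the two diagonals of the same quadrilateral. Equal
  diagonals force equal angles.\<close>

lemma quad_compare:
  assumes x: "x \<in> quad_cone" and y: "y \<in> quad_cone" and eq: "cmods (pw x) = cmods (pw y)" and pos: "\<And>i. pw x $ i \<noteq> 0"
  shows "diagonal x < diagonal y \<Longrightarrow> diagonal (rot y) < diagonal (rot x)" "diagonal x = diagonal y \<Longrightarrow> cp3_of x = cp3_of y"
proof -
  obtain \<theta> where \<theta>: "lifted x \<theta>" using x by (rule quad_coneE)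
  obtain \<psi> where \<psi>: "lifted y \<psi>" using y by (rule quad_coneE)
  have r: "cmod (pw x $ i) = cmod (pw y $ i)" for i using eq by (metis cmods_nth)
  have p: "cmod (pw y $ i) > 0" for i using pos[of i] r[of i] by (metis zero_less_norm_iff)
  define a where "a k = (if k = 0 then \<theta> $ 1 - \<theta> $ 0 else if k = 1 then \<theta> $ 2 - \<theta> $ 1
      else if k = 2 then \<theta> $ 3 - \<theta> $ 2 else \<theta> $ 0 + 2 * pi - \<theta> $ 3)" for k :: nat
  define b where "b k = (if k = 0 then \<psi> $ 1 - \<psi> $ 0 else if k = 1 then \<psi> $ 2 - \<psi> $ 1
      else if k = 2 then \<psi> $ 3 - \<psi> $ 2 else \<psi> $ 0 + 2 * pi - \<psi> $ 3)" for k :: nat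
  note Ex = diagonal_cos[OF x \<theta>] diagonal_cos[OF rot_quad_cone_imp[OF x] lifted_rot[OF \<theta>]]
  note Ey = diagonal_cos[OF y \<psi>] diagonal_cos[OF rot_quad_cone_imp[OF y] lifted_rot[OF \<psi>]]
  have a: "0 \<le> a i \<and> a i \<le> pi" "a 0 + a 1 + a 2 + a 3 = 2 * pi" for i
    using lifted_gaps[OF \<theta>] by (auto simp: a_def)
  have b: "0 \<le> b i \<and> b i \<le> pi" "b 0 + b 1 + b 2 + b 3 = 2 * pi" for i
    using lifted_gaps[OF \<psi>] by (auto simp: b_def)
  have ab_val: "a 0 = \<theta> $ 1 - \<theta> $ 0" "a 1 = \<theta> $ 2 - \<theta> $ 1" "a 2 = \<theta> $ 3 - \<theta> $ 2" "a 3 = \<theta> $ 0 + 2 * pi - \<theta> $ 3"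
    "b 0 = \<psi> $ 1 - \<psi> $ 0" "b 1 = \<psi> $ 2 - \<psi> $ 1" "b 2 = \<psi> $ 3 - \<psi> $ 2" "b 3 = \<psi> $ 0 + 2 * pi - \<psi> $ 3"
    by (simp_all add: a_def b_def)
  note * = diagonals_antitone[where x = a and y = b, OF p[of 0] p[of 1] p[of 2] p[of 3] a(1) a(2) b(1) b(2)
      Ex(1,2)[unfolded r vec4_nth, folded ab_val] Ey(1,2)[unfolded vec4_nth, folded ab_val]
      Ex(3,4)[unfolded pw_rot r vec4_nth, folded ab_val] Ey(3,4)[unfolded pw_rot vec4_nth, folded ab_val]]
  have main: "((diagonal x)\<^sup>2 < (diagonal y)\<^sup>2 \<longrightarrow> (diagonal (rot y))\<^sup>2 < (diagonal (rot x))\<^sup>2) \<and>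
      ((diagonal x)\<^sup>2 = (diagonal y)\<^sup>2 \<longrightarrow> a 0 = b 0 \<and> a 1 = b 1 \<and> a 2 = b 2 \<and> a 3 = b 3)"
    using * by blast
  have nonneg: "diagonal v \<ge> 0" for v by (simp add: diagonal_def)
  show "diagonal x < diagonal y \<Longrightarrow> diagonal (rot y) < diagonal (rot x)"
    using main nonneg by (meson power_less_imp_less_base power_strict_mono zero_less_numeral)
  assume "diagonal x = diagonal y"
  then have ab: "a 0 = b 0" "a 1 = b 1" "a 2 = b 2" using main by auto
  then have "\<forall>i j. \<theta> $ i - \<theta> $ j = \<psi> $ i - \<psi> $ j"
    unfolding all4 by (simp add: a_def b_def)
  moreover have "cmod (x $ i) = cmod (y $ i)" for i
  proof -
    have "cmod (x $ i) ^ n = cmod (y $ i) ^ n" using r[of i] by (simp add: pw_nth norm_power)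
    then show ?thesis using n_pos by (simp add: power_eq_iff_eq_base)
  qed
  ultimately have "hp x i j = hp y i j" for i j
    unfolding lifted_hp[OF \<theta>] lifted_hp[OF \<psi>] by metis
  then show "cp3_of x = cp3_of y" using hp_determines quad_coneD(1) x y by blast
qed

lemma nn_pw_pyramid_cone:
  assumes z: "z \<in> quad_cone" shows "z \<in> pyramid_cone \<longleftrightarrow> nn (hp (pw z) 1 0)"
proof
  assume "z \<in> pyramid_cone"
  then have "nn (hp (pw z) 0 1)" using pyramid_cone_tri by (simp add: tri_def)
  then show "nn (hp (pw z) 1 0)" by (metis hp_cnj nn_cnj)
next
  assume nn: "nn (hp (pw z) 1 0)"
  obtain \<theta> where \<theta>: "lifted z \<theta>" using z by (rule quad_coneE)
  have "sec (hp z 1 0)"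
    unfolding lifted_hp[OF \<theta>] using lifted_gaps[OF \<theta>] by (intro sec_cis divide_right_mono) auto
  then have "nn (hp z 1 0)" using nn sec_pow(2) by (simp add: hp_pw)
  then show "z \<in> pyramid_cone" using quad_cone_pyramid_cone z by blast
qed

lemma pyramid_cone_diagonal: "z \<in> quad_cone \<Longrightarrow> z \<in> pyramid_cone \<longleftrightarrow> diagonal z = cmod (pw z $ 0) + cmod (pw z $ 1)"
  unfolding nn_pw_pyramid_cone hp_def nn_iff_add diagonal_def by (simp add: add.commute)

text \<open>One of the triangles cut off by the diagonal is flat, so that the diagonal has its largest
  length. For \<open>rot z\<close> this refers to the other diagonal, whose largest length is attained
  where the first diagonal is shortest.\<close>

definition up :: "complex ^ 4 \<Rightarrow> bool"
  where "up z \<longleftrightarrow> z \<in> pyramid_cone \<or> rot (rot z) \<in> pyramid_cone"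

text \<open>The largest length of the diagonal, by the triangle inequality.\<close>

definition hi :: "real ^ 4 \<Rightarrow> real"
  where "hi r = min (r $ 0 + r $ 1) (r $ 2 + r $ 3)"

lemma diagonal_le_hi: "z \<in> quad_cone \<Longrightarrow> diagonal z \<le> hi (cmods (pw z))"
  using norm_triangle_ineq[of "pw z $ 0" "pw z $ 1"] norm_triangle_ineq[of "pw z $ 2" "pw z $ 3"] diagonal_alt[of z]
  by (simp add: hi_def diagonal_def)

lemma up_diagonal:
  assumes z: "z \<in> quad_cone" shows "up z \<longleftrightarrow> diagonal z = hi (cmods (pw z))"
proof -
  have B: "rot (rot z) \<in> quad_cone" using z by (simp add: rot_quad_cone)
  have "diagonal (rot (rot z)) = diagonal z" using diagonal_alt[OF z] by (simp add: diagonal_def)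
  then have "rot (rot z) \<in> pyramid_cone \<longleftrightarrow> diagonal z = cmod (pw z $ 2) + cmod (pw z $ 3)"
    using pyramid_cone_diagonal[OF B] by simp
  then show ?thesis
    unfolding up_def pyramid_cone_diagonal[OF z] using diagonal_le_hi[OF z] by (auto simp: hi_def min_def split: if_splits)
qed

lemma degen_up:
  assumes z: "z \<in> quad_cone" shows "degen (pw z) \<longleftrightarrow> up z \<or> up (rot z)"
proof
  assume "degen (pw z)"
  then obtain m where "m < 4" "(rot ^^ m) z \<in> pyramid_cone" using degen_pyramid_cone[OF z] by blast
  moreover have "m = 0 \<or> m = 1 \<or> m = 2 \<or> m = 3" using \<open>m < 4\<close> by linarith
  ultimately show "up z \<or> up (rot z)"
    by (auto simp: up_def numeral_2_eq_2 numeral_3_eq_3)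
next
  have "degen (pw (rot z)) = degen (pw z)" for z by (rule degen_monomial[OF monomial_rot])
  then show "up z \<or> up (rot z) \<Longrightarrow> degen (pw z)"
    unfolding up_def using pyramid_cone_degen by metis
qed

text \<open>The lengths of the sides of closed quadrilaterals of perimeter 1: no side is longer than the
  other three together.\<close>

definition octahedron :: "(real ^ 4) set"
  where "octahedron = {r. (\<Sum>i\<in>UNIV. r $ i) = 1 \<and> (\<forall>i. 0 \<le> r $ i \<and> r $ i \<le> 1 / 2)}"

text \<open>The distance to the boundary of the octahedron, measured by its defining inequalities.\<close>

definition margin :: "real ^ 4 \<Rightarrow> real"
  where "margin r = min (min (min (r $ 0) (1 / 2 - r $ 0)) (min (r $ 1) (1 / 2 - r $ 1)))
    (min (min (r $ 2) (1 / 2 - r $ 2)) (min (r $ 3) (1 / 2 - r $ 3)))"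

lemma margin_le_iff: "t \<le> margin r \<longleftrightarrow> (\<forall>i. t \<le> r $ i \<and> t \<le> 1 / 2 - r $ i)"
  unfolding all4 by (auto simp: margin_def)

lemma margin_eq: "\<exists>i. margin r = r $ i \<or> margin r = 1 / 2 - r $ i"
proof -
  have "margin r \<in> {r $ 0, 1 / 2 - r $ 0, r $ 1, 1 / 2 - r $ 1, r $ 2, 1 / 2 - r $ 2, r $ 3, 1 / 2 - r $ 3}"
    unfolding margin_def min_def by simp
  then show ?thesis by blast
qed

lemma margin_nonneg: "r \<in> octahedron \<Longrightarrow> 0 \<le> margin r"
  using margin_le_iff[of 0 r] by (auto simp: octahedron_def)

lemma octahedron_unit:
  assumes z: "z \<in> quad_cone" "total z = 1" shows "cmods (pw z) \<in> octahedron"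
proof -
  have s: "pw z $ i = - (\<Sum>j\<in>UNIV - {i}. pw z $ j)" for i
    using quad_coneD(2)[OF z(1)] sum.remove[of UNIV i "\<lambda>j. pw z $ j"] by (simp add: pw_sum eq_neg_iff_add_eq_0)
  have "cmod (pw z $ i) \<le> (\<Sum>j\<in>UNIV - {i}. cmod (pw z $ j))" for i
    by (subst s) (metis norm_minus_cancel norm_sum)
  moreover have "(\<Sum>j\<in>UNIV. cmod (pw z $ j)) = cmod (pw z $ i) + (\<Sum>j\<in>UNIV - {i}. cmod (pw z $ j))" for i
    by (rule sum.remove) auto
  ultimately have "2 * cmod (pw z $ i) \<le> 1" for i using z(2) unfolding total_def by (smt (verit))
  then show ?thesis using z(2) by (auto simp: octahedron_def total_def mult.commute)
qed

lemma unit_rep: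
  assumes "cone K" "z \<in> K"
  obtains y where "y \<in> K" "total y = 1" "cp3_of y = cp3_of z"
proof -
  have z0: "z \<noteq> 0" using assms by (auto simp: cone_def)
  define c :: complex where "c = of_real (root n (1 / total z))"
  have t: "1 / total z > 0" using total_pos[OF z0] by simp
  have c: "c \<noteq> 0" "cmod c ^ n = 1 / total z"
    using t n_pos by (auto simp: c_def intro: real_root_pow_pos)
  have "total (c *s z) = 1" using c total_pos[OF z0] by (simp add: total_scale)
  then show thesis using that[of "c *s z"] assms c cp3_of_scale[OF z0 c(1)] by (auto simp: cone_def)
qed

text \<open>The two sides on one side of the diagonal have total length at most one half. With these two
  straightened, the side lengths are those of a triangle.\<close>

lemma up_exists:
  assumes r: "r \<in> octahedron" obtains z where "z \<in> quad_cone" "cmods (pw z) = r" "up z"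
proof -
  have r': "r $ 0 + r $ 1 + r $ 2 + r $ 3 = 1" "\<And>i. 0 \<le> r $ i" "\<And>i. r $ i \<le> 1 / 2"
    using r by (auto simp: octahedron_def sum4)
  have ex: "\<exists>z\<in>pyramid_cone. cmods (pw z) = q"
    if q: "q $ 0 + q $ 1 + q $ 2 + q $ 3 = 1" "\<And>i. 0 \<le> q $ i" "\<And>i. q $ i \<le> 1 / 2" "q $ 0 + q $ 1 \<le> 1 / 2" for q :: "real ^ 4"
  proof -
    have "\<forall>t<5. 0 \<le> slack t q"
      unfolding less5 using q(1,4) q(2)[of 0] q(2)[of 1] q(3)[of 2] q(3)[of 3] by simp
    then show ?thesis using pyramid_cone_exists[of q] q(1) by (metis sum4 zero_less_one)
  qed
  show thesis
  proof (cases "r $ 0 + r $ 1 \<le> 1 / 2")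
    case True
    then obtain z where "z \<in> pyramid_cone" "cmods (pw z) = r" using ex r' by blast
    then show thesis using that pyramid_cone_quad_cone by (auto simp: up_def)
  next
    case False
    define q where "q = vec4 (r $ 2) (r $ 3) (r $ 0) (r $ 1)"
    have qi: "0 \<le> q $ i \<and> q $ i \<le> 1 / 2" for i
    proof -
      have "\<forall>i. 0 \<le> q $ i \<and> q $ i \<le> 1 / 2" unfolding all4 using r' by (simp add: q_def)
      then show ?thesis by blast
    qed
    obtain y where y: "y \<in> pyramid_cone" "cmods (pw y) = q"
      using ex[of q] qi r' False by (auto simp: q_def)
    have "\<forall>i. cmods (pw (rot (rot y))) $ i = r $ i"
      unfolding all4 using arg_cong[OF y(2), of "\<lambda>v. v $ 0"] arg_cong[OF y(2), of "\<lambda>v. v $ 1"]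
        arg_cong[OF y(2), of "\<lambda>v. v $ 2"] arg_cong[OF y(2), of "\<lambda>v. v $ 3"] by (simp add: q_def)
    then have "cmods (pw (rot (rot y))) = r" by (simp add: vec_eq_iff)
    moreover have "rot (rot y) \<in> quad_cone" using pyramid_cone_quad_cone[OF y(1)] by (simp add: rot_quad_cone)
    moreover have "up (rot (rot y))" using pyramid_cone_scale[OF y(1), of \<omega>] by (simp add: up_def rot4)
    ultimately show thesis using that by blast
  qed
qed

lemma up_scale: "c \<noteq> 0 \<Longrightarrow> up z \<Longrightarrow> up (c *s z)"
  using pyramid_cone_scale by (auto simp: up_def monomial_scale[OF monomial_rot])

lemma low_exists:
  assumes r: "r \<in> octahedron" obtains z where "z \<in> quad_cone" "cmods (pw z) = r" "up (rot z)"
proof -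
  define q where "q = vec4 (r $ 1) (r $ 2) (r $ 3) (r $ 0)"
  have "\<forall>i. 0 \<le> q $ i \<and> q $ i \<le> 1 / 2" unfolding all4 using r by (simp add: q_def octahedron_def)
  then have "q \<in> octahedron" using r by (auto simp: octahedron_def sum4 q_def)
  then obtain y where y: "y \<in> quad_cone" "cmods (pw y) = q" "up y" using up_exists by blast
  have "\<forall>i. cmods (pw (rot (rot (rot y)))) $ i = r $ i"
    unfolding all4 using arg_cong[OF y(2), of "\<lambda>v. v $ 0"] arg_cong[OF y(2), of "\<lambda>v. v $ 1"]
      arg_cong[OF y(2), of "\<lambda>v. v $ 2"] arg_cong[OF y(2), of "\<lambda>v. v $ 3"] by (simp add: q_def)
  then have "cmods (pw (rot (rot (rot y)))) = r" by (simp add: vec_eq_iff)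
  then show thesis
    using that[of "rot (rot (rot y))"] y up_scale[of \<omega> y] by (simp add: rot_quad_cone rot4)
qed

lemma quad_cone_extreme:
  assumes z: "z \<in> quad_cone" and r: "pw z $ 0 = 0 \<or> cmod (pw z $ 3) = cmod (pw z $ 0) + cmod (pw z $ 1) + cmod (pw z $ 2)"
  shows "z \<in> pyramid_cone"
proof -
  have "nn (hp (pw z) 1 0)"
  proof (cases "pw z $ 0 = 0")
    case False
    have "pw z $ 3 = - (pw z $ 0 + pw z $ 1 + pw z $ 2)" by (rule sum4_zero(2)[OF pw_sum0[OF z]])
    then have "cmod (pw z $ 3) = cmod (pw z $ 0 + pw z $ 1 + pw z $ 2)" by (simp only: norm_minus_cancel)
    then have "cmod (pw z $ 1 + pw z $ 0) = cmod (pw z $ 1) + cmod (pw z $ 0)"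
      using r False norm_triangle_ineq[of "pw z $ 0 + pw z $ 1" "pw z $ 2"] norm_triangle_ineq[of "pw z $ 1" "pw z $ 0"]
      by (simp add: add.commute)
    then show ?thesis by (simp add: hp_def nn_iff_add)
  qed (simp add: hp_def)
  then show ?thesis using nn_pw_pyramid_cone[OF z] by blast
qed

text \<open>A zero side, or a side as long as the other three together, makes two neighbouring sides
  parallel, and which two depends on the side lengths only.\<close>

lemma margin_zero_pyramid_cone:
  assumes r: "r \<in> octahedron" "margin r = 0"
  obtains m where "\<And>z. z \<in> quad_cone \<Longrightarrow> cmods (pw z) = r \<Longrightarrow> (rot ^^ m) z \<in> pyramid_cone"
proof -
  have s: "r $ 0 + r $ 1 + r $ 2 + r $ 3 = 1" using r by (simp add: octahedron_def sum4)
  have cm: "cmod (pw z $ i) = r $ i" if "cmods (pw z) = r" for z i using that by (metis cmods_nth)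
  have zero: "pw z $ i = 0" if "cmods (pw z) = r" "r $ i = 0" for z i using cm[OF that(1), of i] that(2) by simp
  have "(\<exists>i. r $ i = 0) \<or> (\<exists>i. r $ i = 1 / 2)" using margin_eq[of r] r(2) by auto
  moreover have "(\<exists>i. r $ i = c) \<longleftrightarrow> r $ 0 = c \<or> r $ 1 = c \<or> r $ 2 = c \<or> r $ 3 = c" for c
    using all4[of "\<lambda>i. r $ i \<noteq> c"] by blast
  ultimately consider "r $ 0 = 0 \<or> r $ 3 = 1 / 2" | "r $ 1 = 0 \<or> r $ 0 = 1 / 2" | "r $ 2 = 0 \<or> r $ 1 = 1 / 2"
    | "r $ 3 = 0 \<or> r $ 2 = 1 / 2" by metis
  then show thesis
  proof cases
    case 1
    then have "(rot ^^ 0) z \<in> pyramid_cone" if "z \<in> quad_cone" "cmods (pw z) = r" for z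
      using quad_cone_extreme[OF that(1)] cm[OF that(2)] zero[OF that(2)] s by auto
    then show thesis using that by blast
  next
    case 2
    then have "(rot ^^ 1) z \<in> pyramid_cone" if "z \<in> quad_cone" "cmods (pw z) = r" for z
      using quad_cone_extreme[of "rot z"] cm[OF that(2)] zero[OF that(2)] s that(1) by (auto simp: rot_quad_cone)
    then show thesis using that by blast
  next
    case 3
    then have "(rot ^^ 2) z \<in> pyramid_cone" if "z \<in> quad_cone" "cmods (pw z) = r" for z
      using quad_cone_extreme[of "rot (rot z)"] cm[OF that(2)] zero[OF that(2)] s that(1)
      by (auto simp: rot_quad_cone numeral_2_eq_2)
    then show thesis using that by blast
  next
    case 4
    then have "(rot ^^ 3) z \<in> pyramid_cone" if "z \<in> quad_cone" "cmods (pw z) = r" for z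
      using quad_cone_extreme[of "rot (rot (rot z))"] cm[OF that(2)] zero[OF that(2)] s that(1)
      by (auto simp: rot_quad_cone numeral_3_eq_3)
    then show thesis using that by blast
  qed
qed

lemma cp3_monomial_cancel:
  assumes A: "monomial A" and xy: "x \<noteq> 0" "y \<noteq> 0" "cp3_of (A x) = cp3_of (A y)"
  shows "cp3_of x = cp3_of y"
proof -
  obtain B where B: "monomial B" "\<And>z. B (A z) = z" using monomial_inverse[OF A] by metis
  have "act B (cp3_of (A x)) = act B (cp3_of (A y))" using xy by simp
  moreover have "A x \<noteq> 0" "A y \<noteq> 0" using xy A by simp_all
  ultimately show ?thesis using act_cp3_of[OF B(1), of "A x"] act_cp3_of[OF B(1), of "A y"] B(2) by simp
qed

text \<open>If no side length is extreme, side lengths and diagonal determine the angles. On the boundary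
  of the octahedron the quadrilateral lies in a pyramid, where the side lengths suffice.\<close>

lemma quad_unique:
  assumes x: "x \<in> quad_cone" and y: "y \<in> quad_cone" and eq: "cmods (pw x) = cmods (pw y)" "total x = 1"
    and diagonal: "margin (cmods (pw x)) > 0 \<Longrightarrow> diagonal x = diagonal y"
  shows "cp3_of x = cp3_of y"
proof (cases "margin (cmods (pw x)) > 0")
  case True
  have "pw x $ i \<noteq> 0" for i
    using True margin_le_iff[of "margin (cmods (pw x))" "cmods (pw x)"] by (auto dest: spec[of _ i])
  then show ?thesis using quad_compare(2)[OF x y eq(1)] diagonal True by blast
next
  case False
  have o: "cmods (pw x) \<in> octahedron" using octahedron_unit x eq(2) by blast
  then have "margin (cmods (pw x)) = 0" using False margin_nonneg by force
  then obtain m where m: "\<And>z. z \<in> quad_cone \<Longrightarrow> cmods (pw z) = cmods (pw x) \<Longrightarrow> (rot ^^ m) z \<in> pyramid_cone"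
    using margin_zero_pyramid_cone[OF o] by metis
  obtain \<sigma> u where A: "bij \<sigma>" "\<And>i. u i ^ n = 1" "rot ^^ m = permscale \<sigma> u"
    using monomial_rot_pow[of m] by (auto simp: monomial_def)
  have "cmods (pw ((rot ^^ m) x)) = cmods (pw ((rot ^^ m) y))"
  proof -
    have "pw ((rot ^^ m) z) $ i = pw z $ \<sigma> i" for z i
      by (simp add: A pw_nth power_mult_distrib)
    then show ?thesis using eq(1) by (simp add: vec_eq_iff)
  qed
  then have "cp3_of ((rot ^^ m) x) = cp3_of ((rot ^^ m) y)"
    using pyramid_cone_unique m x y eq by metis
  then show ?thesis using cp3_monomial_cancel[OF monomial_rot_pow] quad_coneD(1) x y by blast
qed

text \<open>The other diagonal of \<open>x\<close> is as long as possible, and one diagonal shrinks as the other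
  grows.\<close>

lemma low_diagonal_least:
  assumes x: "x \<in> quad_cone" and y: "y \<in> quad_cone" and eq: "cmods (pw x) = cmods (pw y)" and pos: "\<And>i. pw x $ i \<noteq> 0"
    and low: "up (rot x)"
  shows "diagonal x \<le> diagonal y" "up (rot y) \<Longrightarrow> diagonal x = diagonal y"
proof -
  have B: "rot x \<in> quad_cone" "rot y \<in> quad_cone" using x y by (simp_all add: rot_quad_cone)
  have r: "cmod (pw x $ i) = cmod (pw y $ i)" for i using eq by (metis cmods_nth)
  have hi: "hi (cmods (pw (rot x))) = hi (cmods (pw (rot y)))" by (simp add: hi_def r)
  have py: "pw y $ i \<noteq> 0" for i using pos[of i] r[of i] by auto
  have "diagonal (rot y) \<le> diagonal (rot x)" using diagonal_le_hi[OF B(2)] low up_diagonal[OF B(1)] hi by simp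
  then show le: "diagonal x \<le> diagonal y" using quad_compare(1)[OF y x eq[symmetric] py] by fastforce
  assume "up (rot y)"
  then have "diagonal (rot y) = diagonal (rot x)" using low up_diagonal B hi by simp
  then show "diagonal x = diagonal y" using le quad_compare(1)[OF x y eq pos] by fastforce
qed

text \<open>A pair of parallel sides for one diagonal and one for the other have a side in common. Unless it
  is zero, three sides have the same direction, and the fourth is half of the perimeter.\<close>

lemma up_low_margin:
  assumes x: "x \<in> quad_cone" "total x = 1" and ul: "up x" "up (rot x)"
  shows "margin (cmods (pw x)) = 0"
proof (rule ccontr)
  assume ne: "margin (cmods (pw x)) \<noteq> 0"
  have o: "cmods (pw x) \<in> octahedron" using octahedron_unit x by blast
  then have m: "margin (cmods (pw x)) > 0" using ne margin_nonneg by force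
  then have pos: "pw x $ i \<noteq> 0" "cmod (pw x $ i) < 1 / 2" for i
    using margin_le_iff[of "margin (cmods (pw x))" "cmods (pw x)"] by (auto dest: spec[of _ i])
  have s: "cmod (pw x $ 0) + cmod (pw x $ 1) + cmod (pw x $ 2) + cmod (pw x $ 3) = 1"
    using x(2) by (simp add: total_def sum4)
  have B: "rot x \<in> quad_cone" "rot (rot x) \<in> quad_cone" "rot (rot (rot x)) \<in> quad_cone" using x by (simp_all add: rot_quad_cone)
  have sum: "pw x $ 0 + pw x $ 1 + pw x $ 2 + pw x $ 3 = 0" using pw_sum0 x by blast
  have no: False if "pw x $ i + pw x $ j + pw x $ k = - pw x $ l" "cmod (pw x $ i) + cmod (pw x $ j) + cmod (pw x $ k) + cmod (pw x $ l) = 1"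
     "nn (pw x $ i * cnj (pw x $ j))" "nn (pw x $ k * cnj (pw x $ j))" for i j k l
  proof -
    have "cmod (- pw x $ l) = cmod (pw x $ i) + cmod (pw x $ j) + cmod (pw x $ k)"
      using three_parallel[OF pos(1) that(3,4)] that(1) by simp
    then show False using that(2) pos(2)[of l] by simp
  qed
  have sw: "nn (a * cnj b) \<longleftrightarrow> nn (b * cnj a)" for a b
    by (metis complex_cnj_cnj complex_cnj_mult mult.commute nn_cnj)
  have u: "nn (pw x $ 1 * cnj (pw x $ 0)) \<or> nn (pw x $ 3 * cnj (pw x $ 2))"
    using ul(1) nn_pw_pyramid_cone[OF x(1)] nn_pw_pyramid_cone[OF B(2)] by (simp add: up_def hp_def)
  have l: "nn (pw x $ 2 * cnj (pw x $ 1)) \<or> nn (pw x $ 0 * cnj (pw x $ 3))"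
    using ul(2) nn_pw_pyramid_cone[OF B(1)] nn_pw_pyramid_cone[OF B(3)] by (simp add: up_def hp_def)
  have sums: "pw x $ 0 + pw x $ 1 + pw x $ 2 = - pw x $ 3" "pw x $ 1 + pw x $ 0 + pw x $ 3 = - pw x $ 2"
    "pw x $ 3 + pw x $ 2 + pw x $ 1 = - pw x $ 0" "pw x $ 2 + pw x $ 3 + pw x $ 0 = - pw x $ 1"
    using sum by (simp_all add: eq_neg_iff_add_eq_0 add_ac)
  show False
    using u l no[OF sums(1)] no[OF sums(2)] no[OF sums(3)] no[OF sums(4)] s sw by (auto simp: add_ac)
qed

end

section \<open>The space of convex quadrilaterals is a 4-cell\<close>

text \<open>The projections of the closed polygon onto the directions of its second and of its third side
  vanish. In one of these two sums, replacing the angles by those of the claim decreases no cosine.\<close>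

lemma convex_projection:
  fixes r \<theta> :: "real ^ 4"
  assumes r: "\<And>i. 0 \<le> r $ i" and sum: "(\<Sum>i\<in>UNIV. of_real (r $ i) * cis (\<theta> $ i)) = 0"
    and g: "0 \<le> \<theta> $ 1 - \<theta> $ 0" "0 \<le> \<theta> $ 2 - \<theta> $ 1" "0 \<le> \<theta> $ 3 - \<theta> $ 2" "\<theta> $ 3 \<le> \<theta> $ 0 + 2 * pi"
      "\<theta> $ 2 - \<theta> $ 1 \<le> pi"
  shows "0 \<le> r $ 1 + r $ 2 + r $ 0 * cos (\<theta> $ 1 - \<theta> $ 0) + r $ 3 * cos (\<theta> $ 3 - \<theta> $ 2)"
proof -
  define a b c where "a = \<theta> $ 1 - \<theta> $ 0" and "b = \<theta> $ 2 - \<theta> $ 1" and "c = \<theta> $ 3 - \<theta> $ 2"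
  have C: "r $ 0 * cos (\<theta> $ 0) + r $ 1 * cos (\<theta> $ 1) + r $ 2 * cos (\<theta> $ 2) + r $ 3 * cos (\<theta> $ 3) = 0"
    and S: "r $ 0 * sin (\<theta> $ 0) + r $ 1 * sin (\<theta> $ 1) + r $ 2 * sin (\<theta> $ 2) + r $ 3 * sin (\<theta> $ 3) = 0"
    using arg_cong[OF sum, of Re] arg_cong[OF sum, of Im] by (simp_all add: sum4)
  have proj: "r $ 0 * cos (x - \<theta> $ 0) + r $ 1 * cos (x - \<theta> $ 1) + r $ 2 * cos (\<theta> $ 2 - x) + r $ 3 * cos (\<theta> $ 3 - x) = 0" for x
  proof -
    have "r $ 0 * cos (x - \<theta> $ 0) + r $ 1 * cos (x - \<theta> $ 1) + r $ 2 * cos (\<theta> $ 2 - x) + r $ 3 * cos (\<theta> $ 3 - x)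
      = cos x * (r $ 0 * cos (\<theta> $ 0) + r $ 1 * cos (\<theta> $ 1) + r $ 2 * cos (\<theta> $ 2) + r $ 3 * cos (\<theta> $ 3))
      + sin x * (r $ 0 * sin (\<theta> $ 0) + r $ 1 * sin (\<theta> $ 1) + r $ 2 * sin (\<theta> $ 2) + r $ 3 * sin (\<theta> $ 3))"
      by (simp add: cos_diff algebra_simps)
    then show ?thesis unfolding C S by simp
  qed
  have p1: "r $ 0 * cos a + r $ 1 + r $ 2 * cos b + r $ 3 * cos (c + b) = 0"
    using proj[of "\<theta> $ 1"] by (simp add: a_def b_def c_def)
  have p2: "r $ 0 * cos (a + b) + r $ 1 * cos b + r $ 2 + r $ 3 * cos c = 0"
    using proj[of "\<theta> $ 2"] by (simp add: a_def b_def c_def)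
  have cb: "x * cos b \<le> x" if "0 \<le> x" for x using mult_left_mono[OF cos_le_one[of b] that] by simp
  have "c + b / 2 \<le> pi" if "\<not> a + b / 2 \<le> pi"
  proof -
    have "a + b + c \<le> 2 * pi" using g by (simp add: a_def b_def c_def)
    then show ?thesis using that by argo
  qed
  then consider "a + b / 2 \<le> pi" | "c + b / 2 \<le> pi" by blast
  then have "0 \<le> r $ 1 + r $ 2 + r $ 0 * cos a + r $ 3 * cos c"
  proof cases
    case 1
    then have "cos (a + b) \<le> cos a" using g by (intro cos_diff_nonneg) (auto simp: a_def b_def)
    then have "r $ 0 * cos (a + b) \<le> r $ 0 * cos a" using r by (simp add: mult_left_mono)
    then show ?thesis using p2 cb[OF r[of 1]] by linarith
  next
    case 2
    then have "cos (c + b) \<le> cos c" using g by (intro cos_diff_nonneg) (auto simp: b_def c_def)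
    then have "r $ 3 * cos (c + b) \<le> r $ 3 * cos c" using r by (simp add: mult_left_mono)
    then show ?thesis using p1 cb[OF r[of 2]] by linarith
  qed
  then show ?thesis by (simp add: a_def c_def)
qed

lemma cos_sum_angle:
  assumes "0 \<le> \<alpha>" "\<alpha> \<le> pi" "0 \<le> \<beta>" "\<beta> \<le> pi" "cos \<alpha> + cos \<beta> \<le> 0"
  shows "pi \<le> \<alpha> + \<beta>"
proof -
  have "cos \<alpha> \<le> cos (pi - \<beta>)" using assms by simp
  then have "pi - \<beta> \<le> \<alpha>" using cos_mono_le_eq[of \<alpha> "pi - \<beta>"] assms by simp
  then show ?thesis by simp
qed

text \<open>Two triangles glued along a common side of length \<open>D\<close> form a convex quadrilateral
  if the angles at both ends of that side are at most a half turn. In terms of cosines this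
  is linear in the square of \<open>D\<close>, which is the form of the last two assumptions.\<close>

lemma glue_triangles:
  fixes r :: "real ^ 4"
  assumes r: "\<And>i. 0 < r $ i" and D: "0 < D" "D \<le> r $ 0 + r $ 1" "D \<le> r $ 2 + r $ 3"
      "\<bar>r $ 0 - r $ 1\<bar> \<le> D" "\<bar>r $ 2 - r $ 3\<bar> \<le> D"
    and Q1: "r $ 2 * ((r $ 0)\<^sup>2 - (r $ 1)\<^sup>2) + r $ 1 * ((r $ 3)\<^sup>2 - (r $ 2)\<^sup>2) \<le> (r $ 1 + r $ 2) * D\<^sup>2"
    and Q2: "r $ 3 * ((r $ 1)\<^sup>2 - (r $ 0)\<^sup>2) + r $ 0 * ((r $ 2)\<^sup>2 - (r $ 3)\<^sup>2) \<le> (r $ 0 + r $ 3) * D\<^sup>2"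
  obtains \<theta> :: "real ^ 4" where
    "\<theta> $ 0 \<le> \<theta> $ 1" "\<theta> $ 1 \<le> \<theta> $ 2" "\<theta> $ 2 \<le> \<theta> $ 3" "\<theta> $ 3 \<le> \<theta> $ 0 + 2 * pi"
    "\<theta> $ 1 - \<theta> $ 0 \<le> pi" "\<theta> $ 2 - \<theta> $ 1 \<le> pi" "\<theta> $ 3 - \<theta> $ 2 \<le> pi" "\<theta> $ 0 + 2 * pi - \<theta> $ 3 \<le> pi"
    "of_real (r $ 0) * cis (\<theta> $ 0) + of_real (r $ 1) * cis (\<theta> $ 1) = of_real D"
    "of_real (r $ 2) * cis (\<theta> $ 2) + of_real (r $ 3) * cis (\<theta> $ 3) = - of_real D"
proof -
  have pos: "0 < r $ 0" "0 < r $ 1" "0 < r $ 2" "0 < r $ 3" using r by auto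
  have law: "2 * D * b * cos \<theta> = c\<^sup>2 - D\<^sup>2 - b\<^sup>2" if "D + b * cos \<theta> + c * cos \<phi> = 0" "b * sin \<theta> = c * sin \<phi>" for b c \<theta> \<phi> :: real
  proof -
    have "(D + b * cos \<theta>)\<^sup>2 + (b * sin \<theta>)\<^sup>2 = (c * cos \<phi>)\<^sup>2 + (c * sin \<phi>)\<^sup>2"
    proof -
      have "D + b * cos \<theta> = - (c * cos \<phi>)" using that(1) by linarith
      then show ?thesis using that(2) by simp
    qed
    also have "\<dots> = c\<^sup>2 * ((cos \<phi>)\<^sup>2 + (sin \<phi>)\<^sup>2)" by (simp only: power_mult_distrib distrib_left)
    also have "\<dots> = c\<^sup>2" by simp
    finally have e: "(D + b * cos \<theta>)\<^sup>2 + (b * sin \<theta>)\<^sup>2 = c\<^sup>2" .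
    have "(D + b * cos \<theta>)\<^sup>2 + (b * sin \<theta>)\<^sup>2 = D\<^sup>2 + 2 * D * b * cos \<theta> + b\<^sup>2 * ((cos \<theta>)\<^sup>2 + (sin \<theta>)\<^sup>2)"
    proof -
      have "(D + b * x)\<^sup>2 + (b * y)\<^sup>2 = D\<^sup>2 + 2 * D * b * x + b\<^sup>2 * (x\<^sup>2 + y\<^sup>2)" for x y
        by (simp add: power2_eq_square algebra_simps)
      then show ?thesis .
    qed
    also have "\<dots> = D\<^sup>2 + 2 * D * b * cos \<theta> + b\<^sup>2" by simp
    finally show ?thesis using e by simp
  qed
  obtain \<alpha> \<beta> where 2: "0 \<le> \<alpha>" "\<alpha> \<le> pi" "0 \<le> \<beta>" "\<beta> \<le> pi" "\<alpha> + \<beta> \<ge> pi"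
    "D + r $ 2 * cos \<alpha> + r $ 3 * cos \<beta> = 0" "r $ 2 * sin \<alpha> = r $ 3 * sin \<beta>"
    using triangle_exists[of D "r $ 2" "r $ 3"] pos D by (auto simp: abs_le_iff)
  obtain \<gamma> \<delta> where 1: "0 \<le> \<gamma>" "\<gamma> \<le> pi" "0 \<le> \<delta>" "\<delta> \<le> pi" "\<gamma> + \<delta> \<ge> pi"
    "D + r $ 0 * cos \<gamma> + r $ 1 * cos \<delta> = 0" "r $ 0 * sin \<gamma> = r $ 1 * sin \<delta>"
    using triangle_exists[of D "r $ 0" "r $ 1"] pos D by (auto simp: abs_le_iff)
  have swap: "D + c * cos \<phi> + b * cos \<theta> = 0" if "D + b * cos \<theta> + c * cos \<phi> = 0" for b c \<theta> \<phi> :: real using that by simp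
  have la: "2 * D * r $ 2 * cos \<alpha> = (r $ 3)\<^sup>2 - D\<^sup>2 - (r $ 2)\<^sup>2" by (rule law[OF 2(6,7)])
  have lb: "2 * D * r $ 3 * cos \<beta> = (r $ 2)\<^sup>2 - D\<^sup>2 - (r $ 3)\<^sup>2" by (rule law[OF swap[OF 2(6)] 2(7)[symmetric]])
  have lc: "2 * D * r $ 0 * cos \<gamma> = (r $ 1)\<^sup>2 - D\<^sup>2 - (r $ 0)\<^sup>2" by (rule law[OF 1(6,7)])
  have ld: "2 * D * r $ 1 * cos \<delta> = (r $ 0)\<^sup>2 - D\<^sup>2 - (r $ 1)\<^sup>2" by (rule law[OF swap[OF 1(6)] 1(7)[symmetric]])
  have "pi \<le> \<alpha> + \<delta>"
  proof (rule cos_sum_angle[OF 2(1,2) 1(3,4)])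
    have "(2 * D * r $ 1 * r $ 2) * (cos \<alpha> + cos \<delta>) = r $ 1 * (2 * D * r $ 2 * cos \<alpha>) + r $ 2 * (2 * D * r $ 1 * cos \<delta>)"
      by (simp add: algebra_simps)
    also have "\<dots> \<le> 0" unfolding la ld using Q1 by (simp add: algebra_simps)
    finally show "cos \<alpha> + cos \<delta> \<le> 0" using pos D by (simp add: mult_le_0_iff)
  qed
  moreover have "pi \<le> \<gamma> + \<beta>"
  proof (rule cos_sum_angle[OF 1(1,2) 2(3,4)])
    have "(2 * D * r $ 0 * r $ 3) * (cos \<gamma> + cos \<beta>) = r $ 3 * (2 * D * r $ 0 * cos \<gamma>) + r $ 0 * (2 * D * r $ 3 * cos \<beta>)"
      by (simp add: algebra_simps)
    also have "\<dots> \<le> 0" unfolding lb lc using Q2 by (simp add: algebra_simps)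
    finally show "cos \<gamma> + cos \<beta> \<le> 0" using pos D by (simp add: mult_le_0_iff)
  qed
  moreover have "of_real (r $ 0) * cis (\<gamma> - pi) + of_real (r $ 1) * cis (pi - \<delta>) = of_real D"
    using 1(6,7) by (simp add: complex_eq_iff cos_diff sin_diff)
  moreover have "of_real (r $ 2) * cis \<alpha> + of_real (r $ 3) * cis (2 * pi - \<beta>) = - of_real D"
    using 2(6,7) by (simp add: complex_eq_iff)
  ultimately show thesis
    using that[of "vec4 (\<gamma> - pi) (pi - \<delta>) \<alpha> (2 * pi - \<beta>)"] 1 2 by simp
qed

text \<open>Where the damping factor vanishes the denominator may vanish as well, but the ratio stays bounded
  by 1.\<close>

lemma continuous_on_damped_ratio:
  fixes m a b :: "'a::topological_space \<Rightarrow> real"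
  assumes cont: "continuous_on S m" "continuous_on S a" "continuous_on S b"
    and m: "\<And>x. x \<in> S \<Longrightarrow> 0 \<le> m x" and ab: "\<And>x. x \<in> S \<Longrightarrow> \<bar>a x\<bar> \<le> \<bar>b x\<bar>" and b: "\<And>x. x \<in> S \<Longrightarrow> m x > 0 \<Longrightarrow> b x \<noteq> 0"
  shows "continuous_on S (\<lambda>x. m x * (a x / b x))"
  unfolding continuous_on_def
proof
  fix x assume x: "x \<in> S"
  have lim: "(m \<longlongrightarrow> m x) (at x within S)" "(a \<longlongrightarrow> a x) (at x within S)" "(b \<longlongrightarrow> b x) (at x within S)"
    using cont x by (auto simp: continuous_on_def)
  show "((\<lambda>x. m x * (a x / b x)) \<longlongrightarrow> m x * (a x / b x)) (at x within S)"
  proof (cases "m x > 0")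
    case True
    then show ?thesis using lim b[OF x] by (intro tendsto_intros) auto
  next
    case False
    then have "m x = 0" using m[OF x] by simp
    have "\<bar>m y * (a y / b y)\<bar> \<le> m y" if "y \<in> S" for y
    proof -
      have "\<bar>a y / b y\<bar> \<le> 1" using ab[OF that] by (simp add: abs_divide divide_le_eq_1)
      then have "m y * \<bar>a y / b y\<bar> \<le> m y * 1" using m[OF that] by (rule mult_left_mono)
      then show ?thesis using m[OF that] by (simp add: abs_mult)
    qed
    then have ev: "eventually (\<lambda>y. norm (m y * (a y / b y)) \<le> m y) (at x within S)"
      by (auto simp: eventually_at_filter)
    have "(m \<longlongrightarrow> 0) (at x within S)" using lim(1) \<open>m x = 0\<close> by simp
    then have "((\<lambda>x. m x * (a x / b x)) \<longlongrightarrow> 0) (at x within S)"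
      by (rule Lim_null_comparison[OF ev])
    then show ?thesis using \<open>m x = 0\<close> by simp
  qed
qed

context fermat begin

text \<open>Convexity is a lower bound for the square of the diagonal, which \<open>x\<close> satisfies, so it
  persists for longer diagonals. Two triangles can then be glued along one of length \<open>D\<close>.\<close>

lemma fiber_exists:
  assumes x: "x \<in> quad_cone" and pos: "\<And>i. pw x $ i \<noteq> 0" and D: "diagonal x < D" "D \<le> hi (cmods (pw x))"
  obtains z where "z \<in> quad_cone" "cmods (pw z) = cmods (pw x)" "diagonal z = D"
proof -
  define r where "r = cmods (pw x)"
  have r: "0 < r $ i" for i using pos by (simp add: r_def)
  obtain \<theta> where \<theta>: "lifted x \<theta>" using x by (rule quad_coneE)
  have sum: "(\<Sum>i\<in>UNIV. of_real (r $ i) * cis (\<theta> $ i)) = 0"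
    using quad_coneD(2)[OF x] lifted_pw[OF \<theta>] by (simp add: r_def flip: pw_sum)
  \<comment> \<open>The inequality at the opposite vertex is the same one, with the sides numbered from the third.\<close>
  define \<psi> where "\<psi> = vec4 (\<theta> $ 2) (\<theta> $ 3) (\<theta> $ 0 + 2 * pi) (\<theta> $ 1 + 2 * pi)"
  define q where "q = vec4 (r $ 2) (r $ 3) (r $ 0) (r $ 1)"
  note g = lifted_gaps[OF \<theta>]
  have E1: "(diagonal x)\<^sup>2 = (r $ 0)\<^sup>2 + (r $ 1)\<^sup>2 + 2 * r $ 0 * r $ 1 * cos (\<theta> $ 1 - \<theta> $ 0)"
    and E2: "(diagonal x)\<^sup>2 = (r $ 2)\<^sup>2 + (r $ 3)\<^sup>2 + 2 * r $ 2 * r $ 3 * cos (\<theta> $ 3 - \<theta> $ 2)"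
    using diagonal_cos[OF x \<theta>] by (simp_all add: r_def)
  have c1: "0 \<le> r $ 1 + r $ 2 + r $ 0 * cos (\<theta> $ 1 - \<theta> $ 0) + r $ 3 * cos (\<theta> $ 3 - \<theta> $ 2)"
    using r g by (intro convex_projection sum) (auto intro: less_imp_le)
  have c2: "0 \<le> r $ 3 + r $ 0 + r $ 2 * cos (\<theta> $ 3 - \<theta> $ 2) + r $ 1 * cos (\<theta> $ 1 - \<theta> $ 0)"
  proof -
    have per: "cis (t + 2 * pi) = cis t" for t by (simp add: complex_eq_iff)
    have "(\<Sum>i\<in>UNIV. of_real (q $ i) * cis (\<psi> $ i)) = (\<Sum>i\<in>UNIV. of_real (r $ i) * cis (\<theta> $ i))"
      by (simp add: sum4 q_def \<psi>_def per)
    moreover have "0 \<le> q $ i" for i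
    proof -
      have "\<forall>i. 0 \<le> q $ i" unfolding all4 using r by (simp add: q_def less_imp_le)
      then show ?thesis by blast
    qed
    ultimately have "0 \<le> q $ 1 + q $ 2 + q $ 0 * cos (\<psi> $ 1 - \<psi> $ 0) + q $ 3 * cos (\<psi> $ 3 - \<psi> $ 2)"
    proof (intro convex_projection)
      show "0 \<le> \<psi> $ 1 - \<psi> $ 0" "0 \<le> \<psi> $ 2 - \<psi> $ 1" "0 \<le> \<psi> $ 3 - \<psi> $ 2" "\<psi> $ 3 \<le> \<psi> $ 0 + 2 * pi"
        "\<psi> $ 2 - \<psi> $ 1 \<le> pi"
        unfolding \<psi>_def vec4_nth using g by linarith+
    qed (use sum in simp_all)
    then show ?thesis by (simp add: q_def \<psi>_def)
  qed
  have E0: "diagonal x \<ge> 0" by (simp add: diagonal_def)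
  have D2: "(diagonal x)\<^sup>2 \<le> D\<^sup>2" using D E0 by (intro power_mono) auto
  have Dpos: "0 < D" using D E0 by linarith
  have Q1: "r $ 2 * ((r $ 0)\<^sup>2 - (r $ 1)\<^sup>2) + r $ 1 * ((r $ 3)\<^sup>2 - (r $ 2)\<^sup>2) \<le> (r $ 1 + r $ 2) * (diagonal x)\<^sup>2"
  proof -
    have "(r $ 1 + r $ 2) * (diagonal x)\<^sup>2 = r $ 2 * (diagonal x)\<^sup>2 + r $ 1 * (diagonal x)\<^sup>2" by (simp add: algebra_simps)
    also have "\<dots> = r $ 2 * ((r $ 0)\<^sup>2 + (r $ 1)\<^sup>2 + 2 * r $ 0 * r $ 1 * cos (\<theta> $ 1 - \<theta> $ 0))
        + r $ 1 * ((r $ 2)\<^sup>2 + (r $ 3)\<^sup>2 + 2 * r $ 2 * r $ 3 * cos (\<theta> $ 3 - \<theta> $ 2))"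
      using E1 E2 by simp
    also have "\<dots> = r $ 2 * ((r $ 0)\<^sup>2 - (r $ 1)\<^sup>2) + r $ 1 * ((r $ 3)\<^sup>2 - (r $ 2)\<^sup>2)
        + 2 * r $ 1 * r $ 2 * (r $ 1 + r $ 2 + r $ 0 * cos (\<theta> $ 1 - \<theta> $ 0) + r $ 3 * cos (\<theta> $ 3 - \<theta> $ 2))"
      by (simp add: algebra_simps power2_eq_square)
    finally show ?thesis using c1 r[of 1] r[of 2] by simp
  qed
  have Q2: "r $ 3 * ((r $ 1)\<^sup>2 - (r $ 0)\<^sup>2) + r $ 0 * ((r $ 2)\<^sup>2 - (r $ 3)\<^sup>2) \<le> (r $ 0 + r $ 3) * (diagonal x)\<^sup>2"
  proof -
    have "(r $ 0 + r $ 3) * (diagonal x)\<^sup>2 = r $ 3 * (diagonal x)\<^sup>2 + r $ 0 * (diagonal x)\<^sup>2" by (simp add: algebra_simps)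
    also have "\<dots> = r $ 3 * ((r $ 0)\<^sup>2 + (r $ 1)\<^sup>2 + 2 * r $ 0 * r $ 1 * cos (\<theta> $ 1 - \<theta> $ 0))
        + r $ 0 * ((r $ 2)\<^sup>2 + (r $ 3)\<^sup>2 + 2 * r $ 2 * r $ 3 * cos (\<theta> $ 3 - \<theta> $ 2))"
      using E1 E2 by simp
    also have "\<dots> = r $ 3 * ((r $ 1)\<^sup>2 - (r $ 0)\<^sup>2) + r $ 0 * ((r $ 2)\<^sup>2 - (r $ 3)\<^sup>2)
        + 2 * r $ 0 * r $ 3 * (r $ 3 + r $ 0 + r $ 2 * cos (\<theta> $ 3 - \<theta> $ 2) + r $ 1 * cos (\<theta> $ 1 - \<theta> $ 0))"
      by (simp add: algebra_simps power2_eq_square)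
    finally show ?thesis using c2 r[of 0] r[of 3] by simp
  qed
  have tri: "\<bar>r $ 0 - r $ 1\<bar> \<le> D" "\<bar>r $ 2 - r $ 3\<bar> \<le> D"
  proof -
    have t: "\<bar>cmod v - cmod w\<bar> \<le> cmod (v + w)" for v w :: complex
      using norm_triangle_ineq3[of v "- w"] unfolding norm_minus_cancel diff_minus_eq_add .
    show "\<bar>r $ 0 - r $ 1\<bar> \<le> D"
      using t[of "pw x $ 0" "pw x $ 1"] D(1) unfolding diagonal_def r_def cmods_nth by linarith
    show "\<bar>r $ 2 - r $ 3\<bar> \<le> D"
      using t[of "pw x $ 2" "pw x $ 3"] D(1) unfolding diagonal_alt[OF x] r_def cmods_nth by linarith
  qed
  have up: "D \<le> r $ 0 + r $ 1" "D \<le> r $ 2 + r $ 3" using D(2) by (simp_all add: hi_def r_def)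
  have m: "(r $ 1 + r $ 2) * (diagonal x)\<^sup>2 \<le> (r $ 1 + r $ 2) * D\<^sup>2" "(r $ 0 + r $ 3) * (diagonal x)\<^sup>2 \<le> (r $ 0 + r $ 3) * D\<^sup>2"
    using D2 r[of 0] r[of 1] r[of 2] r[of 3] by (auto intro!: mult_left_mono)
  obtain \<phi> :: "real ^ 4" where \<phi>:
    "\<phi> $ 0 \<le> \<phi> $ 1" "\<phi> $ 1 \<le> \<phi> $ 2" "\<phi> $ 2 \<le> \<phi> $ 3" "\<phi> $ 3 \<le> \<phi> $ 0 + 2 * pi"
    "\<phi> $ 1 - \<phi> $ 0 \<le> pi" "\<phi> $ 2 - \<phi> $ 1 \<le> pi" "\<phi> $ 3 - \<phi> $ 2 \<le> pi" "\<phi> $ 0 + 2 * pi - \<phi> $ 3 \<le> pi"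
    and \<phi>D: "of_real (r $ 0) * cis (\<phi> $ 0) + of_real (r $ 1) * cis (\<phi> $ 1) = of_real D"
    "of_real (r $ 2) * cis (\<phi> $ 2) + of_real (r $ 3) * cis (\<phi> $ 3) = - of_real D"
    using glue_triangles[OF r Dpos up tri order_trans[OF Q1 m(1)] order_trans[OF Q2 m(2)]] .
  define z where "z = (\<chi> i. of_real (root n (r $ i)) * cis (\<phi> $ i / n))"
  have root: "root n (r $ i) > 0" "root n (r $ i) ^ n = r $ i" for i
    using r[of i] n_pos by (auto intro: real_root_pow_pos)
  have pwz: "pw z $ i = of_real (r $ i) * cis (\<phi> $ i)" for i
    by (simp add: pw_nth z_def power_mult_distrib cis_pow root(2) flip: of_real_power)
  have cmz: "cmod (z $ i) = root n (r $ i)" for i using root(1)[of i] by (simp add: z_def norm_mult)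
  have "z $ 0 \<noteq> 0" using root(1)[of 0] by (simp add: z_def)
  then have "z \<noteq> 0" by auto
  moreover have "(\<Sum>i\<in>UNIV. (z $ i) ^ n) = 0"
  proof -
    have "(\<Sum>i\<in>UNIV. pw z $ i) = (of_real (r $ 0) * cis (\<phi> $ 0) + of_real (r $ 1) * cis (\<phi> $ 1))
        + (of_real (r $ 2) * cis (\<phi> $ 2) + of_real (r $ 3) * cis (\<phi> $ 3))"
      unfolding sum4 pwz by simp
    then show ?thesis unfolding \<phi>D by (simp add: pw_sum)
  qed
  moreover have "\<forall>i. z $ i = of_real (cmod (z $ i)) * cis (\<phi> $ i / n)"
    unfolding cmz by (simp add: z_def)
  then have "lifted z \<phi>" unfolding lifted_def using \<phi> by blast
  ultimately have "z \<in> quad_cone" unfolding quad_cone_def mem_Collect_eq by (intro conjI exI)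
  moreover have "cmods (pw z) = cmods (pw x)"
    unfolding r_def[symmetric] using r by (simp add: vec_eq_iff pwz norm_mult less_imp_le)
  moreover have "diagonal z = D" unfolding diagonal_def pwz \<phi>D using Dpos by simp
  ultimately show thesis using that by blast
qed

definition diag :: "cp3 \<Rightarrow> real"
  where "diag p = diagonal (homog p) / total (homog p)"

lemma diagonal_scale: "diagonal (c *s z) = cmod c ^ n * diagonal z"
  unfolding diagonal_def pw_scale by (simp add: norm_mult norm_power flip: distrib_left)

lemma diag_scale: "c \<noteq> 0 \<Longrightarrow> diagonal (c *s z) / total (c *s z) = diagonal z / total z"
  by (simp add: diagonal_scale total_scale)

lemma diag_cp3_of: "z \<noteq> 0 \<Longrightarrow> diag (cp3_of z) = diagonal z / total z"
  unfolding diag_def by (rule cp3_lift[where f = "\<lambda>z. diagonal z / total z"]) (simp_all add: diag_scale)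

lemma continuous_diag: "continuous_on X diag"
proof -
  have "continuous_on (- {0}) (\<lambda>z. diagonal z / total z)"
    unfolding diagonal_def by (intro continuous_on_divide continuous_on_norm continuous_on_add continuous_pw_nth continuous_total)
      (use total_pos in force)
  from continuous_cp3_lift[OF this diag_scale] show ?thesis
    using continuous_on_subset[OF _ subset_UNIV] by (simp add: diag_def[abs_def])
qed

lemma unit_values:
  assumes "z \<in> quad_cone" "total z = 1"
  shows "len (cp3_of z) = cmods (pw z)" "diag (cp3_of z) = diagonal z"
  using len_cp3_of diag_cp3_of quad_coneD(1) assms by (simp_all add: lens_def)

lemma octahedron_total: "cmods (pw z) \<in> octahedron \<Longrightarrow> total z = 1"
  by (simp add: octahedron_def total_def)

lemma face_cone_top: "face_cone {0,1,2,3,4} = pyramid_cone"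
proof -
  have "\<forall>t<5. \<not> {0,1,2,3,4} \<subseteq> side t" unfolding less5 by simp
  then show ?thesis by (auto simp: face_cone_def)
qed

lemma rot_pyramid_cone_cell:
  obtains R where "monomial R" "{z. (rot ^^ m) z \<in> pyramid_cone} = R ` pyramid_cone"
    "cp3_of ` {z. (rot ^^ m) z \<in> pyramid_cone} = act R ` base_face {0,1,2,3,4}"
proof -
  obtain R where R: "monomial R" "\<And>z. R ((rot ^^ m) z) = z" "\<And>z. (rot ^^ m) (R z) = z"
    using monomial_inverse[OF monomial_rot_pow[of m]] by metis
  have eq: "{z. (rot ^^ m) z \<in> pyramid_cone} = R ` pyramid_cone"
  proof (intro equalityI subsetI)
    fix z assume "z \<in> {z. (rot ^^ m) z \<in> pyramid_cone}"
    then show "z \<in> R ` pyramid_cone" using R(2)[of z] by (intro image_eqI[of _ _ "(rot ^^ m) z"]) simp_all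
  qed (use R(3) in auto)
  moreover have "cp3_of ` R ` pyramid_cone = act R ` base_face {0,1,2,3,4}"
    using act_base_face[OF R(1), of "{0,1,2,3,4}"] unfolding face_cone_top by (rule sym)
  ultimately show thesis using that R(1) by simp
qed

text \<open>The part of the 4-cell where the diagonal is shortest for the given side lengths. It is the union
  of two pyramids and a graph over the octahedron.\<close>

definition low :: "cp3 set"
  where "low = cp3_of ` {z \<in> quad_cone. up (rot z)}"

lemma compact_low: "compact low"
proof -
  have "{z \<in> quad_cone. up (rot z)} = {z. (rot ^^ 1) z \<in> pyramid_cone} \<union> {z. (rot ^^ 3) z \<in> pyramid_cone}"
    using pyramid_cone_quad_cone rot_pow_quad_cone[of 1] rot_pow_quad_cone[of 3] by (auto simp: up_def numeral_3_eq_3)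
  then have low: "low = cp3_of ` {z. (rot ^^ 1) z \<in> pyramid_cone} \<union> cp3_of ` {z. (rot ^^ 3) z \<in> pyramid_cone}"
    by (simp only: low_def image_Un)
  have c: "compact (cp3_of ` {z. (rot ^^ m) z \<in> pyramid_cone})" for m
  proof -
    obtain R where "monomial R" "cp3_of ` {z. (rot ^^ m) z \<in> pyramid_cone} = act R ` base_face {0,1,2,3,4}"
      using rot_pyramid_cone_cell .
    then show ?thesis using compact_continuous_image[OF continuous_act compact_base_face] by simp
  qed
  show ?thesis unfolding low by (rule compact_Un[OF c c])
qed

lemma lowE:
  assumes "p \<in> low"
  obtains z where "z \<in> quad_cone" "total z = 1" "up (rot z)" "p = cp3_of z"
proof -
  have "cone {z \<in> quad_cone. up (rot z)}"
    using cone_quad_cone up_scale by (auto simp: cone_def monomial_scale[OF monomial_rot])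
  moreover obtain w where "w \<in> {z \<in> quad_cone. up (rot z)}" "p = cp3_of w" using assms by (auto simp: low_def)
  ultimately show thesis using unit_rep that by (metis (no_types, lifting) mem_Collect_eq)
qed

lemma base_cellE:
  assumes "p \<in> base_cell"
  obtains z where "z \<in> quad_cone" "total z = 1" "p = cp3_of z"
proof -
  obtain w where "w \<in> quad_cone" "p = cp3_of w" using assms by (auto simp: base_cell_def)
  then show thesis using unit_rep[OF cone_quad_cone] that by metis
qed

lemma pos_of_margin: "margin (cmods w) > 0 \<Longrightarrow> w $ i \<noteq> 0"
  using margin_le_iff[of "margin (cmods w)" "cmods w"] by (auto dest: spec[of _ i])

lemma inj_on_len_low: "inj_on len low"
proof (rule inj_onI)
  fix p q assume pq: "p \<in> low" "q \<in> low" "len p = len q"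
  obtain x where x: "x \<in> quad_cone" "total x = 1" "up (rot x)" "p = cp3_of x" using lowE[OF pq(1)] .
  obtain y where y: "y \<in> quad_cone" "total y = 1" "up (rot y)" "q = cp3_of y" using lowE[OF pq(2)] .
  have eq: "cmods (pw x) = cmods (pw y)" using pq(3) x y unit_values by simp
  show "p = q"
    unfolding x(4) y(4)
  proof (rule quad_unique[OF x(1) y(1) eq x(2)])
    assume "margin (cmods (pw x)) > 0"
    then show "diagonal x = diagonal y"
      by (intro low_diagonal_least(2)[OF x(1) y(1) eq pos_of_margin x(3) y(3)])
  qed
qed

lemma len_low: "len ` low = octahedron"
proof
  show "len ` low \<subseteq> octahedron" using lowE unit_values octahedron_unit by (metis image_subsetI)
  show "octahedron \<subseteq> len ` low"
  proof
    fix r assume r: "r \<in> octahedron"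
    obtain z where z: "z \<in> quad_cone" "cmods (pw z) = r" "up (rot z)" using low_exists[OF r] .
    then have "len (cp3_of z) = r" using unit_values(1) octahedron_total r by simp
    then show "r \<in> len ` low" using z by (auto simp: low_def)
  qed
qed

text \<open>The shortest length of the diagonal. Unlike the largest one it is not given by a formula;
  its continuity comes from the compactness of \<open>low\<close>.\<close>

definition lo :: "real ^ 4 \<Rightarrow> real"
  where "lo r = diag (the_inv_into low len r)"

lemma lo_low: "p \<in> low \<Longrightarrow> lo (len p) = diag p"
  by (simp add: lo_def the_inv_into_f_f[OF inj_on_len_low])

lemma continuous_lo: "continuous_on octahedron lo"
proof -
  have "continuous_on (len ` low) (the_inv_into low len)"
    using continuous_on_inv[OF continuous_len compact_low] the_inv_into_f_f[OF inj_on_len_low] by blast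
  then show ?thesis
    unfolding lo_def[abs_def] len_low
    by (rule continuous_on_compose2[OF continuous_diag[of UNIV]]) auto
qed

lemma fiber_bounds:
  assumes z: "z \<in> quad_cone" "total z = 1" and m: "margin (cmods (pw z)) > 0"
  shows "lo (cmods (pw z)) \<le> diagonal z" "diagonal z \<le> hi (cmods (pw z))" "lo (cmods (pw z)) < hi (cmods (pw z))"
    "diagonal z = hi (cmods (pw z)) \<longleftrightarrow> up z" "diagonal z = lo (cmods (pw z)) \<longleftrightarrow> up (rot z)"
proof -
  define r where "r = cmods (pw z)"
  have r: "r \<in> octahedron" using octahedron_unit z by (simp add: r_def)
  obtain x where x: "x \<in> quad_cone" "cmods (pw x) = r" "up (rot x)" using low_exists[OF r] .
  have tx: "total x = 1" using octahedron_total x r by simp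
  have lo: "lo r = diagonal x"
    using lo_low[of "cp3_of x"] unit_values[OF x(1) tx] x by (auto simp: low_def)
  have px: "pw x $ i \<noteq> 0" for i using pos_of_margin[of "pw x" i] m x(2) by (simp add: r_def)
  have eq: "cmods (pw x) = cmods (pw z)" using x by (simp add: r_def)
  note least = low_diagonal_least[OF x(1) z(1) eq px x(3)]
  show "lo (cmods (pw z)) \<le> diagonal z" using least(1) lo by (simp add: r_def)
  show "diagonal z \<le> hi (cmods (pw z))" by (rule diagonal_le_hi[OF z(1)])
  have "diagonal x \<noteq> hi r" using up_diagonal[OF x(1)] up_low_margin[OF x(1) tx _ x(3)] m x(2) by (auto simp: r_def)
  then show "lo (cmods (pw z)) < hi (cmods (pw z))"
    using diagonal_le_hi[OF x(1)] x(2) lo by (simp add: r_def)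
  show "diagonal z = hi (cmods (pw z)) \<longleftrightarrow> up z" using up_diagonal[OF z(1)] by simp
  show "diagonal z = lo (cmods (pw z)) \<longleftrightarrow> up (rot z)"
  proof
    assume "diagonal z = lo (cmods (pw z))"
    then have "diagonal x = diagonal z" using lo by (simp add: r_def)
    then have "cp3_of x = cp3_of z" using quad_compare(2)[OF x(1) z(1) eq px] by blast
    then obtain c where c: "c \<noteq> 0" "z = c *s x"
      using cp3_of_eq_iff[of z x] quad_coneD(1) x z by metis
    then show "up (rot z)" using up_scale x(3) by (simp add: monomial_scale[OF monomial_rot])
  next
    assume "up (rot z)"
    then show "diagonal z = lo (cmods (pw z))" using least(2) lo by (simp add: r_def)
  qed
qed

lemma fiber_point:
  assumes r: "r \<in> octahedron" and m: "margin r > 0" and s: "lo r \<le> s" "s \<le> hi r"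
  obtains z where "z \<in> quad_cone" "total z = 1" "cmods (pw z) = r" "diagonal z = s"
proof -
  obtain x where x: "x \<in> quad_cone" "cmods (pw x) = r" "up (rot x)" using low_exists[OF r] .
  have tx: "total x = 1" using octahedron_total x r by simp
  have Ex: "diagonal x = lo r" using fiber_bounds(5)[OF x(1) tx] m x by simp
  have px: "pw x $ i \<noteq> 0" for i using pos_of_margin[of "pw x" i] m x(2) by simp
  show thesis
  proof (cases "s = lo r")
    case True
    then show thesis using that x tx Ex by blast
  next
    case False
    then obtain z where "z \<in> quad_cone" "cmods (pw z) = cmods (pw x)" "diagonal z = s"
      using fiber_exists[OF x(1) px] s Ex x(2) by (metis less_le)
    then show thesis using that octahedron_total x(2) r by metis
  qed
qed

text \<open>The chart of the 4-cell: three side lengths, and the relative position of the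
  diagonal between its extremes, damped so that the fibres shrink to points over the
  boundary of the octahedron.\<close>

definition height :: "cp3 \<Rightarrow> real"
  where "height p = margin (len p) * ((hi (len p) - diag p) / (hi (len p) - lo (len p)))"

definition chart :: "cp3 \<Rightarrow> real ^ 4"
  where "chart p = vec4 (len p $ 0) (len p $ 1) (len p $ 2) (height p)"

text \<open>The fourth side length is recovered from the first three.\<close>

definition base :: "real ^ 4 \<Rightarrow> real ^ 4"
  where "base x = vec4 (x $ 0) (x $ 1) (x $ 2) (1 - x $ 0 - x $ 1 - x $ 2)"

text \<open>The cone over the octahedron with apex over its centre, since all terms of \<open>margin\<close> are
  equal there.\<close>

definition body :: "(real ^ 4) set"
  where "body = {x. 0 \<le> x $ 3 \<and> x $ 3 \<le> margin (base x)}"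

lemma body_polyhedron:
  shows "convex body" "aff_dim body = 4"
    "rel_frontier body = {x \<in> body. x $ 3 = 0 \<or> x $ 3 = margin (base x)}"
proof -
  \<comment> \<open>One affine constraint for the bottom of the body, and two per side length for its top.\<close>
  define g :: "(4 \<times> bool) option \<Rightarrow> real ^ 4 \<Rightarrow> real" where
    "g t x = (case t of None \<Rightarrow> x $ 3 | Some (i, b) \<Rightarrow> (if b then base x $ i else 1 / 2 - base x $ i) - x $ 3)" for t x
  define m :: "real ^ 4" where "m = vec4 (1 / 4) (1 / 4) (1 / 4) (1 / 8)"
  have base: "base (u *\<^sub>R x + v *\<^sub>R y) $ i = u * base x $ i + v * base y $ i" if uv: "u + v = 1" for u v x y i
  proof -
    have "u * 1 + v * 1 = 1" using uv by simp
    then have "\<forall>i. base (u *\<^sub>R x + v *\<^sub>R y) $ i = u * base x $ i + v * base y $ i"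
      unfolding all4 by (simp add: base_def algebra_simps)
    then show ?thesis by blast
  qed
  have aff: "g t (u *\<^sub>R x + v *\<^sub>R y) = u * g t x + v * g t y" if uv: "u + v = 1" for t u v x y
  proof -
    have h: "1 / 2 = u * (1 / 2) + v * (1 / 2)" using uv by (simp add: field_simps)
    show ?thesis
    proof (cases t)
      case (Some ib)
      obtain i b where "ib = (i, b)" by (cases ib)
      then show ?thesis
        using Some base[OF uv, of x y i] h by (cases b) (simp_all add: g_def algebra_simps)
    qed (simp add: g_def)
  qed
  have basec: "continuous_on UNIV (\<lambda>x. base x $ i)" for i
  proof -
    have "\<forall>i. continuous_on UNIV (\<lambda>x. base x $ i)"
      unfolding all4 by (simp add: base_def continuous_intros)
    then show ?thesis by blast
  qed
  have cont: "continuous_on UNIV (g t)" for t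
  proof (cases t)
    case (Some ib)
    obtain i b where "ib = (i, b)" by (cases ib)
    then show ?thesis
      using Some basec[of i] unfolding g_def[abs_def] by (cases b) (auto intro!: continuous_intros)
  qed (simp add: g_def[abs_def] continuous_intros)
  have mpos: "g t m > 0" for t
  proof -
    have "\<forall>i. base m $ i = 1 / 4" unfolding all4 by (simp add: base_def m_def)
    then have b: "base m $ i = 1 / 4" for i by blast
    have m3: "m $ 3 = 1 / 8" by (simp add: m_def)
    show ?thesis
    proof (cases t)
      case None then show ?thesis by (simp add: g_def m3)
    next
      case (Some ib)
      then show ?thesis by (cases ib; cases "snd ib") (simp_all add: g_def b m3)
    qed
  qed
  have all_g: "(\<forall>t. 0 \<le> g t x) \<longleftrightarrow> 0 \<le> x $ 3 \<and> x $ 3 \<le> margin (base x)" for x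
    unfolding split_option_all split_paired_All margin_le_iff by (auto simp: g_def all_bool_eq)
  have eq: "body = {x \<in> UNIV. \<forall>t\<in>UNIV. 0 \<le> g t x}"
    using all_g by (auto simp: body_def)
  have poly: "convex body" "affine hull body = UNIV" "rel_frontier body = {x \<in> body. \<exists>t\<in>UNIV. g t x = 0}"
    unfolding eq
    using polyhedron_frontier[where A = UNIV and T = UNIV and g = g and m = m] aff cont mpos by simp_all
  show "convex body" by (rule poly(1))
  have "aff_dim body = aff_dim (affine hull body)" by (simp only: aff_dim_affine_hull)
  then show "aff_dim body = 4" using poly(2) by simp
  show "rel_frontier body = {x \<in> body. x $ 3 = 0 \<or> x $ 3 = margin (base x)}"
  proof -
    have "(\<exists>t\<in>UNIV. g t x = 0) \<longleftrightarrow> x $ 3 = 0 \<or> x $ 3 = margin (base x)" if x: "x \<in> body" for x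
    proof
      assume "\<exists>t\<in>UNIV. g t x = 0"
      then obtain t where t: "g t x = 0" by blast
      have le: "x $ 3 \<le> base x $ i" "x $ 3 \<le> 1 / 2 - base x $ i" "margin (base x) \<le> base x $ i"
        "margin (base x) \<le> 1 / 2 - base x $ i" "x $ 3 \<le> margin (base x)" for i
        using x margin_le_iff[of "x $ 3" "base x"] margin_le_iff[of "margin (base x)" "base x"]
        by (auto simp: body_def)
      show "x $ 3 = 0 \<or> x $ 3 = margin (base x)"
      proof (cases t)
        case None then show ?thesis using t by (simp add: g_def)
      next
        case (Some ib)
        obtain i b where "ib = (i, b)" by (cases ib)
        then show ?thesis using t Some le(3)[of i] le(4)[of i] le(5) by (cases b) (auto simp: g_def)
      qed
    next
      assume "x $ 3 = 0 \<or> x $ 3 = margin (base x)"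
      then show "\<exists>t\<in>UNIV. g t x = 0"
      proof
        assume "x $ 3 = 0" then show ?thesis by (intro bexI[of _ None]) (simp_all add: g_def)
      next
        assume e: "x $ 3 = margin (base x)"
        obtain i where "margin (base x) = base x $ i \<or> margin (base x) = 1 / 2 - base x $ i"
          using margin_eq by blast
        then show ?thesis
        proof
          assume "margin (base x) = base x $ i"
          then show ?thesis using e by (intro bexI[of _ "Some (i, True)"]) (simp_all add: g_def)
        next
          assume "margin (base x) = 1 / 2 - base x $ i"
          then show ?thesis using e by (intro bexI[of _ "Some (i, False)"]) (simp_all add: g_def)
        qed
      qed
    qed
    then show ?thesis unfolding poly(3) by blast
  qed
qed

lemma len_base_cell: "p \<in> base_cell \<Longrightarrow> len p \<in> octahedron"
  using base_cellE unit_values(1) octahedron_unit by metis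

lemma base_chart: "p \<in> base_cell \<Longrightarrow> base (chart p) = len p"
proof -
  assume "p \<in> base_cell"
  then have "len p $ 0 + len p $ 1 + len p $ 2 + len p $ 3 = 1"
    using len_base_cell by (auto simp: octahedron_def sum4)
  then have "\<forall>i. base (chart p) $ i = len p $ i" unfolding all4 by (simp add: base_def chart_def)
  then show ?thesis by (simp add: vec_eq_iff)
qed

lemma height_values:
  assumes z: "z \<in> quad_cone" "total z = 1"
  defines "r \<equiv> cmods (pw z)"
  shows "height (cp3_of z) = margin r * ((hi r - diagonal z) / (hi r - lo r))"
    "0 \<le> height (cp3_of z)" "height (cp3_of z) \<le> margin r"
    "height (cp3_of z) = 0 \<or> height (cp3_of z) = margin r \<longleftrightarrow> degen (pw z)"
proof -
  show h: "height (cp3_of z) = margin r * ((hi r - diagonal z) / (hi r - lo r))"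
    by (simp add: height_def unit_values[OF z] r_def)
  have r: "r \<in> octahedron" using octahedron_unit z by (simp add: r_def)
  have "0 \<le> height (cp3_of z) \<and> height (cp3_of z) \<le> margin r \<and>
    (height (cp3_of z) = 0 \<or> height (cp3_of z) = margin r \<longleftrightarrow> degen (pw z))"
  proof (cases "margin r > 0")
    case True
    note fb = fiber_bounds[OF z, folded r_def, OF True]
    have q: "0 \<le> (hi r - diagonal z) / (hi r - lo r)" "(hi r - diagonal z) / (hi r - lo r) \<le> 1"
      using fb by (auto simp: divide_le_eq)
    have "height (cp3_of z) = 0 \<longleftrightarrow> up z" "height (cp3_of z) = margin r \<longleftrightarrow> up (rot z)"
      unfolding h fb(4,5)[symmetric] using True fb(3) by (auto simp: field_simps)
    moreover have "0 \<le> height (cp3_of z)" "height (cp3_of z) \<le> margin r"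
      unfolding h using mult_left_mono[OF q(2), of "margin r"] mult_nonneg_nonneg[OF _ q(1), of "margin r"] True
      by linarith+
    ultimately show ?thesis using degen_up[OF z(1)] by blast
  next
    case False
    then have m: "margin r = 0" using margin_nonneg[OF r] by simp
    obtain k where "(rot ^^ k) z \<in> pyramid_cone"
      using margin_zero_pyramid_cone[OF r m] z(1) by (metis r_def)
    then have "degen (pw z)"
      using pyramid_cone_degen degen_monomial[OF monomial_rot_pow] by blast
    then show ?thesis using m by (simp add: h)
  qed
  then show "0 \<le> height (cp3_of z)" "height (cp3_of z) \<le> margin r"
    "height (cp3_of z) = 0 \<or> height (cp3_of z) = margin r \<longleftrightarrow> degen (pw z)" by auto
qed

lemma chart_3 [simp]: "chart p $ 3 = height p"
  by (simp add: chart_def)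

text \<open>Over the boundary of the octahedron the point is the only one with its side lengths. So it lies in
  \<open>low\<close>, and the numerator and the denominator of the ratio agree.\<close>

lemma continuous_chart: "continuous_on base_cell chart"
proof -
  have l: "continuous_on base_cell (\<lambda>p. len p $ i)" for i
    using continuous_on_component[OF continuous_len] .
  have hi: "continuous_on base_cell (\<lambda>p. hi (len p))" and mg: "continuous_on base_cell (\<lambda>p. margin (len p))"
    unfolding hi_def margin_def
    by (intro continuous_on_min continuous_on_add continuous_on_diff continuous_on_const l)+
  have lo: "continuous_on base_cell (\<lambda>p. lo (len p))"
    by (rule continuous_on_compose2[OF continuous_lo continuous_len]) (use len_base_cell in blast)
  have "continuous_on base_cell height"
    unfolding height_def[abs_def]
  proof (rule continuous_on_damped_ratio)
    fix p assume "p \<in> base_cell"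
    then obtain z where z: "z \<in> quad_cone" "total z = 1" "p = cp3_of z" using base_cellE by blast
    show "0 \<le> margin (len p)" using margin_nonneg len_base_cell \<open>p \<in> base_cell\<close> by blast
    show "\<bar>hi (len p) - diag p\<bar> \<le> \<bar>hi (len p) - lo (len p)\<bar>"
    proof (cases "margin (cmods (pw z)) > 0")
      case True
      then show ?thesis using fiber_bounds[OF z(1,2)] by (simp add: z(3) unit_values[OF z(1,2)])
    next
      case False
      define r where "r = cmods (pw z)"
      have r: "r \<in> octahedron" using octahedron_unit z by (simp add: r_def)
      obtain x where x: "x \<in> quad_cone" "cmods (pw x) = r" "up (rot x)" using low_exists[OF r] .
      have tx: "total x = 1" using octahedron_total x r by simp
      have "cp3_of x = cp3_of z"
        using False x by (intro quad_unique[OF x(1) z(1) _ tx]) (auto simp: r_def)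
      then have "p \<in> low" unfolding low_def z(3) using x(1,3) by (metis (mono_tags, lifting) image_eqI mem_Collect_eq)
      then show ?thesis using lo_low by simp
    qed
    show "margin (len p) > 0 \<Longrightarrow> hi (len p) - lo (len p) \<noteq> 0"
      using fiber_bounds(3)[OF z(1,2)] by (simp add: z(3) unit_values[OF z(1,2)])
  qed (intro continuous_intros mg hi lo continuous_diag)+
  then have "\<forall>i. continuous_on base_cell (\<lambda>p. chart p $ i)"
    unfolding all4 by (simp add: chart_def l)
  then have "continuous_on base_cell (\<lambda>p. chart p $ i)" for i by blast
  then have "continuous_on base_cell (\<lambda>p. \<chi> i. chart p $ i)" by (intro continuous_on_vec_lambda)
  then show ?thesis by (simp add: vec_lambda_eta)
qed

lemma inj_on_chart: "inj_on chart base_cell"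
proof (rule inj_onI)
  fix p q assume pq: "p \<in> base_cell" "q \<in> base_cell" "chart p = chart q"
  obtain x where x: "x \<in> quad_cone" "total x = 1" "p = cp3_of x" using base_cellE[OF pq(1)] .
  obtain y where y: "y \<in> quad_cone" "total y = 1" "q = cp3_of y" using base_cellE[OF pq(2)] .
  have "len p = len q" using pq base_chart by metis
  then have eq: "cmods (pw x) = cmods (pw y)" using x y unit_values by simp
  have h: "height p = height q" using pq(3) chart_3 by metis
  have "diagonal x = diagonal y" if m: "margin (cmods (pw x)) > 0"
    using h m fiber_bounds(3)[OF x(1,2) m] height_values(1)[OF x(1,2)] height_values(1)[OF y(1,2)] x(3) y(3) eq
    by simp
  then show "p = q" unfolding x(3) y(3) by (intro quad_unique[OF x(1) y(1) eq x(2)])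
qed

lemma chart_base_cell: "chart ` base_cell = body"
proof
  show "chart ` base_cell \<subseteq> body"
  proof clarify
    fix p assume p: "p \<in> base_cell"
    then obtain z where z: "z \<in> quad_cone" "total z = 1" "p = cp3_of z" using base_cellE by blast
    show "chart p \<in> body"
      using height_values(2,3)[OF z(1,2)] base_chart[OF p] by (simp add: body_def z(3) unit_values[OF z(1,2)])
  qed
  show "body \<subseteq> chart ` base_cell"
  proof
    fix x assume x: "x \<in> body"
    define r where "r = base x"
    have "0 \<le> margin r" using x by (simp add: body_def r_def)
    then have "\<forall>i. 0 \<le> r $ i \<and> r $ i \<le> 1 / 2" using margin_le_iff[of 0 r] by simp
    moreover have "(\<Sum>i\<in>UNIV. r $ i) = 1" by (simp add: r_def base_def sum4)
    ultimately have r: "r \<in> octahedron" by (simp add: octahedron_def)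
    have "\<exists>z\<in>quad_cone. total z = 1 \<and> cmods (pw z) = r \<and> height (cp3_of z) = x $ 3"
    proof (cases "margin r > 0")
      case True
      obtain y where y: "y \<in> quad_cone" "cmods (pw y) = r" "up (rot y)" using low_exists[OF r] .
      have lt: "lo r < hi r" using fiber_bounds(3)[OF y(1) octahedron_total] y r True by simp
      define t where "t = x $ 3 / margin r"
      have t: "0 \<le> t" "t \<le> 1" using x True by (auto simp: t_def body_def r_def)
      define s where "s = hi r - t * (hi r - lo r)"
      have "t * (hi r - lo r) \<le> 1 * (hi r - lo r)" "0 \<le> t * (hi r - lo r)"
        using t lt by (auto intro: mult_right_mono)
      then have "lo r \<le> s" "s \<le> hi r" by (auto simp: s_def)
      then obtain z where z: "z \<in> quad_cone" "total z = 1" "cmods (pw z) = r" "diagonal z = s"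
        by (rule fiber_point[OF r True])
      have "height (cp3_of z) = margin r * ((hi r - s) / (hi r - lo r))"
        using height_values(1)[OF z(1,2)] z by simp
      also have "\<dots> = x $ 3" using lt True by (simp add: s_def t_def)
      finally show ?thesis using z by blast
    next
      case False
      then have m: "margin r = 0" "x $ 3 = 0" using margin_nonneg[OF r] x by (auto simp: body_def r_def)
      obtain z where z: "z \<in> quad_cone" "cmods (pw z) = r" "up z" using up_exists[OF r] .
      then have "total z = 1" using octahedron_total r by simp
      then show ?thesis using z m height_values(1)[of z] by auto
    qed
    then obtain z where z: "z \<in> quad_cone" "total z = 1" "cmods (pw z) = r" "height (cp3_of z) = x $ 3" by blast
    have "\<forall>i. chart (cp3_of z) $ i = x $ i"
      unfolding all4 using z(4) by (simp add: chart_def unit_values[OF z(1,2)] z(3)) (simp add: r_def base_def)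
    then have "chart (cp3_of z) = x" by (simp add: vec_eq_iff)
    then show "x \<in> chart ` base_cell" using z(1) by (auto simp: base_cell_def)
  qed
qed

lemma base_cell_surf: "base_cell \<subseteq> surf"
  by (auto simp: base_cell_def cp3_of_in_fermat_surface quad_coneD)

lemma closed_base_cell:
  shows "closed_cell (top_of_set surf) 4 base_cell"
    "cell_boundary (top_of_set surf) 4 base_cell = cp3_of ` {z \<in> quad_cone. degen (pw z)}"
proof -
  have "convex (chart ` base_cell)" "aff_dim (chart ` base_cell) = int 4"
    using body_polyhedron by (simp_all add: chart_base_cell)
  note * = closed_cell_convex[OF compact_base_cell base_cell_surf continuous_chart inj_on_chart this]
  show "closed_cell (top_of_set surf) 4 base_cell" by (rule *(1))
  have "p \<in> cp3_of ` {z \<in> quad_cone. degen (pw z)} \<longleftrightarrow> chart p \<in> rel_frontier body" if p: "p \<in> base_cell" for p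
  proof -
    obtain z where z: "z \<in> quad_cone" "total z = 1" "p = cp3_of z" using base_cellE[OF p] .
    have "chart p \<in> rel_frontier body \<longleftrightarrow> height p = 0 \<or> height p = margin (len p)"
      unfolding body_polyhedron(3) using p chart_base_cell base_chart[OF p] by auto
    also have "\<dots> \<longleftrightarrow> degen (pw z)"
      using height_values(4)[OF z(1,2)] by (simp add: z(3) unit_values[OF z(1,2)])
    also have "\<dots> \<longleftrightarrow> p \<in> cp3_of ` {z \<in> quad_cone. degen (pw z)}"
    proof -
      have "cone {z \<in> quad_cone. degen (pw z)}"
        using cone_quad_cone degen_scale by (auto simp: cone_def)
      from cone_mem[OF this quad_coneD(1)[OF z(1)]] show ?thesis using z by simp
    qed
    finally show ?thesis by blast
  qed
  then show "cell_boundary (top_of_set surf) 4 base_cell = cp3_of ` {z \<in> quad_cone. degen (pw z)}"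
    unfolding *(2) chart_base_cell by (auto simp: base_cell_def)
qed

end

section \<open>The tessellation\<close>

context fermat begin

definition top_cells :: "cp3 set set"
  where "top_cells = {act A ` base_cell | A. monomial A}"

definition tess :: "nat \<Rightarrow> cp3 set set"
  where "tess k = (if k \<le> 3 then face_cells k else if k = 4 then top_cells else {})"

lemma act_base_cell: "monomial A \<Longrightarrow> act A ` base_cell = cp3_of ` (A ` quad_cone)"
  unfolding base_cell_def using cone_quad_cone by (intro act_image) (auto simp: cone_def)

lemma top_cell_closed:
  assumes A: "monomial A"
  shows "closed_cell (top_of_set surf) 4 (act A ` base_cell)"
    "cell_boundary (top_of_set surf) 4 (act A ` base_cell) = act A ` (cp3_of ` {z \<in> quad_cone. degen (pw z)})"
  using cell_homeomorphic_image[OF homeomorphic_act[OF A] closed_base_cell(1)] closed_base_cell(2) by simp_all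

text \<open>A degenerate quadrilateral becomes a member of the pyramid after a rotation, and the fourth power of
  the rotation is a scalar.\<close>

lemma base_cell_boundary_faces:
  "cp3_of ` {z \<in> quad_cone. degen (pw z)} = (\<Union>k<4. act (rot ^^ k) ` base_face {0,1,2,3,4})"
proof -
  have act_rot: "act (rot ^^ k) ` base_face {0,1,2,3,4} = cp3_of ` ((rot ^^ k) ` pyramid_cone)" for k
    using act_base_face[OF monomial_rot_pow[of k], of "{0,1,2,3,4}"] unfolding face_cone_top .
  have rot4': "(rot ^^ 4) z = \<omega> *s z" for z
    by (simp add: numeral_eq_Suc rot4)
  show ?thesis
  proof (intro equalityI subsetI)
    fix p assume "p \<in> cp3_of ` {z \<in> quad_cone. degen (pw z)}"
    then obtain z where z: "z \<in> quad_cone" "degen (pw z)" "p = cp3_of z" by blast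
    obtain m where m: "m < 4" "(rot ^^ m) z \<in> pyramid_cone" using degen_pyramid_cone[OF z(1,2)] .
    have "\<exists>k<4. p \<in> cp3_of ` ((rot ^^ k) ` pyramid_cone)"
    proof (cases "m = 0")
      case True
      then show ?thesis using m z(3) by (intro exI[of _ 0]) auto
    next
      case False
      have "(rot ^^ (4 - m)) ((rot ^^ m) z) = (rot ^^ (4 - m + m)) z" by (simp only: funpow_add o_apply)
      also have "\<dots> = \<omega> *s z" using m rot4' by simp
      finally have "cp3_of ((rot ^^ (4 - m)) ((rot ^^ m) z)) = p"
        using cp3_of_scale[OF quad_coneD(1)[OF z(1)]] z(3) by simp
      then show ?thesis using m False by (intro exI[of _ "4 - m"]) (auto simp: image_iff)
    qed
    then show "p \<in> (\<Union>k<4. act (rot ^^ k) ` base_face {0,1,2,3,4})" unfolding act_rot by blast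
  next
    fix p assume "p \<in> (\<Union>k<4. act (rot ^^ k) ` base_face {0,1,2,3,4})"
    then obtain k y where y: "y \<in> pyramid_cone" "p = cp3_of ((rot ^^ k) y)" unfolding act_rot by blast
    have "(rot ^^ k) y \<in> quad_cone" using pyramid_cone_quad_cone[OF y(1)] by (simp add: rot_pow_quad_cone)
    moreover have "degen (pw ((rot ^^ k) y))"
      using degen_monomial[OF monomial_rot_pow] pyramid_cone_degen[OF y(1)] by blast
    ultimately show "p \<in> cp3_of ` {z \<in> quad_cone. degen (pw z)}" using y(2) by blast
  qed
qed

lemma face_cell_degen:
  assumes "c \<in> face_cells j" "p \<in> c"
  obtains z where "z \<noteq> 0" "p = cp3_of z" "degen (pw z)"
proof -
  obtain A V where A: "monomial A" "c = act A ` base_face V" using assms(1) by (auto simp: face_cells_def)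
  then obtain z where z: "z \<in> face_cone V" "p = cp3_of (A z)" using assms(2) act_base_face by auto
  then have "z \<in> pyramid_cone" by (simp add: face_cone_def)
  then have "A z \<noteq> 0" "degen (pw (A z))"
    using pyramid_coneD(1) A(1) degen_monomial pyramid_cone_degen by auto
  then show thesis using that z(2) by blast
qed

lemma degen_cp3:
  assumes "z \<noteq> 0" "w \<noteq> 0" "cp3_of z = cp3_of w"
  shows "degen (pw z) \<longleftrightarrow> degen (pw w)"
  using assms cp3_of_eq_iff degen_scale by blast

lemma top_interior:
  assumes A: "monomial A" and p: "p \<in> cell_interior (top_of_set surf) 4 (act A ` base_cell)"
  obtains z where "z \<in> quad_cone" "p = cp3_of (A z)" "\<not> degen (pw z)"
proof -
  have "p \<in> act A ` cell_interior (top_of_set surf) 4 base_cell"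
    using p cell_interior_act[OF A closed_base_cell(1) base_cell_surf] by simp
  then obtain q where q: "q \<in> base_cell" "q \<notin> cp3_of ` {z \<in> quad_cone. degen (pw z)}" "p = act A q"
    unfolding cell_interior_def closed_base_cell(2) by blast
  then obtain z where z: "z \<in> quad_cone" "q = cp3_of z" by (auto simp: base_cell_def)
  then show thesis using that q act_cp3_of[OF A quad_coneD(1)[OF z(1)]] by blast
qed

text \<open>The two cells differ by a symmetry that keeps a generic point in the base cell, and such a symmetry
  maps the base cell to itself.\<close>

lemma top_overlap:
  assumes A: "monomial A" and B: "monomial B" and z: "z \<in> quad_cone" "\<not> degen (pw z)" and y: "y \<in> quad_cone"
    and eq: "cp3_of (A z) = cp3_of (B y)"
  shows "act A ` base_cell = act B ` base_cell"
proof -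
  obtain B' where B': "monomial B'" "\<And>z. B' (B z) = z" "\<And>z. B (B' z) = z"
    using monomial_inverse[OF B] by metis
  have nz: "A z \<noteq> 0" "B y \<noteq> 0" using quad_coneD(1) z y A B by simp_all
  then obtain c where c: "c \<noteq> 0" "A z = c *s B y" using eq cp3_of_eq_iff by blast
  define M where "M z = B' (A z)" for z
  have M: "monomial M" unfolding M_def[abs_def] by (rule monomial_comp[OF B'(1) A])
  have "M z = c *s y" by (simp add: M_def c(2) monomial_scale[OF B'(1)] B'(2))
  then have "M z \<in> quad_cone" using quad_cone_scale[OF y c(1)] by simp
  note over = generic_overlap[OF z M this]
  have "A ` quad_cone = B ` quad_cone"
  proof (intro equalityI subsetI)
    fix v assume "v \<in> A ` quad_cone"
    then obtain x where x: "x \<in> quad_cone" "v = A x" by blast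
    then have "v = B (M x)" by (simp add: M_def B'(3))
    then show "v \<in> B ` quad_cone" using over x(1) by blast
  next
    fix v assume "v \<in> B ` quad_cone"
    then obtain x where x: "x \<in> quad_cone" "v = B x" by blast
    obtain A' where A': "monomial A'" "\<And>z. A' (A z) = z" "\<And>z. A (A' z) = z"
      using monomial_inverse[OF A] by metis
    have "M (A' v) = x" by (simp add: M_def A'(3) x(2) B'(2))
    then have "A' v \<in> quad_cone" using over x(1) by metis
    then show "v \<in> A ` quad_cone" using A'(3) by (metis imageI)
  qed
  then show ?thesis unfolding act_base_cell[OF A] act_base_cell[OF B] by simp
qed

lemma finite_tess: "finite (tess k)"
proof -
  have "top_cells = (\<lambda>A. act A ` base_cell) ` {A. monomial A}" by (auto simp: top_cells_def)
  then have "finite top_cells" using finite_monomial by simp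
  then show ?thesis using finite_face_cells by (simp add: tess_def)
qed

text \<open>Points of cells of dimension at most 3 are degenerate, and interior points of 4-cells are not;
  within each of the two classes the overlap lemmas apply.\<close>

lemma tess_disjoint:
  assumes c: "c \<in> tess j" and d: "d \<in> tess k" and p: "p \<in> cell_interior (top_of_set surf) j c"
    "p \<in> cell_interior (top_of_set surf) k d"
  shows "(j, c) = (k, d)"
proof -
  have mixed: False if h: "c \<in> face_cells j" "d \<in> top_cells" "p \<in> c" "p \<in> cell_interior (top_of_set surf) 4 d" for c d j p
  proof -
    obtain B where B: "monomial B" "d = act B ` base_cell" using h(2) by (auto simp: top_cells_def)
    obtain y where y: "y \<in> quad_cone" "p = cp3_of (B y)" "\<not> degen (pw y)"
      using top_interior[OF B(1)] h(4) B(2) by metis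
    obtain z where z: "z \<noteq> 0" "p = cp3_of z" "degen (pw z)" using face_cell_degen[OF h(1,3)] .
    have "degen (pw (B y))" using degen_cp3[of z "B y"] z y B(1) quad_coneD(1) by auto
    then show False using y(3) degen_monomial[OF B(1)] by blast
  qed
  have sub: "p \<in> c" "p \<in> d" using p by (auto simp: cell_interior_def)
  have j: "j \<le> 4" "k \<le> 4" using c d by (auto simp: tess_def split: if_splits)
  consider "j \<le> 3" "k \<le> 3" | "j \<le> 3" "k = 4" | "j = 4" "k \<le> 3" | "j = 4" "k = 4" using j by linarith
  then show ?thesis
  proof cases
    case 1
    then obtain A V B W where "monomial A" "V \<in> faces j" "c = act A ` base_face V" "monomial B" "W \<in> faces k" "d = act B ` base_face W"
      using c d by (auto simp: tess_def face_cells_def)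
    then show ?thesis using face_cells_disjoint p by blast
  next
    case 2
    then show ?thesis using mixed[of c j d p] c d p sub by (simp add: tess_def)
  next
    case 3
    then show ?thesis using mixed[of d k c p] c d p sub by (simp add: tess_def)
  next
    case 4
    then obtain A B where A: "monomial A" "c = act A ` base_cell" and B: "monomial B" "d = act B ` base_cell"
      using c d by (auto simp: tess_def top_cells_def)
    obtain z where z: "z \<in> quad_cone" "p = cp3_of (A z)" "\<not> degen (pw z)"
      using top_interior[OF A(1)] p(1) A(2) 4 by metis
    obtain y where y: "y \<in> quad_cone" "p = cp3_of (B y)" "\<not> degen (pw y)"
      using top_interior[OF B(1)] p(2) B(2) 4 by metis
    show ?thesis using top_overlap[OF A(1) B(1) z(1,3) y(1)] z(2) y(2) A(2) B(2) 4 by simp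
  qed
qed

lemma tess_cover: "(\<Union>k. \<Union>(tess k)) = surf"
proof
  have "c \<subseteq> surf" if "c \<in> tess k" for c k
  proof -
    have surf: "act A ` X \<subseteq> surf" if "monomial A" "X \<subseteq> surf" for A X using that act_surface by blast
    obtain A X where "monomial A" "c = act A ` X" "X \<subseteq> surf"
      using \<open>c \<in> tess k\<close> base_face_surf base_cell_surf
      unfolding tess_def face_cells_def top_cells_def by (auto split: if_splits)
    then show ?thesis using surf by simp
  qed
  then show "(\<Union>k. \<Union>(tess k)) \<subseteq> surf" by blast
  show "surf \<subseteq> (\<Union>k. \<Union>(tess k))"
  proof
    fix p assume "p \<in> surf"
    then obtain z where z: "z \<noteq> 0" "(\<Sum>i\<in>UNIV. (z $ i) ^ n) = 0" "p = cp3_of z"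
      by (auto simp: fermat_surface_def)
    obtain A y where A: "monomial A" "y \<in> quad_cone" "z = A y" using covering[OF z(1,2)] .
    have "p \<in> act A ` base_cell" unfolding act_base_cell[OF A(1)] using A z(3) by blast
    moreover have "act A ` base_cell \<in> tess 4" using A(1) by (auto simp: tess_def top_cells_def)
    ultimately show "p \<in> (\<Union>k. \<Union>(tess k))" by blast
  qed
qed

lemma pyramids_around:
  assumes A: "monomial A"
  defines "P \<equiv> (\<lambda>k. act (\<lambda>z. A ((rot ^^ k) z)) ` base_face {0,1,2,3,4}) ` {..<4}"
  shows "P \<subseteq> face_cells 3" "card P = 4" "cell_boundary (top_of_set surf) 4 (act A ` base_cell) = \<Union>P"
proof -
  have M: "monomial (\<lambda>z. A ((rot ^^ k) z))" for k by (rule monomial_comp[OF A monomial_rot_pow])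
  then show "P \<subseteq> face_cells 3"
    by (auto simp: P_def face_cells_def faces_simps intro!: exI[of _ "\<lambda>z. A ((rot ^^ _) z)"])
  have ac: "act (\<lambda>z. A ((rot ^^ k) z)) ` X = act A ` (act (rot ^^ k) ` X)" for k X
    unfolding image_image act_comp[OF A monomial_rot_pow] ..
  show "cell_boundary (top_of_set surf) 4 (act A ` base_cell) = \<Union>P"
    unfolding top_cell_closed(2)[OF A] base_cell_boundary_faces P_def ac by blast
  have "inj_on (\<lambda>k. act (\<lambda>z. A ((rot ^^ k) z)) ` base_face {0,1,2,3,4}) {..<4}"
  proof (rule inj_onI)
    fix k l assume kl: "k \<in> {..<4::nat}" "l \<in> {..<4}"
      "act (\<lambda>z. A ((rot ^^ k) z)) ` base_face {0,1,2,3,4} = act (\<lambda>z. A ((rot ^^ l) z)) ` base_face {0,1,2,3,4}"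
    have sub: "act (rot ^^ k) ` base_face {0,1,2,3,4} \<subseteq> surf" for k
      using act_surface[OF monomial_rot_pow] base_face_surf by blast
    have "act (rot ^^ k) ` base_face {0,1,2,3,4} = act (rot ^^ l) ` base_face {0,1,2,3,4}"
      using kl(3) inj_on_image_eq_iff[OF inj_act[OF A] sub sub] unfolding ac by simp
    then have eq: "len ` (act (rot ^^ k) ` base_face {0,1,2,3,4}) = len ` (act (rot ^^ l) ` base_face {0,1,2,3,4})" by simp
    define S where "S k = len ` (act (rot ^^ k) ` base_face {0,1,2,3,4})" for k
    have lens_rot: "lens (rot z) = vec4 (lens z $ 1) (lens z $ 2) (lens z $ 3) (lens z $ 0)" for z
    proof -
      have "total (rot z) = total z" by (simp add: total_def sum4)
      then have "\<forall>i. lens (rot z) $ i = vec4 (lens z $ 1) (lens z $ 2) (lens z $ 3) (lens z $ 0) $ i"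
        unfolding all4 by (simp add: lens_nth)
      then show ?thesis by (simp add: vec_eq_iff)
    qed
    have S: "S k = (\<lambda>z. lens ((rot ^^ k) z)) ` pyramid_cone" for k
    proof -
      have "act (rot ^^ k) ` base_face {0,1,2,3,4} = cp3_of ` ((rot ^^ k) ` pyramid_cone)"
        using act_base_face[OF monomial_rot_pow[of k], of "{0,1,2,3,4}"] unfolding face_cone_top .
      moreover have "(rot ^^ k) z \<noteq> 0" if "z \<in> pyramid_cone" for z
        using pyramid_coneD(1)[OF that] monomial_rot_pow by simp
      ultimately show ?thesis
        unfolding S_def by (auto simp: image_image len_cp3_of intro!: image_cong)
    qed
    have fp: "lens ` pyramid_cone = face_poly {0,1,2,3,4}"
    proof -
      have "lens ` pyramid_cone = len ` base_face {0,1,2,3,4}"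
        unfolding base_face_def face_cone_top image_image using pyramid_coneD(1) len_cp3_of by (intro image_cong) auto
      then show ?thesis by (simp add: len_base_face)
    qed
    have face: "r \<in> face_poly {0,1,2,3,4} \<longleftrightarrow> r $ 0 + r $ 1 + r $ 2 + r $ 3 = 1 \<and> (\<forall>t<5. 0 \<le> slack t r)" for r
    proof -
      have "\<forall>t<5. \<not> {0,1,2,3,4} \<subseteq> side t" unfolding less5 by simp
      then show ?thesis unfolding face_poly_def sum4 by blast
    qed
    \<comment> \<open>The four pyramids are told apart by which pairs of consecutive sides may sum to more than
      half of the perimeter. Each of the following length vectors lies in two of the four bodies.\<close>
    define q where "q = vec4 (1/8) (1/4) (3/8) (1/4 :: real)"
    define r where "r = vec4 (1/4) (1/8) (1/4) (3/8 :: real)"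
    have mem: "vec4 a b c d \<in> S 0 \<longleftrightarrow> vec4 a b c d \<in> face_poly {0,1,2,3,4}"
      "vec4 a b c d \<in> S 1 \<longleftrightarrow> vec4 d a b c \<in> face_poly {0,1,2,3,4}"
      "vec4 a b c d \<in> S 2 \<longleftrightarrow> vec4 c d a b \<in> face_poly {0,1,2,3,4}"
      "vec4 a b c d \<in> S 3 \<longleftrightarrow> vec4 b c d a \<in> face_poly {0,1,2,3,4}" for a b c d
    proof -
      have vec4_eq: "vec4 a b c d = v \<longleftrightarrow> a = v $ 0 \<and> b = v $ 1 \<and> c = v $ 2 \<and> d = v $ 3" for a b c d and v :: "real ^ 4"
        unfolding vec_eq_iff all4 by simp
      have in_img: "v \<in> f ` lens ` pyramid_cone \<longleftrightarrow> g v \<in> face_poly {0,1,2,3,4}"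
        if h: "\<And>v. f (g v) = v" "\<And>v. g (f v) = v" for f g :: "real ^ 4 \<Rightarrow> real ^ 4" and v
      proof
        assume "v \<in> f ` lens ` pyramid_cone"
        then show "g v \<in> face_poly {0,1,2,3,4}" unfolding fp by (auto simp only: h(2))
      next
        assume "g v \<in> face_poly {0,1,2,3,4}"
        then show "v \<in> f ` lens ` pyramid_cone" unfolding fp by (rule rev_image_eqI) (simp only: h(1))
      qed
      define f where "f v = vec4 (v $ 1) (v $ 2) (v $ 3) (v $ 0)" for v :: "real ^ 4"
      define g where "g v = vec4 (v $ 3) (v $ 0) (v $ 1) (v $ 2)" for v :: "real ^ 4"
      have fg: "f (g v) = v" "g (f v) = v" for v
        by (simp_all add: f_def g_def vec4_eq)
      have lr: "lens (rot z) = f (lens z)" for z by (simp add: lens_rot f_def)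
      have S': "S 0 = id ` lens ` pyramid_cone" "S 1 = f ` lens ` pyramid_cone" "S 2 = (\<lambda>v. f (f v)) ` lens ` pyramid_cone"
        "S 3 = (\<lambda>v. f (f (f v))) ` lens ` pyramid_cone"
        unfolding S by (simp_all add: image_image lr numeral_2_eq_2 numeral_3_eq_3)
      show "vec4 a b c d \<in> S 0 \<longleftrightarrow> vec4 a b c d \<in> face_poly {0,1,2,3,4}"
        unfolding S' fp by (simp only: image_id id_apply)
      show "vec4 a b c d \<in> S 1 \<longleftrightarrow> vec4 d a b c \<in> face_poly {0,1,2,3,4}"
      proof -
        have "vec4 a b c d \<in> S 1 \<longleftrightarrow> g (vec4 a b c d) \<in> face_poly {0,1,2,3,4}"
          unfolding S' by (rule in_img) (simp_all only: fg)
        moreover have "g (vec4 a b c d) = vec4 d a b c" by (simp add: g_def)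
        ultimately show ?thesis by (simp only:)
      qed
      show "vec4 a b c d \<in> S 2 \<longleftrightarrow> vec4 c d a b \<in> face_poly {0,1,2,3,4}"
      proof -
        have "vec4 a b c d \<in> S 2 \<longleftrightarrow> g (g (vec4 a b c d)) \<in> face_poly {0,1,2,3,4}"
          unfolding S' by (rule in_img) (simp_all only: fg)
        moreover have "g (g (vec4 a b c d)) = vec4 c d a b" by (simp add: g_def)
        ultimately show ?thesis by (simp only:)
      qed
      show "vec4 a b c d \<in> S 3 \<longleftrightarrow> vec4 b c d a \<in> face_poly {0,1,2,3,4}"
      proof -
        have "vec4 a b c d \<in> S 3 \<longleftrightarrow> g (g (g (vec4 a b c d))) \<in> face_poly {0,1,2,3,4}"
          unfolding S' by (rule in_img) (simp_all only: fg)
        moreover have "g (g (g (vec4 a b c d))) = vec4 b c d a" by (simp add: g_def)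
        ultimately show ?thesis by (simp only:)
      qed
    qed
    have memb: "q \<in> S 0" "q \<in> S 1" "q \<notin> S 2" "q \<notin> S 3" "r \<in> S 0" "r \<notin> S 1" "r \<notin> S 2" "r \<in> S 3"
      unfolding q_def r_def mem face less5 by simp_all
    have "S k = S l" using eq by (simp add: S_def)
    moreover have "k = 0 \<or> k = 1 \<or> k = 2 \<or> k = 3" "l = 0 \<or> l = 1 \<or> l = 2 \<or> l = 3" using kl(1,2) by auto
    ultimately show "k = l" using memb by (elim disjE) auto
  qed
  then show "card P = 4" unfolding P_def by (simp add: card_image)
qed

lemma tess_boundary:
  assumes "c \<in> tess k"
  shows "\<exists>D \<subseteq> (\<Union>j<k. tess j). cell_boundary (top_of_set surf) k c = \<Union>D"
proof (cases "k \<le> 3")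
  case True
  then obtain A V where A: "monomial A" "V \<in> faces k" "c = act A ` base_face V"
    using assms by (auto simp: tess_def face_cells_def)
  define D where "D = (\<Union>j<k. (\<lambda>W. act A ` base_face W) ` {W \<in> faces j. W \<subset> V})"
  have "D \<subseteq> (\<Union>j<k. tess j)"
    using A(1) True by (auto simp: D_def tess_def face_cells_def)
  moreover have "cell_boundary (top_of_set surf) k c = \<Union>D"
    unfolding A(3) face_cell_closed(2)[OF A(1,2)] D_def by blast
  ultimately show ?thesis by blast
next
  case False
  then have "k = 4" "c \<in> top_cells" using assms by (auto simp: tess_def split: if_splits)
  then obtain A where A: "monomial A" "c = act A ` base_cell" by (auto simp: top_cells_def)
  note P = pyramids_around[OF A(1)]
  have "face_cells 3 \<subseteq> (\<Union>j<k. tess j)" using \<open>k = 4\<close> by (auto simp: tess_def intro!: bexI[of _ 3])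
  then show ?thesis using P(1,3) \<open>k = 4\<close> A(2) by blast
qed

lemma tess_tessellation: "tessellation 4 (top_of_set surf) tess"
  unfolding tessellation_def
proof (intro conjI allI ballI impI)
  show "tess k = {}" if "4 < k" for k using that by (simp add: tess_def)
  show "finite (tess k)" for k by (rule finite_tess)
  show "closed_cell (top_of_set surf) k c" if "c \<in> tess k" for k c
    using that face_cell_closed(1) top_cell_closed(1)
    by (auto simp: tess_def face_cells_def top_cells_def split: if_splits)
  show "cell_interior (top_of_set surf) j c \<inter> cell_interior (top_of_set surf) k d = {}"
    if "c \<in> tess j" "d \<in> tess k" "(j, c) \<noteq> (k, d)" for j k c d
    using tess_disjoint[OF that(1,2)] that(3) by blast
  show "(\<Union>k. \<Union>(tess k)) = topspace (top_of_set surf)" using tess_cover by simp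
  show "\<exists>D\<subseteq>\<Union> (tess ` {..<k}). cell_boundary (top_of_set surf) k c = \<Union> D" if "c \<in> tess k" for k c
    by (rule tess_boundary[OF that])
qed

text \<open>The stabiliser of the base cell is generated by the rotation and the scalars. Every coset
  has exactly one representative that leaves the first coordinate alone: a power of the rotation
  moves that coordinate to its place, and a scalar cancels its phase.\<close>

definition normal_maps :: "((4 \<Rightarrow> 4) \<times> (4 \<Rightarrow> complex)) set"
  where "normal_maps = {\<sigma>. bij \<sigma> \<and> \<sigma> 0 = 0} \<times> {u. (\<forall>i. u i ^ n = 1) \<and> u 0 = 1}"

lemma card_normal_perms: "card {\<sigma> :: 4 \<Rightarrow> 4. bij \<sigma> \<and> \<sigma> 0 = 0} = 6"
proof -
  have "{\<sigma> :: 4 \<Rightarrow> 4. bij \<sigma> \<and> \<sigma> 0 = 0} = {\<sigma>. \<sigma> permutes (UNIV - {0})}"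
    by (auto simp: permutes_def bij_iff)
  moreover have "card {\<sigma>. \<sigma> permutes (UNIV - {0 :: 4})} = fact 3"
    by (rule card_permutations) simp_all
  ultimately show ?thesis by (simp add: fact_numeral)
qed

lemma card_normal_phases: "card {u :: 4 \<Rightarrow> complex. (\<forall>i. u i ^ n = 1) \<and> u 0 = 1} = n ^ 3"
proof -
  have "{u :: 4 \<Rightarrow> complex. (\<forall>i. u i ^ n = 1) \<and> u 0 = 1} =
      PiE UNIV (\<lambda>i. if i = 0 then {1} else {u. u ^ n = 1})"
  proof (intro equalityI subsetI)
    fix u :: "4 \<Rightarrow> complex" assume "u \<in> PiE UNIV (\<lambda>i. if i = 0 then {1} else {u. u ^ n = 1})"
    then have u: "u i \<in> (if i = 0 then {1} else {u. u ^ n = 1})" for i by (rule PiE_mem) simp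
    have "u 0 = 1" using u[of 0] by simp
    moreover have "u i ^ n = 1" for i using u[of i] by (cases "i = 0") simp_all
    ultimately show "u \<in> {u. (\<forall>i. u i ^ n = 1) \<and> u 0 = 1}" by simp
  qed auto
  then have "card {u :: 4 \<Rightarrow> complex. (\<forall>i. u i ^ n = 1) \<and> u 0 = 1} =
      (\<Prod>i\<in>(UNIV :: 4 set). card (if i = 0 then {1} else {u :: complex. u ^ n = 1}))"
    by (simp add: card_PiE)
  also have "\<dots> = (\<Prod>i\<in>(UNIV :: 4 set). if i = 0 then 1 else n)"
    using n_pos by (intro prod.cong) (auto simp: card_roots_unity_eq)
  also have "\<dots> = (\<Prod>i\<in>(UNIV - {0 :: 4}). n)"
    by (subst prod.remove[of UNIV 0]) auto
  also have "\<dots> = n ^ 3" by simp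
  finally show ?thesis .
qed

text \<open>The square.\<close>

lemma generic_point: obtains z where "z \<in> quad_cone" "\<not> degen (pw z)"
proof -
  define \<theta> :: "real ^ 4" where "\<theta> = vec4 0 (pi / 2) pi (3 * pi / 2)"
  define z :: "complex ^ 4" where "z = (\<chi> i. cis (\<theta> $ i / n))"
  have c: "cis (3 * pi / 2) = - \<i>"
    using cos_3over2_pi sin_3over2_pi by (simp add: complex_eq_iff)
  have pw: "pw z $ i = cis (\<theta> $ i)" for i by (simp add: pw_nth z_def cis_pow)
  have vals: "pw z $ 0 = 1" "pw z $ 1 = \<i>" "pw z $ 2 = - 1" "pw z $ 3 = - \<i>"
    unfolding pw by (simp_all add: \<theta>_def c)
  have "lifted z \<theta>" unfolding lifted_def by (simp add: z_def) (simp add: \<theta>_def)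
  moreover have "z $ 0 \<noteq> 0" by (simp add: z_def)
  then have "z \<noteq> 0" by auto
  moreover have "(\<Sum>i\<in>UNIV. (z $ i) ^ n) = 0"
    using vals by (simp add: sum4 pw_nth)
  ultimately have "z \<in> quad_cone" unfolding quad_cone_def by blast
  moreover have "\<not> degen (pw z)"
  proof -
    have "\<forall>i j. i \<noteq> j \<longrightarrow> \<not> nn (hp (pw z) i j)"
      unfolding all4 hp_def vals by (simp add: nn_def)
    then show ?thesis by (auto simp: degen_def)
  qed
  ultimately show thesis using that by blast
qed

lemma card_top_cells: "card top_cells = 6 * n ^ 3"
proof -
  define F where "F = (\<lambda>(\<sigma>, u). act (permscale \<sigma> u) ` base_cell)"
  have "inj_on F normal_maps"
  proof (rule inj_onI)
    fix p q assume pq: "p \<in> normal_maps" "q \<in> normal_maps" "F p = F q"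
    obtain \<sigma> u where p: "p = (\<sigma>, u)" by (cases p)
    obtain \<tau> v where q: "q = (\<tau>, v)" by (cases q)
    have \<sigma>: "bij \<sigma>" "\<sigma> 0 = 0" "\<And>i. u i ^ n = 1" "u 0 = 1" and \<tau>: "bij \<tau>" "\<tau> 0 = 0" "\<And>i. v i ^ n = 1" "v 0 = 1"
      using pq(1,2) by (auto simp: p q normal_maps_def)
    define A B where "A = permscale \<sigma> u" and "B = permscale \<tau> v"
    have A: "monomial A" and B: "monomial B"
      unfolding A_def B_def using \<sigma> \<tau> by (auto intro: monomial_permscale)
    have "cp3_of ` (A ` quad_cone) = cp3_of ` (B ` quad_cone)"
      using pq(3) act_base_cell[OF A] act_base_cell[OF B] by (simp add: F_def p q A_def B_def)
    then have eq: "A ` quad_cone = B ` quad_cone"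
      using cone_eq[OF cone_monomial[OF A cone_quad_cone] cone_monomial[OF B cone_quad_cone]] by simp
    obtain z where z: "z \<in> quad_cone" "\<not> degen (pw z)" by (rule generic_point)

    have "A z \<in> B ` quad_cone" using eq z by blast
    then obtain y where y: "y \<in> quad_cone" "A z = B y" by blast
    note \<tau>' = bij_on_4[OF \<tau>(1)]
    \<comment> \<open>The quotient of two such representatives is of the same kind and keeps a generic point in
      the base cell, so it is the identity by rigidity.\<close>
    define M where "M = permscale (\<sigma> \<circ> inv_into UNIV \<tau>) (\<lambda>i. inverse (v (inv_into UNIV \<tau> i)) * u (inv_into UNIV \<tau> i))"
    have BM: "B (M x) = A x" for x
      using \<tau>' root_nonzero[OF \<tau>(3)] by (simp add: A_def B_def M_def vec_eq_iff)
    have inj_B: "B x = B x' \<Longrightarrow> x = x'" for x x'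
      using monomial_inverse[OF B] by metis
    have Mz: "M z = y" using inj_B BM y(2) by metis
    have inv0: "inv_into UNIV \<tau> 0 = 0" using \<tau>'(3)[of 0] \<tau>(2) by simp
    have M: "\<sigma> \<circ> inv_into UNIV \<tau> = id" "inverse (v (inv_into UNIV \<tau> i)) * u (inv_into UNIV \<tau> i) = inverse (v (inv_into UNIV \<tau> 0)) * u (inv_into UNIV \<tau> 0)" for i
    proof -
      have b: "bij (\<sigma> \<circ> inv_into UNIV \<tau>)" using \<sigma>(1) \<tau>'(1) by (rule bij_comp[rotated])
      have z0: "(\<sigma> \<circ> inv_into UNIV \<tau>) 0 = 0" using inv0 \<sigma>(2) by simp
      have r: "(inverse (v (inv_into UNIV \<tau> i)) * u (inv_into UNIV \<tau> i)) ^ n = 1" for i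
        using \<sigma>(3) \<tau>(3) by (simp add: power_mult_distrib power_inverse)
      have Mz': "permscale (\<sigma> \<circ> inv_into UNIV \<tau>) (\<lambda>i. inverse (v (inv_into UNIV \<tau> i)) * u (inv_into UNIV \<tau> i)) z \<in> quad_cone"
        using Mz y(1) by (simp add: M_def)
      note * = generic_rigid[OF z b z0 r Mz']
      show "\<sigma> \<circ> inv_into UNIV \<tau> = id" by (rule *(1))
      show "inverse (v (inv_into UNIV \<tau> i)) * u (inv_into UNIV \<tau> i) = inverse (v (inv_into UNIV \<tau> 0)) * u (inv_into UNIV \<tau> 0)"
        by (rule *(2))
    qed
    have "\<sigma> i = \<tau> i" for i using fun_cong[OF M(1), of "\<tau> i"] \<tau>'(3) by simp
    then have "\<sigma> = \<tau>" by (simp add: fun_eq_iff)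
    moreover have "u i = v i" for i
      using M(2)[of "\<tau> i"] \<tau>'(3) inv0 \<sigma>(4) \<tau>(4) root_nonzero[OF \<tau>(3)[of i]] by (simp add: field_simps)
    then have "u = v" by (simp add: fun_eq_iff)
    ultimately show "p = q" by (simp add: p q)
  qed
  moreover have "F ` normal_maps = top_cells"
  proof (intro equalityI subsetI)
    fix c assume "c \<in> F ` normal_maps"
    then show "c \<in> top_cells"
      by (auto simp: F_def normal_maps_def top_cells_def intro: monomial_permscale)
  next
    fix c assume "c \<in> top_cells"
    then obtain A where A: "monomial A" "c = act A ` base_cell" by (auto simp: top_cells_def)
    then obtain \<sigma> u where \<sigma>: "bij \<sigma>" "\<And>i. u i ^ n = 1" "A = permscale \<sigma> u" by (auto simp: monomial_def)
    obtain m where m: "\<And>z :: complex ^ 4. \<exists>a. a ^ n = 1 \<and> (rot ^^ m) z $ (\<sigma> 0) = a * z $ 0"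
    proof -
      have "\<sigma> 0 = 0 \<or> \<sigma> 0 = 1 \<or> \<sigma> 0 = 2 \<or> \<sigma> 0 = 3"
        using all4[of "\<lambda>i. i = 0 \<or> i = 1 \<or> i = 2 \<or> i = 3"] by blast
      then show thesis
      proof (elim disjE)
        assume "\<sigma> 0 = 0" then show thesis by (intro that[of 0] exI[of _ 1]) simp
      next
        assume "\<sigma> 0 = 1" then show thesis by (intro that[of 3] exI[of _ \<omega>]) (simp add: numeral_3_eq_3 omega_pow)
      next
        assume "\<sigma> 0 = 2" then show thesis by (intro that[of 2] exI[of _ \<omega>]) (simp add: numeral_2_eq_2 omega_pow)
      next
        assume "\<sigma> 0 = 3" then show thesis by (intro that[of 1] exI[of _ \<omega>]) (simp add: omega_pow)
      qed
    qed
    define B where "B z = A ((rot ^^ m) z)" for z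
    have B: "monomial B" unfolding B_def[abs_def] by (rule monomial_comp[OF A(1) monomial_rot_pow])
    then obtain \<tau> v where \<tau>: "bij \<tau>" "\<And>i. v i ^ n = 1" "B = permscale \<tau> v" by (auto simp: monomial_def)
    have "\<tau> 0 = 0"
    proof (rule ccontr)
      assume ne: "\<tau> 0 \<noteq> 0"
      \<comment> \<open>A vector whose only zero is the first coordinate detects where the permutation sends it.\<close>
      define x :: "complex ^ 4" where "x = (\<chi> i. if i = 0 then 0 else 1)"
      have "B x $ 0 \<noteq> 0" using ne root_nonzero[OF \<tau>(2)] by (simp add: \<tau>(3) x_def)
      moreover have "B x $ 0 = 0" using m[of x] by (auto simp: B_def \<sigma>(3) x_def)
      ultimately show False by simp
    qed
    have v0: "v 0 \<noteq> 0" using root_nonzero[OF \<tau>(2)] .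
    define u' where "u' i = v i / v 0" for i
    have u': "u' i ^ n = 1" "u' 0 = 1" for i using \<tau>(2) v0 by (simp_all add: u'_def power_divide)
    have "(rot ^^ m) ` quad_cone = quad_cone"
    proof (intro equalityI subsetI)
      fix z assume z: "z \<in> quad_cone"
      obtain R where R: "monomial R" "\<And>z. R ((rot ^^ m) z) = z" "\<And>z. (rot ^^ m) (R z) = z"
        using monomial_inverse[OF monomial_rot_pow[of m]] by metis
      have "R z \<in> quad_cone" using z rot_pow_quad_cone[of m "R z"] R(3) by simp
      then show "z \<in> (rot ^^ m) ` quad_cone" using R(3)[of z] by (metis imageI)
    qed (auto simp: rot_pow_quad_cone)
    then have "B ` quad_cone = A ` quad_cone" unfolding B_def[abs_def] by (metis image_image)
    moreover have "permscale \<tau> u' ` quad_cone = B ` quad_cone"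
    proof -

      have e: "permscale \<tau> u' z = B (inverse (v 0) *s z)" "B z = permscale \<tau> u' (v 0 *s z)" for z
        using v0 by (simp_all add: vec_eq_iff \<tau>(3) u'_def field_simps)
      have m: "inverse (v 0) *s z \<in> quad_cone" "v 0 *s z \<in> quad_cone" if "z \<in> quad_cone" for z
        using quad_cone_scale[OF that, of "inverse (v 0)"] quad_cone_scale[OF that v0] v0 by simp_all
      show ?thesis
      proof (intro equalityI image_subsetI)
        show "permscale \<tau> u' z \<in> B ` quad_cone" if "z \<in> quad_cone" for z
          unfolding e(1) using m(1)[OF that] by (rule imageI)
        show "B z \<in> permscale \<tau> u' ` quad_cone" if "z \<in> quad_cone" for z
          unfolding e(2) using m(2)[OF that] by (rule imageI)
      qed
    qed
    moreover have mu: "monomial (permscale \<tau> u')" using \<tau>(1) u'(1) by (rule monomial_permscale)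
    ultimately have "c = act (permscale \<tau> u') ` base_cell"
      unfolding A(2) act_base_cell[OF A(1)] act_base_cell[OF mu] by simp
    moreover have "(\<tau>, u') \<in> normal_maps" using \<tau>(1) \<open>\<tau> 0 = 0\<close> u' by (auto simp: normal_maps_def)
    ultimately show "c \<in> F ` normal_maps" by (force simp: F_def)
  qed
  ultimately have "card top_cells = card normal_maps" using card_image by metis
  then show ?thesis
    by (simp add: normal_maps_def card_cartesian_product card_normal_perms card_normal_phases)
qed

lemma act_tess: "monomial A \<Longrightarrow> c \<in> tess k \<Longrightarrow> act A ` c \<in> tess k"
proof -
  assume A: "monomial A" and c: "c \<in> tess k"
  have comp: "act A ` act B ` X = act (\<lambda>z. A (B z)) ` X" if "monomial B" for B X
    unfolding image_image act_comp[OF A that] ..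
  show ?thesis
  proof (cases "k \<le> 3")
    case True
    then obtain B V where B: "monomial B" "V \<in> faces k" "c = act B ` base_face V"
      using c by (auto simp: tess_def face_cells_def)
    have "act A ` c = act (\<lambda>z. A (B z)) ` base_face V" unfolding B(3) by (rule comp[OF B(1)])
    then have "act A ` c \<in> face_cells k"
      unfolding face_cells_def using monomial_comp[OF A B(1)] B(2) by blast
    then show ?thesis using True by (simp add: tess_def)
  next
    case False
    then have k: "k = 4" "c \<in> top_cells" using c by (auto simp: tess_def split: if_splits)
    then obtain B where B: "monomial B" "c = act B ` base_cell" by (auto simp: top_cells_def)
    have "act A ` c = act (\<lambda>z. A (B z)) ` base_cell" unfolding B(2) by (rule comp[OF B(1)])
    then have "act A ` c \<in> top_cells" unfolding top_cells_def using monomial_comp[OF A B(1)] by blast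
    then show ?thesis using k by (simp add: tess_def)
  qed
qed

lemma tess_invariant: "invariant_under (fermat_group n) tess"
  unfolding invariant_under_def
proof (intro ballI allI)
  fix g k c assume g: "g \<in> fermat_group n" and c: "c \<in> tess k"
  obtain A where A: "monomial A" "\<forall>p\<in>surf. g p = act A p" using fermat_group_act[OF g] by blast
  have "c \<subseteq> surf" using c tess_cover by blast
  then have "g ` c = act A ` c" using A(2) by (intro image_cong) auto
  then show "g ` c \<in> tess k" using act_tess[OF A(1) c] by simp
qed

lemma tess_transitive: "transitive_on (fermat_group n) top_cells"
  unfolding transitive_on_def
proof (intro ballI)
  fix c d assume "c \<in> top_cells" "d \<in> top_cells"
  then obtain A B where A: "monomial A" "c = act A ` base_cell" and B: "monomial B" "d = act B ` base_cell"
    by (auto simp: top_cells_def)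
  obtain A' where A': "monomial A'" "\<And>z. A' (A z) = z" "\<And>z. A (A' z) = z"
    using monomial_inverse[OF A(1)] by metis
  define M where "M z = B (A' z)" for z
  have M: "monomial M" unfolding M_def[abs_def] by (rule monomial_comp[OF B(1) A'(1)])
  obtain g where g: "g \<in> fermat_group n" "\<forall>p\<in>surf. g p = act M p" using act_fermat_group[OF M] by blast
  have "c \<subseteq> surf" unfolding A(2) using act_surface[OF A(1)] base_cell_surf by blast
  then have "g ` c = act M ` c" using g(2) by (intro image_cong) auto
  also have "\<dots> = act (\<lambda>z. M (A z)) ` base_cell" unfolding A(2) image_image act_comp[OF M A(1)] ..
  also have "(\<lambda>z. M (A z)) = B" by (simp add: M_def A'(2) fun_eq_iff)
  finally show "\<exists>g\<in>fermat_group n. g ` c = d" using g(1) B(2) by blast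
qed

end

theorem mainTheorem1:
  fixes n :: nat
  assumes "n > 0"
  shows "\<exists>C :: nat \<Rightarrow> cp3 set set.
    tessellation 4 (top_of_set (fermat_surface n)) C \<and>
    card (C 4) = 6 * n ^ 3 \<and>
    (\<forall>c \<in> C 4. \<exists>P \<subseteq> C 3. card P = 4 \<and>
        cell_boundary (top_of_set (fermat_surface n)) 4 c = \<Union>P \<and>
        (\<forall>d \<in> P. square_pyramid (top_of_set (fermat_surface n)) C d)) \<and>
    invariant_under (fermat_group n) C \<and>
    transitive_on (fermat_group n) (C 4)"
proof -
  interpret fermat n by unfold_locales (rule assms)
  have C: "tess i = face_cells i" if "i \<le> 2" for i using that by (simp add: tess_def)
  have 34: "tess 3 = face_cells 3" "tess 4 = top_cells" by (simp_all add: tess_def)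
  have "\<exists>P \<subseteq> tess 3. card P = 4 \<and> cell_boundary (top_of_set surf) 4 c = \<Union>P \<and>
      (\<forall>d \<in> P. square_pyramid (top_of_set surf) tess d)" if c: "c \<in> tess 4" for c
  proof -
    obtain A where A: "monomial A" "c = act A ` base_cell" using c by (auto simp: 34 top_cells_def)
    show ?thesis
      unfolding A(2) 34(1) using pyramids_around[OF A(1)] face_cells_square_pyramid[OF C] by blast
  qed
  then show ?thesis
    using tess_tessellation card_top_cells tess_invariant tess_transitive
    by (intro exI[of _ tess]) (simp add: 34(2))
qed

end
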